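(* Let $\Omega\subset\mathbb{C}^n$ be a bounded domain and let $\psi\ge0$ be a continuous function on $\overline\Omega$. Let $\Gamma$, $f$, $F$ be as in the context, and assume $$\lim_{R\to\infty}f(R,R,\dots,R)>\psi(z)\quad\text{for every }z\in\Omega.$$ Let $v:\overline\Omega\to\mathbb{R}$ be bounded and lower semicontinuous, continuous at every point $z\in\partial\Omega$, and a viscosity supersolution of $F(Hw)=\psi(z)$ in $\Omega$. Let $$\Phi_v=\sup\{w: w\text{ is a viscosity subsolution of }F(Hw)=\psi(z)\text{ in }\Omega,\ w\le v\}.$$ Then, for every relatively compact open subset $U$ of $\Omega$, there exists a decreasing sequence $u_j$ of viscosity solutions of $F(Hw)=\psi(z)$ in $U$ such that $\lim_{j\to\infty}u_j=\Phi_v$ in $U$.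
   Context: Cone and operator. For $1\le k\le n$ let $\sigma_k(x)=\sum_{1\le j_1<\dots<j_k\le n}x_{j_1}\cdots x_{j_k}$ and $\Gamma_k=\{x\in\mathbb{R}^n:\sigma_1(x)>0,\dots,\sigma_k(x)>0\}$. $\Gamma\subsetneq\mathbb{R}^n$ is an open, convex, symmetric (permutation invariant) cone with vertex at the origin with $\Gamma_n\subseteq\Gamma\subseteq\Gamma_1$. $f:\overline{\Gamma}\to[0,\infty)$ is continuous, symmetric, concave, strictly increasing in each variable on $\Gamma$, with $f>0$ on $\Gamma$ and $f=0$ on $\partial\Gamma$. $\mathcal{H}^n$ is the set of $n\times n$ Hermitian matrices, $\lambda(H)\in\mathbb{R}^n$ denotes the eigenvalues of $H$, $M(\Gamma,n)=\{H\in\mathcal{H}^n:\lambda(H)\in\Gamma\}$, and $F:\mathcal{H}^n\to[-\infty,\infty)$ is $F(H)=f(\lambda(H))$ if $H\in\overline{M(\Gamma,n)}$ and $F(H)=-\infty$ otherwise. $Hu=\left(\frac{\partial^2u}{\partial z_\alpha\partial\overline{z_\beta}}\right)$ is the complex Hessian. Viscosity sub/supersolutions, on an open set $D$ ($D=\Omega$ or $D=U$). $USC(D)$ is the set of upper semicontinuous functions $D\to[-\infty,\infty)$. An upper (resp. lower) test function for $w$ at $z_0$ is a $C^2$ function $q$ near $z_0$ with $w(z_0)=q(z_0)$ and $w\le q$ (resp. $w\ge q$) near $z_0$. $u\in USC(D)$ is a viscosity subsolution of $F(Hw)=\psi(z)$ in $D$ if $F(Hq(z_0))\ge\psi(z_0)$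 for every $z_0\in D$ and every upper test function $q$ for $u$ at $z_0$. A lower semicontinuous $v$ is a viscosity supersolution in $D$ if $F(Hq(z_0))\le\psi(z_0)$ for every $z_0\in D$ and every lower test function $q$ for $v$ at $z_0$. A viscosity solution in $D$ is a continuous function $D\to\mathbb{R}$ that is both a subsolution and a supersolution in $D$. *)

theory Defs
  imports "HOL-Analysis.Analysis"
begin

definition elem_sym :: "nat \<Rightarrow> real ^ 'n \<Rightarrow> real" where
  "elem_sym k x = (\<Sum>S | card S = k. \<Prod>j\<in>S. x $ j)"

definition garding_cone :: "nat \<Rightarrow> (real ^ 'n) set" where
  "garding_cone k = {x. \<forall>m\<in>{1..k}. elem_sym m x > 0}"

text \<open>
  The cone is open, so its vertex 0 need not belong to it: closure is only required under
  multiplication by positive scalars (the library's \<open>cone\<close> and \<open>conic\<close> allow the scalar 0).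
\<close>

definition admissible_cone :: "(real ^ 'n) set \<Rightarrow> bool" where
  "admissible_cone \<Gamma> \<longleftrightarrow>
     \<Gamma> \<noteq> UNIV \<and> open \<Gamma> \<and> convex \<Gamma> \<and>
     (\<forall>x\<in>\<Gamma>. \<forall>c>0. c *\<^sub>R x \<in> \<Gamma>) \<and>
     (\<forall>x\<in>\<Gamma>. \<forall>p. bij p \<longrightarrow> (\<chi> i. x $ p i) \<in> \<Gamma>) \<and>
     garding_cone CARD('n) \<subseteq> \<Gamma> \<and> \<Gamma> \<subseteq> garding_cone 1"

text \<open>Only the values of \<open>f\<close> on \<open>closure \<Gamma>\<close> are relevant.\<close>

definition admissible_fun :: "(real ^ 'n) set \<Rightarrow> (real ^ 'n \<Rightarrow> real) \<Rightarrow> bool" where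
  "admissible_fun \<Gamma> f \<longleftrightarrow>
     (\<forall>x\<in>closure \<Gamma>. f x \<ge> 0) \<and>
     continuous_on (closure \<Gamma>) f \<and>
     (\<forall>x\<in>closure \<Gamma>. \<forall>p. bij p \<longrightarrow> f (\<chi> i. x $ p i) = f x) \<and>
     concave_on (closure \<Gamma>) f \<and>
     (\<forall>x\<in>\<Gamma>. \<forall>i. \<forall>t>0. x + axis i t \<in> \<Gamma> \<longrightarrow> f x < f (x + axis i t)) \<and>
     (\<forall>x\<in>\<Gamma>. f x > 0) \<and>
     (\<forall>x\<in>frontier \<Gamma>. f x = 0)"

definition hermitian :: "complex ^ 'n ^ 'n \<Rightarrow> bool" where
  "hermitian H \<longleftrightarrow> (\<forall>i j. H $ i $ j = cnj (H $ j $ i))"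

text \<open>
  The eigenvalues of a Hermitian matrix, listed with multiplicity, i.e. the roots of the
  characteristic polynomial. The choice of an ordering is immaterial, as it is only used for
  membership in symmetric sets and as an argument of symmetric functions. For matrices which
  are not Hermitian the value may be meaningless; it is never used.
\<close>

definition eigenvals :: "complex ^ 'n ^ 'n \<Rightarrow> real ^ 'n" where
  "eigenvals H =
     (SOME l. \<forall>t. det (mat t - H) = (\<Prod>i\<in>UNIV. t - complex_of_real (l $ i)))"

definition cone_matrices :: "(real ^ 'n) set \<Rightarrow> (complex ^ 'n ^ 'n) set" where
  "cone_matrices \<Gamma> = {H. hermitian H \<and> eigenvals H \<in> \<Gamma>}"

definition matrix_op ::
    "(real ^ 'n) set \<Rightarrow> (real ^ 'n \<Rightarrow> real) \<Rightarrow> complex ^ 'n ^ 'n \<Rightarrow> ereal" where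
  "matrix_op \<Gamma> f H =
     (if H \<in> closure (cone_matrices \<Gamma>) then ereal (f (eigenvals H)) else - \<infinity>)"

definition partial_deriv ::
    "complex ^ 'n \<Rightarrow> (complex ^ 'n \<Rightarrow> complex) \<Rightarrow> complex ^ 'n \<Rightarrow> complex" where
  "partial_deriv e g z = vector_derivative (\<lambda>t::real. g (z + t *\<^sub>R e)) (at 0)"

text \<open>
  With \<open>z\<^sub>\<alpha> = x\<^sub>\<alpha> + \<i> y\<^sub>\<alpha>\<close>, the operators
  \<open>\<partial>/\<partial>z\<^sub>\<alpha> = (\<partial>/\<partial>x\<^sub>\<alpha> - \<i> \<partial>/\<partial>y\<^sub>\<alpha>) / 2\<close> and its conjugate.
\<close>

definition d_dz :: "'n \<Rightarrow> (complex ^ 'n \<Rightarrow> complex) \<Rightarrow> complex ^ 'n \<Rightarrow> complex" where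
  "d_dz \<alpha> g z =
     (partial_deriv (axis \<alpha> 1) g z - \<i> * partial_deriv (axis \<alpha> \<i>) g z) / 2"

definition d_dzbar :: "'n \<Rightarrow> (complex ^ 'n \<Rightarrow> complex) \<Rightarrow> complex ^ 'n \<Rightarrow> complex" where
  "d_dzbar \<beta> g z =
     (partial_deriv (axis \<beta> 1) g z + \<i> * partial_deriv (axis \<beta> \<i>) g z) / 2"

definition complex_hessian ::
    "(complex ^ 'n \<Rightarrow> real) \<Rightarrow> complex ^ 'n \<Rightarrow> complex ^ 'n ^ 'n" where
  "complex_hessian q z =
     (\<chi> \<alpha> \<beta>. d_dz \<alpha> (d_dzbar \<beta> (\<lambda>w. complex_of_real (q w))) z)"

definition C2_near :: "('a::real_normed_vector \<Rightarrow> real) \<Rightarrow> 'a \<Rightarrow> bool" where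
  "C2_near q z0 \<longleftrightarrow>
     (\<exists>N (q' :: 'a \<Rightarrow> 'a \<Rightarrow>\<^sub>L real) (q'' :: 'a \<Rightarrow> 'a \<Rightarrow>\<^sub>L 'a \<Rightarrow>\<^sub>L real).
        open N \<and> z0 \<in> N \<and>
        (\<forall>z\<in>N. (q has_derivative blinfun_apply (q' z)) (at z)) \<and>
        (\<forall>z\<in>N. (q' has_derivative blinfun_apply (q'' z)) (at z)) \<and>
        continuous_on N q'')"

definition usc_on :: "'a::topological_space set \<Rightarrow> ('a \<Rightarrow> ereal) \<Rightarrow> bool" where
  "usc_on D w \<longleftrightarrow> (\<forall>z0\<in>D. \<forall>c. w z0 < c \<longrightarrow> (\<forall>\<^sub>F z in at z0 within D. w z < c))"

definition lsc_on :: "'a::topological_space set \<Rightarrow> ('a \<Rightarrow> ereal) \<Rightarrow> bool" where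
  "lsc_on D w \<longleftrightarrow> (\<forall>z0\<in>D. \<forall>c. c < w z0 \<longrightarrow> (\<forall>\<^sub>F z in at z0 within D. c < w z))"

definition upper_test ::
    "('a::real_normed_vector \<Rightarrow> ereal) \<Rightarrow> 'a \<Rightarrow> ('a \<Rightarrow> real) \<Rightarrow> bool" where
  "upper_test w z0 q \<longleftrightarrow>
     C2_near q z0 \<and> w z0 = ereal (q z0) \<and> (\<forall>\<^sub>F z in nhds z0. w z \<le> ereal (q z))"

definition lower_test ::
    "('a::real_normed_vector \<Rightarrow> ereal) \<Rightarrow> 'a \<Rightarrow> ('a \<Rightarrow> real) \<Rightarrow> bool" where
  "lower_test w z0 q \<longleftrightarrow>
     C2_near q z0 \<and> w z0 = ereal (q z0) \<and> (\<forall>\<^sub>F z in nhds z0. w z \<ge> ereal (q z))"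

text \<open>
  In the following notions \<open>D\<close> is meant to be open, so that the values of the functions
  outside \<open>D\<close> play no role. Subsolutions take values in \<open>[-\<infinity>, \<infinity>)\<close> on \<open>D\<close>,
  supersolutions in \<open>(-\<infinity>, \<infinity>]\<close>.
\<close>

definition viscosity_subsol ::
    "(complex ^ 'n ^ 'n \<Rightarrow> ereal) \<Rightarrow> (complex ^ 'n \<Rightarrow> real) \<Rightarrow> (complex ^ 'n) set \<Rightarrow>
     (complex ^ 'n \<Rightarrow> ereal) \<Rightarrow> bool" where
  "viscosity_subsol F \<psi> D u \<longleftrightarrow>
     usc_on D u \<and> (\<forall>z\<in>D. u z < \<infinity>) \<and>
     (\<forall>z0\<in>D. \<forall>q. upper_test u z0 q \<longrightarrow> F (complex_hessian q z0) \<ge> ereal (\<psi> z0))"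

definition viscosity_supersol ::
    "(complex ^ 'n ^ 'n \<Rightarrow> ereal) \<Rightarrow> (complex ^ 'n \<Rightarrow> real) \<Rightarrow> (complex ^ 'n) set \<Rightarrow>
     (complex ^ 'n \<Rightarrow> ereal) \<Rightarrow> bool" where
  "viscosity_supersol F \<psi> D v \<longleftrightarrow>
     lsc_on D v \<and> (\<forall>z\<in>D. - \<infinity> < v z) \<and>
     (\<forall>z0\<in>D. \<forall>q. lower_test v z0 q \<longrightarrow> F (complex_hessian q z0) \<le> ereal (\<psi> z0))"

definition viscosity_sol ::
    "(complex ^ 'n ^ 'n \<Rightarrow> ereal) \<Rightarrow> (complex ^ 'n \<Rightarrow> real) \<Rightarrow> (complex ^ 'n) set \<Rightarrow>
     (complex ^ 'n \<Rightarrow> real) \<Rightarrow> bool" where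
  "viscosity_sol F \<psi> D u \<longleftrightarrow>
     continuous_on D u \<and>
     viscosity_subsol F \<psi> D (\<lambda>z. ereal (u z)) \<and>
     viscosity_supersol F \<psi> D (\<lambda>z. ereal (u z))"

definition sub_envelope ::
    "(complex ^ 'n ^ 'n \<Rightarrow> ereal) \<Rightarrow> (complex ^ 'n \<Rightarrow> real) \<Rightarrow> (complex ^ 'n) set \<Rightarrow>
     (complex ^ 'n \<Rightarrow> real) \<Rightarrow> complex ^ 'n \<Rightarrow> ereal" where
  "sub_envelope F \<psi> D v z =
     (SUP w \<in> {w. viscosity_subsol F \<psi> D w \<and> (\<forall>y\<in>D. w y \<le> ereal (v y))}. w z)"

end

theory Submission
  imports Defs "HOL-Probability.Probability" "HOL-Combinatorics.Permutations"
    "HOL-Computational_Algebra.Polynomial"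
begin

text \<open>
  The operator is concave and symmetric, and this reduces it to linear inequalities. For a
  \<open>C\<^sup>2\<close> function \<open>q\<close>, the condition that the value of the operator at its complex Hessian
  is at least \<open>c\<close> says that in every unitary frame the diagonal of the Hessian lies in
  \<open>{f \<ge> c}\<close> (\<open>matrix_op_hessian_iff\<close>); this is the easy half of the Schur--Horn
  theorem. As \<open>{f \<ge> c}\<close> is closed and convex and increases under addition of nonnegative vectors,
  it is an intersection of half-spaces with nonnegative normals, so the condition is a family of
  linear second-order inequalities with constant coefficients (\<open>opge_if_halfspaces\<close>,
  \<open>opge_halfspace\<close>).

  Linear inequalities survive convolution, also when they hold only in the viscosity sense. To see
  this without pointwise second derivatives of semiconvex functions, a viscosity subsolution of a
  linear equation is compared with the Gaussian heat semigroup of the corresponding quadratic form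
  (\<open>heat_subsolution\<close>): it lies below its own heat evolution up to the expected linear
  error. Applying this to a mollification and differentiating at time zero gives the smooth
  inequality (\<open>mollified_subsolution\<close>). Hence bounded subsolutions are approximated by smooth
  ones (\<open>subsol_mollification\<close>), and the growth of \<open>f\<close> along the diagonal makes them
  strict after a small multiple of \<open>|z|\<^sup>2\<close> is added (\<open>strict_smooth_approximation\<close>). A smooth
  strict subsolution is itself a test function for a supersolution at a maximum of their
  difference, so the comparison principle follows (\<open>comparison\<close>) without doubling of variables.

  With comparison at hand, Perron's method solves the Dirichlet problem on every bounded open set
  with exterior balls, when the boundary data extend to a continuous subsolution
  (\<open>dirichlet_problem\<close>); as subsolutions are subharmonic, classical superharmonic barriers
  bound them near the boundary.
  Comparison with the supersolution \<open>v\<close>, together with its continuity at the boundary,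
  also shows that the envelope \<open>\<Phi>\<close> is itself a subsolution below \<open>v\<close>, hence the largest one
  (\<open>envelope_subsol\<close>).

  For the approximation, the given set is enclosed in an open set \<open>D\<close> of points whose distance
  to the complement of \<open>\<Omega>\<close> exceeds a constant; such a set has exterior balls. On the closure of
  \<open>D\<close> there are smooth subsolutions that decrease to \<open>\<Phi>\<close> (\<open>smooth_subsol_between\<close>). The
  solutions with these boundary data decrease and stay above \<open>\<Phi>\<close>. Their limit, continued by \<open>\<Phi>\<close>
  outside \<open>D\<close>, is a subsolution on \<open>\<Omega>\<close>, because it has no upward jump at the boundary of \<open>D\<close>;
  by comparison it is at most \<open>v\<close>, hence at most \<open>\<Phi>\<close> (\<open>envelope_decreasing_limit\<close>).
\<close>

section \<open>Eigenvalues of Hermitian matrices and unitary frames\<close>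

text \<open>
  Dual certificate for the rearrangement inequality: if \<open>a\<close> and \<open>l\<close> are similarly ordered, the
  identity is an optimal assignment for the rewards \<open>a\<^sub>i l\<^sub>j\<close>, and \<open>u\<close>, \<open>v\<close> are optimal dual
  prices. With prices in hand, optimality over all doubly stochastic matrices is immediate, which
  replaces Birkhoff's theorem below.
\<close>

lemma similarly_ordered_potentials:
  fixes a l :: "'i \<Rightarrow> real"
  assumes "finite I" and "\<And>i j. i \<in> I \<Longrightarrow> j \<in> I \<Longrightarrow> (a i - a j) * (l i - l j) \<ge> 0"
  shows "\<exists>u v. (\<forall>i\<in>I. u i + v i = a i * l i) \<and> (\<forall>i\<in>I. \<forall>j\<in>I. u i + v j \<ge> a i * l j)"
  using assms
\<comment> \<open>The elements are added in increasing order of \<open>a + l\<close>, so the new one dominates in both \<open>a\<close> and \<open>l\<close>.\<close>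
proof (induction I rule: finite_ranking_induct[where f = "\<lambda>i. a i + l i"])
  case empty
  show ?case by simp
next
  case (insert m I)
  show ?case
  proof (cases "m \<in> I")
    case True
    then show ?thesis using insert by (simp add: insert_absorb)
  next
    case False
    have "\<exists>u v. (\<forall>i\<in>I. u i + v i = a i * l i) \<and> (\<forall>i\<in>I. \<forall>j\<in>I. u i + v j \<ge> a i * l j)"
      using insert.IH insert.prems by blast
    then obtain u v where uv: "\<forall>i\<in>I. u i + v i = a i * l i" "\<forall>i\<in>I. \<forall>j\<in>I. u i + v j \<ge> a i * l j"
      by blast
    have am: "a m \<ge> a i \<and> l m \<ge> l i" if "i \<in> I" for i
    proof -
      have "a i + l i \<le> a m + l m" using insert.hyps that by blast
      moreover have "(a m - a i) * (l m - l i) \<ge> 0" using insert.prems that by blast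
      ultimately show ?thesis by (smt (verit) mult_nonneg_nonpos mult_pos_neg zero_le_mult_iff)
    qed
    \<comment> \<open>The smallest price admissible for the row \<open>m\<close>; the dominance of \<open>m\<close> makes the column price feasible too.\<close>
    define um where "um = (if I = {} then 0 else Max ((\<lambda>j. a m * l j - v j) ` I))"
    have um1: "um \<ge> a m * l j - v j" if "j \<in> I" for j
      using that insert.hyps by (auto simp: um_def)
    have um2: "um \<le> a m * l m - a i * l m + u i" if "i \<in> I" for i
    proof -
      have "um \<in> (\<lambda>j. a m * l j - v j) ` I"
        using that insert.hyps by (auto simp: um_def intro!: Max_in)
      then obtain j where j: "j \<in> I" "um = a m * l j - v j" by blast
      have "(a m - a i) * l j \<le> (a m - a i) * l m"
        using am[OF that] am[OF j(1)] by (intro mult_left_mono) auto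
      moreover have "u i + v j \<ge> a i * l j" using uv that j by blast
      ultimately show ?thesis using j(2) by (simp add: algebra_simps)
    qed
    show ?thesis
    proof (intro exI conjI ballI)
      fix i assume "i \<in> insert m I"
      then show "(u(m := um)) i + (v(m := a m * l m - um)) i = a i * l i"
        using uv False by auto
    next
      fix i j assume "i \<in> insert m I" "j \<in> insert m I"
      then show "a i * l j \<le> (u(m := um)) i + (v(m := a m * l m - um)) j"
        using uv False um1[of j] um2[of i] by auto
    qed
  qed
qed

text \<open>
  If the average were outside \<open>C\<close>, a hyperplane would separate it. Among all permutations of \<open>x\<close> one
  minimises the separating functional; minimality under transpositions orders it oppositely to the
  normal, and the dual prices bound the functional on the average from below by its value there.
\<close>

lemma doubly_stochastic_image_in_convex:
  fixes S :: "'n::finite \<Rightarrow> 'n \<Rightarrow> real" and C :: "(real ^ 'n) set"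
  assumes C: "closed C" "convex C" "\<And>x p. x \<in> C \<Longrightarrow> bij p \<Longrightarrow> (\<chi> i. x $ p i) \<in> C"
    and x: "x \<in> C"
    and S: "\<And>i j. S i j \<ge> 0" "\<And>i. (\<Sum>j\<in>UNIV. S i j) = 1" "\<And>j. (\<Sum>i\<in>UNIV. S i j) = 1"
  shows "(\<chi> i. \<Sum>j\<in>UNIV. S i j * x $ j) \<in> C"
proof (rule ccontr)
  assume "\<not> ?thesis"
  then obtain a b where ab: "inner a (\<chi> i. \<Sum>j\<in>UNIV. S i j * x $ j) < b" "\<And>x. x \<in> C \<Longrightarrow> inner a x > b"
    using separating_hyperplane_closed_point[OF C(2,1)] by blast
  define g where "g p = (\<Sum>k\<in>UNIV. a $ k * x $ (p k))" for p :: "'n \<Rightarrow> 'n"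
  have fin: "finite {p::'n \<Rightarrow> 'n. bij p}" by simp
  have ne: "{p::'n \<Rightarrow> 'n. bij p} \<noteq> {}" using bij_id by blast
  obtain p where p: "bij p" and pmin: "\<And>p'. bij p' \<Longrightarrow> g p \<le> g p'"
    using arg_min_if_finite[OF fin ne, of g] by (metis linorder_not_le mem_Collect_eq)
  define y where "y k = x $ (p k)" for k
  have ord: "(- a $ i - (- a $ j)) * (y i - y j) \<ge> 0" for i j
  proof (cases "i = j")
    case False
    have "bij (p \<circ> Transposition.transpose i j)" using p by (simp add: bij_comp)
    from pmin[OF this] have "(\<Sum>k\<in>UNIV. a $ k * y k) \<le> (\<Sum>k\<in>UNIV. a $ k * y (Transposition.transpose i j k))"
      by (simp add: g_def y_def)
    moreover have "(\<Sum>k\<in>UNIV. f k) = f i + f j + (\<Sum>k\<in>UNIV - {i} - {j}. f k)" for f :: "'n \<Rightarrow> real"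
      using False by (simp add: sum.remove[of UNIV i] sum.remove[of "UNIV - {i}" j])
    moreover have "(\<Sum>k\<in>UNIV - {i} - {j}. a $ k * y (Transposition.transpose i j k)) = (\<Sum>k\<in>UNIV - {i} - {j}. a $ k * y k)"
      by (intro sum.cong) (auto simp: Transposition.transpose_def)
    ultimately have "a $ i * y i + a $ j * y j \<le> a $ i * y j + a $ j * y i"
      by simp
    then show ?thesis by (simp add: algebra_simps)
  qed simp
  obtain u v where uv: "\<And>i. u i + v i = - a $ i * y i" "\<And>i j. u i + v j \<ge> - a $ i * y j"
    using similarly_ordered_potentials[of UNIV "\<lambda>i. - a $ i" y] ord by auto
  have "inner a (\<chi> i. \<Sum>j\<in>UNIV. S i j * x $ j) = (\<Sum>i\<in>UNIV. \<Sum>j\<in>UNIV. S i j * a $ i * x $ j)"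
    by (simp add: inner_vec_def sum_distrib_left algebra_simps)
  also have "\<dots> = (\<Sum>i\<in>UNIV. \<Sum>m\<in>UNIV. S i (p m) * a $ i * y m)"
  proof (rule sum.cong[OF refl])
    fix i
    show "(\<Sum>j\<in>UNIV. S i j * a $ i * x $ j) = (\<Sum>m\<in>UNIV. S i (p m) * a $ i * y m)"
      unfolding y_def using sum.reindex_bij_betw[OF p, of "\<lambda>j. S i j * a $ i * x $ j"] by simp
  qed
  also have "\<dots> \<ge> (\<Sum>i\<in>UNIV. \<Sum>m\<in>UNIV. - (S i (p m) * u i + S i (p m) * v m))"
  proof (intro sum_mono)
    fix i m
    have "S i (p m) * (- a $ i * y m) \<le> S i (p m) * (u i + v m)"
      using uv(2) S(1) by (intro mult_left_mono) auto
    then show "- (S i (p m) * u i + S i (p m) * v m) \<le> S i (p m) * a $ i * y m"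
      by (simp add: algebra_simps)
  qed
  moreover have "(\<Sum>i\<in>UNIV. \<Sum>m\<in>UNIV. - (S i (p m) * u i + S i (p m) * v m)) = - ((\<Sum>i\<in>UNIV. u i) + (\<Sum>m\<in>UNIV. v m))"
  proof -
    have r: "(\<Sum>m\<in>UNIV. S i (p m)) = 1" for i
      using sum.reindex_bij_betw[OF p, of "\<lambda>j. S i j"] S(2) by simp
    have "(\<Sum>i\<in>UNIV. \<Sum>m\<in>UNIV. S i (p m) * u i) = (\<Sum>i\<in>UNIV. u i)"
      by (simp add: sum_distrib_right[symmetric] r)
    moreover have "(\<Sum>i\<in>UNIV. \<Sum>m\<in>UNIV. S i (p m) * v m) = (\<Sum>m\<in>UNIV. v m)"
      by (subst sum.swap) (simp add: sum_distrib_right[symmetric] S(3))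
    ultimately show ?thesis by (simp add: sum_negf sum.distrib sum_subtractf)
  qed
  moreover have "(\<Sum>i\<in>UNIV. u i) + (\<Sum>m\<in>UNIV. v m) = - inner a (\<chi> k. y k)"
    unfolding sum.distrib[symmetric] uv(1) by (simp add: inner_vec_def sum_negf)
  moreover have "inner a (\<chi> k. y k) > b"
    using ab(2) C(3)[OF x p] by (simp add: y_def)
  ultimately show False using ab(1) by linarith
qed

text \<open>
  The convention is linear in the first argument, so that the Hessian entry
  \<open>\<partial>\<^sup>2q/\<partial>z\<^sub>\<alpha>\<partial>z\<^sub>\<beta>\<close> (with \<open>z\<^sub>\<beta>\<close> conjugated) is paired with \<open>\<zeta>\<^sub>\<alpha>\<close> and the conjugate of
  \<open>\<zeta>\<^sub>\<beta>\<close>.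
\<close>

definition sesq :: "complex ^ 'n ^ 'n \<Rightarrow> complex ^ 'n \<Rightarrow> complex ^ 'n \<Rightarrow> complex" where
  "sesq H x y = (\<Sum>i\<in>UNIV. \<Sum>j\<in>UNIV. x $ i * H $ i $ j * cnj (y $ j))"

definition adjoint_mat :: "complex ^ 'n ^ 'n \<Rightarrow> complex ^ 'n ^ 'n" where
  "adjoint_mat E = (\<chi> i j. cnj (E $ j $ i))"

text \<open>
  The rows of \<open>E\<close> form an orthonormal basis.
\<close>

definition unitary_frame :: "complex ^ 'n ^ 'n \<Rightarrow> bool" where
  "unitary_frame E \<longleftrightarrow> E ** adjoint_mat E = mat 1"

lemma conjugated_entry: "(E ** H ** adjoint_mat G) $ j $ k = sesq H (E $ j) (G $ k)"
proof -
  have "(E ** H ** adjoint_mat G) $ j $ k = (\<Sum>b\<in>UNIV. \<Sum>a\<in>UNIV. E $ j $ a * H $ a $ b * cnj (G $ k $ b))"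
    by (simp add: matrix_matrix_mult_def adjoint_mat_def sum_distrib_right)
  also have "\<dots> = sesq H (E $ j) (G $ k)"
    unfolding sesq_def by (rule sum.swap)
  finally show ?thesis .
qed

lemma sesq_add_left: "sesq H (x + y) z = sesq H x z + sesq H y z"
  by (simp add: sesq_def algebra_simps sum.distrib)
lemma sesq_add_right: "sesq H z (x + y) = sesq H z x + sesq H z y"
  by (simp add: sesq_def algebra_simps sum.distrib)
lemma sesq_scale_left: "sesq H (c *s x) z = c * sesq H x z"
  by (simp add: sesq_def sum_distrib_left algebra_simps)
lemma sesq_scale_right: "sesq H z (c *s x) = cnj c * sesq H z x"
  by (simp add: sesq_def sum_distrib_left algebra_simps)

lemmas sesq_simps = sesq_add_left sesq_add_right sesq_scale_left sesq_scale_right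

lemma sesq_mat: "sesq (mat t) x y = t * (\<Sum>i\<in>UNIV. x $ i * cnj (y $ i))"
  by (simp add: sesq_def mat_def if_distrib if_distribR sum_distrib_left algebra_simps cong: if_cong)

lemma sesq_hermitian_flip:
  assumes "hermitian H"
  shows "sesq H y x = cnj (sesq H x y)"
proof -
  have cH: "cnj (H $ i $ j) = H $ j $ i" for i j
    using assms unfolding hermitian_def by metis
  have "cnj (sesq H x y) = (\<Sum>i\<in>UNIV. \<Sum>j\<in>UNIV. cnj (x $ i) * H $ j $ i * y $ j)"
    by (simp add: sesq_def cH)
  also have "\<dots> = sesq H y x"
    by (subst sum.swap) (simp add: sesq_def algebra_simps)
  finally show ?thesis ..
qed

lemma unitary_frame_iff:
  "unitary_frame E \<longleftrightarrow> (\<forall>j k. sesq (mat 1) (E $ j) (E $ k) = (if j = k then 1 else 0))"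
proof -
  have "(E ** adjoint_mat E) $ j $ k = sesq (mat 1) (E $ j) (E $ k)" for j k
    using conjugated_entry[of E "mat 1" E] by simp
  then show ?thesis
    by (auto simp: unitary_frame_def vec_eq_iff mat_def)
qed

lemma unitary_frame_left: "unitary_frame E \<Longrightarrow> adjoint_mat E ** E = mat 1"
  by (simp add: unitary_frame_def matrix_left_right_inverse)

lemma unitary_frame_norm_1:
  assumes "unitary_frame E"
  shows "(\<Sum>i\<in>UNIV. (cmod (E $ k $ i))\<^sup>2) = 1"
proof -
  have "complex_of_real (\<Sum>i\<in>UNIV. (cmod (E $ k $ i))\<^sup>2) = sesq (mat 1) (E $ k) (E $ k)"
    unfolding sesq_mat of_real_sum complex_norm_square by simp
  also have "\<dots> = 1" using assms by (simp add: unitary_frame_iff)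
  finally show ?thesis by (simp only: of_real_eq_1_iff)
qed

lemma adjoint_mat_mult: "adjoint_mat (A ** B) = adjoint_mat B ** adjoint_mat A"
  by (simp add: adjoint_mat_def matrix_matrix_mult_def vec_eq_iff algebra_simps)

lemma adjoint_mat_adjoint_mat [simp]: "adjoint_mat (adjoint_mat A) = A"
  by (simp add: adjoint_mat_def vec_eq_iff)

lemma unitary_frame_adjoint: "unitary_frame E \<Longrightarrow> unitary_frame (adjoint_mat E)"
  using unitary_frame_left by (auto simp: unitary_frame_def)

lemma unitary_frame_mult: "unitary_frame E \<Longrightarrow> unitary_frame G \<Longrightarrow> unitary_frame (E ** G)"
proof -
  assume a: "unitary_frame E" "unitary_frame G"
  have "(E ** G) ** adjoint_mat (E ** G) = E ** (G ** adjoint_mat G) ** adjoint_mat E"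
    by (simp add: adjoint_mat_mult matrix_mul_assoc)
  then show ?thesis using a by (simp add: unitary_frame_def)
qed

definition frame_diag :: "complex ^ 'n ^ 'n \<Rightarrow> complex ^ 'n ^ 'n \<Rightarrow> real ^ 'n" where
  "frame_diag H E = (\<chi> k. Re (sesq H (E $ k) (E $ k)))"

definition eigenframe :: "complex ^ 'n ^ 'n \<Rightarrow> complex ^ 'n ^ 'n \<Rightarrow> bool" where
  "eigenframe H E \<longleftrightarrow> unitary_frame E \<and> (\<forall>j k. j \<noteq> k \<longrightarrow> sesq H (E $ j) (E $ k) = 0)"

lemma compact_unitary_frames: "compact {E :: complex ^ 'n ^ 'n. unitary_frame E}"
proof -
  have "closed {E :: complex ^ 'n ^ 'n. unitary_frame E}"
    unfolding unitary_frame_iff sesq_def Collect_all_eq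
    by (intro closed_INT ballI closed_Collect_eq continuous_intros)
  moreover have "bounded {E :: complex ^ 'n ^ 'n. unitary_frame E}"
    unfolding bounded_iff
  proof (intro exI ballI)
    fix E :: "complex ^ 'n ^ 'n" assume "E \<in> {E. unitary_frame E}"
    then have E: "unitary_frame E" by simp
    have "norm (E $ k) = 1" for k
      using unitary_frame_norm_1[OF E, of k] by (simp add: norm_vec_def L2_set_def)
    then show "norm E \<le> sqrt (real CARD('n))"
      by (simp add: norm_vec_def L2_set_def)
  qed
  ultimately show ?thesis by (simp add: compact_eq_bounded_closed)
qed

lemma hermitian_form_real: "hermitian H \<Longrightarrow> complex_of_real (Re (sesq H x x)) = sesq H x x"
  using sesq_hermitian_flip[of H x x] by (simp add: complex_eq_iff)

text \<open>
  Jacobi's argument for diagonalisation: a unitary frame that maximises the sum of the squared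
  diagonal entries of \<open>H\<close> has no off-diagonal entry, since a rotation in the plane of
  \<open>E\<^sub>j\<close>, \<open>E\<^sub>k\<close> would move the weight of that entry onto the diagonal.
\<close>

lemma eigenframe_exists:
  fixes H :: "complex ^ 'n ^ 'n"
  assumes H: "hermitian H"
  shows "\<exists>E. eigenframe H E"
proof -
  define F where "F E = (\<Sum>k\<in>UNIV. (frame_diag H E $ k)\<^sup>2)" for E
  have "unitary_frame (mat 1 :: complex ^ 'n ^ 'n)"
  proof -
    have "adjoint_mat (mat 1) = (mat 1 :: complex ^ 'n ^ 'n)"
      by (auto simp: adjoint_mat_def mat_def vec_eq_iff)
    then show ?thesis by (simp add: unitary_frame_def)
  qed
  then have ne: "{E :: complex ^ 'n ^ 'n. unitary_frame E} \<noteq> {}" by blast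
  have "continuous_on {E :: complex ^ 'n ^ 'n. unitary_frame E} F"
    unfolding F_def frame_diag_def sesq_def by (simp, intro continuous_intros)
  then obtain E where E: "unitary_frame E" and Emax: "\<And>G. unitary_frame G \<Longrightarrow> F G \<le> F E"
    using continuous_attains_sup[OF compact_unitary_frames ne] by blast
  have "sesq H (E $ j) (E $ k) = 0" if jk: "j \<noteq> k" for j k
  proof (rule ccontr)
    assume nz: "sesq H (E $ j) (E $ k) \<noteq> 0"
    define m where "m = cmod (sesq H (E $ j) (E $ k))"
    define \<omega> where "\<omega> = sesq H (E $ j) (E $ k) / of_real m"
    have m: "m > 0" using nz by (simp add: m_def)
    have \<omega>: "\<omega> * cnj \<omega> = 1"
      unfolding \<omega>_def using m by (simp add: m_def complex_norm_square[symmetric] power2_eq_square)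
    define \<Delta> where "\<Delta> = frame_diag H E $ j - frame_diag H E $ k"
    define R where "R = sqrt (\<Delta>\<^sup>2 + (2 * m)\<^sup>2)"
    have R2: "R\<^sup>2 = \<Delta>\<^sup>2 + (2 * m)\<^sup>2" unfolding R_def by simp
    have R: "R > 0" unfolding R_def real_sqrt_gt_0_iff using m by (intro add_nonneg_pos) simp_all
    have "(\<Delta> / R)\<^sup>2 + (2 * m / R)\<^sup>2 = 1"
    proof -
      have "(\<Delta> / R)\<^sup>2 + (2 * m / R)\<^sup>2 = (\<Delta>\<^sup>2 + (2 * m)\<^sup>2) / R\<^sup>2"
        by (simp add: power_divide add_divide_distrib)
      then show ?thesis using R unfolding R2[symmetric] by simp
    qed
    \<comment> \<open>\<open>\<tau> / 2\<close> is the Jacobi rotation angle: \<open>R\<close> is the gap of the eigenvalues of the 2 by 2 block.\<close>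
    then obtain \<tau> where \<tau>: "\<Delta> / R = cos \<tau>" "2 * m / R = sin \<tau>"
      using sincos_total_2pi[of "\<Delta> / R" "2 * m / R"] by blast
    define c where "c = cos (\<tau> / 2)"
    define s where "s = sin (\<tau> / 2)"
    have cs1: "c\<^sup>2 + s\<^sup>2 = 1" by (simp add: c_def s_def)
    have cs2: "c\<^sup>2 - s\<^sup>2 = \<Delta> / R" using \<tau>(1) cos_double[of "\<tau>/2"] by (simp add: c_def s_def)
    have cs3: "2 * (c * s) = 2 * m / R" using \<tau>(2) sin_double[of "\<tau>/2"] by (simp add: c_def s_def)
    define M where "M = complex_of_real (- s)"
    have M: "cnj M = M" "M = - of_real s" by (simp_all add: M_def)
    define a where "a = of_real c *s (E $ j) + (of_real s * \<omega>) *s (E $ k)"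
    define b where "b = M *s (E $ j) + (of_real c * \<omega>) *s (E $ k)"
    define G where "G = (\<chi> i. if i = j then a else if i = k then b else E $ i)"
    have Eo: "sesq (mat 1) (E $ p) (E $ q) = (if p = q then 1 else 0)" for p q
      using E by (simp add: unitary_frame_iff)
    have csc: "(of_real c)\<^sup>2 + (of_real s)\<^sup>2 = (1::complex)"
      using cs1 by (metis of_real_1 of_real_add of_real_power)
    have \<omega>': "cnj \<omega> * (\<omega> * x) = x" "\<omega> * (cnj \<omega> * x) = x" for x
      using \<omega> by (metis mult.assoc mult.commute mult_1)+
    have Ga: "unitary_frame G"
    proof -
      have p: "sesq (mat 1) a a = 1" "sesq (mat 1) b b = 1" "sesq (mat 1) a b = 0" "sesq (mat 1) b a = 0"
        using jk csc unfolding a_def b_def sesq_simps Eo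
        by (simp_all add: M algebra_simps \<omega>' power2_eq_square)
      have q: "sesq (mat 1) a (E $ i) = 0" "sesq (mat 1) (E $ i) a = 0" "sesq (mat 1) b (E $ i) = 0" "sesq (mat 1) (E $ i) b = 0"
        if "i \<noteq> j" "i \<noteq> k" for i
        using that unfolding a_def b_def sesq_simps Eo by simp_all
      show ?thesis unfolding unitary_frame_iff using jk p q Eo by (simp add: G_def)
    qed
    have hjk: "cnj \<omega> * sesq H (E $ j) (E $ k) = of_real m"
    proof -
      have "sesq H (E $ j) (E $ k) = \<omega> * of_real m" using m by (simp add: \<omega>_def)
      then show ?thesis by (simp only: \<omega>')
    qed
    have hkj: "\<omega> * sesq H (E $ k) (E $ j) = of_real m"
      using arg_cong[OF hjk, of cnj] sesq_hermitian_flip[OF H, of "E $ k" "E $ j"] by simp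
    define dj where "dj = frame_diag H E $ j"
    define dk where "dk = frame_diag H E $ k"
    have djj: "sesq H (E $ j) (E $ j) = of_real dj" and dkk: "sesq H (E $ k) (E $ k) = of_real dk"
      using hermitian_form_real[OF H] by (auto simp: dj_def dk_def frame_diag_def)
    have ga: "sesq H a a = of_real (c\<^sup>2 * dj + s\<^sup>2 * dk + 2 * (c * s) * m)"
    proof -
      have "sesq H a a = of_real c * of_real c * sesq H (E $ j) (E $ j) + of_real c * of_real s * (cnj \<omega> * sesq H (E $ j) (E $ k))
          + of_real s * of_real c * (\<omega> * sesq H (E $ k) (E $ j)) + of_real s * of_real s * (\<omega> * (cnj \<omega> * sesq H (E $ k) (E $ k)))"
        by (simp add: a_def sesq_simps algebra_simps)
      then show ?thesis unfolding hjk hkj \<omega>' djj dkk by (simp add: algebra_simps power2_eq_square)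
    qed
    have gb: "sesq H b b = of_real (s\<^sup>2 * dj + c\<^sup>2 * dk - 2 * (c * s) * m)"
    proof -
      have "sesq H b b = of_real s * of_real s * sesq H (E $ j) (E $ j) - of_real c * of_real s * (cnj \<omega> * sesq H (E $ j) (E $ k))
          - of_real s * of_real c * (\<omega> * sesq H (E $ k) (E $ j)) + of_real c * of_real c * (\<omega> * (cnj \<omega> * sesq H (E $ k) (E $ k)))"
        by (simp add: b_def sesq_simps M(1)) (simp add: M(2) algebra_simps)
      then show ?thesis unfolding hjk hkj \<omega>' djj dkk by (simp add: algebra_simps power2_eq_square)
    qed
    define gj where "gj = frame_diag H G $ j"
    define gk where "gk = frame_diag H G $ k"
    have gj: "gj = c\<^sup>2 * dj + s\<^sup>2 * dk + 2 * (c * s) * m" 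
      by (simp add: gj_def frame_diag_def G_def ga)
    have gk: "gk = s\<^sup>2 * dj + c\<^sup>2 * dk - 2 * (c * s) * m" 
      using jk by (simp add: gk_def frame_diag_def G_def gb)
    \<comment> \<open>The trace of the block is preserved and the diagonal gap grows from \<open>\<Delta>\<close> to \<open>R\<close>.\<close>
    have sm: "gj + gk = dj + dk"
    proof -
      have "gj + gk = (c\<^sup>2 + s\<^sup>2) * (dj + dk)" unfolding gj gk by (simp add: algebra_simps)
      then show ?thesis using cs1 by simp
    qed
    have df: "gj - gk = R"
    proof -
      have "gj - gk = (c\<^sup>2 - s\<^sup>2) * \<Delta> + 2 * (2 * (c * s)) * m"
        unfolding gj gk \<Delta>_def dj_def dk_def by (simp add: algebra_simps)
      also have "\<dots> = R\<^sup>2 / R" unfolding cs2 cs3 R2 by (simp add: add_divide_distrib power2_eq_square)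
      finally show ?thesis using R by (simp add: power2_eq_square)
    qed
    have "gj\<^sup>2 + gk\<^sup>2 = ((gj + gk)\<^sup>2 + (gj - gk)\<^sup>2) / 2"
      by (simp add: power2_eq_square algebra_simps)
    also have "\<dots> = ((dj + dk)\<^sup>2 + (dj - dk)\<^sup>2) / 2 + 2 * m\<^sup>2"
      unfolding sm df R2 by (simp add: \<Delta>_def dj_def dk_def power2_eq_square)
    also have "((dj + dk)\<^sup>2 + (dj - dk)\<^sup>2) / 2 = dj\<^sup>2 + dk\<^sup>2"
      by (simp add: power2_eq_square algebra_simps)
    finally have gt: "gj\<^sup>2 + gk\<^sup>2 > dj\<^sup>2 + dk\<^sup>2" using m by simp
    have sp: "(\<Sum>i\<in>UNIV. f i) = f j + f k + (\<Sum>i\<in>UNIV - {j} - {k}. f i)" for f :: "'n \<Rightarrow> real"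
      using jk by (simp add: sum.remove[of UNIV j] sum.remove[of "UNIV - {j}" k])
    have "(\<Sum>i\<in>UNIV - {j} - {k}. (frame_diag H G $ i)\<^sup>2) = (\<Sum>i\<in>UNIV - {j} - {k}. (frame_diag H E $ i)\<^sup>2)"
      by (intro sum.cong) (auto simp: frame_diag_def G_def)
    then have "F G > F E" unfolding F_def sp using gt by (simp add: gj_def gk_def dj_def dk_def)
    then show False using Emax[OF Ga] by simp
  qed
  then show ?thesis using E by (auto simp: eigenframe_def)
qed

lemma eigenframe_conjugate:
  assumes "hermitian H" "eigenframe H E"
  shows "(E ** H ** adjoint_mat E) $ j $ k = (if j = k then of_real (frame_diag H E $ j) else 0)"
  using assms hermitian_form_real[OF assms(1), of "E $ k"]
  by (auto simp: conjugated_entry eigenframe_def frame_diag_def)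

text \<open>
  The passage from an eigenframe to another unitary frame averages the eigenvalues with the doubly
  stochastic matrix \<open>|U\<^sub>k\<^sub>j|\<^sup>2\<close>.
\<close>

lemma frame_diag_in_convex:
  fixes C :: "(real ^ 'n) set"
  assumes C: "closed C" "convex C" "\<And>x p. x \<in> C \<Longrightarrow> bij p \<Longrightarrow> (\<chi> i. x $ p i) \<in> C"
    and H: "hermitian H" "eigenframe H E" and x: "frame_diag H E \<in> C" and G: "unitary_frame G"
  shows "frame_diag H G \<in> C"
proof -
  define U where "U = G ** adjoint_mat E"
  have E: "unitary_frame E" using H by (simp add: eigenframe_def)
  have U: "unitary_frame U" unfolding U_def by (intro unitary_frame_mult unitary_frame_adjoint G E)
  have UE: "U ** E = G"
    using unitary_frame_left[OF E] by (simp add: U_def matrix_mul_assoc[symmetric])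
  have "G ** H ** adjoint_mat G = U ** (E ** H ** adjoint_mat E) ** adjoint_mat U"
    unfolding UE[symmetric] adjoint_mat_mult by (simp add: matrix_mul_assoc)
  then have "sesq H (G $ k) (G $ k) = sesq (E ** H ** adjoint_mat E) (U $ k) (U $ k)" for k
    by (simp flip: conjugated_entry)
  also have "\<dots> k = of_real (\<Sum>j\<in>UNIV. (cmod (U $ k $ j))\<^sup>2 * frame_diag H E $ j)" for k
  proof -
    have "sesq (E ** H ** adjoint_mat E) (U $ k) (U $ k)
      = (\<Sum>i\<in>UNIV. U $ k $ i * of_real (frame_diag H E $ i) * cnj (U $ k $ i))"
      unfolding sesq_def eigenframe_conjugate[OF H] by (simp add: if_distrib if_distribR cong: if_cong)
    then show ?thesis by (simp only: of_real_sum of_real_mult complex_norm_square) (simp add: algebra_simps)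
  qed
  finally have eq: "frame_diag H G = (\<chi> k. \<Sum>j\<in>UNIV. (cmod (U $ k $ j))\<^sup>2 * frame_diag H E $ j)"
    unfolding frame_diag_def[of H G] by (simp add: vec_eq_iff)
  have "(\<Sum>i\<in>UNIV. (cmod (U $ i $ j))\<^sup>2) = 1" for j
    using unitary_frame_norm_1[OF unitary_frame_adjoint[OF U], of j] by (simp add: adjoint_mat_def)
  then show ?thesis unfolding eq
    by (intro doubly_stochastic_image_in_convex C x) (simp_all add: unitary_frame_norm_1[OF U])
qed

text \<open>
  Monic polynomials with the same values have the same multiset of roots, so whichever list
  \<open>eigenvals\<close> selects, it is a permutation of the diagonal in any eigenframe.
\<close>

lemma eigenvals_eigenframe:
  fixes H :: "complex ^ 'n ^ 'n"
  assumes H: "hermitian H" "eigenframe H E"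
  shows "\<exists>p. bij p \<and> eigenvals H = (\<chi> i. frame_diag H E $ p i)"
proof -
  let ?l = "frame_diag H E"
  have E: "unitary_frame E" using H by (simp add: eigenframe_def)
  have sp: "det (mat t - H) = (\<Prod>i\<in>UNIV. t - complex_of_real (?l $ i))" for t
  proof -
    have "det (E ** (mat t - H) ** adjoint_mat E) = det (E ** adjoint_mat E) * det (mat t - H)"
      by (simp add: det_mul)
    then have "det (mat t - H) = det (E ** (mat t - H) ** adjoint_mat E)"
      using E by (simp add: unitary_frame_def)
    also have "E ** (mat t - H) ** adjoint_mat E = (\<chi> j k. if j = k then t - of_real (?l $ j) else 0)"
    proof -
      have "sesq (mat t - H) x y = sesq (mat t) x y - sesq H x y" for x y
        by (simp add: sesq_def algebra_simps sum_subtractf)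
      moreover have "sesq (mat t) (E $ j) (E $ k) = (if j = k then t else 0)" for j k
        using E by (simp add: sesq_mat unitary_frame_iff)
      ultimately show ?thesis
        using eigenframe_conjugate[OF H] by (auto simp: vec_eq_iff conjugated_entry)
    qed
    also have "det \<dots> = (\<Prod>i\<in>UNIV. t - complex_of_real (?l $ i))"
      by (subst det_diagonal) auto
    finally show ?thesis .
  qed
  define m where "m = eigenvals H"
  have "\<exists>l :: real ^ 'n. \<forall>t. det (mat t - H) = (\<Prod>i\<in>UNIV. t - complex_of_real (l $ i))"
    by (intro exI[of _ ?l]) (simp add: sp)
  then have "\<forall>t. det (mat t - H) = (\<Prod>i\<in>UNIV. t - complex_of_real (m $ i))"
    unfolding m_def eigenvals_def by (rule someI_ex)
  then have eq: "(\<Prod>i\<in>UNIV. t - complex_of_real (m $ i)) = (\<Prod>i\<in>UNIV. t - complex_of_real (?l $ i))" for t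
    using sp by simp
  define P where "P x = (\<Prod>i\<in>UNIV. [:- complex_of_real (x $ i), 1:])" for x :: "real ^ 'n"
  have "poly (P m) = poly (P ?l)"
    using eq by (auto simp: P_def poly_prod fun_eq_iff)
  then have "P m = P ?l" by (simp add: poly_eq_poly_eq_iff)
  moreover have "proots (P x) = image_mset (\<lambda>i. complex_of_real (x $ i)) (mset_set UNIV)" for x
  proof -
    have "proots (P x) = (\<Sum>i\<in>UNIV. {#complex_of_real (x $ i)#})"
      unfolding P_def by (subst proots_prod) (auto simp: proots_linear_factor)
    also have "\<dots> = image_mset (\<lambda>i. complex_of_real (x $ i)) (mset_set UNIV)"
      by (simp add: sum_unfold_sum_mset)
    finally show ?thesis .
  qed
  ultimately have "image_mset (\<lambda>i. complex_of_real (m $ i)) (mset_set UNIV) = image_mset (\<lambda>i. complex_of_real (?l $ i)) (mset_set UNIV)"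
    by metis
  then obtain p where "p permutes UNIV" "\<forall>i\<in>UNIV. complex_of_real (m $ i) = complex_of_real (?l $ p i)"
    by (rule image_mset_eq_implies_permutes[rotated]) auto
  then show ?thesis unfolding m_def by (intro exI[of _ p]) (auto simp: vec_eq_iff permutes_bij)
qed

section \<open>Second derivatives and the complex Hessian\<close>

text \<open>
  The derivatives are carried as explicit data, since the operator acts on \<open>q''\<close> directly.
\<close>

definition C2_on :: "'a::real_normed_vector set \<Rightarrow> ('a \<Rightarrow> real) \<Rightarrow> ('a \<Rightarrow> 'a \<Rightarrow>\<^sub>L real) \<Rightarrow>
    ('a \<Rightarrow> 'a \<Rightarrow>\<^sub>L 'a \<Rightarrow>\<^sub>L real) \<Rightarrow> bool" where
  "C2_on N q q' q'' \<longleftrightarrow> open N \<and>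
     (\<forall>z\<in>N. (q has_derivative blinfun_apply (q' z)) (at z)) \<and>
     (\<forall>z\<in>N. (q' has_derivative blinfun_apply (q'' z)) (at z)) \<and> continuous_on N q''"

lemma C2_near_iff: "C2_near q z \<longleftrightarrow> (\<exists>N q' q''. z \<in> N \<and> C2_on N q q' q'')"
  by (auto simp: C2_near_def C2_on_def)

lemma line_derivative:
  assumes "(q has_derivative blinfun_apply (q' (a + t *\<^sub>R h))) (at (a + t *\<^sub>R h))"
  shows "((\<lambda>t. q (a + t *\<^sub>R h)) has_vector_derivative q' (a + t *\<^sub>R h) h) (at t)"
proof -
  have "((\<lambda>t. a + t *\<^sub>R h) has_derivative (\<lambda>t. t *\<^sub>R h)) (at t)"
    by (auto intro!: derivative_eq_intros)
  from has_derivative_compose[OF this assms]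
  show ?thesis by (simp add: has_vector_derivative_def blinfun.scaleR_right)
qed

lemma blinfun_apply_derivative:
  assumes "(q' has_vector_derivative D) F"
  shows "((\<lambda>t. blinfun_apply (q' t) h) has_vector_derivative D h) F"
  using bounded_linear.has_vector_derivative[OF blinfun.bounded_linear_left assms] .

lemma C2_on_second_difference:
  fixes q :: "'a::real_normed_vector \<Rightarrow> real"
  assumes C: "C2_on N q q' q''" and s: "s > 0"
    and N: "\<And>\<theta> \<tau>. \<theta> \<in> {0..s} \<Longrightarrow> \<tau> \<in> {0..s} \<Longrightarrow> z + \<theta> *\<^sub>R h + \<tau> *\<^sub>R k \<in> N"
  shows "\<exists>\<theta>\<in>{0..s}. \<exists>\<tau>\<in>{0..s}. q (z + s *\<^sub>R h + s *\<^sub>R k) - q (z + s *\<^sub>R h) - q (z + s *\<^sub>R k) + q z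
     = s\<^sup>2 * q'' (z + \<theta> *\<^sub>R h + \<tau> *\<^sub>R k) k h"
proof -
  have dq: "(q has_derivative blinfun_apply (q' w)) (at w)" "(q' has_derivative blinfun_apply (q'' w)) (at w)"
    if "w \<in> N" for w using C that by (auto simp: C2_on_def)
  define g where "g t = q ((z + s *\<^sub>R k) + t *\<^sub>R h) - q (z + t *\<^sub>R h)" for t
  have "DERIV g t :> q' ((z + s *\<^sub>R k) + t *\<^sub>R h) h - q' (z + t *\<^sub>R h) h" if "0 \<le> t" "t \<le> s" for t
  proof -
    have "(z + s *\<^sub>R k) + t *\<^sub>R h \<in> N" "z + t *\<^sub>R h \<in> N"
      using N[of t s] N[of t 0] that s by (auto simp: algebra_simps)
    then show ?thesis unfolding g_def has_real_derivative_iff_has_vector_derivative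
      by (intro has_vector_derivative_diff line_derivative dq)
  qed
  from MVT2[OF s this] obtain \<theta> where \<theta>: "0 < \<theta>" "\<theta> < s"
    "g s - g 0 = (s - 0) * (q' ((z + s *\<^sub>R k) + \<theta> *\<^sub>R h) h - q' (z + \<theta> *\<^sub>R h) h)" by blast
  have "DERIV (\<lambda>t. q' ((z + \<theta> *\<^sub>R h) + t *\<^sub>R k) h) t :> q'' ((z + \<theta> *\<^sub>R h) + t *\<^sub>R k) k h" if "0 \<le> t" "t \<le> s" for t
  proof -
    have "(z + \<theta> *\<^sub>R h) + t *\<^sub>R k \<in> N" using N[of \<theta> t] that \<theta> by simp
    then show ?thesis unfolding has_real_derivative_iff_has_vector_derivative
      by (intro blinfun_apply_derivative line_derivative dq)
  qed
  from MVT2[OF s this] obtain \<tau> where \<tau>: "0 < \<tau>" "\<tau> < s"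
    "q' ((z + \<theta> *\<^sub>R h) + s *\<^sub>R k) h - q' ((z + \<theta> *\<^sub>R h) + 0 *\<^sub>R k) h = (s - 0) * q'' ((z + \<theta> *\<^sub>R h) + \<tau> *\<^sub>R k) k h"
    by blast
  have "g s - g 0 = s\<^sup>2 * q'' (z + \<theta> *\<^sub>R h + \<tau> *\<^sub>R k) k h"
    using \<theta>(3) \<tau>(3) by (simp add: power2_eq_square algebra_simps)
  then show ?thesis using \<theta> \<tau> by (intro bexI[of _ \<theta>] bexI[of _ \<tau>]) (auto simp: g_def algebra_simps)
qed

text \<open>
  Schwarz's theorem: the second difference quotient is symmetric in the two directions, and it is a
  value of \<open>q''\<close> at a nearby point for either order of the two mean value steps.
\<close>

lemma C2_on_symmetric:
  fixes q :: "'a::real_normed_vector \<Rightarrow> real"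
  assumes C: "C2_on N q q' q''" and z: "z \<in> N"
  shows "q'' z h k = q'' z k h"
proof (rule ccontr)
  assume ne: "q'' z h k \<noteq> q'' z k h"
  define e where "e = \<bar>q'' z h k - q'' z k h\<bar> / 2"
  have e: "e > 0" using ne by (simp add: e_def)
  have cont: "isCont q'' z" using C z by (auto simp: C2_on_def continuous_on_eq_continuous_at)
  have c1: "isCont (\<lambda>w. q'' w h k) z" "isCont (\<lambda>w. q'' w k h) z"
    using cont by (auto intro!: continuous_intros)
  obtain d1 where d1: "d1 > 0" "\<And>w. dist w z < d1 \<Longrightarrow> \<bar>q'' w h k - q'' z h k\<bar> < e"
    using c1(1) e unfolding continuous_at_eps_delta dist_real_def by blast
  obtain d2 where d2: "d2 > 0" "\<And>w. dist w z < d2 \<Longrightarrow> \<bar>q'' w k h - q'' z k h\<bar> < e"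
    using c1(2) e unfolding continuous_at_eps_delta dist_real_def by blast
  obtain d3 where d3: "d3 > 0" "ball z d3 \<subseteq> N"
    using C z unfolding C2_on_def open_contains_ball by blast
  define d where "d = Min {d1, d2, d3}"
  have d: "d > 0" "d \<le> d1" "d \<le> d2" "d \<le> d3" using d1 d2 d3 by (auto simp: d_def)
  define s where "s = d / (2 * (norm h + norm k + 1))"
  have pos: "norm h + norm k + 1 > 0" by (simp add: add_nonneg_pos)
  have s: "s > 0" using d pos by (simp add: s_def)
  have near: "dist (z + \<theta> *\<^sub>R h + \<tau> *\<^sub>R k) z < d" if "\<theta> \<in> {0..s}" "\<tau> \<in> {0..s}" for \<theta> \<tau>
  proof -
    have "dist (z + \<theta> *\<^sub>R h + \<tau> *\<^sub>R k) z \<le> \<theta> * norm h + \<tau> * norm k"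
      using that norm_triangle_ineq[of "\<theta> *\<^sub>R h" "\<tau> *\<^sub>R k"] by (simp add: dist_norm add.assoc)
    also have "\<dots> \<le> s * norm h + s * norm k" using that by (intro add_mono mult_right_mono) auto
    also have "\<dots> \<le> s * (norm h + norm k + 1)" using s by (simp add: algebra_simps)
    also have "\<dots> = d / 2" using pos by (simp add: s_def field_simps)
    finally show ?thesis using d by simp
  qed
  have inN: "z + \<theta> *\<^sub>R h + \<tau> *\<^sub>R k \<in> N" "z + \<theta> *\<^sub>R k + \<tau> *\<^sub>R h \<in> N" if "\<theta> \<in> {0..s}" "\<tau> \<in> {0..s}" for \<theta> \<tau>
    using near[OF that] near[OF that(2) that(1)] d d3 by (auto simp: dist_commute algebra_simps subset_iff)
  obtain \<theta> \<tau> where 1: "\<theta> \<in> {0..s}" "\<tau> \<in> {0..s}"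
    "q (z + s *\<^sub>R h + s *\<^sub>R k) - q (z + s *\<^sub>R h) - q (z + s *\<^sub>R k) + q z = s\<^sup>2 * q'' (z + \<theta> *\<^sub>R h + \<tau> *\<^sub>R k) k h"
    using C2_on_second_difference[OF C s inN(1)] by blast
  obtain \<theta>' \<tau>' where 2: "\<theta>' \<in> {0..s}" "\<tau>' \<in> {0..s}"
    "q (z + s *\<^sub>R k + s *\<^sub>R h) - q (z + s *\<^sub>R k) - q (z + s *\<^sub>R h) + q z = s\<^sup>2 * q'' (z + \<theta>' *\<^sub>R k + \<tau>' *\<^sub>R h) h k"
    using C2_on_second_difference[OF C s inN(2)] by blast
  have "s\<^sup>2 * q'' (z + \<theta> *\<^sub>R h + \<tau> *\<^sub>R k) k h = s\<^sup>2 * q'' (z + \<theta>' *\<^sub>R k + \<tau>' *\<^sub>R h) h k"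
    using 1(3) 2(3) by (simp add: algebra_simps)
  then have eq: "q'' (z + \<theta> *\<^sub>R h + \<tau> *\<^sub>R k) k h = q'' (z + \<theta>' *\<^sub>R k + \<tau>' *\<^sub>R h) h k" using s by simp
  have n1: "dist (z + \<theta> *\<^sub>R h + \<tau> *\<^sub>R k) z < d" using near 1 by blast
  have n2: "dist (z + \<theta>' *\<^sub>R k + \<tau>' *\<^sub>R h) z < d" using near[OF 2(2,1)] by (simp add: algebra_simps)
  have "\<bar>q'' (z + \<theta> *\<^sub>R h + \<tau> *\<^sub>R k) k h - q'' z k h\<bar> < e" "\<bar>q'' (z + \<theta>' *\<^sub>R k + \<tau>' *\<^sub>R h) h k - q'' z h k\<bar> < e"
    using n1 n2 d1(2) d2(2) d by auto
  moreover have "False" if "\<bar>a - K\<bar> < \<bar>H - K\<bar> / 2" "\<bar>b - H\<bar> < \<bar>H - K\<bar> / 2" "a = b" for a b H K :: real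
    using that by (auto simp: abs_if split: if_splits)
  ultimately show False using eq unfolding e_def by blast
qed

text \<open>
  The Levi form: up to the factor fixed by the convention for \<open>\<partial>/\<partial>z\<close>, the complex Hessian of \<open>q\<close>
  is the average of the real second derivative over a complex line.
\<close>

definition levi :: "((complex ^ 'n) \<Rightarrow>\<^sub>L (complex ^ 'n) \<Rightarrow>\<^sub>L real) \<Rightarrow> complex ^ 'n \<Rightarrow> real" where
  "levi A \<zeta> = (A \<zeta> \<zeta> + A (\<i> *s \<zeta>) (\<i> *s \<zeta>)) / 4"

lemma levi_add: "levi (A + B) \<zeta> = levi A \<zeta> + levi B \<zeta>"
  by (simp add: levi_def blinfun.add_left add_divide_distrib)
lemma levi_scale: "levi (c *\<^sub>R A) \<zeta> = c * levi A \<zeta>"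
  by (simp add: levi_def blinfun.scaleR_left algebra_simps)

definition inner2 :: "'a::real_inner \<Rightarrow>\<^sub>L 'a \<Rightarrow>\<^sub>L real" where
  "inner2 = Blinfun blinfun_inner_right"

lemma inner2_apply [simp]: "inner2 x y = x \<bullet> y"
  by (simp add: inner2_def bounded_linear_Blinfun_apply bounded_linear_blinfun_inner_right blinfun_inner_right.rep_eq)

lemma levi_inner2: "levi inner2 \<zeta> = (norm \<zeta>)\<^sup>2 / 2"
proof -
  have "norm (\<i> *s \<zeta>) = norm \<zeta>" by (simp add: norm_vec_def norm_mult)
  then show ?thesis by (simp add: levi_def power2_norm_eq_inner[symmetric])
qed

lemma norm_unitary_frame: "unitary_frame E \<Longrightarrow> norm (E $ k) = 1"
  using unitary_frame_norm_1[of E k] by (simp add: norm_vec_def L2_set_def)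

text \<open>
  The mixed second partial derivatives are read off the bilinear form \<open>q''\<close> on the real basis
  \<open>e\<^sub>\<alpha>\<close>, \<open>\<i> e\<^sub>\<alpha>\<close>.
\<close>

lemma complex_hessian_entry:
  fixes q :: "complex ^ 'n \<Rightarrow> real"
  assumes C: "C2_on N q q' q''" and z: "z \<in> N"
  shows "complex_hessian q z $ \<alpha> $ \<beta> =
    (of_real (q'' z (axis \<alpha> 1) (axis \<beta> 1) + q'' z (axis \<alpha> \<i>) (axis \<beta> \<i>))
      + \<i> * of_real (q'' z (axis \<alpha> 1) (axis \<beta> \<i>) - q'' z (axis \<alpha> \<i>) (axis \<beta> 1))) / 4"
proof -
  have dq: "(q has_derivative blinfun_apply (q' w)) (at w)" "(q' has_derivative blinfun_apply (q'' w)) (at w)"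
    if "w \<in> N" for w using C that by (auto simp: C2_on_def)
  have N: "open N" using C by (simp add: C2_on_def)
  have p1: "partial_deriv e (\<lambda>w. complex_of_real (q w)) w = of_real (q' w e)" if "w \<in> N" for w e
    unfolding partial_deriv_def
    by (rule vector_derivative_at, rule has_vector_derivative_of_real)
      (use line_derivative[of q q' w 0 e] dq that in \<open>simp add: has_real_derivative_iff_has_vector_derivative\<close>)
  define G where "G \<beta> w = (complex_of_real (q' w (axis \<beta> 1)) + \<i> * of_real (q' w (axis \<beta> \<i>))) / 2" for \<beta> w
  have G: "d_dzbar \<beta> (\<lambda>w. complex_of_real (q w)) w = G \<beta> w" if "w \<in> N" for w \<beta>
    by (simp add: d_dzbar_def p1[OF that] G_def)
  have p2: "partial_deriv e (d_dzbar \<beta> (\<lambda>w. complex_of_real (q w))) z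
      = (of_real (q'' z e (axis \<beta> 1)) + \<i> * of_real (q'' z e (axis \<beta> \<i>))) / 2" for e \<beta>
  proof -
    let ?D = "(complex_of_real (q'' z e (axis \<beta> 1)) + \<i> * of_real (q'' z e (axis \<beta> \<i>))) / 2"
    have a: "((\<lambda>t. q' (z + t *\<^sub>R e)) has_vector_derivative q'' z e) (at 0)"
    proof -
      have "((\<lambda>t. z + t *\<^sub>R e) has_derivative (\<lambda>t. t *\<^sub>R e)) (at 0)"
        by (auto intro!: derivative_eq_intros)
      from has_derivative_compose[OF this, of q' "q'' z"] dq(2)[OF z]
      show ?thesis by (simp add: has_vector_derivative_def blinfun.scaleR_right)
    qed
    have b: "((\<lambda>t. complex_of_real (q' (z + t *\<^sub>R e) x)) has_vector_derivative of_real (q'' z e x)) (at 0)" for x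
      using blinfun_apply_derivative[OF a, of x]
      by (intro has_vector_derivative_of_real) (simp add: has_real_derivative_iff_has_vector_derivative)
    have c: "((\<lambda>t. G \<beta> (z + t *\<^sub>R e)) has_vector_derivative ?D) (at 0)"
      unfolding G_def by (intro has_vector_derivative_divide has_vector_derivative_add has_vector_derivative_mult_right b)
    have "open ((\<lambda>t. z + t *\<^sub>R e) -` N)"
      by (rule open_vimage[OF N]) (intro continuous_intros)
    then have "((\<lambda>t. d_dzbar \<beta> (\<lambda>w. complex_of_real (q w)) (z + t *\<^sub>R e)) has_vector_derivative ?D) (at 0)"
      by (rule has_vector_derivative_transform_within_open[OF c]) (auto simp: z G)
    then show ?thesis unfolding partial_deriv_def by (rule vector_derivative_at)
  qed
  show ?thesis
    by (simp add: complex_hessian_def d_dz_def p2 field_simps)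
qed

lemma complex_hessian_hermitian:
  assumes C: "C2_on N q q' q''" and z: "z \<in> N"
  shows "hermitian (complex_hessian q z)"
  unfolding hermitian_def complex_hessian_entry[OF C z]
  using C2_on_symmetric[OF C z] by (auto simp: complex_eq_iff)

lemma complex_vec_expansion: "\<zeta> = (\<Sum>\<alpha>\<in>UNIV. Re (\<zeta> $ \<alpha>) *\<^sub>R axis \<alpha> 1 + Im (\<zeta> $ \<alpha>) *\<^sub>R axis \<alpha> \<i>)"
  for \<zeta> :: "complex ^ 'n"
proof (subst vec_eq_iff, rule)
  fix i
  have "(\<Sum>\<alpha>\<in>UNIV. Re (\<zeta> $ \<alpha>) *\<^sub>R axis \<alpha> 1 + Im (\<zeta> $ \<alpha>) *\<^sub>R axis \<alpha> \<i>) $ i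
     = (\<Sum>\<alpha>\<in>UNIV. if \<alpha> = i then \<zeta> $ \<alpha> else 0)"
    unfolding sum_component by (intro sum.cong) (auto simp: axis_def complex_eq_iff)
  then show "\<zeta> $ i = (\<Sum>\<alpha>\<in>UNIV. Re (\<zeta> $ \<alpha>) *\<^sub>R axis \<alpha> 1 + Im (\<zeta> $ \<alpha>) *\<^sub>R axis \<alpha> \<i>) $ i" by simp
qed

lemma bilinear_expansion:
  fixes A :: "(complex ^ 'n) \<Rightarrow>\<^sub>L (complex ^ 'n) \<Rightarrow>\<^sub>L real"
  shows "A \<zeta> \<zeta> = (\<Sum>i\<in>UNIV. \<Sum>j\<in>UNIV.
      Re (\<zeta> $ i) * Re (\<zeta> $ j) * A (axis i 1) (axis j 1) + Re (\<zeta> $ i) * Im (\<zeta> $ j) * A (axis i 1) (axis j \<i>)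
    + Im (\<zeta> $ i) * Re (\<zeta> $ j) * A (axis i \<i>) (axis j 1) + Im (\<zeta> $ i) * Im (\<zeta> $ j) * A (axis i \<i>) (axis j \<i>))"
proof -
  have "A \<zeta> \<zeta> = A (\<Sum>\<alpha>\<in>UNIV. Re (\<zeta> $ \<alpha>) *\<^sub>R axis \<alpha> 1 + Im (\<zeta> $ \<alpha>) *\<^sub>R axis \<alpha> \<i>)
      (\<Sum>\<alpha>\<in>UNIV. Re (\<zeta> $ \<alpha>) *\<^sub>R axis \<alpha> 1 + Im (\<zeta> $ \<alpha>) *\<^sub>R axis \<alpha> \<i>)"
    by (simp only: complex_vec_expansion[symmetric])
  then show ?thesis
    by (simp only: blinfun.sum_right blinfun.sum_left blinfun.add_left blinfun.add_right blinfun.scaleR_left blinfun.scaleR_right)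
      (subst sum.swap, intro sum.cong refl, simp add: algebra_simps sum_distrib_left sum.distrib)
qed

lemma frame_diag_complex_hessian:
  assumes C: "C2_on N q q' q''" and z: "z \<in> N"
  shows "frame_diag (complex_hessian q z) E = (\<chi> k. levi (q'' z) (E $ k))"
proof -
  have "Re (sesq (complex_hessian q z) \<zeta> \<zeta>) = levi (q'' z) \<zeta>" for \<zeta>
    unfolding levi_def bilinear_expansion[of "q'' z" "\<zeta>"] bilinear_expansion[of "q'' z" "\<i> *s \<zeta>"]
      sesq_def complex_hessian_entry[OF C z] sum.distrib[symmetric] sum_divide_distrib Re_sum
    by (intro sum.cong refl) (simp add: field_simps)
  then show ?thesis by (simp add: frame_diag_def)
qed

section \<open>The operator in terms of unitary frames\<close>

definition ones :: "real ^ 'n" where "ones = (\<chi> i. 1)"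

lemma ones_nth [simp]: "ones $ i = 1" by (simp add: ones_def)

text \<open>
  Positive vectors lie in the smallest Garding cone, hence in every admissible cone.
\<close>

lemma elem_sym_pos:
  fixes x :: "real ^ 'n"
  assumes "\<And>i. x $ i > 0" "m \<le> CARD('n)"
  shows "elem_sym m x > 0"
proof -
  obtain S :: "'n set" where "card S = m"
    using assms(2) obtain_subset_with_card_n[of m "UNIV :: 'n set"] by auto
  then have "{S :: 'n set. card S = m} \<noteq> {}" by blast
  then show ?thesis unfolding elem_sym_def
    by (intro sum_pos prod_pos) (auto simp: assms)
qed

lemma elem_sym_1: "elem_sym 1 x = (\<Sum>i\<in>UNIV. x $ i)"
proof -
  have "{S :: 'a set. card S = 1} = (\<lambda>i. {i}) ` UNIV" by (auto simp: card_1_singleton_iff)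
  then show ?thesis by (simp add: elem_sym_def sum.reindex)
qed

locale hessian_operator =
  fixes \<Gamma> :: "(real ^ 'n) set" and f :: "real ^ 'n \<Rightarrow> real"
  assumes cone: "admissible_cone \<Gamma>" and fn: "admissible_fun \<Gamma> f"
begin

text \<open>
  Closed, convex, symmetric and stable under addition of nonnegative vectors; these are the only
  properties of the operator that the linear reduction uses.
\<close>

definition superlevel :: "real \<Rightarrow> (real ^ 'n) set" where
  "superlevel c = {x \<in> closure \<Gamma>. f x \<ge> c}"

lemma cone_facts: "open \<Gamma>" "convex \<Gamma>" "\<And>x c. x \<in> \<Gamma> \<Longrightarrow> c > 0 \<Longrightarrow> c *\<^sub>R x \<in> \<Gamma>"
  "\<And>x p. x \<in> \<Gamma> \<Longrightarrow> bij p \<Longrightarrow> (\<chi> i. x $ p i) \<in> \<Gamma>"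
  using cone by (auto simp: admissible_cone_def)

lemma fun_facts: "\<And>x. x \<in> closure \<Gamma> \<Longrightarrow> f x \<ge> 0" "continuous_on (closure \<Gamma>) f"
  "\<And>x p. x \<in> closure \<Gamma> \<Longrightarrow> bij p \<Longrightarrow> f (\<chi> i. x $ p i) = f x"
  "concave_on (closure \<Gamma>) f" "\<And>x. x \<in> frontier \<Gamma> \<Longrightarrow> f x = 0"
  using fn by (auto simp: admissible_fun_def)

lemma positive_in_cone: "(\<And>i. x $ i > 0) \<Longrightarrow> x \<in> \<Gamma>"
  using cone elem_sym_pos[of x] unfolding admissible_cone_def garding_cone_def by (auto simp: subset_iff)

text \<open>
  The midpoint of a point of the closure and an interior point of a convex set is interior.
\<close>

lemma closure_add_cone:
  assumes "x \<in> closure \<Gamma>" "y \<in> \<Gamma>"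
  shows "x + y \<in> \<Gamma>"
proof -
  have "(1/2) *\<^sub>R (x + y) \<in> \<Gamma>"
  proof (cases "x = y")
    case True
    then show ?thesis using assms by simp
  next
    case False
    have "open_segment y x \<subseteq> interior \<Gamma>"
      using in_interior_closure_convex_segment[OF cone_facts(2), of y x] assms cone_facts(1) by (simp add: interior_open)
    moreover have "(1/2) *\<^sub>R (x + y) \<in> open_segment y x"
      using midpoint_in_open_segment[of y x] False by (simp add: midpoint_def add.commute)
    ultimately show ?thesis using interior_subset by blast
  qed
  then show ?thesis using cone_facts(3)[of "(1/2) *\<^sub>R (x + y)" 2] by simp
qed

lemma closure_add_nonneg:
  assumes "x \<in> closure \<Gamma>" "\<And>i. y $ i \<ge> 0"
  shows "x + y \<in> closure \<Gamma>"
proof -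
  have "x + (y + (1 / real (Suc k)) *\<^sub>R ones) \<in> \<Gamma>" for k
    using assms by (intro closure_add_cone positive_in_cone) (auto simp: add_nonneg_pos)
  moreover have "(\<lambda>k. x + (y + (1 / real (Suc k)) *\<^sub>R ones)) \<longlonglongrightarrow> x + (y + 0 *\<^sub>R ones)"
    by (intro tendsto_intros LIMSEQ_Suc[OF lim_1_over_n])
  ultimately show ?thesis unfolding closure_sequential by (intro exI conjI allI) (auto simp: add.assoc)
qed

lemma closure_scale:
  assumes "x \<in> closure \<Gamma>" "c > 0"
  shows "c *\<^sub>R x \<in> closure \<Gamma>"
proof -
  have "(*\<^sub>R) c ` closure \<Gamma> = closure ((*\<^sub>R) c ` \<Gamma>)" by (rule closure_scaleR)
  also have "\<dots> \<subseteq> closure \<Gamma>" using cone_facts(3) assms(2) by (intro closure_mono) auto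
  finally show ?thesis using assms by blast
qed

lemma closure_perm:
  assumes "x \<in> closure \<Gamma>" "bij p"
  shows "(\<chi> i. x $ p i) \<in> closure \<Gamma>"
proof -
  have "(\<lambda>x. (\<chi> i. x $ p i)) ` closure \<Gamma> \<subseteq> closure \<Gamma>"
    by (rule image_closure_subset) (auto intro!: continuous_intros closure_subset[THEN subsetD] cone_facts(4) assms(2))
  then show ?thesis using assms by blast
qed

lemma closure_trace_nonneg: "x \<in> closure \<Gamma> \<Longrightarrow> (\<Sum>i\<in>UNIV. x $ i) \<ge> 0"
proof -
  have "closure \<Gamma> \<subseteq> {x. (\<Sum>i\<in>UNIV. x $ i) \<ge> 0}"
  proof (rule closure_minimal)
    show "\<Gamma> \<subseteq> {x. (\<Sum>i\<in>UNIV. x $ i) \<ge> 0}"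
    proof
      fix x assume "x \<in> \<Gamma>"
      then have "x \<in> garding_cone 1" using cone unfolding admissible_cone_def by blast
      then have "elem_sym 1 x > 0" unfolding garding_cone_def by simp
      then show "x \<in> {x. (\<Sum>i\<in>UNIV. x $ i) \<ge> 0}" unfolding elem_sym_1 by simp
    qed
    show "closed {x :: real ^ 'n. (\<Sum>i\<in>UNIV. x $ i) \<ge> 0}"
      by (intro closed_Collect_le continuous_intros)
  qed
  then show "x \<in> closure \<Gamma> \<Longrightarrow> (\<Sum>i\<in>UNIV. x $ i) \<ge> 0" by blast
qed

lemma f_concave:
  assumes "x \<in> closure \<Gamma>" "y \<in> closure \<Gamma>" "0 \<le> t" "t \<le> 1"
  shows "f ((1 - t) *\<^sub>R x + t *\<^sub>R y) \<ge> (1 - t) * f x + t * f y"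
  using fun_facts(4) assms unfolding concave_on_iff by (metis add_diff_cancel_left' diff_add_cancel diff_ge_0_iff_ge)

text \<open>
  Monotonicity along every direction in which the ray stays in the cone: by concavity \<open>f (x + y)\<close> is
  at least \<open>s f x\<close> plus a multiple of a value of \<open>f\<close> far out on the ray, which is nonnegative, and
  \<open>s\<close> can be taken arbitrarily close to 1.
\<close>

lemma f_add_mono:
  assumes x: "x \<in> closure \<Gamma>" and y: "\<And>t. t > 0 \<Longrightarrow> x + t *\<^sub>R y \<in> closure \<Gamma>"
  shows "f (x + y) \<ge> f x"
proof -
  have "s * f x \<le> f (x + y)" if s: "0 < s" "s < 1" for s
  proof -
    have "x + y = (1 - (1 - s)) *\<^sub>R x + (1 - s) *\<^sub>R (x + (1 / (1 - s)) *\<^sub>R y)"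
      using s by (simp add: algebra_simps)
    moreover have "x + (1 / (1 - s)) *\<^sub>R y \<in> closure \<Gamma>" using s by (intro y) simp
    ultimately have "(1 - (1 - s)) * f x + (1 - s) * f (x + (1 / (1 - s)) *\<^sub>R y) \<le> f (x + y)"
      using f_concave[OF x, of "x + (1 / (1 - s)) *\<^sub>R y" "1 - s"] s by simp
    moreover have "(1 - s) * f (x + (1 / (1 - s)) *\<^sub>R y) \<ge> 0"
      using s fun_facts(1) \<open>x + (1 / (1 - s)) *\<^sub>R y \<in> closure \<Gamma>\<close> by simp
    ultimately show ?thesis by simp
  qed
  then show ?thesis by (rule field_le_mult_one_interval)
qed

lemma superlevel_closed: "closed (superlevel c)"
proof -
  have "closed (closure \<Gamma> \<inter> f -` {c..})"
    by (rule continuous_closed_preimage[OF fun_facts(2)]) auto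
  moreover have "superlevel c = closure \<Gamma> \<inter> f -` {c..}" by (auto simp: superlevel_def)
  ultimately show ?thesis by simp
qed

lemma superlevel_convex: "convex (superlevel c)"
  unfolding convex_alt
proof (intro ballI allI impI)
  fix x y u assume a: "x \<in> superlevel c" "y \<in> superlevel c" "0 \<le> u \<and> u \<le> (1::real)"
  have "(1 - u) *\<^sub>R x + u *\<^sub>R y \<in> closure \<Gamma>"
    using convex_closure[OF cone_facts(2)] a by (auto simp: convex_alt superlevel_def)
  moreover have "(1 - u) * c + u * c \<le> (1 - u) * f x + u * f y"
    using a by (intro add_mono mult_left_mono) (auto simp: superlevel_def)
  ultimately show "(1 - u) *\<^sub>R x + u *\<^sub>R y \<in> superlevel c"
    using f_concave[of x y u] a by (auto simp: superlevel_def algebra_simps)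
qed

lemma superlevel_perm: "x \<in> superlevel c \<Longrightarrow> bij p \<Longrightarrow> (\<chi> i. x $ p i) \<in> superlevel c"
  using closure_perm fun_facts(3) by (auto simp: superlevel_def)

lemma superlevel_add_nonneg:
  assumes "x \<in> superlevel c" "\<And>i. y $ i \<ge> 0"
  shows "x + y \<in> superlevel c"
  using assms closure_add_nonneg[of x y] f_add_mono[of x y] closure_add_nonneg[of x "_ *\<^sub>R y"]
  by (fastforce simp: superlevel_def)

lemma f_ones_mono:
  assumes "R \<le> R'" "R > 0"
  shows "f (R *\<^sub>R ones) \<le> f (R' *\<^sub>R ones)"
proof -
  have "R *\<^sub>R ones \<in> superlevel (f (R *\<^sub>R ones))"
    using positive_in_cone[of "R *\<^sub>R ones"] assms closure_subset by (auto simp: superlevel_def)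
  from superlevel_add_nonneg[OF this, of "(R' - R) *\<^sub>R ones"] assms
  show ?thesis by (simp add: superlevel_def scaleR_left_diff_distrib)
qed

text \<open>
  A uniform gain: by concavity \<open>f\<close> increases from \<open>x\<close> towards \<open>x + R \<cdot> 1\<close> at least linearly, and at
  the far end \<open>f\<close> exceeds \<open>c1\<close>, because adding \<open>x\<close> to \<open>R \<cdot> 1\<close> does not decrease it. The gain does
  not depend on \<open>x\<close>.
\<close>

lemma superlevel_strict:
  assumes R: "R > 0" "f (R *\<^sub>R ones) > c1" and d: "\<delta> > 0"
  shows "\<exists>\<eta>>0. \<forall>c x. 0 \<le> c \<and> c \<le> c1 \<and> x \<in> superlevel c \<longrightarrow> x + \<delta> *\<^sub>R ones \<in> superlevel (c + \<eta>)"
proof -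
  define \<delta>' where "\<delta>' = min \<delta> R"
  define \<gamma> where "\<gamma> = f (R *\<^sub>R ones) - c1"
  define \<eta> where "\<eta> = \<delta>' / R * \<gamma>"
  have pos: "\<delta>' > 0" "\<delta>' \<le> R" "\<delta>' \<le> \<delta>" "\<gamma> > 0" using R d by (auto simp: \<delta>'_def \<gamma>_def)
  show ?thesis
  proof (intro exI conjI allI impI)
    show "\<eta> > 0" using pos R by (simp add: \<eta>_def)
    fix c x assume a: "0 \<le> c \<and> c \<le> c1 \<and> x \<in> superlevel c"
    have x: "x \<in> closure \<Gamma>" "f x \<ge> c" using a by (auto simp: superlevel_def)
    have R1: "R *\<^sub>R ones \<in> \<Gamma>" using R by (intro positive_in_cone) simp
    have xR: "x + R *\<^sub>R ones \<in> closure \<Gamma>" using closure_add_cone[OF x(1) R1] closure_subset by blast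
    have "f (R *\<^sub>R ones + x) \<ge> f (R *\<^sub>R ones)"
      using closure_add_cone[OF closure_scale[OF x(1)] R1] closure_subset
      by (intro f_add_mono) (auto simp: add.commute R1 intro: closure_subset[THEN subsetD])
    then have fR: "f (x + R *\<^sub>R ones) \<ge> c1 + \<gamma>" by (simp add: \<gamma>_def add.commute)
    define t where "t = \<delta>' / R"
    have t: "0 \<le> t" "t \<le> 1" using pos R by (auto simp: t_def)
    have eq: "x + \<delta>' *\<^sub>R ones = (1 - t) *\<^sub>R x + t *\<^sub>R (x + R *\<^sub>R ones)"
      using R by (simp add: t_def algebra_simps)
    have "c + \<eta> \<le> (1 - t) * c + t * (c1 + \<gamma>)"
      using mult_left_mono[of c c1 t] a t by (simp add: \<eta>_def t_def[symmetric] algebra_simps)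
    also have "\<dots> \<le> (1 - t) * f x + t * f (x + R *\<^sub>R ones)"
      using x fR t by (intro add_mono mult_left_mono) auto
    also have "\<dots> \<le> f (x + \<delta>' *\<^sub>R ones)" unfolding eq by (rule f_concave[OF x(1) xR t])
    finally have "x + \<delta>' *\<^sub>R ones \<in> superlevel (c + \<eta>)"
      using closure_add_nonneg[OF x(1), of "\<delta>' *\<^sub>R ones"] pos by (simp add: superlevel_def)
    from superlevel_add_nonneg[OF this, of "(\<delta> - \<delta>') *\<^sub>R ones"] pos
    show "x + \<delta> *\<^sub>R ones \<in> superlevel (c + \<eta>)" by (simp add: scaleR_left_diff_distrib)
  qed
qed

lemma superlevel_pos_in_cone: "x \<in> superlevel c \<Longrightarrow> c > 0 \<Longrightarrow> x \<in> \<Gamma>"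
  using fun_facts(5)[of x] cone_facts(1) by (auto simp: superlevel_def frontier_def interior_open)

text \<open>
  \<open>opge c (q'' z)\<close> says that the operator is at least \<open>c\<close> at the complex Hessian of \<open>q\<close> at \<open>z\<close>. The
  eigenvalues do not appear: the diagonal is tested in all unitary frames.
\<close>

definition opge :: "real \<Rightarrow> ((complex ^ 'n) \<Rightarrow>\<^sub>L (complex ^ 'n) \<Rightarrow>\<^sub>L real) \<Rightarrow> bool" where
  "opge c A \<longleftrightarrow> (\<forall>E. unitary_frame E \<longrightarrow> (\<chi> k. levi A (E $ k)) \<in> superlevel c)"

lemma hermitian_add: "hermitian A \<Longrightarrow> hermitian B \<Longrightarrow> hermitian (A + B)"
proof -
  assume a: "hermitian A" "hermitian B"
  have "A $ i $ j = cnj (A $ j $ i)" "B $ i $ j = cnj (B $ j $ i)" for i j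
    using a unfolding hermitian_def by blast+
  then show "hermitian (A + B)" unfolding hermitian_def vector_add_component complex_cnj_add by metis
qed

lemma hermitian_mat_real: "hermitian (mat (complex_of_real r))"
  by (auto simp: hermitian_def mat_def)

lemma frame_diag_mono_shift:
  assumes "eigenframe H E"
  shows "eigenframe (H + mat t) E" "frame_diag (H + mat (of_real s)) E = frame_diag H E + s *\<^sub>R ones"
proof -
  have E: "unitary_frame E" using assms by (simp add: eigenframe_def)
  have add: "sesq (H + mat t) x y = sesq H x y + t * sesq (mat 1) x y" for x y t
  proof -
    have "sesq (H + mat t) x y = sesq H x y + sesq (mat t) x y"
      by (simp add: sesq_def algebra_simps sum.distrib)
    then show ?thesis by (simp add: sesq_mat)
  qed
  show "eigenframe (H + mat t) E" using assms E unfolding eigenframe_def add by (simp add: unitary_frame_iff)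
  show "frame_diag (H + mat (of_real s)) E = frame_diag H E + s *\<^sub>R ones"
    using E unfolding frame_diag_def add by (simp add: unitary_frame_iff vec_eq_iff)
qed

lemma frame_diag_continuous: "continuous_on UNIV (\<lambda>H. frame_diag H E)"
  unfolding frame_diag_def sesq_def by (intro continuous_intros)

text \<open>
  Membership in the closure passes to the frame diagonals because these are continuous in the matrix;
  conversely a shift by a small positive multiple of the identity moves the eigenvalues from the
  closed cone into the open one.
\<close>

lemma closure_cone_matrices:
  assumes H: "hermitian H" "eigenframe H E"
  shows "H \<in> closure (cone_matrices \<Gamma>) \<longleftrightarrow> frame_diag H E \<in> closure \<Gamma>"
proof
  have E: "unitary_frame E" using H by (simp add: eigenframe_def)
  assume "H \<in> closure (cone_matrices \<Gamma>)"
  moreover have "cone_matrices \<Gamma> \<subseteq> (\<lambda>H. frame_diag H E) -` closure \<Gamma>"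
  proof
    fix K assume "K \<in> cone_matrices \<Gamma>"
    then have K: "hermitian K" "eigenvals K \<in> \<Gamma>" by (auto simp: cone_matrices_def)
    obtain G where G: "eigenframe K G" using eigenframe_exists[OF K(1)] by blast
    obtain p where p: "bij p" "eigenvals K = (\<chi> i. frame_diag K G $ p i)" using eigenvals_eigenframe[OF K(1) G] by (elim exE conjE) (rule that)
    have "frame_diag K G = (\<chi> i. eigenvals K $ inv p i)"
      using p(1) unfolding p(2) by (simp add: vec_eq_iff bij_is_surj surj_f_inv_f)
    then have "frame_diag K G \<in> closure \<Gamma>"
      using closure_perm[of "eigenvals K" "inv p"] K closure_subset bij_imp_bij_inv[OF p(1)] by auto
    from frame_diag_in_convex[OF closed_closure convex_closure[OF cone_facts(2)] closure_perm K(1) G this E]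
    show "K \<in> (\<lambda>H. frame_diag H E) -` closure \<Gamma>" by simp
  qed
  moreover have "closed ((\<lambda>H. frame_diag H E) -` closure \<Gamma>)"
    by (intro closed_vimage frame_diag_continuous) simp
  ultimately show "frame_diag H E \<in> closure \<Gamma>" using closure_minimal by blast
next
  assume L: "frame_diag H E \<in> closure \<Gamma>"
  define K where "K k = H + mat (complex_of_real (1 / real (Suc k)))" for k
  have "K k \<in> cone_matrices \<Gamma>" for k
  proof -
    have e: "eigenframe (K k) E" unfolding K_def by (rule frame_diag_mono_shift[OF H(2)])
    have h: "hermitian (K k)" unfolding K_def by (intro hermitian_add H hermitian_mat_real)
    have "frame_diag (K k) E \<in> \<Gamma>" unfolding K_def frame_diag_mono_shift(2)[OF H(2)]
      by (intro closure_add_cone[OF L] positive_in_cone) simp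
    then have "eigenvals (K k) \<in> \<Gamma>" using eigenvals_eigenframe[OF h e] cone_facts(4) by auto
    then show ?thesis using h by (simp add: cone_matrices_def)
  qed
  moreover have "K \<longlonglongrightarrow> H"
  proof -
    have "K = (\<lambda>k. H + (1 / real (Suc k)) *\<^sub>R mat 1)"
      by (auto simp: K_def fun_eq_iff vec_eq_iff mat_def complex_eq_iff)
    moreover have "\<dots> \<longlonglongrightarrow> H + 0 *\<^sub>R mat 1"
      by (intro tendsto_intros LIMSEQ_Suc[OF lim_1_over_n])
    ultimately show ?thesis by simp
  qed
  ultimately show "H \<in> closure (cone_matrices \<Gamma>)" unfolding closure_sequential by blast
qed

lemma matrix_op_ge_iff:
  assumes H: "hermitian H"
  shows "matrix_op \<Gamma> f H \<ge> ereal c \<longleftrightarrow> (\<forall>E. unitary_frame E \<longrightarrow> frame_diag H E \<in> superlevel c)"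
proof -
  obtain E where E: "eigenframe H E" using eigenframe_exists[OF H] by blast
  obtain p where p: "bij p" "eigenvals H = (\<chi> i. frame_diag H E $ p i)" using eigenvals_eigenframe[OF H E] by (elim exE conjE) (rule that)
  have fe: "f (eigenvals H) = f (frame_diag H E)" if "frame_diag H E \<in> closure \<Gamma>"
    unfolding p(2) by (rule fun_facts(3)[OF that p(1)])
  have "matrix_op \<Gamma> f H \<ge> ereal c \<longleftrightarrow> frame_diag H E \<in> superlevel c"
  proof (cases "frame_diag H E \<in> closure \<Gamma>")
    case True
    then show ?thesis unfolding matrix_op_def closure_cone_matrices[OF H E] superlevel_def by (simp add: fe)
  next
    case False
    then show ?thesis unfolding matrix_op_def closure_cone_matrices[OF H E] superlevel_def by simp
  qed
  also have "\<dots> \<longleftrightarrow> (\<forall>E. unitary_frame E \<longrightarrow> frame_diag H E \<in> superlevel c)"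
  proof
    assume "frame_diag H E \<in> superlevel c"
    from frame_diag_in_convex[OF superlevel_closed superlevel_convex superlevel_perm H E this]
    show "\<forall>E. unitary_frame E \<longrightarrow> frame_diag H E \<in> superlevel c" by simp
  next
    assume "\<forall>E. unitary_frame E \<longrightarrow> frame_diag H E \<in> superlevel c"
    then show "frame_diag H E \<in> superlevel c" using E unfolding eigenframe_def by simp
  qed
  finally show ?thesis .
qed

lemma matrix_op_hessian_iff:
  assumes "C2_on N q q' q''" "z \<in> N"
  shows "matrix_op \<Gamma> f (complex_hessian q z) \<ge> ereal c \<longleftrightarrow> opge c (q'' z)"
  unfolding matrix_op_ge_iff[OF complex_hessian_hermitian[OF assms]] frame_diag_complex_hessian[OF assms] opge_def ..

lemma opge_add:
  assumes "opge c A" "\<And>\<zeta>. levi B \<zeta> \<ge> 0"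
  shows "opge c (A + B)"
  unfolding opge_def
proof (intro allI impI)
  fix E :: "complex ^ 'n ^ 'n" assume E: "unitary_frame E"
  have "(\<chi> k. levi (A + B) (E $ k)) = (\<chi> k. levi A (E $ k)) + (\<chi> k. levi B (E $ k))"
    by (simp add: vec_eq_iff levi_add)
  then show "(\<chi> k. levi (A + B) (E $ k)) \<in> superlevel c"
    using assms E superlevel_add_nonneg[of "\<chi> k. levi A (E $ k)" c "\<chi> k. levi B (E $ k)"] by (simp add: opge_def)
qed

lemma opge_mono: "opge c A \<Longrightarrow> c' \<le> c \<Longrightarrow> opge c' A"
  by (force simp: opge_def superlevel_def)

lemma levi_frame_shift:
  assumes "unitary_frame E"
  shows "(\<chi> k. levi (A + (2 * t) *\<^sub>R inner2) (E $ k)) = (\<chi> k. levi A (E $ k)) + t *\<^sub>R ones"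
  using norm_unitary_frame[OF assms] by (simp add: vec_eq_iff levi_add levi_scale levi_inner2)

text \<open>
  The factor 2 is the normalisation of the Levi form, which is \<open>1/2\<close> for the inner product on unit vectors.
\<close>

lemma opge_strict:
  assumes R: "R > 0" "f (R *\<^sub>R ones) > c1" and d: "\<delta> > 0"
  shows "\<exists>\<eta>>0. \<forall>c A. 0 \<le> c \<and> c \<le> c1 \<and> opge c A \<longrightarrow> opge (c + \<eta>) (A + (2 * \<delta>) *\<^sub>R inner2)"
  using superlevel_strict[OF assms] by (auto simp: opge_def levi_frame_shift)

lemma levi_continuous: "continuous_on UNIV (\<lambda>E. (\<chi> k. levi A (E $ k)))"
  unfolding levi_def vector_scalar_mult_def by (intro continuous_intros) auto

text \<open>
  For \<open>c > 0\<close> a superlevel set is contained in the open cone, where \<open>f\<close> is continuous; compactness of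
  the unitary group makes the loss uniform over all frames.
\<close>

lemma opge_open:
  assumes A: "opge c A" and c: "0 \<le> c'" "c' < c"
  shows "\<exists>\<eta>>0. opge c' (A - (2 * \<eta>) *\<^sub>R inner2)"
proof (rule ccontr)
  assume n: "\<not> ?thesis"
  define K where "K = (\<lambda>E. (\<chi> k. levi A (E $ k))) ` {E. unitary_frame E}"
  have "compact K" unfolding K_def
    by (intro compact_continuous_image compact_unitary_frames continuous_on_subset[OF levi_continuous]) auto
  have KL: "K \<subseteq> superlevel c" using A by (auto simp: K_def opge_def)
  have "\<exists>E. unitary_frame E \<and> (\<chi> k. levi A (E $ k)) - (1 / real (Suc m)) *\<^sub>R ones \<notin> superlevel c'" for m
  proof -
    have "\<not> opge c' (A - (2 * (1 / real (Suc m))) *\<^sub>R inner2)"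
    proof
      assume a: "opge c' (A - (2 * (1 / real (Suc m))) *\<^sub>R inner2)"
      have "1 / real (Suc m) > 0" by simp
      with a n show False by blast
    qed
    then obtain E where E: "unitary_frame E" "(\<chi> k. levi (A - (2 * (1 / real (Suc m))) *\<^sub>R inner2) (E $ k)) \<notin> superlevel c'"
      by (auto simp: opge_def)
    then show ?thesis using levi_frame_shift[OF E(1), of A "- (1 / real (Suc m))"] by (auto intro!: exI[of _ E])
  qed
  then have "\<forall>m. \<exists>E. unitary_frame E \<and> (\<chi> k. levi A (E $ k)) - (1 / real (Suc m)) *\<^sub>R ones \<notin> superlevel c'" by blast
  then obtain E where E: "\<forall>m. unitary_frame (E m) \<and> (\<chi> k. levi A (E m $ k)) - (1 / real (Suc m)) *\<^sub>R ones \<notin> superlevel c'"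
    by (rule choice[THEN exE])
  define x where "x m = (\<chi> k. levi A (E m $ k))" for m
  have x: "\<And>m. x m \<in> K" "\<And>m. x m - (1 / real (Suc m)) *\<^sub>R ones \<notin> superlevel c'"
    using E by (auto simp: x_def K_def)
  obtain l r where l: "l \<in> K" "strict_mono r" "(x \<circ> r) \<longlonglongrightarrow> l"
    using \<open>compact K\<close> x(1) unfolding compact_def by blast
  have lc: "l \<in> superlevel c" using l KL by blast
  have lG: "l \<in> \<Gamma>" using superlevel_pos_in_cone[OF lc] c by simp
  have "(\<lambda>m. (x \<circ> r) m - (1 / real (Suc (r m))) *\<^sub>R ones) \<longlonglongrightarrow> l - 0 *\<^sub>R ones"
    using LIMSEQ_subseq_LIMSEQ[OF LIMSEQ_Suc[OF lim_1_over_n] l(2)]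
    by (intro tendsto_intros l(3)) (simp add: o_def)
  then have lim: "(\<lambda>m. x (r m) - (1 / real (Suc (r m))) *\<^sub>R ones) \<longlonglongrightarrow> l" by simp
  have "\<forall>\<^sub>F m in sequentially. x (r m) - (1 / real (Suc (r m))) *\<^sub>R ones \<in> \<Gamma>"
    using topological_tendstoD[OF lim cone_facts(1) lG] .
  moreover have "isCont f l"
    using fun_facts(2) cone_facts(1) lG closure_subset by (meson continuous_on_eq_continuous_at continuous_on_subset)
  then have "(\<lambda>m. f (x (r m) - (1 / real (Suc (r m))) *\<^sub>R ones)) \<longlonglongrightarrow> f l"
    by (rule isCont_tendsto_compose[OF _ lim])
  then have "\<forall>\<^sub>F m in sequentially. f (x (r m) - (1 / real (Suc (r m))) *\<^sub>R ones) > c'"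
    using lc c order_tendstoD(1)[of "\<lambda>m. f (x (r m) - (1 / real (Suc (r m))) *\<^sub>R ones)" "f l" sequentially c'] by (simp add: superlevel_def)
  ultimately have "\<forall>\<^sub>F m in sequentially. False"
    by eventually_elim (use x(2) closure_subset in \<open>force simp: superlevel_def\<close>)
  then show False by simp
qed

lemma opge_limit:
  assumes "\<And>\<epsilon>. \<epsilon> > 0 \<Longrightarrow> \<exists>c' A'. c' > c - \<epsilon> \<and> norm (A' - A) < \<epsilon> \<and> opge c' A'"
  shows "opge c A"
  unfolding opge_def
proof (intro allI impI)
  fix E :: "complex ^ 'n ^ 'n" assume E: "unitary_frame E"
  have "\<exists>c' A'. c' > c - 1 / real (Suc m) \<and> norm (A' - A) < 1 / real (Suc m) \<and> opge c' A'" for m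
    using assms[of "1 / real (Suc m)"] by simp
  then obtain C B where CB: "\<And>m. C m > c - 1 / real (Suc m)" "\<And>m. norm (B m - A) < 1 / real (Suc m)" "\<And>m. opge (C m) (B m)"
    by metis
  have "B \<longlonglongrightarrow> A"
  proof (rule LIM_zero_cancel, rule Lim_null_comparison)
    show "\<forall>\<^sub>F m in sequentially. norm (B m - A) \<le> 1 / real (Suc m)" using CB(2) by (simp add: less_imp_le)
  qed (rule LIMSEQ_Suc[OF lim_1_over_n])
  then have lim: "(\<lambda>m. (\<chi> k. levi (B m) (E $ k))) \<longlonglongrightarrow> (\<chi> k. levi A (E $ k))"
    unfolding levi_def by (intro tendsto_intros) auto
  have inc: "(\<chi> k. levi (B m) (E $ k)) \<in> superlevel (C m)" for m using CB(3) E by (simp add: opge_def)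
  then have incl: "(\<chi> k. levi (B m) (E $ k)) \<in> closure \<Gamma>" for m by (simp add: superlevel_def)
  then have in1: "(\<chi> k. levi A (E $ k)) \<in> closure \<Gamma>"
    using closed_sequentially[OF closed_closure _ lim] by blast
  have "(\<lambda>m. f (\<chi> k. levi (B m) (E $ k))) \<longlonglongrightarrow> f (\<chi> k. levi A (E $ k))"
    by (rule continuous_on_tendsto_compose[OF fun_facts(2) lim in1]) (simp add: incl)
  moreover have "(\<lambda>m. c - 1 / real (Suc m)) \<longlonglongrightarrow> c - 0"
    by (intro tendsto_intros LIMSEQ_Suc[OF lim_1_over_n])
  moreover have "c - 1 / real (Suc m) \<le> f (\<chi> k. levi (B m) (E $ k))" for m
    using inc[of m] CB(1)[of m] by (simp add: superlevel_def)
  ultimately have "c - 0 \<le> f (\<chi> k. levi A (E $ k))"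
    by (intro LIMSEQ_le) auto
  then show "(\<chi> k. levi A (E $ k)) \<in> superlevel c" using in1 by (simp add: superlevel_def)
qed

text \<open>
  Only half-spaces with nonnegative normals matter, since \<open>superlevel c\<close> contains with each point a
  translate of the positive orthant. They correspond to degenerate elliptic linear operators.
\<close>

lemma opge_if_halfspaces:
  assumes "\<And>E l b. unitary_frame E \<Longrightarrow> (\<And>k. l $ k \<ge> 0) \<Longrightarrow> (\<And>x. x \<in> superlevel c \<Longrightarrow> l \<bullet> x \<ge> b) \<Longrightarrow>
      (\<Sum>k\<in>UNIV. l $ k * levi A (E $ k)) \<ge> b"
    and ne: "superlevel c \<noteq> {}"
  shows "opge c A"
  unfolding opge_def
proof (intro allI impI, rule ccontr)
  fix E :: "complex ^ 'n ^ 'n" assume E: "unitary_frame E" and n: "(\<chi> k. levi A (E $ k)) \<notin> superlevel c"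
  obtain l b where lb: "l \<bullet> (\<chi> k. levi A (E $ k)) < b" "\<And>x. x \<in> superlevel c \<Longrightarrow> l \<bullet> x > b"
    using separating_hyperplane_closed_point[OF superlevel_convex superlevel_closed n] by blast
  obtain x where x: "x \<in> superlevel c" using ne by blast
  have "l $ k \<ge> 0" for k
  proof (rule ccontr)
    assume neg: "\<not> l $ k \<ge> 0"
    define t where "t = (\<bar>b\<bar> + \<bar>l \<bullet> x\<bar>) / \<bar>l $ k\<bar>"
    have "x + axis k t \<in> superlevel c"
      using x by (intro superlevel_add_nonneg) (auto simp: axis_def t_def)
    from lb(2)[OF this] have "l \<bullet> x + l $ k * t > b" by (simp add: inner_add_right inner_axis)
    moreover have "l $ k * t = - (\<bar>b\<bar> + \<bar>l \<bullet> x\<bar>)" using neg by (simp add: t_def abs_if)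
    ultimately show False by linarith
  qed
  from assms(1)[OF E this, of b] lb show False by (auto simp: inner_vec_def less_imp_le)
qed

lemma opge_halfspace:
  assumes "opge c A" "unitary_frame E" "\<And>x. x \<in> superlevel c \<Longrightarrow> l \<bullet> x \<ge> b"
  shows "(\<Sum>k\<in>UNIV. l $ k * levi A (E $ k)) \<ge> b"
  using assms(3)[of "\<chi> k. levi A (E $ k)"] assms(1,2) by (simp add: opge_def inner_vec_def)

text \<open>
  Every subsolution is subharmonic, because the admissible cone lies in the half-space of positive trace.
\<close>

lemma opge_trace: "opge c A \<Longrightarrow> unitary_frame E \<Longrightarrow> (\<Sum>k\<in>UNIV. levi A (E $ k)) \<ge> 0"
  using closure_trace_nonneg[of "\<chi> k. levi A (E $ k)"] by (simp add: opge_def superlevel_def)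

text \<open>
  The supply of explicit smooth subsolutions.
\<close>

lemma opge_quadratic:
  assumes "R > 0" "f (R *\<^sub>R ones) \<ge> c"
  shows "opge c ((2 * R) *\<^sub>R inner2)"
proof -
  have "R *\<^sub>R ones \<in> superlevel c"
    using positive_in_cone[of "R *\<^sub>R ones"] assms closure_subset by (auto simp: superlevel_def)
  moreover have "(\<chi> k. levi ((2 * R) *\<^sub>R inner2) (E $ k)) = R *\<^sub>R ones" if "unitary_frame E" for E
    using norm_unitary_frame[OF that] by (simp add: vec_eq_iff levi_scale levi_inner2)
  ultimately show ?thesis unfolding opge_def by metis
qed

text \<open>
  The viscosity notions in terms of \<open>opge\<close>. For supersolutions the value at a test function is
  bounded above by \<open>\<psi>\<close> iff no \<open>c > \<psi>\<close> is reached; this includes the value \<open>-\<infinity>\<close> outside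
  the closed cone.
\<close>

definition subsol :: "(complex ^ 'n \<Rightarrow> real) \<Rightarrow> (complex ^ 'n) set \<Rightarrow> (complex ^ 'n \<Rightarrow> ereal) \<Rightarrow> bool" where
  "subsol \<psi> D u \<longleftrightarrow> usc_on D u \<and> (\<forall>z\<in>D. u z < \<infinity>) \<and>
     (\<forall>z N q q' q''. z \<in> D \<longrightarrow> z \<in> N \<longrightarrow> C2_on N q q' q'' \<longrightarrow> u z = ereal (q z) \<longrightarrow>
        (\<forall>\<^sub>F x in nhds z. u x \<le> ereal (q x)) \<longrightarrow> opge (\<psi> z) (q'' z))"

definition supersol :: "(complex ^ 'n \<Rightarrow> real) \<Rightarrow> (complex ^ 'n) set \<Rightarrow> (complex ^ 'n \<Rightarrow> ereal) \<Rightarrow> bool" where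
  "supersol \<psi> D v \<longleftrightarrow> lsc_on D v \<and> (\<forall>z\<in>D. - \<infinity> < v z) \<and>
     (\<forall>z N q q' q'' c. z \<in> D \<longrightarrow> z \<in> N \<longrightarrow> C2_on N q q' q'' \<longrightarrow> v z = ereal (q z) \<longrightarrow>
        (\<forall>\<^sub>F x in nhds z. v x \<ge> ereal (q x)) \<longrightarrow> c > \<psi> z \<longrightarrow> \<not> opge c (q'' z))"

lemma viscosity_subsol_iff: "viscosity_subsol (matrix_op \<Gamma> f) \<psi> D u \<longleftrightarrow> subsol \<psi> D u"
proof
  assume L: "viscosity_subsol (matrix_op \<Gamma> f) \<psi> D u"
  show "subsol \<psi> D u"
    unfolding subsol_def
  proof (intro conjI allI impI)
    fix z N q q' q''
    assume a: "z \<in> D" "z \<in> N" "C2_on N q q' q''" "u z = ereal (q z)" "\<forall>\<^sub>F x in nhds z. u x \<le> ereal (q x)"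
    then have "upper_test u z q" unfolding upper_test_def C2_near_iff by blast
    then have "matrix_op \<Gamma> f (complex_hessian q z) \<ge> ereal (\<psi> z)"
      using L a(1) unfolding viscosity_subsol_def by blast
    then show "opge (\<psi> z) (q'' z)" using matrix_op_hessian_iff[OF a(3,2)] by blast
  qed (use L in \<open>simp_all add: viscosity_subsol_def\<close>)
next
  assume R: "subsol \<psi> D u"
  have "matrix_op \<Gamma> f (complex_hessian q z) \<ge> ereal (\<psi> z)" if z: "z \<in> D" and t: "upper_test u z q" for z q
  proof -
    obtain N q' q'' where a: "z \<in> N" "C2_on N q q' q''" using t unfolding upper_test_def C2_near_iff by blast
    then have "opge (\<psi> z) (q'' z)" using R z t unfolding subsol_def upper_test_def by blast
    then show ?thesis using matrix_op_hessian_iff[OF a(2,1)] by blast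
  qed
  then show "viscosity_subsol (matrix_op \<Gamma> f) \<psi> D u" using R unfolding viscosity_subsol_def subsol_def by simp
qed

lemma ereal_le_iff_all_greater: "x \<le> ereal a \<longleftrightarrow> (\<forall>c>a. \<not> ereal c \<le> x)"
proof
  assume "x \<le> ereal a" then show "\<forall>c>a. \<not> ereal c \<le> x" by (metis ereal_less_eq(3) leD order_trans)
next
  assume a: "\<forall>c>a. \<not> ereal c \<le> x"
  show "x \<le> ereal a"
  proof (rule ccontr)
    assume "\<not> x \<le> ereal a"
    then obtain c where "ereal a < ereal c" "ereal c < x" by (metis ereal_dense2 not_le)
    then show False using a by auto
  qed
qed

lemma viscosity_supersol_iff: "viscosity_supersol (matrix_op \<Gamma> f) \<psi> D v \<longleftrightarrow> supersol \<psi> D v"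
proof
  assume L: "viscosity_supersol (matrix_op \<Gamma> f) \<psi> D v"
  show "supersol \<psi> D v"
    unfolding supersol_def
  proof (intro conjI allI impI)
    fix z N q q' q'' c
    assume a: "z \<in> D" "z \<in> N" "C2_on N q q' q''" "v z = ereal (q z)" "\<forall>\<^sub>F x in nhds z. v x \<ge> ereal (q x)" "c > \<psi> z"
    then have "lower_test v z q" unfolding lower_test_def C2_near_iff by blast
    then have "matrix_op \<Gamma> f (complex_hessian q z) \<le> ereal (\<psi> z)"
      using L a(1) unfolding viscosity_supersol_def by blast
    then show "\<not> opge c (q'' z)" using matrix_op_hessian_iff[OF a(3,2)] a(6) ereal_le_iff_all_greater by blast
  qed (use L in \<open>simp_all add: viscosity_supersol_def\<close>)
next
  assume R: "supersol \<psi> D v"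
  have "matrix_op \<Gamma> f (complex_hessian q z) \<le> ereal (\<psi> z)" if z: "z \<in> D" and t: "lower_test v z q" for z q
  proof -
    obtain N q' q'' where a: "z \<in> N" "C2_on N q q' q''" using t unfolding lower_test_def C2_near_iff by blast
    then have "\<not> opge c (q'' z)" if "c > \<psi> z" for c using R z t that unfolding supersol_def lower_test_def by blast
    then show ?thesis using matrix_op_hessian_iff[OF a(2,1)] ereal_le_iff_all_greater by blast
  qed
  then show "viscosity_supersol (matrix_op \<Gamma> f) \<psi> D v" using R unfolding viscosity_supersol_def supersol_def by simp
qed

end

section \<open>Gaussian measures\<close>

lemma lborel_product_function:
  fixes F :: "'a::euclidean_space \<Rightarrow> real \<Rightarrow> real"
  assumes "\<And>b. b \<in> Basis \<Longrightarrow> integrable lborel (F b)"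
  shows "integrable lborel (\<lambda>y::'a. \<Prod>b\<in>Basis. F b (y \<bullet> b))"
    and "(\<integral>(y::'a). (\<Prod>b\<in>Basis. F b (y \<bullet> b)) \<partial>lborel) = (\<Prod>b\<in>Basis. \<integral>r. F b r \<partial>lborel)"
proof -
  interpret product_sigma_finite "\<lambda>_::'a. lborel :: real measure" ..
  let ?T = "\<lambda>f. \<Sum>b\<in>(Basis::'a set). f b *\<^sub>R b"
  have T: "?T \<in> measurable (Pi\<^sub>M Basis (\<lambda>_. lborel)) borel" by measurable
  have [measurable]: "F b \<in> borel_measurable borel" if "b \<in> Basis" for b
    using borel_measurable_integrable[OF assms[OF that]] by simp
  have m: "(\<lambda>y::'a. \<Prod>b\<in>Basis. F b (y \<bullet> b)) \<in> borel_measurable borel" by measurable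
  have eq: "(\<Prod>b\<in>Basis. F b (?T f \<bullet> b)) = (\<Prod>b\<in>Basis. F b (f b))" for f
    by (intro prod.cong refl) (simp add: inner_sum_left inner_Basis if_distrib cong: if_cong)
  have i: "integrable (Pi\<^sub>M Basis (\<lambda>_. lborel)) (\<lambda>f. \<Prod>b\<in>(Basis::'a set). F b (f b))"
    by (rule product_integrable_prod) (auto simp: assms)
  show "integrable lborel (\<lambda>y::'a. \<Prod>b\<in>Basis. F b (y \<bullet> b))"
    by (subst lborel_eq, subst integrable_distr_eq[OF T m]) (simp only: eq i)
  show "(\<integral>(y::'a). (\<Prod>b\<in>Basis. F b (y \<bullet> b)) \<partial>lborel) = (\<Prod>b\<in>Basis. \<integral>r. F b r \<partial>lborel)"
    by (subst lborel_eq, subst integral_distr[OF T m], simp only: eq, rule product_integral_prod) (auto simp: assms)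
qed

definition gauss_density :: "'a::euclidean_space \<Rightarrow> real" where
  "gauss_density y = (\<Prod>b\<in>Basis. std_normal_density (y \<bullet> b))"

definition gauss :: "'a::euclidean_space measure" where
  "gauss = density lborel (\<lambda>y. ennreal (gauss_density y))"

lemma gauss_density_pos: "gauss_density y > 0"
  by (simp add: gauss_density_def prod_pos normal_density_pos)

lemma gauss_density_exp:
  "gauss_density (y::'a::euclidean_space) = (1 / sqrt (2 * pi)) ^ DIM('a) * exp (- (norm y)\<^sup>2 / 2)"
proof -
  have "gauss_density y = (\<Prod>b\<in>(Basis :: 'a set). 1 / sqrt (2 * pi)) * (\<Prod>b\<in>Basis. exp (- ((y \<bullet> b)\<^sup>2 / 2)))"
    unfolding gauss_density_def by (simp add: std_normal_density_def prod_dividef power_divide)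
  also have "(\<Prod>b\<in>Basis. exp (- ((y \<bullet> b)\<^sup>2 / 2))) = exp (\<Sum>b\<in>Basis. - ((y \<bullet> b)\<^sup>2 / 2))"
    by (rule exp_sum[symmetric]) simp
  also have "(\<Sum>b\<in>Basis. - ((y \<bullet> b)\<^sup>2 / 2)) = - (norm y)\<^sup>2 / 2"
    unfolding power2_norm_eq_inner euclidean_inner[of y y]
    by (simp add: sum_negf sum_divide_distrib power2_eq_square)
  finally show ?thesis by simp
qed

lemma gauss_density_measurable [measurable]: "gauss_density \<in> borel_measurable borel"
  unfolding gauss_density_def by measurable

lemma sets_gauss [measurable_cong, simp]: "sets gauss = sets borel" and space_gauss [simp]: "space gauss = UNIV"
  by (simp_all add: gauss_def)

lemma gauss_integral:
  "f \<in> borel_measurable borel \<Longrightarrow> integral\<^sup>L gauss f = (\<integral>y. gauss_density y * f y \<partial>lborel)" for f :: "'a::euclidean_space \<Rightarrow> real"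
  unfolding gauss_def by (subst integral_density) (auto simp: gauss_density_pos less_imp_le)

lemma gauss_integrable:
  "f \<in> borel_measurable borel \<Longrightarrow> integrable gauss f \<longleftrightarrow> integrable lborel (\<lambda>y. gauss_density y * f y)" for f :: "'a::euclidean_space \<Rightarrow> real"
  unfolding gauss_def by (subst integrable_density) (auto simp: gauss_density_pos less_imp_le)

lemma gauss_monomial:
  fixes k :: "'a::euclidean_space \<Rightarrow> nat"
  shows "integrable gauss (\<lambda>y::'a. \<Prod>b\<in>Basis. (y \<bullet> b) ^ k b)"
    and "(\<integral>(y::'a). (\<Prod>b\<in>Basis. (y \<bullet> b) ^ k b) \<partial>gauss) = (\<Prod>b\<in>Basis. \<integral>r. std_normal_density r * r ^ k b \<partial>lborel)"
proof -
  have eq: "gauss_density y * (\<Prod>b\<in>Basis. (y \<bullet> b) ^ k b) = (\<Prod>b\<in>Basis. (\<lambda>r. std_normal_density r * r ^ k b) (y \<bullet> b))" for y :: 'a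
    by (simp add: gauss_density_def prod.distrib)
  have i: "integrable lborel (\<lambda>r. std_normal_density r * r ^ n)" for n
    using integrable_normal_moment[of 1 0 n] by simp
  note P = lborel_product_function[of "\<lambda>b r. std_normal_density r * r ^ k b", OF i]
  show "integrable gauss (\<lambda>y::'a. \<Prod>b\<in>Basis. (y \<bullet> b) ^ k b)"
    by (subst gauss_integrable) (measurable, simp only: eq, rule P(1))
  show "(\<integral>(y::'a). (\<Prod>b\<in>Basis. (y \<bullet> b) ^ k b) \<partial>gauss) = (\<Prod>b\<in>Basis. \<integral>r. std_normal_density r * r ^ k b \<partial>lborel)"
    by (subst gauss_integral) (measurable, simp only: eq, rule P(2))
qed

lemma std_normal_moments_012:
  "(\<integral>r. std_normal_density r * r ^ 0 \<partial>lborel) = 1"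
  "(\<integral>r. std_normal_density r * r ^ Suc 0 \<partial>lborel) = 0"
  "(\<integral>r. std_normal_density r * r ^ 2 \<partial>lborel) = 1"
  using integral_std_normal_moment_even[of 0] integral_std_normal_moment_odd[of 0] integral_std_normal_moment_even[of 1]
  by simp_all

lemma prob_space_gauss: "prob_space (gauss :: 'a::euclidean_space measure)"
proof
  have "integrable gauss (\<lambda>y::'a. 1::real)" "(\<integral>(y::'a). (1::real) \<partial>gauss) = 1"
    using gauss_monomial[of "\<lambda>_::'a. 0"] std_normal_moments_012(1) by simp_all
  then have "(\<integral>\<^sup>+(y::'a). ennreal 1 \<partial>gauss) = ennreal 1"
    by (subst nn_integral_eq_integral) auto
  then show "emeasure gauss (space gauss :: 'a set) = 1" by simp
qed

lemma power_indicator_prod: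
  fixes y :: "'a::euclidean_space"
  assumes "c \<in> Basis"
  shows "(\<Prod>b\<in>Basis. (y \<bullet> b) ^ (if b = c then n else 0)) = (y \<bullet> c :: real) ^ n"
proof -
  have "(\<Prod>b\<in>Basis. (y \<bullet> b) ^ (if b = c then n else 0)) = (\<Prod>b\<in>Basis. if b = c then (y \<bullet> c) ^ n else 1)"
    by (intro prod.cong) auto
  then show ?thesis using assms by simp
qed

lemma gauss_first_moment:
  assumes "c \<in> Basis"
  shows "integrable gauss (\<lambda>y::'a::euclidean_space. y \<bullet> c)" "(\<integral>(y::'a). y \<bullet> c \<partial>gauss) = 0"
proof -
  note M = gauss_monomial[of "\<lambda>b. if b = c then Suc 0 else 0"]
  show "integrable gauss (\<lambda>y::'a::euclidean_space. y \<bullet> c)" using M(1) unfolding power_indicator_prod[OF assms] by simp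
  have "(\<Prod>b\<in>Basis. \<integral>r. std_normal_density r * r ^ (if b = c then Suc 0 else 0) \<partial>lborel) = 0"
    by (rule prod_zero) (use assms std_normal_moments_012 in auto)
  then show "(\<integral>(y::'a). y \<bullet> c \<partial>gauss) = 0" using M(2) unfolding power_indicator_prod[OF assms] by simp
qed

lemma gauss_product_moment:
  assumes "c \<in> Basis" "d \<in> Basis"
  shows "integrable gauss (\<lambda>y::'a::euclidean_space. (y \<bullet> c) ^ m * (y \<bullet> d) ^ n)"
    and "(\<integral>(y::'a). (y \<bullet> c) * (y \<bullet> d) \<partial>gauss) = (if c = d then 1 else 0)"
proof -
  let ?k = "\<lambda>m n b. (if b = c then m else 0) + (if b = d then n else 0 :: nat)"
  have eq: "(\<Prod>b\<in>Basis. (y \<bullet> b) ^ ?k m n b) = (y \<bullet> c) ^ m * (y \<bullet> d) ^ n" for y :: 'a and m n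
    by (simp only: power_add prod.distrib power_indicator_prod[OF assms(1)] power_indicator_prod[OF assms(2)])
  show "integrable gauss (\<lambda>y::'a::euclidean_space. (y \<bullet> c) ^ m * (y \<bullet> d) ^ n)"
    using gauss_monomial(1)[of "?k m n"] unfolding eq .
  have "(\<Prod>b\<in>Basis. \<integral>r. std_normal_density r * r ^ ?k 1 1 b \<partial>lborel) = (if c = d then 1 else 0)"
  proof (cases "c = d")
    case True
    have "(\<integral>r. std_normal_density r * r ^ ?k 1 1 b \<partial>lborel) = 1" for b
      using True std_normal_moments_012 by (cases "b = c") (auto simp: numeral_2_eq_2)
    then show ?thesis using True by simp
  next
    case False
    have "(\<Prod>b\<in>Basis. \<integral>r. std_normal_density r * r ^ ?k 1 1 b \<partial>lborel) = 0"
      by (rule prod_zero) (use assms False std_normal_moments_012 in \<open>auto intro!: bexI[of _ c]\<close>)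
    then show ?thesis using False by simp
  qed
  then show "(\<integral>(y::'a). (y \<bullet> c) * (y \<bullet> d) \<partial>gauss) = (if c = d then 1 else 0)"
    using gauss_monomial(2)[of "?k 1 1"] unfolding eq by simp
qed

lemma gauss_norm_moments:
  "integrable gauss (\<lambda>y::'a::euclidean_space. (norm y)\<^sup>2)" "integrable gauss (\<lambda>y::'a. (norm y) ^ 4)"
  "(\<integral>(y::'a). (norm y)\<^sup>2 \<partial>gauss) = DIM('a)"
proof -
  have n2: "(norm y)\<^sup>2 = (\<Sum>b\<in>Basis. (y \<bullet> b) * (y \<bullet> b))" for y :: 'a
    unfolding power2_norm_eq_inner by (rule euclidean_inner)
  have i2: "integrable gauss (\<lambda>y::'a. (y \<bullet> b) * (y \<bullet> b))" if "b \<in> Basis" for b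
    using gauss_product_moment(1)[OF that that, of 1 1] by simp
  show "integrable gauss (\<lambda>y::'a. (norm y)\<^sup>2)" unfolding n2 by (intro Bochner_Integration.integrable_sum i2)
  show "(\<integral>(y::'a). (norm y)\<^sup>2 \<partial>gauss) = DIM('a)" unfolding n2
    by (subst Bochner_Integration.integral_sum[OF i2]) (simp_all add: gauss_product_moment(2))
  have n4: "(norm y) ^ 4 = (\<Sum>b\<in>Basis. \<Sum>c\<in>Basis. (y \<bullet> b)\<^sup>2 * (y \<bullet> c)\<^sup>2)" for y :: 'a
  proof -
    have "(norm y) ^ 4 = (norm y)\<^sup>2 * (norm y)\<^sup>2" by (simp add: power4_eq_xxxx power2_eq_square)
    then show ?thesis unfolding n2 sum_product by (simp add: power2_eq_square)
  qed
  show "integrable gauss (\<lambda>y::'a. (norm y) ^ 4)" unfolding n4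
    by (intro Bochner_Integration.integrable_sum gauss_product_moment(1))
qed

lemma lborel_nn_affine:
  fixes G :: "'a::euclidean_space \<Rightarrow> ennreal"
  assumes [measurable]: "G \<in> borel_measurable borel" and c: "c > 0"
  shows "(\<integral>\<^sup>+x. G x \<partial>lborel) = ennreal (c ^ DIM('a)) * (\<integral>\<^sup>+x. G (t + c *\<^sub>R x) \<partial>lborel)"
  using c by (subst lborel_affine[of c t]) (simp_all add: nn_integral_density nn_integral_distr nn_integral_cmult)

text \<open>
  Rotation invariance of the product Gaussian, here only in the form of the law of one coordinate
  after a rotation; it yields the semigroup property of \<open>heat\<close>.
\<close>

lemma gauss_convolution:
  assumes ab: "a\<^sup>2 + b\<^sup>2 = 1" "b > 0"
  shows "distr (gauss \<Otimes>\<^sub>M gauss) borel (\<lambda>(y, z). a *\<^sub>R y + b *\<^sub>R z) = (gauss :: 'a::euclidean_space measure)"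
    (is "?M = _")
proof (rule measure_eqI)
  interpret gp: prob_space "gauss :: 'a measure" by (rule prob_space_gauss)
  let ?g = "\<lambda>y::'a. ennreal (gauss_density y)"
  show "sets ?M = sets gauss" by simp
  fix A :: "'a set" assume "A \<in> sets ?M"
  then have A[measurable]: "A \<in> sets borel" by simp
  let ?h = "indicator A :: 'a \<Rightarrow> ennreal"
  have mg: "gauss_density y * gauss_density ((1/b) *\<^sub>R (x - a *\<^sub>R y)) = gauss_density x * gauss_density ((1/b) *\<^sub>R (y - a *\<^sub>R x))" for x y :: 'a
  proof -
    have n: "(norm ((1/b) *\<^sub>R (x - a *\<^sub>R y)))\<^sup>2 = ((norm x)\<^sup>2 - 2 * a * (x \<bullet> y) + a\<^sup>2 * (norm y)\<^sup>2) / b\<^sup>2" for x y :: 'a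
    proof -
      have "(norm ((1/b) *\<^sub>R (x - a *\<^sub>R y)))\<^sup>2 = (norm (x - a *\<^sub>R y))\<^sup>2 / b\<^sup>2"
        unfolding norm_scaleR by (simp add: power_mult_distrib power_divide)
      also have "(norm (x - a *\<^sub>R y))\<^sup>2 = (norm x)\<^sup>2 - 2 * a * (x \<bullet> y) + a\<^sup>2 * (norm y)\<^sup>2"
        unfolding power2_norm_eq_inner
        by (simp add: inner_diff_left inner_diff_right inner_commute power2_eq_square)
      finally show ?thesis .
    qed
    have "b\<^sup>2 * ((norm y)\<^sup>2 + (norm ((1/b) *\<^sub>R (x - a *\<^sub>R y)))\<^sup>2) = b\<^sup>2 * ((norm x)\<^sup>2 + (norm ((1/b) *\<^sub>R (y - a *\<^sub>R x)))\<^sup>2)"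
    proof -
      have F: "b\<^sup>2 * ((norm y)\<^sup>2 + (norm ((1/b) *\<^sub>R (x - a *\<^sub>R y)))\<^sup>2) = (a\<^sup>2 + b\<^sup>2) * (norm y)\<^sup>2 + (norm x)\<^sup>2 - 2 * a * (x \<bullet> y)" for x y :: 'a
        using ab(2) unfolding n by (simp add: field_simps)
      show ?thesis unfolding F[of y x] F[of x y] unfolding ab(1) by (simp add: inner_commute)
    qed
    then have "(norm y)\<^sup>2 + (norm ((1/b) *\<^sub>R (x - a *\<^sub>R y)))\<^sup>2 = (norm x)\<^sup>2 + (norm ((1/b) *\<^sub>R (y - a *\<^sub>R x)))\<^sup>2"
      using ab(2) by simp
    then have "exp (- (norm y)\<^sup>2 / 2) * exp (- (norm ((1/b) *\<^sub>R (x - a *\<^sub>R y)))\<^sup>2 / 2) = exp (- (norm x)\<^sup>2 / 2) * exp (- (norm ((1/b) *\<^sub>R (y - a *\<^sub>R x)))\<^sup>2 / 2)"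
      unfolding exp_add[symmetric] by (intro arg_cong[of _ _ exp]) argo
    then show ?thesis unfolding gauss_density_exp by (simp add: mult_ac)
  qed
  have "emeasure ?M A = (\<integral>\<^sup>+p. ?h (a *\<^sub>R fst p + b *\<^sub>R snd p) \<partial>(gauss \<Otimes>\<^sub>M gauss))"
  proof -
    have "emeasure ?M A = (\<integral>\<^sup>+x. ?h x \<partial>?M)" by simp
    also have "\<dots> = (\<integral>\<^sup>+p. ?h (case p of (y, z) \<Rightarrow> a *\<^sub>R y + b *\<^sub>R z) \<partial>(gauss \<Otimes>\<^sub>M gauss))"
      by (rule nn_integral_distr) measurable
    finally show ?thesis by (simp add: case_prod_beta)
  qed
  also have "\<dots> = (\<integral>\<^sup>+y. \<integral>\<^sup>+z. ?h (a *\<^sub>R y + b *\<^sub>R z) \<partial>gauss \<partial>gauss)"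
  proof -
    have "(\<lambda>p. a *\<^sub>R fst p + b *\<^sub>R snd p) \<in> measurable (gauss \<Otimes>\<^sub>M gauss) (borel :: 'a measure)" by measurable
    from measurable_compose[OF this borel_measurable_indicator[OF A]] gp.nn_integral_fst[of "\<lambda>p. ?h (a *\<^sub>R fst p + b *\<^sub>R snd p)" gauss]
    show ?thesis by simp
  qed
  also have "\<dots> = (\<integral>\<^sup>+y. ?g y * (\<integral>\<^sup>+z. ?g z * ?h (a *\<^sub>R y + b *\<^sub>R z) \<partial>lborel) \<partial>lborel)"
    unfolding gauss_def by (simp add: nn_integral_density)
  also have "\<dots> = (\<integral>\<^sup>+y. \<integral>\<^sup>+x. ennreal ((1/b) ^ DIM('a)) * (?g y * ?g ((1/b) *\<^sub>R (x - a *\<^sub>R y)) * ?h x) \<partial>lborel \<partial>lborel)"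
  proof (rule nn_integral_cong)
    fix y :: 'a
    have "(\<integral>\<^sup>+z. ?g z * ?h (a *\<^sub>R y + b *\<^sub>R z) \<partial>lborel)
      = ennreal ((1/b) ^ DIM('a)) * (\<integral>\<^sup>+x. ?g (- (a/b) *\<^sub>R y + (1/b) *\<^sub>R x) * ?h (a *\<^sub>R y + b *\<^sub>R (- (a/b) *\<^sub>R y + (1/b) *\<^sub>R x)) \<partial>lborel)"
      by (rule lborel_nn_affine) (use ab in \<open>measurable, simp_all\<close>)
    also have "(\<lambda>x. ?g (- (a/b) *\<^sub>R y + (1/b) *\<^sub>R x) * ?h (a *\<^sub>R y + b *\<^sub>R (- (a/b) *\<^sub>R y + (1/b) *\<^sub>R x)))
       = (\<lambda>x. ?g ((1/b) *\<^sub>R (x - a *\<^sub>R y)) * ?h x)"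
      using ab(2) by (intro ext) (simp add: algebra_simps)
    finally show "?g y * (\<integral>\<^sup>+z. ?g z * ?h (a *\<^sub>R y + b *\<^sub>R z) \<partial>lborel)
      = (\<integral>\<^sup>+x. ennreal ((1/b) ^ DIM('a)) * (?g y * ?g ((1/b) *\<^sub>R (x - a *\<^sub>R y)) * ?h x) \<partial>lborel)"
      by (simp add: nn_integral_cmult[symmetric] mult_ac)
  qed
  also have "\<dots> = (\<integral>\<^sup>+x. \<integral>\<^sup>+y. ennreal ((1/b) ^ DIM('a)) * (?g y * ?g ((1/b) *\<^sub>R (x - a *\<^sub>R y)) * ?h x) \<partial>lborel \<partial>lborel)"
    by (rule lborel_pair.Fubini'[symmetric]) measurable
  also have "\<dots> = (\<integral>\<^sup>+x. ?g x * ?h x * (ennreal ((1/b) ^ DIM('a)) * (\<integral>\<^sup>+y. ?g (- (a/b) *\<^sub>R x + (1/b) *\<^sub>R y) \<partial>lborel)) \<partial>lborel)"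
  proof (rule nn_integral_cong)
    fix x :: 'a
    have "ennreal ((1/b) ^ DIM('a)) * (?g y * ?g ((1/b) *\<^sub>R (x - a *\<^sub>R y)) * ?h x)
        = ?g x * ?h x * (ennreal ((1/b) ^ DIM('a)) * ?g (- (a/b) *\<^sub>R x + (1/b) *\<^sub>R y))" for y
    proof -
      have "?g y * ?g ((1/b) *\<^sub>R (x - a *\<^sub>R y)) = ?g x * ?g ((1/b) *\<^sub>R (y - a *\<^sub>R x))"
        using mg[of y x] by (simp add: ennreal_mult[symmetric] gauss_density_pos less_imp_le)
      moreover have "(1/b) *\<^sub>R (y - a *\<^sub>R x) = - (a/b) *\<^sub>R x + (1/b) *\<^sub>R y" by (simp add: algebra_simps)
      ultimately show ?thesis by (simp add: mult_ac)
    qed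
    then show "(\<integral>\<^sup>+y. ennreal ((1/b) ^ DIM('a)) * (?g y * ?g ((1/b) *\<^sub>R (x - a *\<^sub>R y)) * ?h x) \<partial>lborel)
      = ?g x * ?h x * (ennreal ((1/b) ^ DIM('a)) * (\<integral>\<^sup>+y. ?g (- (a/b) *\<^sub>R x + (1/b) *\<^sub>R y) \<partial>lborel))"
      by (simp add: nn_integral_cmult)
  qed
  also have "\<dots> = (\<integral>\<^sup>+x. ?g x * ?h x * (\<integral>\<^sup>+y. ?g y \<partial>lborel) \<partial>lborel)"
  proof -
    have "(\<integral>\<^sup>+y. ?g y \<partial>lborel) = ennreal ((1/b) ^ DIM('a)) * (\<integral>\<^sup>+y. ?g (- (a/b) *\<^sub>R x + (1/b) *\<^sub>R y) \<partial>lborel)" for x :: 'a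
      by (rule lborel_nn_affine) (use ab in auto)
    then show ?thesis by simp
  qed
  also have "(\<integral>\<^sup>+(y::'a). ?g y \<partial>lborel) = 1"
    using gp.emeasure_space_1 by (simp add: gauss_def emeasure_density)
  also have "(\<integral>\<^sup>+x. ?g x * ?h x * 1 \<partial>lborel) = emeasure gauss A"
    by (simp add: gauss_def emeasure_density)
  finally show "emeasure ?M A = emeasure gauss A" .
qed

section \<open>The heat semigroup\<close>

definition bdd_borel :: "real \<Rightarrow> ('a::euclidean_space \<Rightarrow> real) \<Rightarrow> bool" where
  "bdd_borel M W \<longleftrightarrow> W \<in> borel_measurable borel \<and> (\<forall>x. \<bar>W x\<bar> \<le> M)"

lemma bdd_borelD: "bdd_borel M W \<Longrightarrow> W \<in> borel_measurable borel" "bdd_borel M W \<Longrightarrow> \<bar>W x\<bar> \<le> M"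
  by (auto simp: bdd_borel_def)

lemma bdd_borel_nonneg: "bdd_borel M W \<Longrightarrow> M \<ge> 0"
  using bdd_borelD(2)[of M W 0] by linarith

text \<open>
  The heat evolution of the constant-coefficient operator \<open>(1/2) \<Sum> \<partial>\<^sub>B\<^sub>b \<partial>\<^sub>B\<^sub>b\<close>, where \<open>b\<close> runs over
  an orthonormal basis; \<open>B\<close> may be degenerate.
\<close>

definition heat :: "('a::euclidean_space \<Rightarrow> 'a) \<Rightarrow> real \<Rightarrow> ('a \<Rightarrow> real) \<Rightarrow> 'a \<Rightarrow> real" where
  "heat B t W x = (\<integral>y. W (x + sqrt t *\<^sub>R B y) \<partial>gauss)"

definition conv :: "('a::euclidean_space \<Rightarrow> real) \<Rightarrow> ('a \<Rightarrow> real) \<Rightarrow> 'a \<Rightarrow> real" where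
  "conv W k x = (\<integral>y. W y * k (x - y) \<partial>lborel)"

lemma bounded_linear_measurable: "bounded_linear B \<Longrightarrow> B \<in> borel_measurable borel" for B :: "'a::euclidean_space \<Rightarrow> 'a"
  by (intro borel_measurable_continuous_onI linear_continuous_on)

lemma heat_integrable:
  fixes B :: "'a::euclidean_space \<Rightarrow> 'a"
  assumes B: "bounded_linear B" and W: "bdd_borel M W"
  shows "integrable gauss (\<lambda>y. W (x + sqrt t *\<^sub>R B y))"
proof -
  interpret prob_space "gauss :: 'a measure" by (rule prob_space_gauss)
  note [measurable] = bounded_linear_measurable[OF B] bdd_borelD(1)[OF W]
  show ?thesis
    by (rule integrable_const_bound[of _ M]) (use bdd_borelD(2)[OF W] in auto)
qed

lemma heat_bdd:
  fixes B :: "'a::euclidean_space \<Rightarrow> 'a"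
  assumes B: "bounded_linear B" and W: "bdd_borel M W"
  shows "bdd_borel M (heat B t W)"
proof -
  interpret prob_space "gauss :: 'a measure" by (rule prob_space_gauss)
  note [measurable] = bounded_linear_measurable[OF B] bdd_borelD(1)[OF W]
  have "heat B t W \<in> borel_measurable borel"
    unfolding heat_def[abs_def] by measurable
  moreover have "\<bar>heat B t W x\<bar> \<le> M" for x
  proof -
    have "\<bar>heat B t W x\<bar> \<le> (\<integral>y. \<bar>W (x + sqrt t *\<^sub>R B y)\<bar> \<partial>gauss)"
      unfolding heat_def by (rule integral_abs_bound)
    also have "\<dots> \<le> (\<integral>(y::'a). M \<partial>gauss)"
      using bdd_borelD(2)[OF W] by (intro integral_mono integrable_abs heat_integrable[OF B W]) auto
    finally show ?thesis using prob_space by simp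
  qed
  ultimately show ?thesis by (simp add: bdd_borel_def)
qed

lemma heat_mono:
  fixes B :: "'a::euclidean_space \<Rightarrow> 'a"
  assumes B: "bounded_linear B" and W: "bdd_borel M W" "bdd_borel M' W'" and le: "\<And>x. W x \<le> W' x"
  shows "heat B t W x \<le> heat B t W' x"
  unfolding heat_def by (intro integral_mono heat_integrable[OF B W(1)] heat_integrable[OF B W(2)] le)

lemma heat_add_const:
  fixes B :: "'a::euclidean_space \<Rightarrow> 'a"
  assumes B: "bounded_linear B" and W: "bdd_borel M W"
  shows "heat B t (\<lambda>x. W x + c) x = heat B t W x + c"
proof -
  interpret prob_space "gauss :: 'a measure" by (rule prob_space_gauss)
  show ?thesis unfolding heat_def
    by (subst Bochner_Integration.integral_add[OF heat_integrable[OF B W]]) (simp_all add: prob_space[simplified])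
qed

lemma heat_0 [simp]: "heat B 0 W x = W x" for x :: "'a::euclidean_space"
proof -
  interpret prob_space "gauss :: 'a measure" by (rule prob_space_gauss)
  show ?thesis unfolding heat_def by (simp add: prob_space[simplified])
qed

text \<open>
  Two independent Gaussian increments of variances \<open>s\<close> and \<open>t\<close> add up to one of variance \<open>s + t\<close>.
\<close>

lemma heat_semigroup:
  fixes B :: "'a::euclidean_space \<Rightarrow> 'a"
  assumes B: "bounded_linear B" and W: "bdd_borel M W" and st: "s \<ge> 0" "t > 0"
  shows "heat B s (heat B t W) x = heat B (s + t) W x"
proof -
  interpret G: prob_space "gauss :: 'a measure" by (rule prob_space_gauss)
  interpret P: pair_prob_space "gauss :: 'a measure" "gauss :: 'a measure" ..
  note [measurable] = bounded_linear_measurable[OF B] bdd_borelD(1)[OF W]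
  interpret B: bounded_linear B by (rule B)
  define a where "a = sqrt (s / (s + t))"
  define b where "b = sqrt (t / (s + t))"
  have ab: "a\<^sup>2 + b\<^sup>2 = 1" "b > 0"
    using st by (simp_all add: a_def b_def add_divide_distrib[symmetric])
  let ?F = "\<lambda>p. W (x + sqrt (s + t) *\<^sub>R B (a *\<^sub>R fst p + b *\<^sub>R snd p))"
  have F[measurable]: "?F \<in> borel_measurable (gauss \<Otimes>\<^sub>M gauss)" by measurable
  have i: "integrable (gauss \<Otimes>\<^sub>M gauss) ?F"
    by (rule P.P.integrable_const_bound[of _ M]) (use bdd_borelD(2)[OF W] in auto)
  have ra: "sqrt (s + t) * a = sqrt s" "sqrt (s + t) * b = sqrt t"
    using st by (simp_all add: a_def b_def real_sqrt_mult[symmetric])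
  have eq: "x + sqrt s *\<^sub>R B y + sqrt t *\<^sub>R B z = x + sqrt (s + t) *\<^sub>R B (a *\<^sub>R y + b *\<^sub>R z)" for y z
    unfolding B.add B.scaleR scaleR_add_right scaleR_scaleR ra by (simp add: add.assoc)
  have "heat B s (heat B t W) x = (\<integral>y. \<integral>z. ?F (y, z) \<partial>gauss \<partial>gauss)"
    unfolding heat_def eq by simp
  also have "\<dots> = (\<integral>p. ?F p \<partial>(gauss \<Otimes>\<^sub>M gauss))"
    by (rule P.integral_fst'[OF i])
  also have "\<dots> = (\<integral>u. W (x + sqrt (s + t) *\<^sub>R B u) \<partial>distr (gauss \<Otimes>\<^sub>M gauss) borel (\<lambda>(y, z). a *\<^sub>R y + b *\<^sub>R z))"
    by (subst integral_distr) (auto simp: case_prod_beta)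
  finally show ?thesis unfolding gauss_convolution[OF ab] heat_def .
qed

section \<open>Convolution with compactly supported kernels\<close>

text \<open>
  Continuous functions supported in the ball of radius \<open>r\<close>; the support is recorded as a radius, since
  convolutions with them only see values of \<open>W\<close> within that distance.
\<close>

definition cc_fun :: "real \<Rightarrow> ('a::euclidean_space \<Rightarrow> real) \<Rightarrow> bool" where
  "cc_fun r k \<longleftrightarrow> continuous_on UNIV k \<and> (\<forall>x. norm x \<ge> r \<longrightarrow> k x = 0)"

lemma cc_fun_measurable: "cc_fun r k \<Longrightarrow> k \<in> borel_measurable borel"
  by (auto simp: cc_fun_def intro: borel_measurable_continuous_onI)

lemma small_support_integral:
  fixes g :: "'a::euclidean_space \<Rightarrow> real"
  assumes [measurable]: "g \<in> borel_measurable borel" and e: "\<And>y. \<bar>g y\<bar> \<le> e" and z: "\<And>y. dist x y > r \<Longrightarrow> g y = 0"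
  shows "integrable lborel g" "\<bar>\<integral>y. g y \<partial>lborel\<bar> \<le> e * measure lborel (cball x r)"
proof -
  have i: "integrable lborel (\<lambda>y. e * indicator (cball x r) y)"
    by (intro integrable_mult_right integrable_real_indicator) (use emeasure_lborel_cball_finite[of x r] in simp_all)
  have b: "norm (g y) \<le> norm (e * indicator (cball x r) y)" for y
    using e[of y] z[of y] by (auto simp: indicator_def not_le)
  show g: "integrable lborel g" by (rule Bochner_Integration.integrable_bound[OF i]) (use b in auto)
  have "\<bar>\<integral>y. g y \<partial>lborel\<bar> \<le> (\<integral>y. \<bar>g y\<bar> \<partial>lborel)" by (rule integral_abs_bound)
  also have "\<dots> \<le> (\<integral>y. e * indicator (cball x r) y \<partial>lborel)"
    using e z by (intro integral_mono integrable_abs g i) (auto simp: indicator_def not_le)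
  finally show "\<bar>\<integral>y. g y \<partial>lborel\<bar> \<le> e * measure lborel (cball x r)" by simp
qed

lemma cc_fun_bounded: "cc_fun r k \<Longrightarrow> \<exists>S\<ge>0. \<forall>x. \<bar>k x\<bar> \<le> S"
proof -
  assume k: "cc_fun r k"
  have "compact (k ` cball 0 r)" using k by (intro compact_continuous_image) (auto simp: cc_fun_def intro: continuous_on_subset)
  then obtain S where S: "\<forall>x\<in>cball 0 r. \<bar>k x\<bar> \<le> S"
    using compact_imp_bounded[of "k ` cball 0 r"] by (auto simp: bounded_iff)
  have "\<bar>k x\<bar> \<le> \<bar>S\<bar>" for x
  proof (cases "norm x \<le> r")
    case True then show ?thesis using bspec[OF S, of x] by simp
  next
    case False then show ?thesis using k by (simp add: cc_fun_def)
  qed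
  then show ?thesis by (intro exI[of _ "\<bar>S\<bar>"]) auto
qed

lemma conv_integrable:
  assumes W: "bdd_borel M W" and k: "cc_fun r k"
  shows "integrable lborel (\<lambda>y. W y * k (x - y))"
proof -
  obtain S where S: "S \<ge> 0" "\<And>x. \<bar>k x\<bar> \<le> S" using cc_fun_bounded[OF k] by blast
  note [measurable] = bdd_borelD(1)[OF W] cc_fun_measurable[OF k]
  show ?thesis
  proof (rule small_support_integral(1))
    show "\<bar>W y * k (x - y)\<bar> \<le> M * S" for y
      unfolding abs_mult using bdd_borelD(2)[OF W] S bdd_borel_nonneg[OF W] by (intro mult_mono) auto
    show "W y * k (x - y) = 0" if "dist x y > r" for y
      using that k by (simp add: cc_fun_def dist_norm)
  qed measurable
qed

lemma conv_alt: "conv W k x = (\<integral>z. W (x - z) * k z \<partial>lborel)"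
  if [measurable]: "W \<in> borel_measurable borel" "k \<in> borel_measurable borel"
proof -
  have eq: "lborel = density (distr lborel borel (\<lambda>z. x + (-1) *\<^sub>R z)) (\<lambda>_. 1)"
    using lborel_affine[of "-1" x] by simp
  have "conv W k x = (\<integral>y. W y * k (x - y) \<partial>density (distr lborel borel (\<lambda>z. x + (-1) *\<^sub>R z)) (\<lambda>_. 1))"
    unfolding conv_def by (subst eq) simp
  also have "\<dots> = (\<integral>z. W (x - z) * k z \<partial>lborel)"
    by (simp add: density_1 integral_distr)
  finally show ?thesis .
qed

lemma conv_alt_integrable:
  assumes W: "bdd_borel M W" and k: "cc_fun r k"
  shows "integrable lborel (\<lambda>z. W (x - z) * k z)"
proof -
  obtain S where S: "S \<ge> 0" "\<And>x. \<bar>k x\<bar> \<le> S" using cc_fun_bounded[OF k] by blast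
  note [measurable] = bdd_borelD(1)[OF W] cc_fun_measurable[OF k]
  show ?thesis
  proof (rule small_support_integral(1)[where x = 0 and r = r])
    show "\<bar>W (x - z) * k z\<bar> \<le> M * S" for z
      unfolding abs_mult using bdd_borelD(2)[OF W] S bdd_borel_nonneg[OF W] by (intro mult_mono) auto
    show "W (x - z) * k z = 0" if "dist 0 z > r" for z
      using that k by (simp add: cc_fun_def dist_norm)
  qed measurable
qed

lemma conv_measurable:
  assumes W: "bdd_borel M W" and k: "cc_fun r k"
  shows "conv W k \<in> borel_measurable borel"
proof -
  note [measurable] = bdd_borelD(1)[OF W] cc_fun_measurable[OF k]
  show ?thesis unfolding conv_def[abs_def] by measurable
qed

lemma conv_bdd:
  assumes W: "bdd_borel M W" and k: "cc_fun r k"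
  shows "\<exists>M'. bdd_borel M' (conv W k)"
proof -
  obtain S where S: "S \<ge> 0" "\<And>x. \<bar>k x\<bar> \<le> S" using cc_fun_bounded[OF k] by blast
  note [measurable] = bdd_borelD(1)[OF W] cc_fun_measurable[OF k]
  have "\<bar>conv W k x\<bar> \<le> (M * S) * measure lborel (cball (0::'a) r)" for x
    unfolding conv_alt[OF bdd_borelD(1)[OF W] cc_fun_measurable[OF k]]
  proof (rule small_support_integral(2))
    show "\<bar>W (x - z) * k z\<bar> \<le> M * S" for z
      unfolding abs_mult using bdd_borelD(2)[OF W] S bdd_borel_nonneg[OF W] by (intro mult_mono) auto
    show "W (x - z) * k z = 0" if "dist 0 z > r" for z
      using that k by (simp add: cc_fun_def dist_norm)
  qed measurable
  then show ?thesis using conv_measurable[OF assms] by (auto simp: bdd_borel_def)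
qed

text \<open>
  Convolution commutes with the heat semigroup, as both are averages over translations.
\<close>

lemma heat_conv:
  fixes B :: "'a::euclidean_space \<Rightarrow> 'a"
  assumes B: "bounded_linear B" and W: "bdd_borel M W" and k: "cc_fun r k"
  shows "heat B t (conv W k) x = conv (heat B t W) k x"
proof -
  interpret G: prob_space "gauss :: 'a measure" by (rule prob_space_gauss)
  interpret P: pair_sigma_finite "gauss :: 'a measure" "lborel :: 'a measure" ..
  note [measurable] = bounded_linear_measurable[OF B] bdd_borelD(1)[OF W] cc_fun_measurable[OF k]
  let ?f = "\<lambda>y z. W (x + sqrt t *\<^sub>R B y - z) * k z"
  have ci: "integrable lborel (?f y)" for y by (rule conv_alt_integrable[OF W k])
  have i: "integrable (gauss \<Otimes>\<^sub>M lborel) (\<lambda>p. ?f (fst p) (snd p))"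
  proof (rule P.Fubini_integrable)
    obtain S where S: "S \<ge> 0" "\<And>x. \<bar>k x\<bar> \<le> S" using cc_fun_bounded[OF k] by blast
    show "integrable gauss (\<lambda>y. \<integral>z. norm (?f (fst (y, z)) (snd (y, z))) \<partial>lborel)"
    proof (rule G.integrable_const_bound[of _ "(M * S) * measure lborel (cball (0::'a) r)"])
      have "\<bar>\<integral>z. norm (?f y z) \<partial>lborel\<bar> \<le> (M * S) * measure lborel (cball (0::'a) r)" for y
      proof (rule small_support_integral(2))
        show "\<bar>norm (?f y z)\<bar> \<le> M * S" for z
          unfolding real_norm_def abs_abs abs_mult using bdd_borelD(2)[OF W] S bdd_borel_nonneg[OF W] by (intro mult_mono) auto
        show "norm (?f y z) = 0" if "dist 0 z > r" for z
          using that k by (simp add: cc_fun_def dist_norm)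
      qed measurable
      then show "AE y in gauss. norm (\<integral>z. norm (?f (fst (y, z)) (snd (y, z))) \<partial>lborel) \<le> (M * S) * measure lborel (cball (0::'a) r)"
        by simp
    qed measurable
    show "AE y in gauss. integrable lborel (\<lambda>z. ?f (fst (y, z)) (snd (y, z)))" using ci by simp
  qed measurable
  have "heat B t (conv W k) x = (\<integral>y. \<integral>z. ?f y z \<partial>lborel \<partial>gauss)"
    unfolding heat_def conv_alt[OF bdd_borelD(1)[OF W] cc_fun_measurable[OF k]] by simp
  also have "\<dots> = (\<integral>z. \<integral>y. ?f y z \<partial>gauss \<partial>lborel)"
    by (rule P.Fubini_integral[symmetric]) (use i in \<open>simp add: case_prod_beta'\<close>)
  also have "\<dots> = (\<integral>z. heat B t W (x - z) * k z \<partial>lborel)"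
    unfolding heat_def by (simp add: algebra_simps)
  also have "\<dots> = conv (heat B t W) k x"
    by (rule conv_alt[symmetric, OF bdd_borelD(1)[OF heat_bdd[OF B W]] cc_fun_measurable[OF k]])
  finally show ?thesis .
qed

lemma differentiable_remainder_bound:
  fixes \<phi> :: "'a::real_normed_vector \<Rightarrow> real"
  assumes d: "\<And>z. (\<phi> has_derivative blinfun_apply (\<phi>' z)) (at z)"
    and uc: "\<And>z w. dist z w \<le> norm h \<Longrightarrow> norm (\<phi>' z - \<phi>' w) \<le> e"
  shows "\<bar>\<phi> (z + h) - \<phi> z - \<phi>' z h\<bar> \<le> e * norm h"
proof -
  have e: "e \<ge> 0" using uc[of z z] by simp
  have "norm (\<phi> (z + h) - \<phi> z - \<phi>' z ((z + h) - z)) \<le> norm ((z + h) - z) * e"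
  proof (rule differentiable_bound_linearization[where S = "cball z (norm h)"])
    show "z + t *\<^sub>R (z + h - z) \<in> cball z (norm h)" if "t \<in> {0..1}" for t
      using that by (simp add: dist_norm mult_left_le_one_le)
    show "(\<phi> has_derivative blinfun_apply (\<phi>' x)) (at x within cball z (norm h))" for x
      using d by (rule has_derivative_at_withinI)
    show "onorm (blinfun_apply (\<phi>' x) - blinfun_apply (\<phi>' z)) \<le> e" if "x \<in> cball z (norm h)" for x
    proof (rule onorm_bound[OF e])
      fix v
      have "norm ((\<phi>' x - \<phi>' z) v) \<le> norm (\<phi>' x - \<phi>' z) * norm v" by (rule norm_blinfun)
      also have "\<dots> \<le> e * norm v" using that by (intro mult_right_mono uc) (auto simp: dist_commute)
      finally show "norm ((blinfun_apply (\<phi>' x) - blinfun_apply (\<phi>' z)) v) \<le> e * norm v"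
        by (simp add: blinfun.diff_left)
    qed
  qed simp
  then show ?thesis by (simp add: mult.commute)
qed

lemma blinfun_basis_expansion: "blinfun_apply A h = (\<Sum>b\<in>Basis. (h \<bullet> b) * A b)"
  for A :: "'a::euclidean_space \<Rightarrow>\<^sub>L real"
proof -
  have "A h = A (\<Sum>b\<in>Basis. (h \<bullet> b) *\<^sub>R b)" by (simp only: euclidean_representation)
  then show ?thesis by (simp only: blinfun.sum_right blinfun.scaleR_right real_scaleR_def)
qed

lemma conv_basis_expansion:
  fixes \<phi>' :: "'a::euclidean_space \<Rightarrow> 'a \<Rightarrow>\<^sub>L real"
  assumes W: "bdd_borel M W" and k: "\<And>b. cc_fun r (\<lambda>z. \<phi>' z b)"
  shows "(\<Sum>b\<in>Basis. (h \<bullet> b) * conv W (\<lambda>z. \<phi>' z b) x) = conv W (\<lambda>z. \<phi>' z h) x"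
proof -
  have "conv W (\<lambda>z. \<phi>' z h) x = (\<integral>y. (\<Sum>b\<in>Basis. (h \<bullet> b) * (W y * \<phi>' (x - y) b)) \<partial>lborel)"
    unfolding conv_def by (subst blinfun_basis_expansion[of _ h]) (simp add: sum_distrib_left mult_ac)
  also have "\<dots> = (\<Sum>b\<in>Basis. (h \<bullet> b) * conv W (\<lambda>z. \<phi>' z b) x)"
    unfolding conv_def
    by (subst Bochner_Integration.integral_sum) (auto intro!: integrable_mult_right conv_integrable[OF W k])
  finally show ?thesis ..
qed

text \<open>
  The derivative falls on the kernel, so \<open>W\<close> need only be bounded and measurable.
\<close>

lemma conv_has_derivative:
  fixes \<phi>' :: "'a::euclidean_space \<Rightarrow> 'a \<Rightarrow>\<^sub>L real"
  assumes W: "bdd_borel M W" and k: "cc_fun r \<phi>" "\<And>b. cc_fun r (\<lambda>z. \<phi>' z b)"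
    and d: "\<And>z. (\<phi> has_derivative blinfun_apply (\<phi>' z)) (at z)"
    and uc: "\<And>\<epsilon>. \<epsilon> > 0 \<Longrightarrow> \<exists>\<delta>>0. \<forall>z w. dist z w < \<delta> \<longrightarrow> norm (\<phi>' z - \<phi>' w) \<le> \<epsilon>"
  shows "(conv W \<phi> has_derivative (\<lambda>h. conv W (\<lambda>z. \<phi>' z h) x)) (at x)"
  unfolding has_derivative_within_alt2
proof (intro conjI allI impI)
  have "bounded_linear (\<lambda>h. \<Sum>b\<in>Basis. (h \<bullet> b) * conv W (\<lambda>z. \<phi>' z b) x)"
    by (intro bounded_linear_sum bounded_linear_mult_const bounded_linear_inner_left bounded_linear_ident)
  then show "bounded_linear (\<lambda>h. conv W (\<lambda>z. \<phi>' z h) x)"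
    by (simp only: conv_basis_expansion[OF W k(2)])
next
  fix e :: real assume e: "e > 0"
  have M: "M \<ge> 0" by (rule bdd_borel_nonneg[OF W])
  define V where "V = measure lborel (cball x (\<bar>r\<bar> + 1))"
  have V: "V \<ge> 0" by (simp add: V_def)
  define \<epsilon> where "\<epsilon> = e / (M * V + 1)"
  have den: "M * V + 1 > 0" using M V by (simp add: add_nonneg_pos)
  have \<epsilon>: "\<epsilon> > 0" "M * V * \<epsilon> \<le> e" using e den M V by (auto simp: \<epsilon>_def field_simps)
  obtain \<delta> where \<delta>: "\<delta> > 0" "\<And>z w. dist z w < \<delta> \<Longrightarrow> norm (\<phi>' z - \<phi>' w) \<le> \<epsilon>" using uc[OF \<epsilon>(1)] by blast
  have main: "norm (conv W \<phi> y - conv W \<phi> x - conv W (\<lambda>z. \<phi>' z (y - x)) x) \<le> e * norm (y - x)"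
    if y: "dist y x < min \<delta> 1" for y
  proof -
    define h where "h = y - x"
    have h: "norm h < \<delta>" "norm h < 1" "y = x + h" using y by (auto simp: h_def dist_norm)
    note [measurable] = bdd_borelD(1)[OF W] cc_fun_measurable[OF k(1)] cc_fun_measurable[OF k(2)]
    let ?g = "\<lambda>u. W u * (\<phi> (x + h - u) - \<phi> (x - u) - \<phi>' (x - u) h)"
    have "conv W \<phi> y - conv W \<phi> x - conv W (\<lambda>z. \<phi>' z (y - x)) x = (\<integral>u. ?g u \<partial>lborel)"
      unfolding conv_def h(3)
      using conv_integrable[OF W k(1), of "x + h"] conv_integrable[OF W k(1), of x] conv_integrable[OF W k(2)[of h], of x]
      by (simp add: right_diff_distrib)
    moreover have "\<bar>\<integral>u. ?g u \<partial>lborel\<bar> \<le> (M * (\<epsilon> * norm h)) * measure lborel (cball x (\<bar>r\<bar> + 1))"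
    proof (rule small_support_integral(2))
      show "\<bar>?g u\<bar> \<le> M * (\<epsilon> * norm h)" for u
      proof -
        have "\<bar>\<phi> ((x - u) + h) - \<phi> (x - u) - \<phi>' (x - u) h\<bar> \<le> \<epsilon> * norm h"
          by (rule differentiable_remainder_bound[OF d]) (use \<delta>(2) h in auto)
        then show ?thesis unfolding abs_mult using bdd_borelD(2)[OF W] M
          by (intro mult_mono) (auto simp: algebra_simps)
      qed
      show "?g u = 0" if u: "dist x u > \<bar>r\<bar> + 1" for u
      proof -
        have "norm (x - u) \<ge> r" "norm (x + h - u) \<ge> r"
          using u h norm_triangle_ineq2[of "x - u" "- h"] by (auto simp: dist_norm algebra_simps)
        then show ?thesis using k by (simp add: cc_fun_def)
      qed
    qed measurable
    moreover have "(M * (\<epsilon> * norm h)) * measure lborel (cball x (\<bar>r\<bar> + 1)) \<le> e * norm h"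
      using mult_right_mono[OF \<epsilon>(2), of "norm h"] by (simp add: V_def mult_ac)
    ultimately show ?thesis by (simp add: h_def)
  qed
  have "\<forall>\<^sub>F y in at x. dist y x < min \<delta> 1" using \<delta>(1) unfolding eventually_at by (intro exI[of _ "min \<delta> 1"]) auto
  then show "\<forall>\<^sub>F y in at x. norm (conv W \<phi> y - conv W \<phi> x - conv W (\<lambda>z. \<phi>' z (y - x)) x) \<le> e * norm (y - x)"
    by (rule eventually_mono) (rule main)
qed

lemma measure_cball_translate:
  fixes x :: "'a::euclidean_space"
  shows "measure lborel (cball x r) = measure lborel (cball (0::'a) r)"
  by (cases "r \<ge> 0") (simp_all add: content_cball)

lemma conv_diff_bound:
  fixes x y :: "'a::euclidean_space"
  assumes W: "bdd_borel M W" and k: "cc_fun r k" and e: "\<And>u. \<bar>k (x - u) - k (y - u)\<bar> \<le> e"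
  shows "\<bar>conv W k x - conv W k y\<bar> \<le> M * e * (2 * measure lborel (cball (0::'a) r))"
proof -
  note [measurable] = bdd_borelD(1)[OF W] cc_fun_measurable[OF k]
  let ?g = "\<lambda>u. W u * (k (x - u) - k (y - u))"
  have M: "M \<ge> 0" "e \<ge> 0" using bdd_borel_nonneg[OF W] e[of 0] by auto
  have ik: "integrable lborel (\<lambda>u. W u * k (x - u))" for x by (rule conv_integrable[OF W k])
  have ig: "integrable lborel ?g" using Bochner_Integration.integrable_diff[OF ik[of x] ik[of y]] by (simp add: right_diff_distrib)
  have ii: "integrable lborel (indicator (cball x r) :: 'a \<Rightarrow> real)" for x
    by (intro integrable_real_indicator) (use emeasure_lborel_cball_finite[of x r] in simp_all)
  have "conv W k x - conv W k y = (\<integral>u. ?g u \<partial>lborel)"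
    unfolding conv_def using ik[of x] ik[of y] by (simp add: right_diff_distrib)
  also have "\<bar>\<dots>\<bar> \<le> (\<integral>u. \<bar>?g u\<bar> \<partial>lborel)" by (rule integral_abs_bound)
  also have "\<dots> \<le> (\<integral>u. M * e * (indicator (cball x r) u + indicator (cball y r) u) \<partial>lborel)"
  proof (rule integral_mono)
    fix u
    show "\<bar>?g u\<bar> \<le> M * e * (indicator (cball x r) u + indicator (cball y r) u)"
    proof (cases "u \<in> cball x r \<or> u \<in> cball y r")
      case True
      have "\<bar>?g u\<bar> \<le> M * e * 1"
        unfolding abs_mult using bdd_borelD(2)[OF W] e M by (simp add: mult_mono)
      also have "\<dots> \<le> M * e * (indicator (cball x r) u + indicator (cball y r) u)"
        using True M by (intro mult_left_mono) (auto simp: indicator_def)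
      finally show ?thesis .
    next
      case False
      then have "norm (x - u) \<ge> r" "norm (y - u) \<ge> r" by (auto simp: dist_norm)
      then have "\<bar>?g u\<bar> = 0" using k by (simp add: cc_fun_def)
      moreover have "0 \<le> M * e * (indicator (cball x r) u + indicator (cball y r) u)"
        using M by (intro mult_nonneg_nonneg add_nonneg_nonneg) auto
      ultimately show ?thesis by linarith
    qed
  qed (use ig ii in \<open>auto intro!: integrable_mult_right\<close>)
  also have "\<dots> = M * e * (2 * measure lborel (cball (0::'a) r))"
    using ii by (simp add: measure_cball_translate[of x] measure_cball_translate[of y])
  finally show ?thesis .
qed

text \<open>
  The bilinear form \<open>(h, k) \<mapsto> \<langle>h, b\<rangle> \<langle>k, c\<rangle>\<close>; these span the bilinear forms, which turns
  componentwise convolutions into a form-valued one.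
\<close>

definition outer2 :: "'a::euclidean_space \<Rightarrow> 'a \<Rightarrow> 'a \<Rightarrow>\<^sub>L 'a \<Rightarrow>\<^sub>L real" where
  "outer2 b c = blinfun_scaleR_left (blinfun_inner_left c) o\<^sub>L blinfun_inner_left b"

lemma outer2_apply [simp]: "outer2 b c h k = (h \<bullet> b) * (k \<bullet> c)"
  by (simp add: outer2_def blinfun.scaleR_left blinfun_inner_left.rep_eq)

definition conv2 :: "('a::euclidean_space \<Rightarrow> real) \<Rightarrow> ('a \<Rightarrow> 'a \<Rightarrow>\<^sub>L 'a \<Rightarrow>\<^sub>L real) \<Rightarrow> 'a \<Rightarrow> 'a \<Rightarrow>\<^sub>L 'a \<Rightarrow>\<^sub>L real" where
  "conv2 W k'' x = (\<Sum>b\<in>Basis. \<Sum>c\<in>Basis. conv W (\<lambda>z. k'' z b c) x *\<^sub>R outer2 b c)"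

definition conv1 :: "('a::euclidean_space \<Rightarrow> real) \<Rightarrow> ('a \<Rightarrow> 'a \<Rightarrow>\<^sub>L real) \<Rightarrow> 'a \<Rightarrow> 'a \<Rightarrow>\<^sub>L real" where
  "conv1 W k' x = (\<Sum>c\<in>Basis. conv W (\<lambda>z. k' z c) x *\<^sub>R blinfun_inner_left c)"

locale smooth_kernel =
  fixes k :: "'a::euclidean_space \<Rightarrow> real" and k' k'' and r :: real
  assumes C2: "C2_on UNIV k k' k''"
    and supp: "\<And>z. norm z \<ge> r \<Longrightarrow> k z = 0" "\<And>z. norm z \<ge> r \<Longrightarrow> k' z = 0" "\<And>z. norm z \<ge> r \<Longrightarrow> k'' z = 0"
begin

lemma dk: "(k has_derivative blinfun_apply (k' z)) (at z)" "(k' has_derivative blinfun_apply (k'' z)) (at z)"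
  using C2 by (auto simp: C2_on_def)

lemma ck: "continuous_on UNIV k" "continuous_on UNIV k'" "continuous_on UNIV k''"
  using C2 dk by (auto simp: C2_on_def intro!: has_derivative_continuous_on)

lemma cc_k: "cc_fun r k" using ck supp by (auto simp: cc_fun_def)
lemma cc_k1: "cc_fun r (\<lambda>z. k' z h)" using ck supp by (auto simp: cc_fun_def intro!: continuous_intros)
lemma cc_k2: "cc_fun r (\<lambda>z. k'' z h h')" using ck supp by (auto simp: cc_fun_def intro!: continuous_intros)

lemma uniform_continuity:
  fixes \<phi> :: "'a \<Rightarrow> 'b::real_normed_vector"
  assumes c: "continuous_on UNIV \<phi>" and s: "\<And>z. norm z \<ge> r \<Longrightarrow> \<phi> z = 0" and e: "\<epsilon> > 0"
  shows "\<exists>\<delta>>0. \<forall>z w. dist z w < \<delta> \<longrightarrow> norm (\<phi> z - \<phi> w) \<le> \<epsilon>"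
proof -
  have "uniformly_continuous_on (cball 0 (r + 1)) \<phi>"
    by (intro compact_uniformly_continuous continuous_on_subset[OF c]) auto
  then obtain \<delta> where \<delta>: "\<delta> > 0" "\<And>z w. z \<in> cball 0 (r + 1) \<Longrightarrow> w \<in> cball 0 (r + 1) \<Longrightarrow> dist w z < \<delta> \<Longrightarrow> dist (\<phi> w) (\<phi> z) < \<epsilon>"
    unfolding uniformly_continuous_on_def using e by blast
  have "norm (\<phi> z - \<phi> w) \<le> \<epsilon>" if zw: "dist z w < min \<delta> 1" for z w
  proof (cases "norm z \<le> r + 1 \<and> norm w \<le> r + 1")
    case True
    then have "dist (\<phi> z) (\<phi> w) < \<epsilon>" using zw by (intro \<delta>(2)) auto
    then show ?thesis by (simp add: dist_norm)
  next
    case False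
    have "norm z \<le> norm w + dist z w" "norm w \<le> norm z + dist z w"
      using norm_triangle_sub[of z w] norm_triangle_sub[of w z] by (auto simp: dist_norm norm_minus_commute)
    then have "norm z \<ge> r" "norm w \<ge> r" using False zw by auto
    then show ?thesis using s e by simp
  qed
  then show ?thesis using \<delta>(1) by (intro exI[of _ "min \<delta> 1"]) auto
qed

text \<open>
  Uniform continuity in a shape with an explicit quadratic remainder, ready to be integrated against a
  Gaussian: \<open>\<epsilon>\<close> covers nearby points and the quadratic term the far ones.
\<close>

lemma kernel_modulus:
  assumes e: "\<epsilon> > 0"
  shows "\<exists>K\<ge>0. \<forall>z w. norm (k'' z - k'' w) \<le> \<epsilon> + K * (dist z w)\<^sup>2"
proof -
  obtain \<delta> where \<delta>: "\<delta> > 0" "\<And>z w. dist z w < \<delta> \<Longrightarrow> norm (k'' z - k'' w) \<le> \<epsilon>"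
    using uniform_continuity[OF ck(3) supp(3) e] by blast
  have "compact (k'' ` cball 0 r)" by (intro compact_continuous_image continuous_on_subset[OF ck(3)]) auto
  then obtain S where S: "\<forall>x\<in>cball 0 r. norm (k'' x) \<le> S"
    using compact_imp_bounded[of "k'' ` cball 0 r"] by (auto simp: bounded_iff)
  have S': "norm (k'' x) \<le> \<bar>S\<bar>" for x
  proof (cases "norm x \<le> r")
    case True then show ?thesis using bspec[OF S, of x] by simp
  next
    case False then show ?thesis using supp by simp
  qed
  have "norm (k'' z - k'' w) \<le> \<epsilon> + (2 * \<bar>S\<bar> / \<delta>\<^sup>2) * (dist z w)\<^sup>2" for z w
  proof (cases "dist z w < \<delta>")
    case True
    then show ?thesis using \<delta>(2)[OF True] by (smt (verit) divide_nonneg_nonneg mult_nonneg_nonneg zero_le_power2)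
  next
    case False
    have "norm (k'' z - k'' w) \<le> 2 * \<bar>S\<bar>" using norm_triangle_ineq4[of "k'' z" "k'' w"] S'[of z] S'[of w] by linarith
    also have "\<dots> = (2 * \<bar>S\<bar> / \<delta>\<^sup>2) * \<delta>\<^sup>2" using \<delta>(1) by simp
    also have "\<dots> \<le> (2 * \<bar>S\<bar> / \<delta>\<^sup>2) * (dist z w)\<^sup>2" using False \<delta>(1) by (intro mult_left_mono power_mono) auto
    finally show ?thesis using e by simp
  qed
  then show ?thesis by (intro exI[of _ "2 * \<bar>S\<bar> / \<delta>\<^sup>2"]) auto
qed

lemma conv1_apply: "bdd_borel M W \<Longrightarrow> conv1 W k' x h = conv W (\<lambda>z. k' z h) x"
  using conv_basis_expansion[OF _ cc_k1, of M W h x]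
  by (simp add: conv1_def blinfun.sum_left blinfun.scaleR_left blinfun_inner_left.rep_eq mult.commute)

lemma conv2_apply:
  assumes W: "bdd_borel M W"
  shows "conv2 W k'' x h h' = conv W (\<lambda>z. k'' z h h') x"
proof -
  define ev where "ev c = Blinfun (\<lambda>A :: 'a \<Rightarrow>\<^sub>L real. A c)" for c :: 'a
  have ev: "ev c A = A c" for c A
    unfolding ev_def by (simp add: bounded_linear_Blinfun_apply blinfun.bounded_linear_left)
  have "(\<Sum>b\<in>Basis. (h \<bullet> b) * conv W (\<lambda>z. (ev c o\<^sub>L k'' z) b) x) = conv W (\<lambda>z. (ev c o\<^sub>L k'' z) h) x" for c
    by (rule conv_basis_expansion[OF W, where r = r]) (simp add: ev cc_k2)
  then have 1: "(\<Sum>b\<in>Basis. (h \<bullet> b) * conv W (\<lambda>z. k'' z b c) x) = conv W (\<lambda>z. k'' z h c) x" for c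
    by (simp add: ev)
  have 2: "(\<Sum>c\<in>Basis. (h' \<bullet> c) * conv W (\<lambda>z. k'' z h c) x) = conv W (\<lambda>z. k'' z h h') x"
    by (rule conv_basis_expansion[OF W cc_k2])
  have "conv2 W k'' x h h' = (\<Sum>b\<in>Basis. \<Sum>c\<in>Basis. (h' \<bullet> c) * ((h \<bullet> b) * conv W (\<lambda>z. k'' z b c) x))"
    by (simp add: conv2_def blinfun.sum_left blinfun.scaleR_left mult_ac)
  also have "\<dots> = (\<Sum>c\<in>Basis. (h' \<bullet> c) * (\<Sum>b\<in>Basis. (h \<bullet> b) * conv W (\<lambda>z. k'' z b c) x))"
    by (subst sum.swap) (simp add: sum_distrib_left)
  finally show ?thesis unfolding 1 2 .
qed

lemma conv_continuous:
  fixes \<phi> :: "'a \<Rightarrow> real"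
  assumes W: "bdd_borel M W" and f: "cc_fun r \<phi>"
  shows "continuous_on UNIV (conv W \<phi>)"
  unfolding continuous_on_iff
proof (intro ballI allI impI)
  fix x :: 'a and e :: real assume e: "e > 0"
  have M: "M \<ge> 0" by (rule bdd_borel_nonneg[OF W])
  define V where "V = 2 * measure lborel (cball (0::'a) r)"
  have V: "V \<ge> 0" by (simp add: V_def)
  have den: "M * V + 1 > 0" using M V by (simp add: add_nonneg_pos)
  define \<epsilon> where "\<epsilon> = e / (M * V + 1)"
  have \<epsilon>: "\<epsilon> > 0" "M * \<epsilon> * V < e" using e den M V by (auto simp: \<epsilon>_def field_simps)
  obtain \<delta> where \<delta>: "\<delta> > 0" "\<And>z w. dist z w < \<delta> \<Longrightarrow> norm (\<phi> z - \<phi> w) \<le> \<epsilon>"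
    using uniform_continuity[of \<phi>, OF _ _ \<epsilon>(1)] f by (auto simp: cc_fun_def)
  have "dist (conv W \<phi> y) (conv W \<phi> x) < e" if y: "dist y x < min \<delta> 1" for y
  proof -
    have "\<bar>conv W \<phi> y - conv W \<phi> x\<bar> \<le> M * \<epsilon> * V"
      unfolding V_def by (rule conv_diff_bound[OF W f]) (use \<delta>(2)[of "y - _" "x - _"] y in \<open>auto simp: dist_norm\<close>)
    then show ?thesis using \<epsilon>(2) by (simp add: dist_real_def)
  qed
  then show "\<exists>d>0. \<forall>x'\<in>UNIV. dist x' x < d \<longrightarrow> dist (conv W \<phi> x') (conv W \<phi> x) < e"
    using \<delta>(1) by (intro exI[of _ "min \<delta> 1"]) auto
qed

lemma conv_C2:
  assumes W: "bdd_borel M W"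
  shows "C2_on UNIV (conv W k) (conv1 W k') (conv2 W k'')"
  unfolding C2_on_def
proof (intro conjI ballI)
  fix x :: 'a
  have "(conv W k has_derivative (\<lambda>h. conv W (\<lambda>z. k' z h) x)) (at x)"
    by (rule conv_has_derivative[OF W cc_k cc_k1 dk(1)]) (rule uniform_continuity[OF ck(2) supp(2)])
  moreover have "blinfun_apply (conv1 W k' x) = (\<lambda>h. conv W (\<lambda>z. k' z h) x)" by (rule ext) (rule conv1_apply[OF W])
  ultimately show "(conv W k has_derivative blinfun_apply (conv1 W k' x)) (at x)" by simp
  define ev where "ev c = Blinfun (\<lambda>A :: 'a \<Rightarrow>\<^sub>L real. A c)" for c :: 'a
  have ev: "ev c A = A c" for c A
    unfolding ev_def by (simp add: bounded_linear_Blinfun_apply blinfun.bounded_linear_left)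
  have "(conv W (\<lambda>z. k' z c) has_derivative (\<lambda>h. conv W (\<lambda>z. (ev c o\<^sub>L k'' z) h) x)) (at x)" for c
  proof (rule conv_has_derivative[OF W cc_k1])
    show "cc_fun r (\<lambda>z. blinfun_apply (ev c o\<^sub>L k'' z) b)" for b by (simp add: ev cc_k2)
    show "((\<lambda>z. k' z c) has_derivative blinfun_apply (ev c o\<^sub>L k'' z)) (at z)" for z
    proof -
      have "blinfun_apply (ev c o\<^sub>L k'' z) = (\<lambda>h. k'' z h c)" by (rule ext) (simp add: ev)
      then show ?thesis using bounded_linear.has_derivative[OF blinfun.bounded_linear_left dk(2)[of z], of c] by simp
    qed
    fix \<epsilon> :: real assume "\<epsilon> > 0"
    moreover have "continuous_on UNIV (\<lambda>z. ev c o\<^sub>L k'' z)" using ck(3) by (intro continuous_intros)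
    moreover have "ev c o\<^sub>L k'' z = 0" if "norm z \<ge> r" for z by (rule blinfun_eqI) (simp add: supp(3)[OF that] ev)
    ultimately show "\<exists>\<delta>>0. \<forall>z w. dist z w < \<delta> \<longrightarrow> norm ((ev c o\<^sub>L k'' z) - (ev c o\<^sub>L k'' w)) \<le> \<epsilon>"
      using uniform_continuity[of "\<lambda>z. ev c o\<^sub>L k'' z"] by blast
  qed
  then have d: "(conv W (\<lambda>z. k' z c) has_derivative (\<lambda>h. conv W (\<lambda>z. k'' z h c) x)) (at x)" for c by (simp add: ev)
  have "(conv1 W k' has_derivative (\<lambda>h. \<Sum>c\<in>Basis. conv W (\<lambda>z. k'' z h c) x *\<^sub>R blinfun_inner_left c)) (at x)"
    unfolding conv1_def[abs_def] by (intro has_derivative_sum has_derivative_scaleR_left d)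
  moreover have "(\<lambda>h. \<Sum>c\<in>Basis. conv W (\<lambda>z. k'' z h c) x *\<^sub>R blinfun_inner_left c) = blinfun_apply (conv2 W k'' x)"
  proof (rule ext, rule blinfun_eqI)
    fix h h' :: 'a
    have "blinfun_apply (\<Sum>c\<in>Basis. conv W (\<lambda>z. k'' z h c) x *\<^sub>R blinfun_inner_left c) h' = (\<Sum>c\<in>Basis. (h' \<bullet> c) * conv W (\<lambda>z. k'' z h c) x)"
      by (simp add: blinfun.sum_left blinfun.scaleR_left blinfun_inner_left.rep_eq mult.commute)
    also have "\<dots> = conv W (\<lambda>z. k'' z h h') x" by (rule conv_basis_expansion[OF W cc_k2])
    finally show "blinfun_apply (\<Sum>c\<in>Basis. conv W (\<lambda>z. k'' z h c) x *\<^sub>R blinfun_inner_left c) h' = conv2 W k'' x h h'"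
      by (simp add: conv2_apply[OF W])
  qed
  ultimately show "(conv1 W k' has_derivative blinfun_apply (conv2 W k'' x)) (at x)" by simp
next
  show "continuous_on UNIV (conv2 W k'')"
    unfolding conv2_def[abs_def] by (intro continuous_intros conv_continuous[OF W] cc_k2)
qed simp

end

section \<open>Truncated Gaussian kernels\<close>

lemma usc_attains_max:
  fixes f :: "'a::topological_space \<Rightarrow> 'b::linorder"
  assumes K: "compact K" "K \<noteq> {}"
    and usc: "\<And>x c. x \<in> K \<Longrightarrow> f x < c \<Longrightarrow> \<exists>U. open U \<and> x \<in> U \<and> (\<forall>y\<in>U \<inter> K. f y < c)"
  shows "\<exists>x\<in>K. \<forall>y\<in>K. f y \<le> f x"
proof (rule ccontr)
  assume "\<not> ?thesis"
  then have "\<forall>x\<in>K. \<exists>y\<in>K. f x < f y" by (meson not_le)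
  then obtain g where g: "\<And>x. x \<in> K \<Longrightarrow> g x \<in> K" "\<And>x. x \<in> K \<Longrightarrow> f x < f (g x)" by metis
  have "\<forall>x\<in>K. \<exists>U. open U \<and> x \<in> U \<and> (\<forall>y\<in>U \<inter> K. f y < f (g x))" using usc g(2) by blast
  then obtain U where U: "\<And>x. x \<in> K \<Longrightarrow> open (U x)" "\<And>x. x \<in> K \<Longrightarrow> x \<in> U x"
    "\<And>x y. x \<in> K \<Longrightarrow> y \<in> U x \<inter> K \<Longrightarrow> f y < f (g x)" by metis
  have cov: "K \<subseteq> (\<Union>x\<in>K. U x)" using U(2) by blast
  obtain T where T: "T \<subseteq> K" "finite T" "K \<subseteq> (\<Union>x\<in>T. U x)"
    by (rule compactE_image[OF K(1) U(1) cov]) (assumption, rule that)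
  have "T \<noteq> {}" using T K by auto
  then have "Max ((\<lambda>t. f (g t)) ` T) \<in> (\<lambda>t. f (g t)) ` T" using T(2) by (intro Max_in) auto
  then obtain t where t: "t \<in> T" "Max ((\<lambda>t. f (g t)) ` T) = f (g t)" by blast
  have "g t \<in> K" using g(1) t(1) T(1) by blast
  then obtain t' where t': "t' \<in> T" "g t \<in> U t'" using T(3) by blast
  have "f (g t) < f (g t')" using U(3)[of t' "g t"] t' T(1) \<open>g t \<in> K\<close> by blast
  moreover have "f (g t') \<le> Max ((\<lambda>t. f (g t)) ` T)" using T(2) t'(1) by simp
  ultimately show False using t(2) by simp
qed

text \<open>
  The cube of the positive part is \<open>C\<^sup>2\<close>, which is all the regularity that the kernels need.
\<close>

lemma positive_part_power_derivative:
  "((\<lambda>s::real. (max 0 s) ^ Suc (Suc n)) has_real_derivative real (n + 2) * (max 0 s) ^ Suc n) (at s)"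
proof -
  consider "s > 0" | "s < 0" | "s = 0" by linarith
  then show ?thesis
  proof cases
    case 1
    have "((\<lambda>s::real. s ^ Suc (Suc n)) has_real_derivative real (n + 2) * s ^ Suc n) (at s)"
      by (rule DERIV_cong[OF DERIV_pow]) simp
    then have "((\<lambda>s::real. (max 0 s) ^ Suc (Suc n)) has_real_derivative real (n + 2) * s ^ Suc n) (at s)"
      by (rule has_field_derivative_transform_within[where d = s]) (use 1 in \<open>auto simp: dist_real_def max_def\<close>)
    moreover have "max 0 s = s" using 1 by simp
    ultimately show ?thesis by simp
  next
    case 2
    have "((\<lambda>s::real. 0) has_real_derivative 0) (at s)" by simp
    then have "((\<lambda>s::real. (max 0 s) ^ Suc (Suc n)) has_real_derivative 0) (at s)"
      by (rule has_field_derivative_transform_within[where d = "- s"]) (use 2 in \<open>auto simp: dist_real_def max_def\<close>)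
    then show ?thesis using 2 by (simp add: max_def)
  next
    case 3
    have "(\<lambda>h::real. (max 0 h) ^ Suc (Suc n) / h) \<midarrow>0\<rightarrow> 0"
    proof (rule Lim_null_comparison)
      have "norm ((max 0 h) ^ Suc (Suc n) / h) \<le> \<bar>h\<bar> ^ Suc n" for h :: real
      proof (cases "h > 0")
        case True then show ?thesis by (simp add: max_def)
      next
        case False
        then have "norm ((max 0 h) ^ Suc (Suc n) / h) = 0" by simp
        moreover have "0 \<le> \<bar>h\<bar> ^ Suc n" by (rule zero_le_power) simp
        ultimately show ?thesis by linarith
      qed
      then show "\<forall>\<^sub>F h in at 0. norm ((max 0 h) ^ Suc (Suc n) / h) \<le> \<bar>h\<bar> ^ Suc n" by simp
      have "(\<lambda>h::real. \<bar>h\<bar> ^ Suc n) \<midarrow>0\<rightarrow> \<bar>0\<bar> ^ Suc n" by (intro tendsto_intros)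
      then show "(\<lambda>h::real. \<bar>h\<bar> ^ Suc n) \<midarrow>0\<rightarrow> 0" by simp
    qed
    then show ?thesis unfolding 3 DERIV_def by simp
  qed
qed

lemma radial_C2:
  fixes f :: "real \<Rightarrow> real"
  assumes f: "\<And>s. (f has_real_derivative f1 s) (at s)" "\<And>s. (f1 has_real_derivative f2 s) (at s)" "continuous_on UNIV f2"
  shows "C2_on UNIV (\<lambda>z::'a::euclidean_space. f (z \<bullet> z)) (\<lambda>z. (2 * f1 (z \<bullet> z)) *\<^sub>R blinfun_inner_right z)
     (\<lambda>z. (2 * f1 (z \<bullet> z)) *\<^sub>R inner2 + (4 * f2 (z \<bullet> z)) *\<^sub>R outer2 z z)"
  unfolding C2_on_def
proof (intro conjI ballI)
  fix z :: 'a
  have d0: "((\<lambda>z::'a. z \<bullet> z) has_derivative (\<lambda>h. 2 * (z \<bullet> h))) (at z)"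
    by (auto intro!: derivative_eq_intros simp: inner_commute)
  have "((\<lambda>z::'a. f (z \<bullet> z)) has_derivative (\<lambda>h. f1 (z \<bullet> z) * (2 * (z \<bullet> h)))) (at z)"
    by (rule has_derivative_compose[OF d0 f(1)[of "z \<bullet> z", unfolded has_field_derivative_def]])
  moreover have "(\<lambda>h. f1 (z \<bullet> z) * (2 * (z \<bullet> h))) = blinfun_apply ((2 * f1 (z \<bullet> z)) *\<^sub>R blinfun_inner_right z)"
    by (rule ext) (simp add: blinfun.scaleR_left blinfun_inner_right.rep_eq)
  ultimately show "((\<lambda>z::'a. f (z \<bullet> z)) has_derivative blinfun_apply ((2 * f1 (z \<bullet> z)) *\<^sub>R blinfun_inner_right z)) (at z)" by simp
  have d1: "((\<lambda>z::'a. 2 * f1 (z \<bullet> z)) has_derivative (\<lambda>h. 4 * f2 (z \<bullet> z) * (z \<bullet> h))) (at z)"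
  proof -
    have "((\<lambda>z::'a. 2 * f1 (z \<bullet> z)) has_derivative (\<lambda>h. 2 * (f2 (z \<bullet> z) * (2 * (z \<bullet> h))))) (at z)"
      by (rule has_derivative_mult_right[OF has_derivative_compose[OF d0 f(2)[of "z \<bullet> z", unfolded has_field_derivative_def]]])
    moreover have "(\<lambda>h. 2 * (f2 (z \<bullet> z) * (2 * (z \<bullet> h)))) = (\<lambda>h. 4 * f2 (z \<bullet> z) * (z \<bullet> h))" by (rule ext) simp
    ultimately show ?thesis by simp
  qed
  have "((\<lambda>z::'a. (2 * f1 (z \<bullet> z)) *\<^sub>R blinfun_inner_right z) has_derivative
      (\<lambda>h. (2 * f1 (z \<bullet> z)) *\<^sub>R blinfun_inner_right h + (4 * f2 (z \<bullet> z) * (z \<bullet> h)) *\<^sub>R blinfun_inner_right z)) (at z)"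
    by (intro has_derivative_scaleR d1 bounded_linear_imp_has_derivative bounded_linear_blinfun_inner_right)
  moreover have "(\<lambda>h. (2 * f1 (z \<bullet> z)) *\<^sub>R blinfun_inner_right h + (4 * f2 (z \<bullet> z) * (z \<bullet> h)) *\<^sub>R blinfun_inner_right z)
     = blinfun_apply ((2 * f1 (z \<bullet> z)) *\<^sub>R inner2 + (4 * f2 (z \<bullet> z)) *\<^sub>R outer2 z z)"
    by (rule ext, rule blinfun_eqI)
      (simp add: blinfun.add_left blinfun.scaleR_left blinfun_inner_right.rep_eq inner_commute)
  ultimately show "((\<lambda>z::'a. (2 * f1 (z \<bullet> z)) *\<^sub>R blinfun_inner_right z) has_derivative
      blinfun_apply ((2 * f1 (z \<bullet> z)) *\<^sub>R inner2 + (4 * f2 (z \<bullet> z)) *\<^sub>R outer2 z z)) (at z)" by simp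
next
  have "continuous_on UNIV f1" using f(2) by (intro DERIV_continuous_on) (auto intro: has_field_derivative_at_within)
  then have c: "continuous_on UNIV (\<lambda>z::'a. f1 (z \<bullet> z))" "continuous_on UNIV (\<lambda>z::'a. f2 (z \<bullet> z))"
    using f(3) by (auto intro!: continuous_on_compose2[of UNIV f1] continuous_on_compose2[of UNIV f2] continuous_intros)
  have "continuous_on UNIV (\<lambda>z::'a. outer2 z z)"
    unfolding outer2_def by (intro continuous_intros bounded_linear.continuous_on[OF bounded_linear_blinfun_scaleR_left]
      bounded_linear.continuous_on[OF bounded_linear_blinfun_inner_left])
  then show "continuous_on UNIV (\<lambda>z::'a. (2 * f1 (z \<bullet> z)) *\<^sub>R inner2 + (4 * f2 (z \<bullet> z)) *\<^sub>R outer2 z z)"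
    by (intro continuous_intros c)
qed simp

text \<open>
  As a function of the squared norm this is a \<open>C\<^sup>2\<close> cutoff supported in the ball of radius \<open>r\<close>.
\<close>

definition cutoff :: "real \<Rightarrow> real \<Rightarrow> real" where "cutoff r s = (max 0 (1 - s / r\<^sup>2)) ^ 3"

lemma cutoff_bounds: "0 \<le> cutoff r s" "s \<ge> 0 \<Longrightarrow> cutoff r s \<le> 1"
  by (auto simp: cutoff_def intro!: power_le_one)

lemma cutoff_lower: "s \<ge> 0 \<Longrightarrow> 1 - cutoff r s \<le> 3 * s / r\<^sup>2"
proof -
  assume s: "s \<ge> 0"
  define a where "a = s / r\<^sup>2"
  have a: "a \<ge> 0" using s by (simp add: a_def)
  have "1 - (max 0 (1 - a)) ^ 3 \<le> 3 * a"
  proof (cases "a \<le> 1")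
    case True
    have "1 + real 3 * (- a) \<le> (1 + (- a)) ^ 3" using True by (intro Bernoulli_inequality) simp
    then show ?thesis using True by (simp add: max_def)
  next
    case False
    then show ?thesis by (simp add: max_def)
  qed
  then show ?thesis by (simp add: cutoff_def a_def)
qed

lemma gauss_scaled_integral:
  fixes h :: "'a::euclidean_space \<Rightarrow> real"
  assumes [measurable]: "h \<in> borel_measurable borel" and t: "t > 0"
  shows "(\<integral>z. h z * gauss_density ((1 / sqrt t) *\<^sub>R z) \<partial>lborel) = sqrt t ^ DIM('a) * (\<integral>y. h (sqrt t *\<^sub>R y) \<partial>gauss)"
proof -
  have "(\<integral>z. h z * gauss_density ((1 / sqrt t) *\<^sub>R z) \<partial>lborel)
      = (\<integral>z. h z * gauss_density ((1 / sqrt t) *\<^sub>R z) \<partial>density (distr lborel borel (\<lambda>y. 0 + sqrt t *\<^sub>R y)) (\<lambda>_. \<bar>sqrt t\<bar> ^ DIM('a)))"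
    using t by (subst lborel_affine[of "sqrt t" 0]) simp_all
  also have "\<dots> = (\<integral>y. sqrt t ^ DIM('a) * (h (sqrt t *\<^sub>R y) * gauss_density y) \<partial>lborel)"
    using t by (subst integral_density) (simp_all add: integral_distr)
  also have "\<dots> = sqrt t ^ DIM('a) * (\<integral>y. h (sqrt t *\<^sub>R y) \<partial>gauss)"
    by (subst gauss_integral) (simp_all add: mult.commute)
  finally show ?thesis .
qed

text \<open>
  A Gaussian of variance \<open>t\<close>, cut off at radius \<open>r\<close> and renormalised. The mass lost by the cutoff is
  at most \<open>3 t DIM / r\<^sup>2\<close> by Bernoulli's inequality and the second moment, which bounds the heat
  evolution of a nonnegative function by the convolution. The linear bound in \<open>t\<close> lets \<open>t\<close> tend to
  zero for fixed \<open>r\<close>.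
\<close>

lemma gaussian_kernel_exists:
  fixes r t :: real
  assumes r: "r > 0" and t: "t > 0" "3 * t * DIM('a::euclidean_space) < r\<^sup>2"
  shows "\<exists>(k :: 'a \<Rightarrow> real) k' k''. smooth_kernel k k' k'' r \<and> (\<forall>z. k z \<ge> 0) \<and> (\<integral>z. k z \<partial>lborel) = 1 \<and> (\<forall>z. k (- z) = k z) \<and>
     (\<forall>M p x. bdd_borel M p \<longrightarrow> (\<forall>x. p x \<ge> 0) \<longrightarrow> heat uminus t p x \<le> conv p k x + M * (3 * t * DIM('a) / r\<^sup>2))"
proof -
  interpret G: prob_space "gauss :: 'a measure" by (rule prob_space_gauss)
  define ct where "ct z = cutoff r (z \<bullet> z)" for z :: 'a
  have chim[measurable]: "ct \<in> borel_measurable borel"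
    unfolding ct_def cutoff_def by measurable
  have chib: "0 \<le> ct z" "ct z \<le> 1" for z using cutoff_bounds by (auto simp: ct_def)
  define \<mu> where "\<mu> = (\<integral>(y::'a). ct (sqrt t *\<^sub>R y) \<partial>gauss)"
  have ichi: "integrable gauss (\<lambda>y::'a. ct (sqrt t *\<^sub>R y))"
    by (rule G.integrable_const_bound[of _ 1]) (use chib in auto)
  have st: "sqrt t * (sqrt t * w) = t * w" for w using t by (simp add: mult.assoc[symmetric])
  have low: "1 - ct (sqrt t *\<^sub>R y) \<le> (3 * t / r\<^sup>2) * (norm y)\<^sup>2" for y
    using cutoff_lower[of "(sqrt t *\<^sub>R y) \<bullet> (sqrt t *\<^sub>R y)" r] t by (simp add: ct_def power2_norm_eq_inner st)
  have "1 - \<mu> = (\<integral>(y::'a). 1 - ct (sqrt t *\<^sub>R y) \<partial>gauss)"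
    unfolding \<mu>_def using ichi by (simp add: G.prob_space[simplified])
  also have "\<dots> \<le> (\<integral>(y::'a). (3 * t / r\<^sup>2) * (norm y)\<^sup>2 \<partial>gauss)"
    by (intro integral_mono low) (use ichi gauss_norm_moments in auto)
  also have "\<dots> = 3 * t * DIM('a) / r\<^sup>2" by (simp add: gauss_norm_moments)
  also have "\<dots> < 1" using t r by simp
  finally have mu0: "\<mu> > 0" by simp
  have "\<mu> \<le> (\<integral>(y::'a). 1 \<partial>gauss)" unfolding \<mu>_def by (intro integral_mono ichi) (use chib in auto)
  then have mu1: "\<mu> \<le> 1" by (simp add: G.prob_space[simplified])
  define \<alpha> where "\<alpha> = - 1 / (2 * t)"
  define C where "C = (1 / sqrt (2 * pi)) ^ DIM('a) / (sqrt t ^ DIM('a) * \<mu>)"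
  have C: "C > 0" using mu0 t by (simp add: C_def)
  define q where "q = 1 / r\<^sup>2"
  let ?g = "\<lambda>s. max 0 (1 - s / r\<^sup>2)"
  define f where "f s = C * (exp (\<alpha> * s) * (?g s) ^ 3)" for s
  define f1 where "f1 s = C * (\<alpha> * exp (\<alpha> * s) * (?g s) ^ 3 - (3 * q) * exp (\<alpha> * s) * (?g s) ^ 2)" for s
  define f2 where "f2 s = C * (\<alpha>\<^sup>2 * exp (\<alpha> * s) * (?g s) ^ 3 - (6 * \<alpha> * q) * exp (\<alpha> * s) * (?g s) ^ 2
      + (6 * q\<^sup>2) * exp (\<alpha> * s) * ?g s)" for s
  have dl: "((\<lambda>s. 1 - s / r\<^sup>2) has_real_derivative - q) (at s)" for s
    unfolding q_def by (rule DERIV_cong[OF DERIV_diff[OF DERIV_const DERIV_cdivide[OF DERIV_ident]]]) simp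
  have d3: "((\<lambda>s. (?g s) ^ 3) has_real_derivative - (3 * q) * (?g s) ^ 2) (at s)" for s
    using DERIV_chain2[OF positive_part_power_derivative[of 1 "1 - s / r\<^sup>2"] dl]
    by (simp add: numeral_3_eq_3 numeral_2_eq_2 mult_ac)
  have d2: "((\<lambda>s. (?g s) ^ 2) has_real_derivative - (2 * q) * ?g s) (at s)" for s
    using DERIV_chain2[OF positive_part_power_derivative[of 0 "1 - s / r\<^sup>2"] dl]
    by (simp add: numeral_2_eq_2 mult_ac)
  have de: "((\<lambda>s. exp (\<alpha> * s)) has_real_derivative \<alpha> * exp (\<alpha> * s)) (at s)" for s
    by (auto intro!: derivative_eq_intros)
  have F1: "(f has_real_derivative f1 s) (at s)" for s
    unfolding f_def[abs_def] f1_def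
    by (rule DERIV_cong[OF DERIV_cmult[OF DERIV_mult[OF de d3]]]) (simp add: algebra_simps)
  have F2: "(f1 has_real_derivative f2 s) (at s)" for s
    unfolding f1_def[abs_def] f2_def mult.assoc[of \<alpha> "exp _"] mult.assoc[of "3 * q" "exp _"]
    by (rule DERIV_cong[OF DERIV_cmult[OF DERIV_diff[OF DERIV_cmult[OF DERIV_mult[OF de d3]] DERIV_cmult[OF DERIV_mult[OF de d2]]]]])
      (simp add: algebra_simps power2_eq_square)
  have ce: "continuous_on UNIV (\<lambda>s. exp (\<alpha> * s))"
    by (rule DERIV_continuous_on) (rule de)
  have cg: "continuous_on UNIV ?g"
  proof -
    have "continuous_on UNIV (\<lambda>s. 1 - s / r\<^sup>2)" by (rule DERIV_continuous_on) (rule dl)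
    then show ?thesis by (rule continuous_on_max[OF continuous_on_const])
  qed
  have F3: "continuous_on UNIV f2"
    unfolding f2_def[abs_def]
    by (intro continuous_on_mult continuous_on_add continuous_on_diff continuous_on_power continuous_on_const ce cg)
  define k where "k z = f (z \<bullet> z)" for z :: 'a
  let ?k' = "\<lambda>z::'a. (2 * f1 (z \<bullet> z)) *\<^sub>R blinfun_inner_right z"
  let ?k'' = "\<lambda>z::'a. (2 * f1 (z \<bullet> z)) *\<^sub>R inner2 + (4 * f2 (z \<bullet> z)) *\<^sub>R outer2 z z"
  have z0: "f s = 0 \<and> f1 s = 0 \<and> f2 s = 0" if "s \<ge> r\<^sup>2" for s
  proof -
    have "?g s = 0" using that r by (simp add: max_def)
    then show ?thesis by (simp add: f_def f1_def f2_def)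
  qed
  have out: "z \<bullet> z \<ge> r\<^sup>2" if "norm z \<ge> r" for z :: 'a
    using that r by (simp add: power2_norm_eq_inner[symmetric] power_mono)
  have sk: "smooth_kernel k ?k' ?k'' r"
  proof
    show "C2_on UNIV k ?k' ?k''" unfolding k_def[abs_def] by (rule radial_C2[OF F1 F2 F3])
  qed (use z0 out in \<open>simp_all add: k_def\<close>)
  have km: "k \<in> borel_measurable borel" using cc_fun_measurable[OF smooth_kernel.cc_k[OF sk]] .
  have kg: "k z = (ct z * gauss_density ((1 / sqrt t) *\<^sub>R z)) / (sqrt t ^ DIM('a) * \<mu>)" for z
  proof -
    have "\<alpha> * (z \<bullet> z) = - (norm ((1 / sqrt t) *\<^sub>R z))\<^sup>2 / 2"
      using t by (simp add: \<alpha>_def power_mult_distrib power_divide power2_norm_eq_inner)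
    then show ?thesis unfolding k_def f_def C_def gauss_density_exp ct_def cutoff_def by (simp add: mult_ac)
  qed
  have int: "(\<integral>z. h z * k z \<partial>lborel) = (\<integral>y. h (sqrt t *\<^sub>R y) * ct (sqrt t *\<^sub>R y) \<partial>gauss) / \<mu>"
    if [measurable]: "h \<in> borel_measurable borel" for h :: "'a \<Rightarrow> real"
  proof -
    have "(\<integral>z. h z * k z \<partial>lborel) = (\<integral>z. (h z * ct z) * gauss_density ((1 / sqrt t) *\<^sub>R z) / (sqrt t ^ DIM('a) * \<mu>) \<partial>lborel)"
      by (simp add: kg mult_ac)
    also have "\<dots> = (\<integral>z. (h z * ct z) * gauss_density ((1 / sqrt t) *\<^sub>R z) \<partial>lborel) / (sqrt t ^ DIM('a) * \<mu>)"
      by (rule integral_divide_zero)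
    finally show ?thesis using t by (subst (asm) gauss_scaled_integral) simp_all
  qed
  have one: "(\<integral>z. k z \<partial>lborel) = 1" using int[of "\<lambda>_. 1"] mu0 by (simp add: \<mu>_def[symmetric])
  have cmp: "heat uminus t p x \<le> conv p k x + M * (3 * t * DIM('a) / r\<^sup>2)"
    if p: "bdd_borel M p" "\<forall>x. p x \<ge> 0" for M p x
  proof -
    note [measurable] = bdd_borelD(1)[OF p(1)]
    have ip: "integrable gauss (\<lambda>y. p (x - sqrt t *\<^sub>R y))"
      by (rule G.integrable_const_bound[of _ M]) (use bdd_borelD(2)[OF p(1)] in auto)
    have ipc: "integrable gauss (\<lambda>y. p (x - sqrt t *\<^sub>R y) * ct (sqrt t *\<^sub>R y))"
    proof (rule G.integrable_const_bound[of _ M])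
      have "\<bar>p u * ct v\<bar> \<le> M * 1" for u v
        unfolding abs_mult using bdd_borelD(2)[OF p(1)] chib bdd_borel_nonneg[OF p(1)] by (intro mult_mono) auto
      then show "AE y in gauss. norm (p (x - sqrt t *\<^sub>R y) * ct (sqrt t *\<^sub>R y)) \<le> M" by simp
    qed measurable
    have M: "M \<ge> 0" by (rule bdd_borel_nonneg[OF p(1)])
    have "heat uminus t p x = (\<integral>y. p (x - sqrt t *\<^sub>R y) * ct (sqrt t *\<^sub>R y) \<partial>gauss) + (\<integral>y. p (x - sqrt t *\<^sub>R y) - p (x - sqrt t *\<^sub>R y) * ct (sqrt t *\<^sub>R y) \<partial>gauss)"
      using ip ipc by (simp add: heat_def)
    also have "(\<integral>y. p (x - sqrt t *\<^sub>R y) - p (x - sqrt t *\<^sub>R y) * ct (sqrt t *\<^sub>R y) \<partial>gauss) \<le> (\<integral>(y::'a). M * ((3 * t / r\<^sup>2) * (norm y)\<^sup>2) \<partial>gauss)"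
    proof (rule integral_mono)
      fix y :: 'a
      have "p (x - sqrt t *\<^sub>R y) - p (x - sqrt t *\<^sub>R y) * ct (sqrt t *\<^sub>R y) = p (x - sqrt t *\<^sub>R y) * (1 - ct (sqrt t *\<^sub>R y))"
        by (simp add: algebra_simps)
      also have "\<dots> \<le> M * ((3 * t / r\<^sup>2) * (norm y)\<^sup>2)"
        using bdd_borelD(2)[OF p(1), of "x - sqrt t *\<^sub>R y"] p(2) chib low[of y] M by (intro mult_mono) auto
      finally show "p (x - sqrt t *\<^sub>R y) - p (x - sqrt t *\<^sub>R y) * ct (sqrt t *\<^sub>R y) \<le> M * ((3 * t / r\<^sup>2) * (norm y)\<^sup>2)" .
    qed (use ip ipc gauss_norm_moments in auto)
    also have "(\<integral>(y::'a). M * ((3 * t / r\<^sup>2) * (norm y)\<^sup>2) \<partial>gauss) = M * (3 * t * DIM('a) / r\<^sup>2)"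
      by (simp add: gauss_norm_moments)
    also have "(\<integral>y. p (x - sqrt t *\<^sub>R y) * ct (sqrt t *\<^sub>R y) \<partial>gauss) \<le> conv p k x"
    proof -
      let ?I = "\<integral>y. p (x - sqrt t *\<^sub>R y) * ct (sqrt t *\<^sub>R y) \<partial>gauss"
      have "?I \<ge> 0" using p(2) chib by (intro Bochner_Integration.integral_nonneg) auto
      then have "?I \<le> ?I / \<mu>" using mu0 mu1 by (simp add: pos_le_divide_eq mult_left_le)
      also have "\<dots> = conv p k x" unfolding conv_alt[OF bdd_borelD(1)[OF p(1)] km] by (subst int) simp_all
      finally show ?thesis .
    qed
    finally show ?thesis by simp
  qed
  have "k z \<ge> 0" "k (- z) = k z" for z using C by (simp_all add: k_def f_def)
  then show ?thesis using sk one cmp by blast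
qed

section \<open>Linear viscosity subsolutions and the heat flow\<close>

text \<open>
  The second-order operator that generates \<open>heat B\<close>, up to the factor \<open>1/2\<close>: the trace of the bilinear
  form pulled back by \<open>B\<close>. For \<open>B = uminus\<close> it is the Laplacian.
\<close>

definition trace_along :: "('a::euclidean_space \<Rightarrow> 'a) \<Rightarrow> ('a \<Rightarrow>\<^sub>L 'a \<Rightarrow>\<^sub>L real) \<Rightarrow> real" where
  "trace_along B A = (\<Sum>b\<in>Basis. A (B b) (B b))"

lemma gauss_linear:
  fixes B :: "'a::euclidean_space \<Rightarrow> 'a" and l :: "'a \<Rightarrow>\<^sub>L real"
  assumes B: "bounded_linear B"
  shows "integrable gauss (\<lambda>y. l (B y))" "(\<integral>y. l (B y) \<partial>gauss) = 0"
proof -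
  interpret B: bounded_linear B by (rule B)
  have eq: "l (B y) = (\<Sum>b\<in>Basis. (y \<bullet> b) * l (B b))" for y
  proof -
    have "l (B y) = l (B (\<Sum>b\<in>Basis. (y \<bullet> b) *\<^sub>R b))" by (simp only: euclidean_representation)
    then show ?thesis by (simp only: B.sum B.scaleR blinfun.sum_right blinfun.scaleR_right real_scaleR_def)
  qed
  have eqf: "(\<lambda>y. l (B y)) = (\<lambda>y. \<Sum>b\<in>Basis. (y \<bullet> b) * l (B b))" by (rule ext) (rule eq)
  show "integrable gauss (\<lambda>y. l (B y))" unfolding eqf
    by (intro Bochner_Integration.integrable_sum integrable_mult_left gauss_first_moment)
  show "(\<integral>y. l (B y) \<partial>gauss) = 0" unfolding eqf
    by (subst Bochner_Integration.integral_sum) (auto simp: gauss_first_moment)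
qed

lemma gauss_quadratic:
  fixes B :: "'a::euclidean_space \<Rightarrow> 'a" and A :: "'a \<Rightarrow>\<^sub>L 'a \<Rightarrow>\<^sub>L real"
  assumes B: "bounded_linear B"
  shows "integrable gauss (\<lambda>y. A (B y) (B y))" "(\<integral>y. A (B y) (B y) \<partial>gauss) = trace_along B A"
proof -
  interpret B: bounded_linear B by (rule B)
  have eq: "A (B y) (B y) = (\<Sum>b\<in>Basis. \<Sum>c\<in>Basis. ((y \<bullet> b) * (y \<bullet> c)) * A (B b) (B c))" for y
  proof -
    have "A (B y) (B y) = A (B (\<Sum>b\<in>Basis. (y \<bullet> b) *\<^sub>R b)) (B (\<Sum>b\<in>Basis. (y \<bullet> b) *\<^sub>R b))" by (simp only: euclidean_representation)
    also have "\<dots> = (\<Sum>b\<in>Basis. \<Sum>c\<in>Basis. (y \<bullet> b) * ((y \<bullet> c) * A (B b) (B c)))"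
      by (simp only: B.sum B.scaleR blinfun.sum_right blinfun.sum_left blinfun.scaleR_right blinfun.scaleR_left real_scaleR_def)
        (subst sum.swap, intro sum.cong refl, simp add: algebra_simps sum_distrib_left)
    finally show ?thesis by (simp add: mult.assoc)
  qed
  have i: "integrable gauss (\<lambda>y::'a. (y \<bullet> b) * (y \<bullet> c))" if "b \<in> Basis" "c \<in> Basis" for b c
    using gauss_product_moment(1)[OF that, of 1 1] by simp
  have eqf: "(\<lambda>y. A (B y) (B y)) = (\<lambda>y. \<Sum>b\<in>Basis. \<Sum>c\<in>Basis. ((y \<bullet> b) * (y \<bullet> c)) * A (B b) (B c))" by (rule ext) (rule eq)
  show "integrable gauss (\<lambda>y. A (B y) (B y))" unfolding eqf
    by (intro Bochner_Integration.integrable_sum integrable_mult_left i)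
  have "(\<integral>y. A (B y) (B y) \<partial>gauss) = (\<Sum>b\<in>Basis. \<Sum>c\<in>Basis. (\<integral>y. (y \<bullet> b) * (y \<bullet> c) \<partial>gauss) * A (B b) (B c))"
  proof -
    have "(\<integral>y. A (B y) (B y) \<partial>gauss) = (\<Sum>b\<in>Basis. \<integral>y. (\<Sum>c\<in>Basis. ((y \<bullet> b) * (y \<bullet> c)) * A (B b) (B c)) \<partial>gauss)"
      unfolding eqf by (rule Bochner_Integration.integral_sum) (intro Bochner_Integration.integrable_sum integrable_mult_left i)
    also have "\<dots> = (\<Sum>b\<in>Basis. \<Sum>c\<in>Basis. \<integral>y. ((y \<bullet> b) * (y \<bullet> c)) * A (B b) (B c) \<partial>gauss)"
      by (intro sum.cong refl Bochner_Integration.integral_sum integrable_mult_left i)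
    finally show ?thesis by simp
  qed
  also have "\<dots> = (\<Sum>b\<in>Basis. \<Sum>c\<in>Basis. if b = c then A (B b) (B c) else 0)"
    by (intro sum.cong refl) (simp add: gauss_product_moment(2))
  also have "\<dots> = trace_along B A" unfolding trace_along_def by (intro sum.cong refl) simp
  finally show "(\<integral>y. A (B y) (B y) \<partial>gauss) = trace_along B A" .
qed

context smooth_kernel
begin

definition vol :: real where "vol = 2 * measure lborel (cball (0::'a) r)"

lemma vol_nonneg: "vol \<ge> 0" by (simp add: vol_def)

lemma conv2_modulus:
  assumes W: "bdd_borel M W" and m: "\<And>z w. norm (k'' z - k'' w) \<le> \<epsilon> + K * (dist z w)\<^sup>2"
  shows "\<bar>conv2 W k'' x h h - conv2 W k'' y h h\<bar> \<le> M * vol * ((\<epsilon> + K * (dist x y)\<^sup>2) * (norm h)\<^sup>2)"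
proof -
  have "\<bar>conv W (\<lambda>z. k'' z h h) x - conv W (\<lambda>z. k'' z h h) y\<bar>
     \<le> M * ((\<epsilon> + K * (dist x y)\<^sup>2) * (norm h)\<^sup>2) * (2 * measure lborel (cball (0::'a) r))"
  proof (rule conv_diff_bound[OF W cc_k2])
    fix u
    have "\<bar>k'' (x - u) h h - k'' (y - u) h h\<bar> = norm ((k'' (x - u) - k'' (y - u)) h h)" by (simp add: blinfun.diff_left)
    also have "\<dots> \<le> norm ((k'' (x - u) - k'' (y - u)) h) * norm h" by (rule norm_blinfun)
    also have "\<dots> \<le> (norm (k'' (x - u) - k'' (y - u)) * norm h) * norm h" by (intro mult_right_mono norm_blinfun) simp
    also have "\<dots> = norm (k'' (x - u) - k'' (y - u)) * (norm h)\<^sup>2" by (simp add: power2_eq_square)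
    also have "\<dots> \<le> (\<epsilon> + K * (dist x y)\<^sup>2) * (norm h)\<^sup>2" using m[of "x - u" "y - u"] by (intro mult_right_mono) (auto simp: dist_norm)
    finally show "\<bar>k'' (x - u) h h - k'' (y - u) h h\<bar> \<le> (\<epsilon> + K * (dist x y)\<^sup>2) * (norm h)\<^sup>2" .
  qed
  then show ?thesis unfolding conv2_apply[OF W] vol_def by (simp add: mult_ac)
qed

text \<open>
  The remainder is controlled by \<open>M\<close> and the kernel alone, uniformly over all \<open>W\<close> bounded by \<open>M\<close>.
  This uniformity is what allows many small time steps with the same step size.
\<close>

lemma conv_taylor:
  assumes W: "bdd_borel M W" and m: "\<And>z w. norm (k'' z - k'' w) \<le> \<epsilon> + K * (dist z w)\<^sup>2" and eK: "\<epsilon> > 0" "K \<ge> 0"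
  shows "\<bar>conv W k (x + h) - conv W k x - conv1 W k' x h - conv2 W k'' x h h / 2\<bar> \<le> M * vol * ((\<epsilon> + K * (norm h)\<^sup>2) * (norm h)\<^sup>2)"
proof -
  have M: "M \<ge> 0" by (rule bdd_borel_nonneg[OF W])
  have C2: "(conv W k has_derivative blinfun_apply (conv1 W k' z)) (at z)" "(conv1 W k' has_derivative blinfun_apply (conv2 W k'' z)) (at z)" for z
    using conv_C2[OF W] by (auto simp: C2_on_def)
  define d where "d m t = (if m = 0 then conv W k (x + t *\<^sub>R h) else if m = 1 then conv1 W k' (x + t *\<^sub>R h) h
     else conv2 W k'' (x + t *\<^sub>R h) h h)" for m :: nat and t :: real
  have "DERIV (d m) t :> d (Suc m) t" if "m < 2" for m t
  proof -
    have "m = 0 \<or> m = 1" using that by auto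
    then show ?thesis
    proof
      assume "m = 0"
      then show ?thesis unfolding d_def has_real_derivative_iff_has_vector_derivative using line_derivative[of "conv W k" "conv1 W k'" x t h, OF C2(1)] by simp
    next
      assume "m = 1"
      then show ?thesis unfolding d_def has_real_derivative_iff_has_vector_derivative
        using blinfun_apply_derivative[OF line_derivative[of "conv1 W k'" "conv2 W k''" x t h, OF C2(2)], of h] by simp
    qed
  qed
  then obtain t where t: "0 < t" "t < 1" "d 0 1 = (\<Sum>m<2. (d m 0 / fact m) * 1 ^ m) + (d 2 t / fact 2) * 1 ^ 2"
    using Maclaurin[of 1 2 d "d 0"] by auto
  have e: "conv W k (x + h) - conv W k x - conv1 W k' x h - conv2 W k'' x h h / 2
      = (conv2 W k'' (x + t *\<^sub>R h) h h - conv2 W k'' x h h) / 2"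
    using t(3) by (simp add: d_def numeral_2_eq_2 field_simps)
  have "\<bar>conv2 W k'' (x + t *\<^sub>R h) h h - conv2 W k'' x h h\<bar> \<le> M * vol * ((\<epsilon> + K * (dist (x + t *\<^sub>R h) x)\<^sup>2) * (norm h)\<^sup>2)"
    by (rule conv2_modulus[OF W m])
  also have "\<dots> \<le> M * vol * ((\<epsilon> + K * (norm h)\<^sup>2) * (norm h)\<^sup>2)"
  proof -
    have "dist (x + t *\<^sub>R h) x \<le> norm h" using t by (simp add: dist_norm mult_left_le_one_le)
    then show ?thesis using M vol_nonneg eK by (intro mult_left_mono mult_right_mono add_left_mono power_mono) auto
  qed
  finally have b: "\<bar>conv2 W k'' (x + t *\<^sub>R h) h h - conv2 W k'' x h h\<bar> \<le> M * vol * ((\<epsilon> + K * (norm h)\<^sup>2) * (norm h)\<^sup>2)" .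
  have "\<bar>(conv2 W k'' (x + t *\<^sub>R h) h h - conv2 W k'' x h h) / 2\<bar> \<le> \<bar>conv2 W k'' (x + t *\<^sub>R h) h h - conv2 W k'' x h h\<bar>" by simp
  then show ?thesis using b unfolding e by linarith
qed

text \<open>
  The generator of the semigroup on mollified functions: the linear Taylor term integrates to zero and
  the quadratic one to \<open>trace_along\<close>. The step size \<open>s0\<close> depends only on the bound \<open>M\<close>, which the
  evolution preserves.
\<close>

lemma heat_expansion:
  assumes B: "bounded_linear B" and M: "M \<ge> 0" and e: "e > 0"
  shows "\<exists>s0>0. \<forall>s W x. 0 < s \<longrightarrow> s \<le> s0 \<longrightarrow> bdd_borel M W \<longrightarrow>
     \<bar>heat B s (conv W k) x - conv W k x - (s/2) * trace_along B (conv2 W k'' x)\<bar> \<le> s * e \<and>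
     \<bar>trace_along B (conv2 (heat B s W) k'' x) - trace_along B (conv2 W k'' x)\<bar> \<le> e"
proof -
  interpret G: prob_space "gauss :: 'a measure" by (rule prob_space_gauss)
  interpret B: bounded_linear B by (rule B)
  obtain \<beta> where \<beta>: "\<beta> \<ge> 0" "\<And>y. norm (B y) \<le> norm y * \<beta>" using B.nonneg_bounded by blast
  define n where "n = real (DIM('a))"
  have n: "n \<ge> 1" by (simp add: n_def Suc_leI)
  define m4 where "m4 = (\<integral>(y::'a). norm y ^ 4 \<partial>gauss)"
  have m4: "m4 \<ge> 0" unfolding m4_def by (intro Bochner_Integration.integral_nonneg) simp
  define C where "C = M * vol"
  have C: "C \<ge> 0" using M vol_nonneg by (simp add: C_def)
  define a where "a = C * \<beta>\<^sup>2 * n"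
  have a: "a \<ge> 0" using C n by (simp add: a_def)
  define \<epsilon> where "\<epsilon> = e / (2 * (a + 1))"
  have \<epsilon>: "\<epsilon> > 0" "a * \<epsilon> \<le> e / 2" using a e by (auto simp: \<epsilon>_def field_simps)
  obtain K where K: "K \<ge> 0" "\<And>z w. norm (k'' z - k'' w) \<le> \<epsilon> + K * (dist z w)\<^sup>2" using kernel_modulus[OF \<epsilon>(1)] by blast
  define b where "b = C * K * \<beta> ^ 4 * (m4 + n\<^sup>2)"
  have b: "b \<ge> 0" using C K(1) \<beta>(1) m4 by (simp add: b_def)
  define s0 where "s0 = e / (2 * (b + 1))"
  have s0: "s0 > 0" "b * s0 \<le> e / 2" using b e by (auto simp: s0_def field_simps)
  have main: "\<bar>heat B s (conv W k) x - conv W k x - (s/2) * trace_along B (conv2 W k'' x)\<bar> \<le> s * e \<and>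
     \<bar>trace_along B (conv2 (heat B s W) k'' x) - trace_along B (conv2 W k'' x)\<bar> \<le> e"
    if s: "0 < s" "s \<le> s0" and W: "bdd_borel M W" for s W x
  proof
    obtain M' where M': "bdd_borel M' (conv W k)" using conv_bdd[OF W cc_k] by blast
    let ?G = "conv W k"
    let ?D = "conv2 W k'' x"
    let ?h = "\<lambda>y. sqrt s *\<^sub>R B y"
    have ss: "sqrt s * (sqrt s * w) = s * w" for w using s by (simp add: mult.assoc[symmetric])
    have nh: "(norm (?h y))\<^sup>2 \<le> s * \<beta>\<^sup>2 * (norm y)\<^sup>2" for y
    proof -
      have "(norm (?h y))\<^sup>2 = s * (norm (B y))\<^sup>2" using s by (simp add: power_mult_distrib)
      also have "\<dots> \<le> s * (norm y * \<beta>)\<^sup>2" using s \<beta> by (intro mult_left_mono power_mono) auto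
      finally show ?thesis by (simp add: power_mult_distrib mult_ac)
    qed
    define T where "T y = ?G (x + ?h y) - ?G x - conv1 W k' x (?h y) - ?D (?h y) (?h y) / 2" for y
    have T: "T y = ?G (x + ?h y) - ?G x - sqrt s * conv1 W k' x (B y) - (s/2) * ?D (B y) (B y)" for y
      unfolding T_def by (simp add: blinfun.scaleR_right blinfun.scaleR_left ss)
    note ints = heat_integrable[OF B M', of x s] gauss_linear(1)[OF B, of "conv1 W k' x"] gauss_quadratic(1)[OF B, of "?D"]
    have iT: "integrable gauss T" unfolding T[abs_def] using ints by simp
    have "(\<integral>y. T y \<partial>gauss) = heat B s ?G x - ?G x - (s/2) * trace_along B ?D"
      unfolding T[abs_def] heat_def using ints gauss_linear(2)[OF B, of "conv1 W k' x"] gauss_quadratic(2)[OF B, of "?D"]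
      by (simp add: G.prob_space[simplified])
    then have "\<bar>heat B s ?G x - ?G x - (s/2) * trace_along B ?D\<bar> = \<bar>\<integral>y. T y \<partial>gauss\<bar>" by simp
    also have "\<dots> \<le> (\<integral>y. \<bar>T y\<bar> \<partial>gauss)" by (rule integral_abs_bound)
    also have "\<dots> \<le> (\<integral>(y::'a). C * (\<epsilon> * s * \<beta>\<^sup>2) * (norm y)\<^sup>2 + C * (K * s\<^sup>2 * \<beta> ^ 4) * (norm y) ^ 4 \<partial>gauss)"
    proof (intro integral_mono integrable_abs iT)
      fix y :: 'a
      define u where "u = (norm (?h y))\<^sup>2"
      define U where "U = s * \<beta>\<^sup>2 * (norm y)\<^sup>2"
      have u: "0 \<le> u" "u \<le> U" using nh by (auto simp: u_def U_def)
      have "\<bar>T y\<bar> \<le> C * ((\<epsilon> + K * u) * u)"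
        unfolding T_def C_def u_def by (rule conv_taylor[OF W K(2) \<epsilon>(1) K(1)])
      also have "\<dots> \<le> C * ((\<epsilon> + K * U) * U)"
        using C \<epsilon> K u by (intro mult_left_mono mult_mono add_mono) auto
      also have "\<dots> = C * (\<epsilon> * s * \<beta>\<^sup>2) * (norm y)\<^sup>2 + C * (K * s\<^sup>2 * \<beta> ^ 4) * (norm y) ^ 4"
        by (simp add: U_def algebra_simps power2_eq_square power4_eq_xxxx)
      finally show "\<bar>T y\<bar> \<le> C * (\<epsilon> * s * \<beta>\<^sup>2) * (norm y)\<^sup>2 + C * (K * s\<^sup>2 * \<beta> ^ 4) * (norm y) ^ 4" .
    qed (use gauss_norm_moments in auto)
    also have "\<dots> = C * (\<epsilon> * s * \<beta>\<^sup>2) * n + C * (K * s\<^sup>2 * \<beta> ^ 4) * m4"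
      using gauss_norm_moments[where 'a = 'a] by (simp add: n_def m4_def)
    also have "\<dots> \<le> s * e"
    proof -
      have "C * (\<epsilon> * s * \<beta>\<^sup>2) * n + C * (K * s\<^sup>2 * \<beta> ^ 4) * m4 = s * (a * \<epsilon>) + s * (s * (C * K * \<beta> ^ 4 * m4))"
        by (simp add: a_def algebra_simps power2_eq_square)
      also have "\<dots> \<le> s * (e / 2) + s * (s0 * b)"
      proof (intro add_mono mult_left_mono \<epsilon>(2) mult_mono)
        show "C * K * \<beta> ^ 4 * m4 \<le> b" unfolding b_def using C K \<beta> by (intro mult_left_mono) auto
      qed (use s C K \<beta> m4 s0 in auto)
      also have "\<dots> \<le> s * (e / 2) + s * (e / 2)" using s s0 by (intro add_mono mult_left_mono) (auto simp: mult.commute)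
      finally show ?thesis by (simp add: algebra_simps)
    qed
    finally show "\<bar>heat B s (conv W k) x - conv W k x - (s/2) * trace_along B (conv2 W k'' x)\<bar> \<le> s * e" .
    have Wh: "bdd_borel M (heat B s W)" by (rule heat_bdd[OF B W])
    have each: "\<bar>conv2 (heat B s W) k'' x (B d) (B d) - conv2 W k'' x (B d) (B d)\<bar> \<le> C * \<beta>\<^sup>2 * (\<epsilon> + K * (s * \<beta>\<^sup>2) * n)"
      if d: "d \<in> Basis" for d
    proof -
      let ?Q = "\<lambda>y. conv2 W k'' y (B d) (B d)"
      have Qeq: "?Q = conv W (\<lambda>z. k'' z (B d) (B d))" by (rule ext) (rule conv2_apply[OF W])
      obtain M2 where M2: "bdd_borel M2 ?Q" unfolding Qeq using conv_bdd[OF W cc_k2] by blast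
      have "conv2 (heat B s W) k'' x (B d) (B d) = heat B s ?Q x"
        unfolding conv2_apply[OF Wh] Qeq by (rule heat_conv[OF B W cc_k2, symmetric])
      then have "\<bar>conv2 (heat B s W) k'' x (B d) (B d) - ?Q x\<bar> = \<bar>\<integral>y. ?Q (x + ?h y) - ?Q x \<partial>gauss\<bar>"
        unfolding heat_def using heat_integrable[OF B M2, of x s] by (simp add: G.prob_space[simplified])
      also have "\<dots> \<le> (\<integral>y. \<bar>?Q (x + ?h y) - ?Q x\<bar> \<partial>gauss)" by (rule integral_abs_bound)
      also have "\<dots> \<le> (\<integral>(y::'a). C * \<beta>\<^sup>2 * \<epsilon> + C * \<beta>\<^sup>2 * K * (s * \<beta>\<^sup>2) * (norm y)\<^sup>2 \<partial>gauss)"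
      proof (intro integral_mono integrable_abs)
        fix y :: 'a
        have nd: "norm (B d) \<le> \<beta>" using \<beta>(2)[of d] d by simp
        have "\<bar>?Q (x + ?h y) - ?Q x\<bar> \<le> C * ((\<epsilon> + K * (dist (x + ?h y) x)\<^sup>2) * (norm (B d))\<^sup>2)"
          unfolding C_def by (rule conv2_modulus[OF W K(2)])
        also have "\<dots> \<le> C * ((\<epsilon> + K * (s * \<beta>\<^sup>2 * (norm y)\<^sup>2)) * \<beta>\<^sup>2)"
          using C \<epsilon> K nh[of y] nd \<beta> s by (intro mult_left_mono mult_mono add_mono power_mono) (auto simp: dist_norm)
        also have "\<dots> = C * \<beta>\<^sup>2 * \<epsilon> + C * \<beta>\<^sup>2 * K * (s * \<beta>\<^sup>2) * (norm y)\<^sup>2" by (simp add: algebra_simps)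
        finally show "\<bar>?Q (x + ?h y) - ?Q x\<bar> \<le> C * \<beta>\<^sup>2 * \<epsilon> + C * \<beta>\<^sup>2 * K * (s * \<beta>\<^sup>2) * (norm y)\<^sup>2" .
      qed (use gauss_norm_moments heat_integrable[OF B M2, of x s] in auto)
      also have "\<dots> = C * \<beta>\<^sup>2 * (\<epsilon> + K * (s * \<beta>\<^sup>2) * n)"
        using gauss_norm_moments[where 'a = 'a] by (simp add: n_def G.prob_space[simplified] algebra_simps)
      finally show ?thesis .
    qed
    have "\<bar>trace_along B (conv2 (heat B s W) k'' x) - trace_along B (conv2 W k'' x)\<bar> \<le> (\<Sum>d\<in>(Basis::'a set). C * \<beta>\<^sup>2 * (\<epsilon> + K * (s * \<beta>\<^sup>2) * n))"
      unfolding trace_along_def sum_subtractf[symmetric] by (rule order_trans[OF sum_abs]) (rule sum_mono[OF each])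
    also have "\<dots> = a * \<epsilon> + s * (C * K * \<beta> ^ 4 * n\<^sup>2)"
      by (simp add: n_def[symmetric] a_def algebra_simps power2_eq_square power4_eq_xxxx)
    also have "\<dots> \<le> e / 2 + s0 * b"
    proof (intro add_mono \<epsilon>(2) mult_mono)
      show "C * K * \<beta> ^ 4 * n\<^sup>2 \<le> b" unfolding b_def using C K \<beta> m4 by (intro mult_left_mono) auto
    qed (use s C K \<beta> s0 in auto)
    also have "\<dots> \<le> e" using s0(2) by (simp add: mult.commute)
    finally show "\<bar>trace_along B (conv2 (heat B s W) k'' x) - trace_along B (conv2 W k'' x)\<bar> \<le> e" .
  qed
  show ?thesis
    by (rule exI[of _ s0]) (use s0(1) main in blast)
qed

end

text \<open>
  Viscosity subsolutions of \<open>trace_along B (q'') = - 2 c\<close>; the factor 2 matches the generator.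
\<close>

definition linear_subsol :: "('a::euclidean_space \<Rightarrow> 'a) \<Rightarrow> real \<Rightarrow> ('a \<Rightarrow> real) \<Rightarrow> bool" where
  "linear_subsol B c p \<longleftrightarrow> (\<forall>x N q q' q''. x \<in> N \<longrightarrow> C2_on N q q' q'' \<longrightarrow> q x = p x \<longrightarrow>
     (\<forall>\<^sub>F y in nhds x. p y \<le> q y) \<longrightarrow> trace_along B (q'' x) \<ge> - 2 * c)"

definition usc_real :: "('a::topological_space \<Rightarrow> real) \<Rightarrow> bool" where
  "usc_real p \<longleftrightarrow> (\<forall>x c. p x < c \<longrightarrow> (\<forall>\<^sub>F y in nhds x. p y < c))"

lemma usc_real_borel: "usc_real p \<Longrightarrow> p \<in> borel_measurable borel"
proof -
  assume u: "usc_real p"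
  have "open {x. p x < c}" for c
  proof (subst open_subopen, intro ballI)
    fix x assume "x \<in> {x. p x < c}"
    then have "\<forall>\<^sub>F y in nhds x. p y < c" using u by (simp add: usc_real_def)
    then obtain S where "open S" "x \<in> S" "\<forall>y\<in>S. p y < c" unfolding eventually_nhds by blast
    then show "\<exists>T. open T \<and> x \<in> T \<and> T \<subseteq> {x. p x < c}" by (intro exI[of _ S]) auto
  qed
  then show ?thesis unfolding borel_measurable_iff_less by simp
qed

text \<open>
  One explicit time step of a monotone scheme. At a maximum of \<open>p\<close> minus the smooth evolved function,
  the latter is a test function, so its generator is bounded below there; by the expansion the
  evolved function has then dropped by at most \<open>s (c + 2 \<epsilon>)\<close> below the previous one. The compact
  support of \<open>p\<close> and the nonnegativity of \<open>W\<close> make the maximum exist.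
\<close>

lemma (in smooth_kernel) heat_comparison_step:
  assumes B: "bounded_linear B" and k: "\<And>z. k z \<ge> 0"
    and W: "bdd_borel M W" "\<And>x. W x \<ge> 0"
    and p: "\<And>x. norm x \<ge> R \<Longrightarrow> p x = 0" "usc_real p" "linear_subsol B c p"
    and c: "c \<ge> 0" and e: "e \<ge> 0" and s: "s > 0"
    and ex: "\<And>x. \<bar>heat B s (conv W k) x - conv W k x - (s/2) * trace_along B (conv2 W k'' x)\<bar> \<le> s * \<epsilon>"
      "\<And>x. \<bar>trace_along B (conv2 (heat B s W) k'' x) - trace_along B (conv2 W k'' x)\<bar> \<le> \<epsilon>"
    and le: "\<And>x. p x \<le> conv W k x + e"
  shows "p x \<le> conv (heat B s W) k x + e + s * (c + 2 * \<epsilon>)"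
proof (rule ccontr)
  assume neg: "\<not> ?thesis"
  have \<epsilon>: "\<epsilon> \<ge> 0" using ex(2)[of 0] by linarith
  define H where "H = conv (heat B s W) k"
  have Wh: "bdd_borel M (heat B s W)" by (rule heat_bdd[OF B W(1)])
  have H0: "H y \<ge> 0" for y
    unfolding H_def conv_def heat_def using W(2) k by (intro Bochner_Integration.integral_nonneg mult_nonneg_nonneg) auto
  have C2: "C2_on UNIV H (conv1 (heat B s W) k') (conv2 (heat B s W) k'')"
    unfolding H_def by (rule conv_C2[OF Wh])
  have Hc: "continuous_on UNIV H" unfolding H_def by (rule conv_continuous[OF Wh cc_k])
  define d where "d y = p y - H y" for y
  have pos: "d x > e + s * (c + 2 * \<epsilon>)" using neg by (simp add: d_def H_def)
  have d0: "d x > 0" using pos e s c \<epsilon> by (smt (verit) mult_nonneg_nonneg)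
  have xin: "norm x < R"
  proof (rule ccontr)
    assume "\<not> norm x < R"
    then have "p x = 0" using p(1) by simp
    then show False using d0 H0[of x] by (simp add: d_def)
  qed
  have "\<exists>z\<in>cball 0 R. \<forall>y\<in>cball 0 R. d y \<le> d z"
  proof (rule usc_attains_max)
    show "cball 0 R \<noteq> ({} :: 'a set)" using xin by (metis mem_cball_0 empty_iff less_imp_le)
    fix z :: 'a and a assume "z \<in> cball 0 R" "d z < a"
    define \<delta> where "\<delta> = (a - d z) / 2"
    have \<delta>: "\<delta> > 0" using \<open>d z < a\<close> by (simp add: \<delta>_def)
    have "\<forall>\<^sub>F y in nhds z. p y < p z + \<delta>" using p(2) \<delta> by (simp add: usc_real_def)
    moreover have "isCont H z" using Hc by (simp add: continuous_on_eq_continuous_at)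
    then have "(H \<longlongrightarrow> H z) (nhds z)" unfolding isCont_def tendsto_at_iff_tendsto_nhds .
    then have "\<forall>\<^sub>F y in nhds z. H y > H z - \<delta>" using \<delta> by (intro order_tendstoD) auto
    ultimately have "\<forall>\<^sub>F y in nhds z. d y < a"
      by eventually_elim (simp add: d_def \<delta>_def field_simps)
    then show "\<exists>U. open U \<and> z \<in> U \<and> (\<forall>y\<in>U \<inter> cball 0 R. d y < a)" unfolding eventually_nhds by blast
  qed simp
  then obtain z where z: "\<And>y. y \<in> cball 0 R \<Longrightarrow> d y \<le> d z" by blast
  have dz: "d z \<ge> d x" using z[of x] xin by simp
  have all: "d y \<le> d z" for y
  proof (cases "norm y \<le> R")
    case True then show ?thesis using z by simp
  next
    case False
    then have "p y = 0" using p(1) by simp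
    then show ?thesis using H0[of y] dz d0 by (simp add: d_def)
  qed
  have "C2_on UNIV (\<lambda>y. H y + d z) (conv1 (heat B s W) k') (conv2 (heat B s W) k'')"
    using C2 unfolding C2_on_def by (auto intro!: derivative_eq_intros)
  moreover have "\<forall>\<^sub>F y in nhds z. p y \<le> H y + d z" using all by (simp add: d_def algebra_simps)
  moreover have "H z + d z = p z" by (simp add: d_def)
  ultimately have "trace_along B (conv2 (heat B s W) k'' z) \<ge> - 2 * c"
    using p(3) unfolding linear_subsol_def by blast
  then have "trace_along B (conv2 W k'' z) \<ge> - 2 * c - \<epsilon>" using ex(2)[of z] by linarith
  then have "(s/2) * trace_along B (conv2 W k'' z) \<ge> (s/2) * (- 2 * c - \<epsilon>)" using s by (intro mult_left_mono) auto
  then have "heat B s (conv W k) z \<ge> conv W k z + (s/2) * (- 2 * c - \<epsilon>) - s * \<epsilon>" using ex(1)[of z] by linarith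
  moreover have "heat B s (conv W k) z = H z" unfolding H_def by (rule heat_conv[OF B W(1) cc_k])
  moreover have "(s/2) * (- 2 * c - \<epsilon>) - s * \<epsilon> \<ge> - s * (c + 2 * \<epsilon>)" using s \<epsilon> by (simp add: algebra_simps)
  ultimately have "H z \<ge> p z - e - s * (c + 2 * \<epsilon>)" using le[of z] by linarith
  then show False using pos dz by (simp add: d_def)
qed

lemma (in smooth_kernel) heat_comparison:
  assumes B: "bounded_linear B" and k: "\<And>z. k z \<ge> 0"
    and W: "bdd_borel M W" "\<And>x. W x \<ge> 0"
    and p: "\<And>x. norm x \<ge> R \<Longrightarrow> p x = 0" "usc_real p" "linear_subsol B c p"
    and c: "c \<ge> 0" and le: "\<And>x. p x \<le> conv W k x" and t: "t > 0"
  shows "p x \<le> conv (heat B t W) k x + t * c"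
proof (rule field_le_epsilon)
  fix e :: real assume e: "e > 0"
  have M: "M \<ge> 0" by (rule bdd_borel_nonneg[OF W(1)])
  define \<epsilon> where "\<epsilon> = e / (2 * t)"
  have \<epsilon>: "\<epsilon> > 0" using e t by (simp add: \<epsilon>_def)
  obtain s0 where s0: "s0 > 0" and ex: "\<forall>s W x. 0 < s \<longrightarrow> s \<le> s0 \<longrightarrow> bdd_borel M W \<longrightarrow>
     \<bar>heat B s (conv W k) x - conv W k x - (s/2) * trace_along B (conv2 W k'' x)\<bar> \<le> s * \<epsilon> \<and>
     \<bar>trace_along B (conv2 (heat B s W) k'' x) - trace_along B (conv2 W k'' x)\<bar> \<le> \<epsilon>"
    using heat_expansion[OF B M \<epsilon>] by blast
  \<comment> \<open>The time \<open>t\<close> is cut into \<open>m\<close> equal steps of size at most \<open>s0\<close>; the errors add up to \<open>e\<close>.\<close>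
  obtain m where m: "real m > t / s0" using reals_Archimedean2 by blast
  have m0: "m > 0" using m t s0 by (metis divide_pos_pos gr0I less_asym of_nat_0)
  define s where "s = t / real m"
  have s: "s > 0" "s \<le> s0" using m m0 t s0 by (auto simp: s_def field_simps)
  have step: "\<forall>x. p x \<le> conv (heat B (real j * s) W) k x + real j * (s * (c + 2 * \<epsilon>))" for j
  proof (induction j)
    case 0
    have "heat B 0 W = W" by (rule ext) simp
    then show ?case using le by simp
  next
    case (Suc j)
    have Wj: "bdd_borel M (heat B (real j * s) W)" by (rule heat_bdd[OF B W(1)])
    have Wj0: "heat B (real j * s) W x \<ge> 0" for x
      unfolding heat_def using W(2) by (intro Bochner_Integration.integral_nonneg) auto
    have "heat B s (heat B (real j * s) W) = heat B (real (Suc j) * s) W"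
    proof (cases "j = 0")
      case True
      have "heat B 0 W = W" by (rule ext) simp
      then show ?thesis using True by simp
    next
      case False
      show ?thesis
        by (rule ext, subst heat_semigroup[OF B W(1)]) (use False s in \<open>auto simp: algebra_simps\<close>)
    qed
    moreover have "p x \<le> conv (heat B s (heat B (real j * s) W)) k x + real j * (s * (c + 2 * \<epsilon>)) + s * (c + 2 * \<epsilon>)" for x
    proof (rule heat_comparison_step[OF B k Wj Wj0 p c _ s(1)])
      show "0 \<le> real j * (s * (c + 2 * \<epsilon>))" using s c \<epsilon> by simp
    qed (use ex s Wj Suc in blast)+
    ultimately show ?case by (simp add: algebra_simps)
  qed
  have "real m * s = t" using m0 by (simp add: s_def)
  moreover have "real m * (s * (c + 2 * \<epsilon>)) = t * c + e"
  proof -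
    have "real m * (s * (c + 2 * \<epsilon>)) = (real m * s) * (c + 2 * \<epsilon>)" by (simp add: mult.assoc)
    also have "\<dots> = t * c + e" unfolding \<open>real m * s = t\<close> using t by (simp add: \<epsilon>_def algebra_simps)
    finally show ?thesis .
  qed
  ultimately show "p x \<le> conv (heat B t W) k x + t * c + e" using step[of m] by (simp add: add.assoc)
qed

text \<open>
  Sup-convolution with a cone of slope \<open>n\<close>, the least \<open>n\<close>-Lipschitz majorant.
\<close>

definition lip_env :: "real \<Rightarrow> ('a::metric_space \<Rightarrow> real) \<Rightarrow> 'a \<Rightarrow> real" where
  "lip_env n p x = (SUP y. p y - n * dist x y)"

context
  fixes p :: "'a::metric_space \<Rightarrow> real" and M n :: real
  assumes p: "\<And>x. 0 \<le> p x" "\<And>x. p x \<le> M" and n: "n \<ge> 0"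
begin

lemma lip_env_bdd: "bdd_above (range (\<lambda>y. p y - n * dist x y))"
proof (rule bdd_aboveI2)
  fix y show "p y - n * dist x y \<le> M" using p(2)[of y] n by (smt (verit) mult_nonneg_nonneg zero_le_dist)
qed

lemma lip_env_ge: "p y - n * dist x y \<le> lip_env n p x"
  unfolding lip_env_def by (rule cSUP_upper[OF _ lip_env_bdd]) simp

lemma lip_env_ge_self: "p x \<le> lip_env n p x"
  using lip_env_ge[of x x] by simp

lemma lip_env_least: "(\<And>y. p y - n * dist x y \<le> a) \<Longrightarrow> lip_env n p x \<le> a"
  unfolding lip_env_def by (rule cSUP_least) auto

lemma lip_env_le: "lip_env n p x \<le> M"
  by (rule lip_env_least) (use p(2) n in \<open>smt (verit) mult_nonneg_nonneg zero_le_dist\<close>)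

lemma lip_env_lipschitz: "\<bar>lip_env n p x - lip_env n p y\<bar> \<le> n * dist x y"
proof -
  have "lip_env n p x \<le> lip_env n p y + n * dist x y" for x y
  proof (rule lip_env_least)
    fix z
    have "n * dist y z \<le> n * dist x y + n * dist x z"
      using dist_triangle[of y z x] n by (metis add.commute dist_commute distrib_left mult_left_mono)
    then show "p z - n * dist x z \<le> lip_env n p y + n * dist x y" using lip_env_ge[of z y] by linarith
  qed
  from this[of x y] this[of y x] show ?thesis by (auto simp: dist_commute)
qed

end

lemma lip_env_tendsto:
  fixes p :: "'a::metric_space \<Rightarrow> real"
  assumes p: "\<And>x. 0 \<le> p x" "\<And>x. p x \<le> M" "usc_real p"
  shows "(\<lambda>n. lip_env (real n) p x) \<longlonglongrightarrow> p x"
proof (rule order_tendstoI)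
  fix a assume "a < p x"
  then have "a < lip_env (real n) p x" for n
    using lip_env_ge_self[of p M "real n" x, OF p(1,2)] by simp
  then show "\<forall>\<^sub>F n in sequentially. a < lip_env (real n) p x" by simp
next
  fix a assume a: "p x < a"
  obtain b where b: "p x < b" "b < a" using dense[OF a] by blast
  have "\<forall>\<^sub>F y in nhds x. p y < b" using p(3) b by (simp add: usc_real_def)
  then obtain d where d: "d > 0" "\<And>y. dist y x < d \<Longrightarrow> p y < b" unfolding eventually_nhds_metric by blast
  have b0: "b > 0" using b p(1)[of x] by linarith
  have "\<forall>\<^sub>F n in sequentially. real n \<ge> M / d" by (rule eventually_sequentiallyI[of "nat \<lceil>M / d\<rceil>"]) linarith
  then show "\<forall>\<^sub>F n in sequentially. lip_env (real n) p x < a"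
  proof eventually_elim
    fix n assume n: "real n \<ge> M / d"
    have "lip_env (real n) p x \<le> b"
    proof (rule lip_env_least[of p M, OF p(1,2)])
      fix y
      show "p y - real n * dist x y \<le> b"
      proof (cases "dist x y < d")
        case True
        then have "p y < b" using d(2)[of y] by (simp add: dist_commute)
        moreover have "real n * dist x y \<ge> 0" by simp
        ultimately show ?thesis by linarith
      next
        case False
        have "M \<le> real n * d" using n d(1) by (simp add: field_simps)
        also have "\<dots> \<le> real n * dist x y" using False by (intro mult_left_mono) auto
        finally show ?thesis using p(2)[of y] b0 by linarith
      qed
    qed simp
    then show "lip_env (real n) p x < a" using b by linarith
  qed
qed

text \<open>
  The comparison on smooth majorants extends to \<open>p\<close> itself: Lipschitz majorants of \<open>p\<close> are uniformly
  close to their mollifications, and they decrease to \<open>p\<close>, so dominated convergence applies.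
\<close>

lemma heat_subsolution:
  fixes p :: "'a::euclidean_space \<Rightarrow> real"
  assumes B: "bounded_linear B"
    and p: "\<And>x. 0 \<le> p x" "\<And>x. p x \<le> M" "\<And>x. norm x \<ge> R \<Longrightarrow> p x = 0" "usc_real p" "linear_subsol B c p"
    and c: "c \<ge> 0" and t: "t > 0"
  shows "p x \<le> heat B t p x + t * c"
proof -
  interpret G: prob_space "gauss :: 'a measure" by (rule prob_space_gauss)
  note [measurable] = bounded_linear_measurable[OF B]
  have lip: "p x \<le> heat B t (lip_env (real n) p) x + t * c" for n
  proof (rule field_le_epsilon)
    fix e :: real assume e: "e > 0"
    define w where "w = lip_env (real n) p"
    have wl: "\<bar>w x - w y\<bar> \<le> real n * dist x y" for x y unfolding w_def by (rule lip_env_lipschitz[of p M, OF p(1,2)]) simp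
    have w0: "p x \<le> w x" "w x \<le> M" for x
      unfolding w_def using lip_env_ge_self[of p M "real n" x, OF p(1,2)] lip_env_le[of p M "real n" x, OF p(1,2)] by auto
    have w00: "w x \<ge> 0" for x using w0(1)[of x] p(1)[of x] by linarith
    have "continuous_on UNIV w"
    proof (rule lipschitz_on_continuous_on)
      show "(real n)-lipschitz_on UNIV w" by (rule lipschitz_onI) (use wl in \<open>auto simp: dist_real_def\<close>)
    qed
    then have wb: "w \<in> borel_measurable borel" by (rule borel_measurable_continuous_onI)
    have wbd: "bdd_borel M w" using wb w0 w00 by (auto simp: bdd_borel_def)
    define r where "r = e / (2 * (real n + 1))"
    have r: "r > 0" "2 * real n * r \<le> e" using e by (auto simp: r_def field_simps)
    define \<tau> where "\<tau> = r\<^sup>2 / (6 * DIM('a))"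
    have \<tau>: "\<tau> > 0" "3 * \<tau> * DIM('a) < r\<^sup>2" using r by (auto simp: \<tau>_def)
    obtain k :: "'a \<Rightarrow> real" and k' k'' where k: "smooth_kernel k k' k'' r" "\<And>z. k z \<ge> 0" "(\<integral>z. k z \<partial>lborel) = 1"
      using gaussian_kernel_exists[OF r(1) \<tau>] by blast
    interpret smooth_kernel k k' k'' r by (rule k(1))
    have ik: "integrable lborel k" using k(3) not_integrable_integral_eq by fastforce
    have near: "\<bar>conv w k x - w x\<bar> \<le> real n * r" for x
    proof -
      have "conv w k x - w x = (\<integral>z. w (x - z) * k z - w x * k z \<partial>lborel)"
        unfolding conv_alt[OF wb cc_fun_measurable[OF cc_k]]
        using conv_alt_integrable[OF wbd cc_k, of x] ik k(3) by simp
      also have "\<bar>\<dots>\<bar> \<le> (\<integral>z. \<bar>w (x - z) * k z - w x * k z\<bar> \<partial>lborel)" by (rule integral_abs_bound)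
      also have "\<dots> \<le> (\<integral>z. (real n * r) * k z \<partial>lborel)"
      proof (intro integral_mono integrable_abs)
        fix z
        show "\<bar>w (x - z) * k z - w x * k z\<bar> \<le> (real n * r) * k z"
        proof (cases "norm z < r")
          case True
          have "\<bar>w (x - z) * k z - w x * k z\<bar> = \<bar>w (x - z) - w x\<bar> * k z"
            using k(2)[of z] by (simp add: left_diff_distrib[symmetric] abs_mult)
          also have "\<dots> \<le> (real n * dist (x - z) x) * k z" by (intro mult_right_mono wl k)
          also have "\<dots> \<le> (real n * r) * k z" using True k(2) by (intro mult_right_mono mult_left_mono) (auto simp: dist_norm)
          finally show ?thesis .
        next
          case False
          then show ?thesis using supp(1)[of z] by simp
        qed
      qed (use conv_alt_integrable[OF wbd cc_k, of x] ik in auto)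
      finally show ?thesis using k(3) by simp
    qed
    \<comment> \<open>The shift by \<open>n r\<close> lifts the mollification above \<open>p\<close>.\<close>
    define W where "W y = w y + real n * r" for y
    have Wb: "bdd_borel (M + real n * r) W" "\<And>x. W x \<ge> 0"
    proof -
      have "W = (\<lambda>y. w y + real n * r)" by (rule ext) (simp add: W_def)
      moreover have "(\<lambda>y. w y + real n * r) \<in> borel_measurable borel" using wb by measurable
      ultimately have "W \<in> borel_measurable borel" by simp
      moreover have "\<bar>W x\<bar> \<le> M + real n * r" "W x \<ge> 0" for x
        using w0[of x] w00[of x] r by (auto simp: W_def)
      ultimately show "bdd_borel (M + real n * r) W" "\<And>x. W x \<ge> 0" by (auto simp: bdd_borel_def)
    qed
    have cW: "conv W k x = conv w k x + real n * r" for x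
      unfolding conv_alt[OF bdd_borelD(1)[OF Wb(1)] cc_fun_measurable[OF cc_k]] conv_alt[OF wb cc_fun_measurable[OF cc_k]] W_def
      using conv_alt_integrable[OF wbd cc_k, of x] ik k(3) by (simp add: distrib_right)
    have "p x \<le> conv (heat B t W) k x + t * c"
    proof (rule heat_comparison[OF B k(2) Wb p(3,4,5) c _ t])
      show "p x \<le> conv W k x" for x using near[of x] w0(1)[of x] by (simp add: cW)
    qed
    also have "conv (heat B t W) k x = heat B t (conv W k) x" by (rule heat_conv[OF B Wb(1) cc_k, symmetric])
    also have "\<dots> \<le> heat B t (\<lambda>x. w x + e) x"
    proof -
      obtain M1 where M1: "bdd_borel M1 (conv W k)" using conv_bdd[OF Wb(1) cc_k] by blast
      have M2: "bdd_borel (M + e) (\<lambda>x. w x + e)" using wb w0 w00 e by (auto simp: bdd_borel_def)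
      show ?thesis
      proof (rule heat_mono[OF B M1 M2])
        show "conv W k x \<le> w x + e" for x using near[of x] r(2) by (simp add: cW)
      qed
    qed
    also have "\<dots> = heat B t w x + e" by (rule heat_add_const[OF B wbd])
    finally show "p x \<le> heat B t (lip_env (real n) p) x + t * c + e" by (simp add: w_def)
  qed
  have "(\<lambda>n. heat B t (lip_env (real n) p) x) \<longlonglongrightarrow> heat B t p x"
    unfolding heat_def
  proof (rule integral_dominated_convergence[where w = "\<lambda>_. M"])
    have lm: "lip_env (real n) p \<in> borel_measurable borel" for n
    proof -
      have "(real n)-lipschitz_on UNIV (lip_env (real n) p)"
        by (rule lipschitz_onI) (use lip_env_lipschitz[of p M "real n", OF p(1,2)] in \<open>auto simp: dist_real_def\<close>)
      then show ?thesis by (intro borel_measurable_continuous_onI lipschitz_on_continuous_on)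
    qed
    note [measurable] = lm usc_real_borel[OF p(4)]
    show "(\<lambda>y. p (x + sqrt t *\<^sub>R B y)) \<in> borel_measurable gauss" by measurable
    show "(\<lambda>y. lip_env (real n) p (x + sqrt t *\<^sub>R B y)) \<in> borel_measurable gauss" for n by measurable
    show "AE y in gauss. (\<lambda>n. lip_env (real n) p (x + sqrt t *\<^sub>R B y)) \<longlonglongrightarrow> p (x + sqrt t *\<^sub>R B y)"
      using lip_env_tendsto[of p M, OF p(1,2,4)] by simp
    show "AE y in gauss. norm (lip_env (real n) p (x + sqrt t *\<^sub>R B y)) \<le> M" for n
    proof (rule AE_I2)
      fix y
      show "norm (lip_env (real n) p (x + sqrt t *\<^sub>R B y)) \<le> M"
        using lip_env_ge_self[of p M "real n" "x + sqrt t *\<^sub>R B y", OF p(1,2)] p(1)[of "x + sqrt t *\<^sub>R B y"]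
          lip_env_le[of p M "real n" "x + sqrt t *\<^sub>R B y", OF p(1,2)] by simp
    qed
  qed simp
  then have "(\<lambda>n. heat B t (lip_env (real n) p) x + t * c) \<longlonglongrightarrow> heat B t p x + t * c" by (intro tendsto_intros)
  then show ?thesis by (rule LIMSEQ_le_const) (use lip in auto)
qed

text \<open>
  Convolving \<open>p \<le> heat B s p + s c\<close> with the kernel and expanding the heat flow of the smooth function
  \<open>conv p k\<close> to first order in \<open>s\<close>.
\<close>

lemma (in smooth_kernel) mollified_subsolution:
  assumes B: "bounded_linear B" and k: "\<And>z. k z \<ge> 0" "(\<integral>z. k z \<partial>lborel) = 1"
    and p: "\<And>x. 0 \<le> p x" "\<And>x. p x \<le> M" "\<And>x. norm x \<ge> R \<Longrightarrow> p x = 0" "usc_real p" "linear_subsol B c p"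
    and c: "c \<ge> 0"
  shows "trace_along B (conv2 p k'' x) \<ge> - 2 * c"
proof (rule ccontr)
  assume neg: "\<not> ?thesis"
  define e where "e = (- 2 * c - trace_along B (conv2 p k'' x)) / 4"
  have e: "e > 0" using neg by (simp add: e_def)
  have pb: "bdd_borel M p" using usc_real_borel[OF p(4)] p by (auto simp: bdd_borel_def)
  have M: "M \<ge> 0" by (rule bdd_borel_nonneg[OF pb])
  have ik: "integrable lborel k" using k(2) not_integrable_integral_eq by fastforce
  obtain s where s: "s > 0" and ex: "\<bar>heat B s (conv p k) x - conv p k x - (s/2) * trace_along B (conv2 p k'' x)\<bar> \<le> s * e"
    using heat_expansion[OF B M e] pb by (metis order_refl)
  have hb: "bdd_borel M (heat B s p)" by (rule heat_bdd[OF B pb])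
  note cm = cc_fun_measurable[OF cc_k]
  have "conv p k x \<le> (\<integral>z. heat B s p (x - z) * k z + s * c * k z \<partial>lborel)"
    unfolding conv_alt[OF bdd_borelD(1)[OF pb] cm]
  proof (rule integral_mono)
    fix z
    have "p (x - z) * k z \<le> (heat B s p (x - z) + s * c) * k z"
      by (intro mult_right_mono heat_subsolution[OF B p c s] k)
    then show "p (x - z) * k z \<le> heat B s p (x - z) * k z + s * c * k z" by (simp add: distrib_right)
  qed (use conv_alt_integrable[OF pb cc_k, of x] conv_alt_integrable[OF hb cc_k, of x] ik in auto)
  also have "\<dots> = conv (heat B s p) k x + s * c"
    unfolding conv_alt[OF bdd_borelD(1)[OF hb] cm] using conv_alt_integrable[OF hb cc_k, of x] ik k(2) by simp
  also have "conv (heat B s p) k x = heat B s (conv p k) x" by (rule heat_conv[OF B pb cc_k, symmetric])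
  finally have "0 \<le> (s/2) * trace_along B (conv2 p k'' x) + s * e + s * c" using ex by linarith
  also have "\<dots> = s * (trace_along B (conv2 p k'' x) / 2 + e + c)" by (simp add: algebra_simps)
  finally have "trace_along B (conv2 p k'' x) / 2 + e + c \<ge> 0" using s by (simp add: zero_le_mult_iff)
  then show False using e by (simp add: e_def field_simps)
qed

section \<open>Mollification of viscosity subsolutions\<close>

lemma C2_on_add:
  assumes "C2_on N p p' p''" "C2_on N' q q' q''"
  shows "C2_on (N \<inter> N') (\<lambda>z. p z + q z) (\<lambda>z. p' z + q' z) (\<lambda>z. p'' z + q'' z)"
proof -
  have "((\<lambda>z. p z + q z) has_derivative blinfun_apply (p' z + q' z)) (at z)" if "z \<in> N \<inter> N'" for z
  proof -
    have "((\<lambda>z. p z + q z) has_derivative (\<lambda>h. p' z h + q' z h)) (at z)"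
      using assms that by (intro has_derivative_add) (auto simp: C2_on_def)
    then show ?thesis by (simp add: blinfun.add_left[abs_def])
  qed
  moreover have "((\<lambda>z. p' z + q' z) has_derivative blinfun_apply (p'' z + q'' z)) (at z)" if "z \<in> N \<inter> N'" for z
  proof -
    have "((\<lambda>z. p' z + q' z) has_derivative (\<lambda>h. p'' z h + q'' z h)) (at z)"
      using assms that by (intro has_derivative_add) (auto simp: C2_on_def)
    then show ?thesis by (simp add: blinfun.add_left[abs_def])
  qed
  ultimately show ?thesis using assms unfolding C2_on_def
    by (auto intro!: continuous_on_add intro: continuous_on_subset)
qed

lemma C2_quadratic:
  "C2_on UNIV (\<lambda>z::'a::euclidean_space. A * (norm (z - x0))\<^sup>2 + \<beta>) (\<lambda>z. (2 * A) *\<^sub>R blinfun_inner_right (z - x0)) (\<lambda>z. (2 * A) *\<^sub>R inner2)"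
  unfolding C2_on_def
proof (intro conjI ballI)
  fix z :: 'a
  have "((\<lambda>z. A * (norm (z - x0))\<^sup>2 + \<beta>) has_derivative (\<lambda>h. A * (2 * ((z - x0) \<bullet> h)))) (at z)"
    unfolding power2_norm_eq_inner by (auto intro!: derivative_eq_intros simp: inner_commute)
  moreover have "(\<lambda>h. A * (2 * ((z - x0) \<bullet> h))) = blinfun_apply ((2 * A) *\<^sub>R blinfun_inner_right (z - x0))"
    by (rule ext) (simp add: blinfun.scaleR_left blinfun_inner_right.rep_eq)
  ultimately show "((\<lambda>z. A * (norm (z - x0))\<^sup>2 + \<beta>) has_derivative blinfun_apply ((2 * A) *\<^sub>R blinfun_inner_right (z - x0))) (at z)" by simp
  have "((\<lambda>z. (2 * A) *\<^sub>R blinfun_inner_right (z - x0)) has_derivative (\<lambda>h. (2 * A) *\<^sub>R blinfun_inner_right h)) (at z)"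
  proof -
    have "((\<lambda>z. z - x0) has_derivative (\<lambda>h. h)) (at z)" by (auto intro!: derivative_eq_intros)
    from bounded_linear.has_derivative[OF bounded_linear_blinfun_inner_right this]
    show ?thesis by (rule has_derivative_scaleR_right)
  qed
  moreover have "(\<lambda>h. (2 * A) *\<^sub>R blinfun_inner_right h) = blinfun_apply ((2 * A) *\<^sub>R (inner2 :: 'a \<Rightarrow>\<^sub>L 'a \<Rightarrow>\<^sub>L real))"
    by (rule ext, rule blinfun_eqI) (simp add: blinfun.scaleR_left blinfun_inner_right.rep_eq)
  ultimately show "((\<lambda>z. (2 * A) *\<^sub>R blinfun_inner_right (z - x0)) has_derivative blinfun_apply ((2 * A) *\<^sub>R inner2)) (at z)" by simp
qed auto

lemma C2_local_min:
  assumes C: "C2_on N q q' q''" and z: "z \<in> N" and m: "\<forall>\<^sub>F y in nhds z. q z \<le> q y"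
  shows "q'' z h h \<ge> 0"
proof (rule ccontr)
  assume neg: "\<not> ?thesis"
  have "isCont q'' z" using C z by (auto simp: C2_on_def continuous_on_eq_continuous_at)
  then have "isCont (\<lambda>w. q'' w h h) z" by (auto intro!: continuous_intros)
  then have "((\<lambda>w. q'' w h h) \<longlongrightarrow> q'' z h h) (nhds z)"
    using tendsto_at_iff_tendsto_nhds[of "\<lambda>w. q'' w h h" z] unfolding isCont_def by simp
  then have "\<forall>\<^sub>F w in nhds z. q'' w h h < 0" using neg by (intro order_tendstoD) auto
  moreover have "\<forall>\<^sub>F w in nhds z. w \<in> N" using C z by (auto simp: C2_on_def intro: eventually_nhds_in_open)
  ultimately have "\<forall>\<^sub>F w in nhds z. q'' w h h < 0 \<and> w \<in> N \<and> q z \<le> q w" using m by eventually_elim simp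
  then obtain d where d: "d > 0" "\<And>w. dist w z < d \<Longrightarrow> q'' w h h < 0 \<and> w \<in> N \<and> q z \<le> q w"
    unfolding eventually_nhds_metric by blast
  define s where "s = d / (2 * (norm h + 1))"
  have pos: "norm h + 1 > 0" by (simp add: add_nonneg_pos)
  have s: "s > 0" using d pos by (simp add: s_def)
  have sh: "s * norm h < d"
  proof -
    have "s * norm h \<le> s * (norm h + 1)" using s by simp
    also have "\<dots> = d / 2" using pos by (simp add: s_def field_simps)
    finally show ?thesis using d by simp
  qed
  have near: "dist ((z - s *\<^sub>R h) + \<theta> *\<^sub>R h + \<tau> *\<^sub>R h) z < d" if "\<theta> \<in> {0..s}" "\<tau> \<in> {0..s}" for \<theta> \<tau>
  proof -
    have "dist ((z - s *\<^sub>R h) + \<theta> *\<^sub>R h + \<tau> *\<^sub>R h) z = norm ((\<theta> + \<tau> - s) *\<^sub>R h)"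
      by (simp add: dist_norm algebra_simps)
    also have "\<dots> \<le> s * norm h" using that by (auto intro!: mult_right_mono)
    finally show ?thesis using sh by simp
  qed
  obtain \<theta> \<tau> where t: "\<theta> \<in> {0..s}" "\<tau> \<in> {0..s}"
    "q ((z - s *\<^sub>R h) + s *\<^sub>R h + s *\<^sub>R h) - q ((z - s *\<^sub>R h) + s *\<^sub>R h) - q ((z - s *\<^sub>R h) + s *\<^sub>R h) + q (z - s *\<^sub>R h)
      = s\<^sup>2 * q'' ((z - s *\<^sub>R h) + \<theta> *\<^sub>R h + \<tau> *\<^sub>R h) h h"
    using C2_on_second_difference[OF C s, of "z - s *\<^sub>R h" h h] near d(2) by blast
  have "q'' ((z - s *\<^sub>R h) + \<theta> *\<^sub>R h + \<tau> *\<^sub>R h) h h < 0" using near[OF t(1,2)] d(2) by blast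
  then have "q (z + s *\<^sub>R h) - 2 * q z + q (z - s *\<^sub>R h) < 0"
    using t(3) s by (simp add: mult_pos_neg algebra_simps)
  moreover have "q z \<le> q (z + s *\<^sub>R h)" "q z \<le> q (z - s *\<^sub>R h)"
    using d(2)[of "z + s *\<^sub>R h"] d(2)[of "z - s *\<^sub>R h"] sh s by (auto simp: dist_norm)
  ultimately show False by linarith
qed

lemma usc_on_open:
  assumes "open D"
  shows "usc_on D w \<longleftrightarrow> (\<forall>z\<in>D. \<forall>c. w z < c \<longrightarrow> (\<forall>\<^sub>F y in nhds z. w y < c))"
  unfolding usc_on_def by (auto simp: at_within_open[OF _ assms] eventually_nhds_conv_at)

lemma lsc_on_open:
  assumes "open D"
  shows "lsc_on D w \<longleftrightarrow> (\<forall>z\<in>D. \<forall>c. c < w z \<longrightarrow> (\<forall>\<^sub>F y in nhds z. c < w y))"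
  unfolding lsc_on_def by (auto simp: at_within_open[OF _ assms] eventually_nhds_conv_at)

text \<open>
  A linear map whose heat semigroup is generated by the weighted Levi form \<open>\<Sum> l\<^sub>k levi (E\<^sub>k)\<close>; the
  weights enter through square roots, and \<open>\<i>\<close> is respected so that both real directions of each
  complex line are covered.
\<close>

definition frame_map :: "complex ^ 'n ^ 'n \<Rightarrow> real ^ 'n \<Rightarrow> complex ^ 'n \<Rightarrow> complex ^ 'n" where
  "frame_map E l z = (\<Sum>k\<in>UNIV. (complex_of_real (sqrt (l $ k)) * z $ k) *s (E $ k))"

lemma bounded_linear_frame_map: "bounded_linear (frame_map E l)"
proof -
  have "linear (frame_map E l)"
    by (rule linearI) (simp_all add: frame_map_def vec_eq_iff sum.distrib algebra_simps scaleR_sum_right)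
  then show ?thesis by (simp add: linear_conv_bounded_linear)
qed

lemma frame_map_axis: "frame_map E l (axis k c) = (complex_of_real (sqrt (l $ k)) * c) *s (E $ k)"
proof -
  have "frame_map E l (axis k c) = (\<Sum>j\<in>UNIV. if j = k then (complex_of_real (sqrt (l $ k)) * c) *s (E $ k) else 0)"
    unfolding frame_map_def by (intro sum.cong) (auto simp: axis_def)
  then show ?thesis by simp
qed

lemma sum_Basis_complex_vec:
  "(\<Sum>b\<in>(Basis :: (complex ^ 'n) set). g b) = (\<Sum>k\<in>UNIV. g (axis k 1) + g (axis k \<i>))"
proof -
  have "Basis = (\<Union>k\<in>(UNIV::'n set). {axis k 1, axis k \<i>} :: (complex ^ 'n) set)"
    by (auto simp: Basis_vec_def Basis_complex_def)
  then have "(\<Sum>b\<in>(Basis :: (complex ^ 'n) set). g b) = (\<Sum>b\<in>(\<Union>k\<in>(UNIV::'n set). {axis k 1, axis k \<i>} :: (complex ^ 'n) set). g b)"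
    by (rule arg_cong)
  also have "\<dots> = (\<Sum>k\<in>UNIV. \<Sum>b\<in>{axis k 1, axis k \<i>}. g b)"
    by (rule sum.UNION_disjoint) (auto simp: axis_eq_axis)
  finally have "(\<Sum>b\<in>(Basis :: (complex ^ 'n) set). g b) = (\<Sum>k\<in>UNIV. \<Sum>b\<in>{axis k 1, axis k \<i>}. g b)" .
  then show ?thesis by (simp add: axis_eq_axis)
qed

lemma trace_along_frame_map:
  assumes "\<And>k. l $ k \<ge> 0"
  shows "trace_along (frame_map E l) A = 4 * (\<Sum>k\<in>UNIV. l $ k * levi A (E $ k))"
proof -
  have r: "(complex_of_real s) *s v = s *\<^sub>R v" for s and v :: "complex ^ 'n"
    by (simp add: vec_eq_iff complex_eq_iff)
  have i: "(complex_of_real s * \<i>) *s v = s *\<^sub>R (\<i> *s v)" for s and v :: "complex ^ 'n"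
    by (simp add: vec_eq_iff complex_eq_iff)
  have sq: "sqrt (l $ k) * (sqrt (l $ k) * y) = l $ k * y" for k y
    using assms[of k] by (simp add: mult.assoc[symmetric])
  have "trace_along (frame_map E l) A = (\<Sum>k\<in>UNIV. l $ k * A (E $ k) (E $ k) + l $ k * A (\<i> *s (E $ k)) (\<i> *s (E $ k)))"
    unfolding trace_along_def sum_Basis_complex_vec frame_map_axis
    by (intro sum.cong refl) (simp add: r i blinfun.scaleR_left blinfun.scaleR_right sq)
  also have "\<dots> = 4 * (\<Sum>k\<in>UNIV. l $ k * levi A (E $ k))"
    unfolding sum_distrib_left by (intro sum.cong refl) (simp add: levi_def field_simps)
  finally show ?thesis .
qed

lemma unitary_frame_mat_1: "unitary_frame (mat 1 :: complex ^ 'n ^ 'n)"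
proof -
  have "adjoint_mat (mat 1) = (mat 1 :: complex ^ 'n ^ 'n)"
    by (auto simp: adjoint_mat_def mat_def vec_eq_iff)
  then show ?thesis by (simp add: unitary_frame_def)
qed

lemma trace_along_uminus:
  fixes A :: "(complex ^ 'n) \<Rightarrow>\<^sub>L (complex ^ 'n) \<Rightarrow>\<^sub>L real"
  shows "trace_along uminus A = 4 * (\<Sum>k\<in>UNIV. levi A ((mat 1 :: complex ^ 'n ^ 'n) $ k))"
proof -
  have "frame_map (mat 1) ones z = z" for z :: "complex ^ 'n"
    unfolding frame_map_def by (auto simp: vec_eq_iff mat_def if_distrib cong: if_cong)
  then have "trace_along uminus A = trace_along (frame_map (mat 1) ones) A" by (simp add: trace_along_def blinfun.minus_left blinfun.minus_right)
  then show ?thesis by (subst (asm) trace_along_frame_map) simp_all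
qed

text \<open>
  Convolution with an even kernel keeps the second derivative of a quadratic polynomial. The
  indicator makes the function bounded; at \<open>x0\<close> a kernel of radius \<open>r\<close> does not see it.
\<close>

lemma convolution_quadratic:
  fixes x0 :: "'a::euclidean_space"
  assumes k: "smooth_kernel k k' k'' r" "\<And>z. k z \<ge> 0" "(\<integral>z. k z \<partial>lborel) = 1" "\<And>z. k (- z) = k z" and r: "r > 0"
    and W: "W = (\<lambda>z. indicator (cball x0 (2 * r)) z * (A * (norm (z - x0))\<^sup>2 + \<beta>))"
  shows "\<exists>M. bdd_borel M W" "conv2 W k'' x0 = (2 * A) *\<^sub>R inner2" "A \<ge> 0 \<Longrightarrow> conv W k x0 \<ge> \<beta>"
proof -
  interpret smooth_kernel k k' k'' r by (rule k(1))
  have Wb: "bdd_borel (\<bar>A\<bar> * (2 * r)\<^sup>2 + \<bar>\<beta>\<bar>) W"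
    unfolding bdd_borel_def
  proof (intro conjI allI)
    show "W \<in> borel_measurable borel" unfolding W
      by (intro borel_measurable_times borel_measurable_indicator borel_measurable_continuous_onI continuous_intros) simp
    fix z
    show "\<bar>W z\<bar> \<le> \<bar>A\<bar> * (2 * r)\<^sup>2 + \<bar>\<beta>\<bar>"
    proof (cases "z \<in> cball x0 (2 * r)")
      case True
      then have "(norm (z - x0))\<^sup>2 \<le> (2 * r)\<^sup>2" by (intro power_mono) (auto simp: dist_norm norm_minus_commute)
      then have "\<bar>A * (norm (z - x0))\<^sup>2\<bar> \<le> \<bar>A\<bar> * (2 * r)\<^sup>2" unfolding abs_mult by (intro mult_left_mono) auto
      then show ?thesis using True by (simp add: W) 
    next
      case False
      then show ?thesis by (simp add: W)
    qed
  qed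
  then show "\<exists>M. bdd_borel M W" by blast
  have ik: "integrable lborel k" using k(3) not_integrable_integral_eq by fastforce
  note km = cc_fun_measurable[OF cc_k]
  have cq: "cc_fun r (\<lambda>z. (norm z)\<^sup>2 * k z)" "cc_fun r (\<lambda>z. (z \<bullet> v) * k z)" for v
    using cc_k by (auto simp: cc_fun_def intro!: continuous_intros)
  have i2: "integrable lborel (\<lambda>z. (norm z)\<^sup>2 * k z)"
  proof -
    have "bdd_borel 1 (\<lambda>_::'a. 1)" by (simp add: bdd_borel_def)
    from conv_alt_integrable[OF this cq(1)] show ?thesis by simp
  qed
  have i1: "integrable lborel (\<lambda>z. (z \<bullet> v) * k z)" for v
  proof -
    have "bdd_borel 1 (\<lambda>_::'a. 1)" by (simp add: bdd_borel_def)
    from conv_alt_integrable[OF this cq(2)] show ?thesis by simp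
  qed
  have odd: "(\<integral>z. (z \<bullet> v) * k z \<partial>lborel) = 0" for v
  proof -
    note [measurable] = km
    have "(\<integral>z. (z \<bullet> v) * k z \<partial>lborel) = (\<integral>z. (z \<bullet> v) * k z \<partial>density (distr lborel borel (\<lambda>z. 0 + (-1) *\<^sub>R z)) (\<lambda>_. 1))"
      using lborel_affine[of "-1" "0::'a"] by simp
    also have "\<dots> = (\<integral>z. - ((z \<bullet> v) * k z) \<partial>lborel)"
      by (simp add: density_1 integral_distr k(4))
    finally show ?thesis by simp
  qed
  define \<mu> where "\<mu> = (\<integral>z. (norm z)\<^sup>2 * k z \<partial>lborel)"
  have mu: "\<mu> \<ge> 0" unfolding \<mu>_def using k(2) by (intro Bochner_Integration.integral_nonneg mult_nonneg_nonneg) auto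
  have val: "conv W k x = A * (norm (x - x0))\<^sup>2 + (A * \<mu> + \<beta>)" if x: "x \<in> ball x0 r" for x
  proof -
    have eq: "W (x - z) * k z = (A * (norm (x - x0))\<^sup>2 + \<beta>) * k z - (2 * A) * ((z \<bullet> (x - x0)) * k z) + A * ((norm z)\<^sup>2 * k z)" for z
    proof (cases "norm z < r")
      case True
      have "dist x0 (x - z) \<le> dist x0 x + norm z" 
      proof -
        have "x0 - (x - z) = (x0 - x) + z" by simp
        then show ?thesis unfolding dist_norm by (simp only:) (rule norm_triangle_ineq)
      qed
      then have "x - z \<in> cball x0 (2 * r)" using True x by auto
      define s where "s = z \<bullet> (x - x0)"
      have "W (x - z) = A * (norm ((x - x0) - z))\<^sup>2 + \<beta>" using \<open>x - z \<in> cball x0 (2 * r)\<close> by (simp add: W algebra_simps)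
      also have "(norm ((x - x0) - z))\<^sup>2 = (norm (x - x0))\<^sup>2 - 2 * s + (norm z)\<^sup>2"
        unfolding power2_norm_eq_inner s_def by (simp add: inner_diff_left inner_diff_right inner_commute)
      finally have Wv: "W (x - z) = A * ((norm (x - x0))\<^sup>2 - 2 * s + (norm z)\<^sup>2) + \<beta>" .
      show ?thesis unfolding Wv s_def[symmetric] by (simp add: algebra_simps)
    next
      case False
      then show ?thesis using supp(1)[of z] by simp
    qed
    have "conv W k x = (\<integral>z. (A * (norm (x - x0))\<^sup>2 + \<beta>) * k z - (2 * A) * ((z \<bullet> (x - x0)) * k z) + A * ((norm z)\<^sup>2 * k z) \<partial>lborel)"
      unfolding conv_alt[OF bdd_borelD(1)[OF Wb] km] eq ..
    also have "\<dots> = (A * (norm (x - x0))\<^sup>2 + \<beta>) * 1 - (2 * A) * 0 + A * \<mu>"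
      using ik i1 i2 k(3) odd by (simp add: \<mu>_def)
    finally show ?thesis by simp
  qed
  show "A \<ge> 0 \<Longrightarrow> conv W k x0 \<ge> \<beta>" using val[of x0] r mu by simp
  have C: "C2_on UNIV (conv W k) (conv1 W k') (conv2 W k'')" by (rule conv_C2[OF Wb])
  note Q = C2_quadratic[of A x0 "A * \<mu> + \<beta>"]
  have d1: "conv1 W k' x = (2 * A) *\<^sub>R blinfun_inner_right (x - x0)" if x: "x \<in> ball x0 r" for x
  proof -
    have "((\<lambda>z. A * (norm (z - x0))\<^sup>2 + (A * \<mu> + \<beta>)) has_derivative blinfun_apply ((2 * A) *\<^sub>R blinfun_inner_right (x - x0))) (at x)"
      using Q by (simp add: C2_on_def)
    then have "(conv W k has_derivative blinfun_apply ((2 * A) *\<^sub>R blinfun_inner_right (x - x0))) (at x)"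
      by (rule has_derivative_transform_within_open[of _ _ _ _ "ball x0 r"]) (use x val in auto)
    moreover have "(conv W k has_derivative blinfun_apply (conv1 W k' x)) (at x)" using C by (simp add: C2_on_def)
    ultimately have "blinfun_apply (conv1 W k' x) = blinfun_apply ((2 * A) *\<^sub>R blinfun_inner_right (x - x0))"
      using has_derivative_unique by blast
    then show ?thesis by (simp add: blinfun_apply_inject)
  qed
  have "((\<lambda>z. (2 * A) *\<^sub>R blinfun_inner_right (z - x0)) has_derivative blinfun_apply ((2 * A) *\<^sub>R (inner2 :: 'a \<Rightarrow>\<^sub>L 'a \<Rightarrow>\<^sub>L real))) (at x0)"
    using Q by (simp add: C2_on_def)
  then have "(conv1 W k' has_derivative blinfun_apply ((2 * A) *\<^sub>R (inner2 :: 'a \<Rightarrow>\<^sub>L 'a \<Rightarrow>\<^sub>L real))) (at x0)"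
    by (rule has_derivative_transform_within_open[of _ _ _ _ "ball x0 r"]) (use r d1 in auto)
  moreover have "(conv1 W k' has_derivative blinfun_apply (conv2 W k'' x0)) (at x0)" using C by (simp add: C2_on_def)
  ultimately have "blinfun_apply (conv2 W k'' x0) = blinfun_apply ((2 * A) *\<^sub>R (inner2 :: 'a \<Rightarrow>\<^sub>L 'a \<Rightarrow>\<^sub>L real))"
    using has_derivative_unique by blast
  then show "conv2 W k'' x0 = (2 * A) *\<^sub>R inner2" by (simp add: blinfun_apply_inject)
qed

lemma trace_along_add: "trace_along B (P + Q) = trace_along B P + trace_along B Q"
  by (simp add: trace_along_def blinfun.add_left sum.distrib)

lemma trace_along_scale: "trace_along B (c *\<^sub>R P) = c * trace_along B P"
  by (simp add: trace_along_def blinfun.scaleR_left sum_distrib_left)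

lemma conv_split:
  assumes b: "bdd_borel M1 u" "bdd_borel M2 v" "bdd_borel M3 w" and k: "cc_fun r \<phi>"
    and eq: "\<And>y. dist y x < r \<Longrightarrow> u y = v y + w y"
  shows "conv u \<phi> x = conv v \<phi> x + conv w \<phi> x"
proof -
  have "u y * \<phi> (x - y) = v y * \<phi> (x - y) + w y * \<phi> (x - y)" for y
  proof (cases "dist y x < r")
    case True then show ?thesis by (simp add: eq distrib_right)
  next
    case False
    then have "\<phi> (x - y) = 0" using k by (simp add: cc_fun_def dist_norm norm_minus_commute)
    then show ?thesis by simp
  qed
  then show ?thesis unfolding conv_def
    using conv_integrable[OF b(2) k, of x] conv_integrable[OF b(3) k, of x] by simp
qed

text \<open>
  The subsolution minus a paraboloid, cut off at zero. For the parameters used below the paraboloid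
  lies under \<open>u\<close> on the ball of radius \<open>r\<close> and above \<open>u\<close> near the sphere of radius \<open>2 r\<close>. Thus the
  result is a globally defined compactly supported function that differs from \<open>u\<close> near \<open>x0\<close> by a
  quadratic polynomial only.
\<close>

definition obstacle :: "('a::euclidean_space \<Rightarrow> real) \<Rightarrow> 'a \<Rightarrow> real \<Rightarrow> real \<Rightarrow> real \<Rightarrow> 'a \<Rightarrow> real" where
  "obstacle u x0 r A \<beta> z = (if z \<in> ball x0 (2 * r) then max (u z - (A * (norm (z - x0))\<^sup>2 + \<beta>)) 0 else 0)"

context hessian_operator
begin

lemma subsol_usc:
  assumes D: "open D" and u: "subsol \<psi> D w" and z: "z \<in> D" "w z < c"
  shows "\<forall>\<^sub>F y in nhds z. w y < c"
proof -
  have "usc_on D w" using u by (simp add: subsol_def)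
  then show ?thesis unfolding usc_on_open[OF D] using z by blast
qed

text \<open>
  Localisation of a linear viscosity inequality. Where the obstacle function vanishes it has a local
  minimum, so test functions have nonnegative second derivative there; elsewhere the inequality for
  \<open>u\<close> is shifted by the second derivative of the paraboloid.
\<close>

lemma obstacle_properties:
  assumes D: "open D" and u: "subsol \<psi> D (\<lambda>z. ereal (u z))" and r: "r > 0" "cball x0 (2 * r) \<subseteq> D"
    and M: "M > 0" "\<And>z. z \<in> D \<Longrightarrow> \<bar>u z\<bar> \<le> M" and A: "A \<ge> M / r\<^sup>2" and \<beta>: "\<beta> = - A * r\<^sup>2 - M"
    and p: "p = obstacle u x0 r A \<beta>"
    and B: "\<And>z P. z \<in> cball x0 (2 * r) \<Longrightarrow> opge (\<psi> z) P \<Longrightarrow> trace_along B P \<ge> b"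
    and c: "c \<ge> 0" "2 * c = 2 * A * trace_along B inner2 - b"
  shows "\<And>x. 0 \<le> p x" "\<And>x. p x \<le> 2 * M + A * r\<^sup>2" "\<And>x. norm x \<ge> norm x0 + 2 * r \<Longrightarrow> p x = 0"
    "usc_real p" "linear_subsol B c p" "\<And>y. dist y x0 < r \<Longrightarrow> u y = p y + (A * (norm (y - x0))\<^sup>2 + \<beta>)"
proof -
  let ?Q = "\<lambda>z. A * (norm (z - x0))\<^sup>2 + \<beta>"
  have Ar: "A * r\<^sup>2 \<ge> M" using A r by (simp add: field_simps)
  have A0: "A > 0" using A M r by (smt (verit) divide_pos_pos zero_less_power)
  show p0: "0 \<le> p x" for x by (simp add: p obstacle_def)
  have Qlow: "?Q z \<ge> \<beta>" for z using A0 by simp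
  show "p x \<le> 2 * M + A * r\<^sup>2" for x
  proof (cases "x \<in> ball x0 (2 * r)")
    case True
    then have "x \<in> D" using r(2) by auto
    then have "u x - ?Q x \<le> M - \<beta>" using M(2)[of x] Qlow[of x] by linarith
    then show ?thesis using True M(1) A0 by (simp add: p obstacle_def \<beta>)
  next
    case False
    then show ?thesis using M(1) A0 by (simp add: p obstacle_def)
  qed
  show "p x = 0" if "norm x \<ge> norm x0 + 2 * r" for x
  proof -
    have "dist x0 x \<ge> 2 * r" using that norm_triangle_ineq2[of x x0] by (simp add: dist_norm norm_minus_commute)
    then show ?thesis by (simp add: p obstacle_def)
  qed
  \<comment> \<open>\<open>A\<close> and \<open>\<beta>\<close> are chosen so that the paraboloid is at most \<open>- M\<close> on the ball of radius \<open>r\<close> and at least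
      \<open>M\<close> beyond \<open>sqrt 3 r\<close>; the gap up to \<open>2 r\<close> gives semicontinuity at the sphere.\<close>
  have far: "p z = 0" if z: "norm (z - x0) > sqrt 3 * r" for z
  proof (cases "z \<in> ball x0 (2 * r)")
    case True
    then have "z \<in> D" using r(2) by auto
    have "(norm (z - x0))\<^sup>2 \<ge> (sqrt 3 * r)\<^sup>2" using z r by (intro power_mono) auto
    then have "A * (norm (z - x0))\<^sup>2 \<ge> A * (3 * r\<^sup>2)" using A0 by (intro mult_left_mono) (auto simp: power_mult_distrib)
    then have "?Q z \<ge> M" using Ar by (simp add: \<beta>)
    then show ?thesis using M(2)[OF \<open>z \<in> D\<close>] True by (simp add: p obstacle_def)
  next
    case False
    then show ?thesis by (simp add: p obstacle_def)
  qed
  have uscu: "\<forall>\<^sub>F y in nhds z. u y < a" if "z \<in> D" "u z < a" for z a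
    using subsol_usc[OF D u that(1), of "ereal a"] that(2) by simp
  show usc: "usc_real p"
    unfolding usc_real_def
  proof (intro allI impI)
    fix z a assume a: "p z < a"
    have a0: "a > 0" using a p0[of z] by linarith
    show "\<forall>\<^sub>F y in nhds z. p y < a"
    proof (cases "z \<in> ball x0 (2 * r)")
      case True
      then have zD: "z \<in> D" using r(2) by auto
      have lt: "u z - ?Q z < a" using a True by (simp add: p obstacle_def)
      define e where "e = (a - (u z - ?Q z)) / 2"
      have e: "e > 0" using lt by (simp add: e_def)
      have "\<forall>\<^sub>F y in nhds z. u y < u z + e" using uscu[OF zD] e by simp
      moreover have "isCont ?Q z" by (intro continuous_intros)
      then have "(?Q \<longlongrightarrow> ?Q z) (nhds z)" using tendsto_at_iff_tendsto_nhds[of ?Q z] unfolding isCont_def by simp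
      then have "\<forall>\<^sub>F y in nhds z. ?Q y > ?Q z - e" using e by (intro order_tendstoD) auto
      ultimately show ?thesis
      proof eventually_elim
        case (elim y)
        then have "u y - ?Q y < a" by (simp add: e_def field_simps)
        then show ?case using a0 by (simp add: p obstacle_def)
      qed
    next
      case False
      have "sqrt 3 < (2::real)" by (rule real_less_lsqrt) auto
      then have "sqrt 3 * r < 2 * r" using r by simp
      then have "norm (z - x0) > sqrt 3 * r" using False by (simp add: dist_norm norm_minus_commute)
      moreover have "open {y. norm (y - x0) > sqrt 3 * r}" by (intro open_Collect_less continuous_intros)
      ultimately have "\<forall>\<^sub>F y in nhds z. norm (y - x0) > sqrt 3 * r"
        using eventually_nhds_in_open[of "{y. norm (y - x0) > sqrt 3 * r}" z] by simp
      then show ?thesis by eventually_elim (simp add: far a0)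
    qed
  qed
  show "u y = p y + ?Q y" if y: "dist y x0 < r" for y
  proof -
    have "y \<in> ball x0 (2 * r)" "y \<in> D" using y r by (auto simp: dist_commute)
    have "(norm (y - x0))\<^sup>2 \<le> r\<^sup>2" using y by (intro power_mono) (auto simp: dist_norm)
    then have "A * (norm (y - x0))\<^sup>2 \<le> A * r\<^sup>2" using A0 by simp
    then have "?Q y \<le> - M" by (simp add: \<beta>)
    then have "?Q y \<le> u y" using M(2)[OF \<open>y \<in> D\<close>] by linarith
    then show ?thesis using \<open>y \<in> ball x0 (2 * r)\<close> by (simp add: p obstacle_def)
  qed
  show "linear_subsol B c p"
    unfolding linear_subsol_def
  proof (intro allI impI)
    fix z N q q' q''
    assume z: "z \<in> N" and C: "C2_on N q q' q''" and qz: "q z = p z" and le: "\<forall>\<^sub>F y in nhds z. p y \<le> q y"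
    show "- 2 * c \<le> trace_along B (q'' z)"
    proof (cases "p z = 0")
      case True
      have "\<forall>\<^sub>F y in nhds z. q z \<le> q y" using le by eventually_elim (use True qz p0 in \<open>smt (verit)\<close>)
      then have "trace_along B (q'' z) \<ge> 0" unfolding trace_along_def by (intro sum_nonneg C2_local_min[OF C z])
      then show ?thesis using c by linarith
    next
      case False
      then have zb: "z \<in> ball x0 (2 * r)" and pz: "p z = u z - ?Q z"
        using p0[of z] by (auto simp: p obstacle_def max_def split: if_splits)
      then have zD: "z \<in> D" using r(2) by auto
      have C': "C2_on (N \<inter> UNIV) (\<lambda>y. q y + ?Q y) (\<lambda>z. q' z + (2 * A) *\<^sub>R blinfun_inner_right (z - x0)) (\<lambda>z. q'' z + (2 * A) *\<^sub>R inner2)"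
        by (rule C2_on_add[OF C C2_quadratic])
      have "\<forall>\<^sub>F y in nhds z. y \<in> ball x0 (2 * r)" using zb by (intro eventually_nhds_in_open) auto
      then have up: "\<forall>\<^sub>F y in nhds z. ereal (u y) \<le> ereal (q y + ?Q y)"
        using le by eventually_elim (simp add: p obstacle_def)
      have "opge (\<psi> z) (q'' z + (2 * A) *\<^sub>R inner2)"
        using u[unfolded subsol_def, THEN conjunct2, THEN conjunct2, rule_format, OF zD _ C' _ up] z qz pz by simp
      then have "trace_along B (q'' z + (2 * A) *\<^sub>R inner2) \<ge> b" using zb by (intro B[of z]) auto
      then show ?thesis using c(2) by (simp add: trace_along_add trace_along_scale)
    qed
  qed
qed

lemma levi_inner2_frame: "unitary_frame E \<Longrightarrow> levi inner2 (E $ k) = 1 / 2"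
  by (simp add: levi_inner2 norm_unitary_frame)

lemma subsol_borel:
  assumes D: "open D" and u: "subsol \<psi> D (\<lambda>z. ereal (u z))"
  shows "(\<lambda>z. if z \<in> D then u z else 0) \<in> borel_measurable borel"
  unfolding borel_measurable_iff_less
proof
  fix a
  have "open {z\<in>D. u z < a}"
  proof (subst open_subopen, intro ballI)
    fix z assume z: "z \<in> {z\<in>D. u z < a}"
    then have "\<forall>\<^sub>F y in nhds z. ereal (u y) < ereal a"
      by (intro subsol_usc[OF D u]) auto
    moreover have "\<forall>\<^sub>F y in nhds z. y \<in> D" using z D by (intro eventually_nhds_in_open) auto
    ultimately have "\<forall>\<^sub>F y in nhds z. y \<in> {z\<in>D. u z < a}" by eventually_elim simp
    then show "\<exists>T. open T \<and> z \<in> T \<and> T \<subseteq> {z\<in>D. u z < a}" unfolding eventually_nhds by blast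
  qed
  moreover have "{z\<in>space borel. (if z \<in> D then u z else 0) < a} = {z\<in>D. u z < a} \<union> (if 0 < a then - D else {})" by auto
  ultimately show "{z\<in>space borel. (if z \<in> D then u z else 0) < a} \<in> sets borel" using D by (auto intro!: sets.Un)
qed

text \<open>
  Each half-space containing \<open>superlevel c\<close> gives a linear inequality for \<open>u\<close>, which is localised and
  mollified; together they give \<open>opge\<close> for the mollification. The lower bound on the mollification
  comes from the Laplacian: a subharmonic function is below its Gaussian averages, hence below its
  mollification up to \<open>O(t)\<close>.
\<close>

lemma mollified_subsol_pointwise:
  fixes u :: "complex ^ 'n \<Rightarrow> real"
  assumes D: "open D" and u: "subsol \<psi> D (\<lambda>z. ereal (u z))" and r: "r > 0" "cball x0 (2 * r) \<subseteq> D"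
    and M: "M > 0" "\<And>z. z \<in> D \<Longrightarrow> \<bar>u z\<bar> \<le> M"
    and k: "smooth_kernel k k' k'' r" "\<And>z. k z \<ge> 0" "(\<integral>z. k z \<partial>lborel) = 1" "\<And>z. k (- z) = k z"
    and v: "v = (\<lambda>z. if z \<in> D then u z else 0)"
    and t: "t > 0"
    and heat: "\<And>M p x. bdd_borel M p \<Longrightarrow> (\<And>x. p x \<ge> 0) \<Longrightarrow> heat uminus t p x \<le> conv p k x + M * (3 * t * DIM((complex, 'n) vec) / r\<^sup>2)"
  shows "\<lbrakk>\<And>y. y \<in> cball x0 (2 * r) \<Longrightarrow> \<psi> y \<ge> c; superlevel c \<noteq> {}\<rbrakk> \<Longrightarrow> opge c (conv2 v k'' x0)"
    and "(\<And>y. y \<in> cball x0 r \<Longrightarrow> u y \<le> m) \<Longrightarrow> conv v k x0 \<le> m"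
    and "u x0 \<le> conv v k x0 + 3 * M * (3 * t * DIM((complex, 'n) vec) / r\<^sup>2) + t * (M / r\<^sup>2 * trace_along uminus (inner2 :: (complex ^ 'n) \<Rightarrow>\<^sub>L (complex ^ 'n) \<Rightarrow>\<^sub>L real))"
proof -
  interpret smooth_kernel k k' k'' r by (rule k(1))
  have vb: "bdd_borel M v"
    unfolding bdd_borel_def v using subsol_borel[OF D u] M by auto
  have split: "conv v \<phi> x0 = conv p \<phi> x0 + conv (\<lambda>z. indicator (cball x0 (2 * r)) z * (A * (norm (z - x0))\<^sup>2 + \<beta>)) \<phi> x0"
    if p: "p = obstacle u x0 r A \<beta>" "bdd_borel M' p" "\<And>y. dist y x0 < r \<Longrightarrow> u y = p y + (A * (norm (y - x0))\<^sup>2 + \<beta>)"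
      and \<phi>: "cc_fun r \<phi>" for \<phi> A \<beta> p M'
  proof -
    obtain M2 where M2: "bdd_borel M2 (\<lambda>z. indicator (cball x0 (2 * r)) z * (A * (norm (z - x0))\<^sup>2 + \<beta>))"
      using convolution_quadratic(1)[OF k r(1) refl] by blast
    show ?thesis
    proof (rule conv_split[OF vb p(2) M2 \<phi>])
      fix y assume y: "dist y x0 < r"
      then have "y \<in> cball x0 (2 * r)" using r by (simp add: dist_commute)
      then show "v y = p y + indicator (cball x0 (2 * r)) y * (A * (norm (y - x0))\<^sup>2 + \<beta>)"
        using p(3)[OF y] r(2) by (auto simp: v)
    qed
  qed
  show "opge c (conv2 v k'' x0)" if \<psi>: "\<And>y. y \<in> cball x0 (2 * r) \<Longrightarrow> \<psi> y \<ge> c" and ne: "superlevel c \<noteq> {}"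
  proof (rule opge_if_halfspaces[OF _ ne])
    fix E :: "complex ^ 'n ^ 'n" and l :: "real ^ 'n" and b :: real
    assume E: "unitary_frame E" and l: "\<And>k. l $ k \<ge> 0" and lb: "\<And>x. x \<in> superlevel c \<Longrightarrow> l \<bullet> x \<ge> b"
    define \<tau> where "\<tau> = (\<Sum>k\<in>UNIV. l $ k)"
    have \<tau>0: "\<tau> \<ge> 0" unfolding \<tau>_def using l by (intro sum_nonneg) auto
    let ?B = "frame_map E l"
    have LI: "trace_along ?B inner2 = 2 * \<tau>"
      unfolding trace_along_frame_map[OF l] by (simp add: levi_inner2_frame[OF E] \<tau>_def sum_divide_distrib[symmetric])
    \<comment> \<open>The opening \<open>A\<close> has to be large enough for the constant \<open>cc\<close> below to be nonnegative.\<close>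
    obtain A where A: "A \<ge> M / r\<^sup>2" "A * \<tau> \<ge> b"
    proof (cases "\<tau> = 0")
      case True
      then have "l $ k = 0" for k using l unfolding \<tau>_def by (simp add: sum_nonneg_eq_0_iff)
      then have "l = 0" by (simp add: vec_eq_iff)
      then have "b \<le> 0" using ne lb by fastforce
      then show ?thesis using True that[of "M / r\<^sup>2"] by simp
    next
      case False
      then have "\<tau> > 0" using \<tau>0 by simp
      then have "max (M / r\<^sup>2) (b / \<tau>) * \<tau> \<ge> b" by (simp add: max_def field_simps)
      then show ?thesis using that[of "max (M / r\<^sup>2) (b / \<tau>)"] by simp
    qed
    define \<beta> where "\<beta> = - A * r\<^sup>2 - M"
    define p where "p = obstacle u x0 r A \<beta>"
    define cc where "cc = 2 * A * \<tau> - 2 * b"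
    have cc: "cc \<ge> 0" "2 * cc = 2 * A * trace_along ?B inner2 - 4 * b" using A by (auto simp: cc_def LI)
    have B: "trace_along ?B P \<ge> 4 * b" if "z \<in> cball x0 (2 * r)" "opge (\<psi> z) P" for z P
    proof -
      have "opge c P" using opge_mono[OF that(2) \<psi>[OF that(1)]] .
      from opge_halfspace[OF this E lb] show ?thesis unfolding trace_along_frame_map[OF l] by simp
    qed
    note P = obstacle_properties[OF D u r M A(1) \<beta>_def p_def B cc]
    have pb: "bdd_borel (2 * M + A * r\<^sup>2) p" using usc_real_borel[OF P(4)] P(1,2) by (auto simp: bdd_borel_def)
    have "trace_along ?B (conv2 p k'' x0) \<ge> - 2 * cc"
      by (rule mollified_subsolution[OF bounded_linear_frame_map k(2,3) P(1,2,3,4,5) cc(1)])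
    moreover have "conv2 v k'' x0 = conv2 p k'' x0 + (2 * A) *\<^sub>R inner2"
    proof (rule blinfun_eqI, rule blinfun_eqI)
      fix h h'
      let ?W = "\<lambda>z. indicator (cball x0 (2 * r)) z * (A * (norm (z - x0))\<^sup>2 + \<beta>)"
      obtain M2 where M2: "bdd_borel M2 ?W" using convolution_quadratic(1)[OF k r(1) refl] by blast
      have "conv2 v k'' x0 h h' = conv2 p k'' x0 h h' + conv2 ?W k'' x0 h h'"
        unfolding conv2_apply[OF vb] conv2_apply[OF pb] conv2_apply[OF M2]
        by (rule split[OF p_def pb P(6) cc_k2])
      then show "conv2 v k'' x0 h h' = (conv2 p k'' x0 + (2 * A) *\<^sub>R inner2) h h'"
        unfolding convolution_quadratic(2)[OF k r(1) refl] by (simp add: blinfun.add_left)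
    qed
    ultimately have "trace_along ?B (conv2 v k'' x0) \<ge> 4 * b" using cc(2) by (simp add: trace_along_add trace_along_scale)
    then show "(\<Sum>k\<in>UNIV. l $ k * levi (conv2 v k'' x0) (E $ k)) \<ge> b" unfolding trace_along_frame_map[OF l] by simp
  qed
  have ik: "integrable lborel k" using k(3) not_integrable_integral_eq by fastforce
  show "conv v k x0 \<le> m" if m: "\<And>y. y \<in> cball x0 r \<Longrightarrow> u y \<le> m"
  proof -
    have "conv v k x0 \<le> (\<integral>z. m * k z \<partial>lborel)"
      unfolding conv_alt[OF bdd_borelD(1)[OF vb] cc_fun_measurable[OF cc_k]]
    proof (rule integral_mono)
      fix z
      show "v (x0 - z) * k z \<le> m * k z"
      proof (cases "norm z < r")
        case True
        then have "x0 - z \<in> cball x0 r" "x0 - z \<in> cball x0 (2 * r)" using r by (auto simp: dist_norm)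
        then have "v (x0 - z) = u (x0 - z)" using subsetD[OF r(2)] by (simp add: v)
        then have "v (x0 - z) \<le> m" using m[OF \<open>x0 - z \<in> cball x0 r\<close>] by simp
        then show ?thesis using k(2) by (intro mult_right_mono) auto
      next
        case False then show ?thesis using supp(1)[of z] by simp
      qed
    qed (use conv_alt_integrable[OF vb cc_k, of x0] ik in auto)
    then show ?thesis using k(3) by simp
  qed
  show "u x0 \<le> conv v k x0 + 3 * M * (3 * t * DIM((complex, 'n) vec) / r\<^sup>2) + t * (M / r\<^sup>2 * trace_along uminus (inner2 :: (complex ^ 'n) \<Rightarrow>\<^sub>L (complex ^ 'n) \<Rightarrow>\<^sub>L real))"
  proof -
    define A where "A = M / r\<^sup>2"
    define \<beta> where "\<beta> = - A * r\<^sup>2 - M"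
    define p where "p = obstacle u x0 r A \<beta>"
    let ?I = "inner2 :: (complex ^ 'n) \<Rightarrow>\<^sub>L (complex ^ 'n) \<Rightarrow>\<^sub>L real"
    define cc where "cc = A * trace_along uminus ?I"
    have Ar: "A * r\<^sup>2 = M" "A \<ge> 0" using r M by (auto simp: A_def)
    have "trace_along uminus ?I \<ge> 0" unfolding trace_along_def by (intro sum_nonneg) simp
    then have cc: "cc \<ge> 0" "2 * cc = 2 * A * trace_along uminus ?I - 0" using Ar by (auto simp: cc_def)
    have B: "trace_along uminus P \<ge> 0" if "z \<in> cball x0 (2 * r)" "opge (\<psi> z) P" for z P
      unfolding trace_along_uminus using opge_trace[OF that(2) unitary_frame_mat_1] by simp
    have AA: "A \<ge> M / r\<^sup>2" by (simp add: A_def)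
    note P = obstacle_properties[OF D u r M AA \<beta>_def p_def B cc]
    have pb: "bdd_borel (3 * M) p" using usc_real_borel[OF P(4)] P(1) P(2)[unfolded Ar] by (auto simp: bdd_borel_def)
    have bl: "bounded_linear (uminus :: complex ^ 'n \<Rightarrow> complex ^ 'n)" by (intro bounded_linear_minus bounded_linear_ident)
    have "p x0 \<le> heat uminus t p x0 + t * cc"
      by (rule heat_subsolution[OF bl P(1,2,3,4,5) cc(1) t])
    also have "heat uminus t p x0 \<le> conv p k x0 + 3 * M * (3 * t * DIM((complex, 'n) vec) / r\<^sup>2)"
      by (rule heat[OF pb P(1)])
    finally have 1: "p x0 \<le> conv p k x0 + 3 * M * (3 * t * DIM((complex, 'n) vec) / r\<^sup>2) + t * cc" by simp
    have "conv v k x0 = conv p k x0 + conv (\<lambda>z. indicator (cball x0 (2 * r)) z * (A * (norm (z - x0))\<^sup>2 + \<beta>)) k x0"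
      by (rule split[OF p_def pb P(6) cc_k])
    moreover have "conv (\<lambda>z. indicator (cball x0 (2 * r)) z * (A * (norm (z - x0))\<^sup>2 + \<beta>)) k x0 \<ge> \<beta>"
      by (rule convolution_quadratic(3)[OF k r(1) refl Ar(2)])
    moreover have "u x0 = p x0 + (A * (norm (x0 - x0))\<^sup>2 + \<beta>)" 
    proof -
      have "dist x0 x0 < r" using r(1) by simp
      show ?thesis by (rule P(6)) (assumption | rule \<open>dist x0 x0 < r\<close>)+
    qed
    ultimately show ?thesis using 1 by (simp add: cc_def A_def)
  qed
qed

text \<open>
  Smooth subsolutions near a given bounded one. The right-hand side may drop to its infimum over a
  ball of radius \<open>2 r\<close>, and no continuity of \<open>u\<close> is available, so the approximation is from above: up
  to \<open>e\<close>, the values lie between \<open>u\<close> and its supremum over a small ball.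
\<close>

theorem subsol_mollification:
  fixes u :: "complex ^ 'n \<Rightarrow> real"
  assumes D: "open D" and u: "subsol \<psi> D (\<lambda>z. ereal (u z))" and r: "r > 0" "\<And>x. x \<in> K \<Longrightarrow> cball x (2 * r) \<subseteq> D"
    and M: "\<And>z. z \<in> D \<Longrightarrow> \<bar>u z\<bar> \<le> M" and e: "e > 0"
  shows "\<exists>w w' w''. C2_on UNIV w w' w'' \<and> (\<forall>x\<in>K. u x - e \<le> w x \<and> (\<forall>m. (\<forall>y\<in>cball x r. u y \<le> m) \<longrightarrow> w x \<le> m) \<and>
      (\<forall>c. superlevel c \<noteq> {} \<longrightarrow> (\<forall>y\<in>cball x (2 * r). \<psi> y \<ge> c) \<longrightarrow> opge c (w'' x)))"
proof -
  define M' where "M' = \<bar>M\<bar> + 1"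
  have M': "M' > 0" "\<And>z. z \<in> D \<Longrightarrow> \<bar>u z\<bar> \<le> M'" 
  proof -
    show "\<bar>u z\<bar> \<le> M'" if "z \<in> D" for z using M[OF that] by (simp add: M'_def)
  qed (simp add: M'_def)
  let ?I = "inner2 :: (complex ^ 'n) \<Rightarrow>\<^sub>L (complex ^ 'n) \<Rightarrow>\<^sub>L real"
  let ?n = "real DIM((complex, 'n) vec)"
  have n: "?n > 0" by simp
  define Z where "Z = 3 * M' * (3 * ?n / r\<^sup>2) + M' / r\<^sup>2 * trace_along uminus ?I"
  have "trace_along uminus ?I \<ge> 0" unfolding trace_along_def by (intro sum_nonneg) simp
  then have Z: "Z \<ge> 0" using M' r by (simp add: Z_def)
  \<comment> \<open>The radius \<open>r\<close> of the kernel is given; only the width \<open>t\<close> of the Gaussian is made small.\<close>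
  define t where "t = min (r\<^sup>2 / (6 * ?n)) (e / (Z + 1))"
  have t: "t > 0" using r n e Z by (simp add: t_def)
  have t2: "3 * t * ?n < r\<^sup>2"
  proof -
    have "3 * t * ?n \<le> 3 * (r\<^sup>2 / (6 * ?n)) * ?n" using n by (intro mult_right_mono mult_left_mono) (auto simp: t_def)
    also have "\<dots> < r\<^sup>2" using r n by simp
    finally show ?thesis .
  qed
  have tZ: "t * Z \<le> e"
  proof -
    have "t * Z \<le> (e / (Z + 1)) * Z" using Z by (intro mult_right_mono) (auto simp: t_def)
    also have "\<dots> \<le> e" using e Z by (simp add: field_simps)
    finally show ?thesis .
  qed
  obtain k :: "complex ^ 'n \<Rightarrow> real" and k' k'' where k: "smooth_kernel k k' k'' r" "\<And>z. k z \<ge> 0" "(\<integral>z. k z \<partial>lborel) = 1" "\<And>z. k (- z) = k z"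
    "\<And>M p x. bdd_borel M p \<Longrightarrow> (\<And>x. p x \<ge> 0) \<Longrightarrow> heat uminus t p x \<le> conv p k x + M * (3 * t * ?n / r\<^sup>2)"
    using gaussian_kernel_exists[OF r(1) t t2] by blast
  define v where "v = (\<lambda>z. if z \<in> D then u z else 0)"
  have vb: "bdd_borel M' v"
    unfolding bdd_borel_def v_def using subsol_borel[OF D u] M' by auto
  note P = mollified_subsol_pointwise[OF D u r(1) _ M' k(1-4) v_def t k(5)]
  show ?thesis
  proof (intro exI conjI ballI allI impI)
    show "C2_on UNIV (conv v k) (conv1 v k') (conv2 v k'')" by (rule smooth_kernel.conv_C2[OF k(1) vb])
    fix x assume x: "x \<in> K"
    have "u x \<le> conv v k x + 3 * M' * (3 * t * ?n / r\<^sup>2) + t * (M' / r\<^sup>2 * trace_along uminus ?I)" by (rule P(3)[OF r(2)[OF x]])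
    also have "\<dots> = conv v k x + t * Z" by (simp add: Z_def algebra_simps)
    finally show "u x - e \<le> conv v k x" using tZ by linarith
  next
    fix x m assume "x \<in> K" "\<forall>y\<in>cball x r. u y \<le> m"
    then show "conv v k x \<le> m" using P(2)[OF r(2)] by blast
  next
    fix x c assume "x \<in> K" "superlevel c \<noteq> {}" "\<forall>y\<in>cball x (2 * r). \<psi> y \<ge> c"
    then show "opge c (conv2 v k'' x)" using P(1)[OF r(2)] by blast
  qed
qed

end

section \<open>Comparison and stability\<close>

text \<open>
  A property that holds near each boundary point holds outside a compact set.
\<close>

lemma compact_boundary_exhaustion:
  fixes D :: "'a::euclidean_space set"
  assumes D: "open D" "bounded D" and Q: "\<And>\<zeta>. \<zeta> \<in> frontier D \<Longrightarrow> \<forall>\<^sub>F z in at \<zeta> within D. Q z"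
  shows "\<exists>K. compact K \<and> K \<subseteq> D \<and> (\<forall>z\<in>D - K. Q z)"
proof -
  have "\<forall>\<zeta>\<in>frontier D. \<exists>d>0. \<forall>z\<in>D. z \<noteq> \<zeta> \<and> dist z \<zeta> < d \<longrightarrow> Q z"
    using Q unfolding eventually_at by blast
  then obtain d where d: "\<And>\<zeta>. \<zeta> \<in> frontier D \<Longrightarrow> d \<zeta> > 0"
    "\<And>\<zeta> z. \<zeta> \<in> frontier D \<Longrightarrow> z \<in> D \<Longrightarrow> z \<noteq> \<zeta> \<Longrightarrow> dist z \<zeta> < d \<zeta> \<Longrightarrow> Q z" by metis
  define V where "V = (\<Union>\<zeta>\<in>frontier D. ball \<zeta> (d \<zeta>))"
  have V: "open V" unfolding V_def by auto
  have fV: "frontier D \<subseteq> V" unfolding V_def using d(1) by force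
  have fD: "\<zeta> \<notin> D" if "\<zeta> \<in> frontier D" for \<zeta> using that D(1) by (simp add: frontier_def interior_open)
  have "compact (closure D - V)" using D(2) V by (intro compact_diff) (auto simp: compact_closure)
  moreover have "closure D - V \<subseteq> D" using fV D(1) by (auto simp: frontier_def interior_open)
  moreover have "Q z" if "z \<in> D - (closure D - V)" for z
  proof -
    have zV: "z \<in> V" "z \<in> D" using that closure_subset by auto
    then obtain \<zeta> where \<zeta>: "\<zeta> \<in> frontier D" "dist z \<zeta> < d \<zeta>" unfolding V_def by (auto simp: dist_commute)
    then show ?thesis using d(2)[OF \<zeta>(1) zV(2)] fD[OF \<zeta>(1)] zV(2) by blast
  qed
  ultimately show ?thesis by blast
qed

text \<open>
  A strict inequality between an upper and a lower semicontinuous function on a compact set persists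
  when the argument of the former is moved by a uniform distance.
\<close>

lemma usc_lsc_separation:
  fixes a b :: "'a::metric_space \<Rightarrow> real"
  assumes S: "compact S"
    and a: "\<And>z c. z \<in> S \<Longrightarrow> a z < c \<Longrightarrow> \<forall>\<^sub>F y in nhds z. a y < c"
    and b: "\<And>z c. z \<in> S \<Longrightarrow> c < b z \<Longrightarrow> \<forall>\<^sub>F y in nhds z. y \<in> S \<longrightarrow> c < b y"
    and ab: "\<And>z. z \<in> S \<Longrightarrow> a z < b z"
  shows "\<exists>r>0. \<forall>z\<in>S. \<forall>y\<in>cball z r. a y < b z"
proof -
  have "\<exists>c d. d > 0 \<and> (\<forall>y. dist y z < 2 * d \<longrightarrow> a y < c \<and> (y \<in> S \<longrightarrow> c < b y))" if z: "z \<in> S" for z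
  proof -
    obtain c where c: "a z < c" "c < b z" using dense[OF ab[OF z]] by blast
    have "\<forall>\<^sub>F y in nhds z. a y < c \<and> (y \<in> S \<longrightarrow> c < b y)"
      using a[OF z c(1)] b[OF z c(2)] by eventually_elim simp
    then obtain d where "d > 0" "\<And>y. dist y z < d \<Longrightarrow> a y < c \<and> (y \<in> S \<longrightarrow> c < b y)"
      unfolding eventually_nhds_metric by blast
    then show ?thesis by (intro exI[of _ c] exI[of _ "d/2"]) auto
  qed
  then obtain c d where d: "\<And>z. z \<in> S \<Longrightarrow> d z > 0"
    "\<And>z y. z \<in> S \<Longrightarrow> dist y z < 2 * d z \<Longrightarrow> a y < c z \<and> (y \<in> S \<longrightarrow> c z < b y)" by metis
  have op: "open (ball z (d z))" for z by simp
  have cov: "S \<subseteq> (\<Union>z\<in>S. ball z (d z))" using d(1) by force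
  obtain T where T: "T \<subseteq> S" "finite T" "S \<subseteq> (\<Union>z\<in>T. ball z (d z))"
    by (rule compactE_image[OF S op cov]) (rule that)
  define r where "r = Min (insert 1 (d ` T)) / 2"
  have mpos: "Min (insert 1 (d ` T)) > 0" using T d(1) by (subst Min_gr_iff) auto
  have r: "r > 0" "\<And>z. z \<in> T \<Longrightarrow> r < d z"
  proof -
    show "r > 0" using mpos by (simp add: r_def)
    fix z assume z: "z \<in> T"
    have "Min (insert 1 (d ` T)) \<le> d z" using T(2) z by (intro Min_le) auto
    then show "r < d z" using mpos d(1)[of z] z T(1) by (auto simp: r_def)
  qed
  have "a y < b w" if w: "w \<in> S" and y: "y \<in> cball w r" for w y
  proof -
    obtain z where z: "z \<in> T" "dist w z < d z" using T(3) w by (auto simp: dist_commute)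
    have zS: "z \<in> S" using z T by blast
    have "dist y z \<le> dist y w + dist w z" by (rule dist_triangle)
    then have "dist y z < 2 * d z" using y z r(2)[OF z(1)] by (simp add: dist_commute)
    then have "a y < c z" using d(2)[OF zS] by blast
    moreover have "c z < b w" using d(2)[OF zS, of w] z w d(1)[OF zS] by simp
    ultimately show ?thesis by linarith
  qed
  then show ?thesis using r(1) by blast
qed

lemma open_relatively_compact_neighbourhood:
  fixes K :: "'a::euclidean_space set"
  assumes K: "compact K" "K \<subseteq> D" "open D"
  shows "\<exists>V. open V \<and> K \<subseteq> V \<and> compact (closure V) \<and> closure V \<subseteq> D"
proof (cases "K = {}")
  case True
  then show ?thesis by (intro exI[of _ "{}"]) auto
next
  case False
  obtain e where e: "e > 0" "{x. infdist x K \<le> e} \<subseteq> D"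
    using compact_in_open_separated[OF False K(1) K(3) K(2)] by blast
  define V where "V = {x. infdist x K < e}"
  have cV: "closure V \<subseteq> {x. infdist x K \<le> e}"
    unfolding V_def by (intro closure_minimal closed_Collect_le continuous_intros) auto
  have "bounded V"
  proof -
    obtain B where B: "\<And>x. x \<in> K \<Longrightarrow> norm x \<le> B" using compact_imp_bounded[OF K(1)] by (auto simp: bounded_iff)
    have "norm x \<le> B + e" if x: "x \<in> V" for x
    proof -
      obtain k where k: "k \<in> K" "infdist x K = dist x k" using infdist_attains_inf[OF compact_imp_closed[OF K(1)] False] by blast
      then have "dist x k < e" using x by (simp add: V_def)
      then show ?thesis using B[OF k(1)] norm_triangle_sub[of x k] by (simp add: dist_norm)
    qed
    then show ?thesis by (auto simp: bounded_iff)
  qed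
  moreover have "open V" unfolding V_def by (intro open_Collect_less continuous_intros)
  moreover have "K \<subseteq> V" using e(1) by (auto simp: V_def)
  ultimately show ?thesis using cV e(2) by (intro exI[of _ V]) (auto simp: compact_closure)
qed

lemma C2_on_diff:
  assumes "C2_on N p p' p''" "C2_on N' q q' q''"
  shows "C2_on (N \<inter> N') (\<lambda>z. p z - q z) (\<lambda>z. p' z - q' z) (\<lambda>z. p'' z - q'' z)"
proof -
  have "((\<lambda>z. p z - q z) has_derivative blinfun_apply (p' z - q' z)) (at z)" if "z \<in> N \<inter> N'" for z
  proof -
    have "((\<lambda>z. p z - q z) has_derivative (\<lambda>h. p' z h - q' z h)) (at z)"
      using assms that by (intro has_derivative_diff) (auto simp: C2_on_def)
    then show ?thesis by (simp add: blinfun.diff_left[abs_def])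
  qed
  moreover have "((\<lambda>z. p' z - q' z) has_derivative blinfun_apply (p'' z - q'' z)) (at z)" if "z \<in> N \<inter> N'" for z
  proof -
    have "((\<lambda>z. p' z - q' z) has_derivative (\<lambda>h. p'' z h - q'' z h)) (at z)"
      using assms that by (intro has_derivative_diff) (auto simp: C2_on_def)
    then show ?thesis by (simp add: blinfun.diff_left[abs_def])
  qed
  ultimately show ?thesis using assms unfolding C2_on_def
    by (auto intro!: continuous_on_diff intro: continuous_on_subset)
qed

lemma C2_on_add_const: "C2_on N q q' q'' \<Longrightarrow> C2_on N (\<lambda>z. q z + m) q' q''"
  unfolding C2_on_def by (auto intro!: derivative_eq_intros)

lemma C2_on_isCont: "C2_on N q q' q'' \<Longrightarrow> z \<in> N \<Longrightarrow> isCont q z"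
  unfolding C2_on_def by (blast intro: has_derivative_continuous)

lemma isCont_nhds: "isCont g z \<longleftrightarrow> (g \<longlongrightarrow> g z) (nhds z)"
  unfolding isCont_def by (rule tendsto_at_iff_tendsto_nhds)

text \<open>
  The sum never meets \<open>\<infinity> - \<infinity>\<close> because the second summand is real.
\<close>

lemma usc_add_real:
  fixes w :: "'a::t2_space \<Rightarrow> ereal"
  assumes w: "\<And>c. w z < c \<Longrightarrow> \<forall>\<^sub>F y in nhds z. w y < c" and h: "isCont h z" and c: "w z + ereal (h z) < c"
  shows "\<forall>\<^sub>F y in nhds z. w y + ereal (h y) < c"
proof -
  have "w z < c - ereal (h z)" using c by (cases "w z"; cases c) auto
  then obtain t where t: "w z < ereal t" "ereal t < c - ereal (h z)" using ereal_dense2 by blast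
  then have "ereal (t + h z) < c" by (cases c) auto
  then obtain s where s: "ereal (t + h z) < ereal s" "ereal s < c" using ereal_dense2 by blast
  have "\<forall>\<^sub>F y in nhds z. h y < s - t" using h s(1) unfolding isCont_nhds by (intro order_tendstoD) auto
  then show ?thesis using w[OF t(1)]
  proof eventually_elim
    case (elim y)
    then have "w y + ereal (h y) \<le> ereal s" by (cases "w y") auto
    then show ?case using s(2) by (rule le_less_trans)
  qed
qed

context hessian_operator
begin

lemma subsol_cong:
  assumes D: "open D" and eq: "\<And>z. z \<in> D \<Longrightarrow> u z = w z" and u: "subsol \<psi> D u"
  shows "subsol \<psi> D w"
  unfolding subsol_def
proof (intro conjI allI impI ballI)
  have inD: "\<forall>\<^sub>F y in nhds z. y \<in> D" if "z \<in> D" for z using D that by (rule eventually_nhds_in_open)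
  show "usc_on D w" unfolding usc_on_open[OF D]
  proof (intro ballI allI impI)
    fix z c assume z: "z \<in> D" "w z < c"
    then have "\<forall>\<^sub>F y in nhds z. u y < c" using subsol_usc[OF D u, of z c] eq by simp
    then show "\<forall>\<^sub>F y in nhds z. w y < c" using inD[OF z(1)] by eventually_elim (simp add: eq)
  qed
  show "w z < \<infinity>" if "z \<in> D" for z using u that eq by (simp add: subsol_def)
  fix z N q q' q''
  assume z: "z \<in> D" "z \<in> N" "C2_on N q q' q''" "w z = ereal (q z)" "\<forall>\<^sub>F x in nhds z. w x \<le> ereal (q x)"
  have "\<forall>\<^sub>F x in nhds z. u x \<le> ereal (q x)" using z(5) inD[OF z(1)] by eventually_elim (simp add: eq)
  moreover have "u z = ereal (q z)" using z eq by simp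
  ultimately show "opge (\<psi> z) (q'' z)" using u z(1-3) unfolding subsol_def by blast
qed

lemma subsol_test:
  assumes "subsol \<psi> D u" "z \<in> D" "z \<in> N" "C2_on N q q' q''" "u z = ereal (q z)" "\<forall>\<^sub>F x in nhds z. u x \<le> ereal (q x)"
  shows "opge (\<psi> z) (q'' z)"
  using assms unfolding subsol_def by blast

lemma supersol_lsc:
  assumes D: "open D" and v: "supersol \<psi> D w" and z: "z \<in> D" "c < w z"
  shows "\<forall>\<^sub>F y in nhds z. c < w y"
proof -
  have "lsc_on D w" using v by (simp add: supersol_def)
  then show ?thesis unfolding lsc_on_open[OF D] using z by blast
qed

lemma subsol_subset:
  assumes D: "open D" "open D'" "D' \<subseteq> D" and u: "subsol \<psi> D u"
  shows "subsol \<psi> D' u"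
  using u D(3) unfolding subsol_def usc_on_open[OF D(1)] usc_on_open[OF D(2)] by blast

text \<open>
  A test function for the maximum is one for whichever function attains it.
\<close>

lemma subsol_max:
  assumes D: "open D" and u: "subsol \<psi> D u" and w: "subsol \<psi> D w"
  shows "subsol \<psi> D (\<lambda>z. max (u z) (w z))"
  unfolding subsol_def
proof (intro conjI allI impI ballI)
  show "usc_on D (\<lambda>z. max (u z) (w z))" unfolding usc_on_open[OF D]
  proof (intro ballI allI impI)
    fix z c assume z: "z \<in> D" "max (u z) (w z) < c"
    then have "\<forall>\<^sub>F y in nhds z. u y < c" "\<forall>\<^sub>F y in nhds z. w y < c" using subsol_usc[OF D u] subsol_usc[OF D w] by auto
    then show "\<forall>\<^sub>F y in nhds z. max (u y) (w y) < c" by eventually_elim simp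
  qed
  show "max (u z) (w z) < \<infinity>" if "z \<in> D" for z
    using u w that unfolding subsol_def max_def by (cases "u z \<le> w z") auto
  fix z N q q' q''
  assume z: "z \<in> D" "z \<in> N" "C2_on N q q' q''" "max (u z) (w z) = ereal (q z)" "\<forall>\<^sub>F x in nhds z. max (u x) (w x) \<le> ereal (q x)"
  have le: "\<forall>\<^sub>F x in nhds z. u x \<le> ereal (q x)" "\<forall>\<^sub>F x in nhds z. w x \<le> ereal (q x)"
    using z(5) by (auto elim: eventually_mono)
  have "u z = ereal (q z) \<or> w z = ereal (q z)" using z(4) by (auto simp: max_def split: if_splits)
  then show "opge (\<psi> z) (q'' z)"
    using subsol_test[OF u z(1-3) _ le(1)] subsol_test[OF w z(1-3) _ le(2)] by blast
qed

text \<open>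
  At a point of contact, a test function from above has the larger second derivative.
\<close>

lemma smooth_subsol:
  assumes D: "open D" and C: "C2_on N p p' p''" "D \<subseteq> N" and o: "\<And>z. z \<in> D \<Longrightarrow> opge (\<psi> z) (p'' z)"
  shows "subsol \<psi> D (\<lambda>z. ereal (p z))"
  unfolding subsol_def
proof (intro conjI allI impI ballI)
  show "usc_on D (\<lambda>z. ereal (p z))" unfolding usc_on_open[OF D]
  proof (intro ballI allI impI)
    fix z c assume z: "z \<in> D" "ereal (p z) < c"
    then obtain t where t: "ereal (p z) < ereal t" "ereal t < c" using ereal_dense2 by blast
    have "isCont p z" using C2_on_isCont[OF C(1)] C(2) z(1) by blast
    then have "\<forall>\<^sub>F y in nhds z. p y < t" using t(1) unfolding isCont_nhds by (intro order_tendstoD) auto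
    then show "\<forall>\<^sub>F y in nhds z. ereal (p y) < c"
    proof eventually_elim
      case (elim y)
      then have "ereal (p y) < ereal t" by simp
      then show ?case using t(2) by (rule less_trans)
    qed
  qed
  show "ereal (p z) < \<infinity>" for z by simp
  fix z N' q q' q''
  assume z: "z \<in> D" "z \<in> N'" "C2_on N' q q' q''" "ereal (p z) = ereal (q z)" "\<forall>\<^sub>F x in nhds z. ereal (p x) \<le> ereal (q x)"
  have zN: "z \<in> N' \<inter> N" using z C(2) by blast
  have "\<forall>\<^sub>F y in nhds z. q z - p z \<le> q y - p y" using z(5) by eventually_elim (use z(4) in simp)
  then have psd: "(q'' z - p'' z) h h \<ge> 0" for h by (rule C2_local_min[OF C2_on_diff[OF z(3) C(1)] zN])
  have "opge (\<psi> z) (p'' z + (q'' z - p'' z))"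
    by (rule opge_add[OF o[OF z(1)]]) (use psd in \<open>simp add: levi_def\<close>)
  then show "opge (\<psi> z) (q'' z)" by simp
qed

lemma superlevel_nonempty: "R > 0 \<Longrightarrow> f (R *\<^sub>R ones) \<ge> c \<Longrightarrow> superlevel c \<noteq> {}"
  using positive_in_cone[of "R *\<^sub>R ones"] closure_subset by (force simp: superlevel_def)

text \<open>
  The paraboloid \<open>\<delta> |z|\<^sup>2\<close> raises the operator by a fixed amount \<open>\<eta>\<close>, while the mollification lowers
  the right-hand side by at most \<open>\<eta> / 2\<close> by uniform continuity of \<open>\<psi>\<close>.
\<close>

lemma strict_smooth_approximation:
  fixes u :: "complex ^ 'n \<Rightarrow> real"
  assumes D: "open D" and u: "subsol \<psi> D (\<lambda>z. ereal (u z))" and M: "\<And>z. z \<in> D \<Longrightarrow> \<bar>u z\<bar> \<le> M"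
    and \<psi>: "continuous_on D \<psi>" "\<And>z. z \<in> D \<Longrightarrow> 0 \<le> \<psi> z" "\<And>z. z \<in> D \<Longrightarrow> \<psi> z \<le> c1"
    and R: "R > 0" "f (R *\<^sub>R ones) > c1" and K: "compact K" "K \<subseteq> D" and e: "e > 0" and r0: "r0 > 0"
  shows "\<exists>W W' W'' \<eta>. \<eta> > 0 \<and> C2_on UNIV W W' W'' \<and>
     (\<forall>x\<in>K. opge (\<psi> x + \<eta>) (W'' x) \<and> u x - e \<le> W x \<and> (\<forall>m. (\<forall>y\<in>cball x r0. u y \<le> m) \<longrightarrow> W x \<le> m + e))"
proof -
  obtain B where B: "\<And>x. x \<in> K \<Longrightarrow> norm x \<le> B" using compact_imp_bounded[OF K(1)] by (auto simp: bounded_iff)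
  define \<delta> where "\<delta> = e / (B\<^sup>2 + 1)"
  have den: "B\<^sup>2 + 1 > 0" by (simp add: add_nonneg_pos)
  have \<delta>: "\<delta> > 0" using e den by (simp add: \<delta>_def)
  have \<delta>K: "\<delta> * (norm x)\<^sup>2 \<le> e" if "x \<in> K" for x
  proof -
    have "(norm x)\<^sup>2 \<le> B\<^sup>2 + 1" using power_mono[OF B[OF that] norm_ge_zero, of 2] by simp
    then have "\<delta> * (norm x)\<^sup>2 \<le> \<delta> * (B\<^sup>2 + 1)" using \<delta> by (intro mult_left_mono) auto
    then show ?thesis using den by (simp add: \<delta>_def)
  qed
  obtain \<eta> where \<eta>: "\<eta> > 0" "\<And>c A. 0 \<le> c \<Longrightarrow> c \<le> c1 \<Longrightarrow> opge c A \<Longrightarrow> opge (c + \<eta>) (A + (2 * \<delta>) *\<^sub>R inner2)"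
    using opge_strict[OF R \<delta>] by blast
  have cont: "isCont \<psi> x" if "x \<in> D" for x using \<psi>(1) D that by (simp add: continuous_on_eq_continuous_at)
  obtain r1 where r1: "r1 > 0" "\<And>z y. z \<in> K \<Longrightarrow> y \<in> cball z r1 \<Longrightarrow> - \<psi> y < - \<psi> z + \<eta> / 2"
  proof -
    have "\<exists>r>0. \<forall>z\<in>K. \<forall>y\<in>cball z r. - \<psi> y < - \<psi> z + \<eta> / 2"
    proof (rule usc_lsc_separation[OF K(1)])
      fix z c assume z: "z \<in> K" "- \<psi> z < c"
      have "isCont (\<lambda>y. - \<psi> y) z" using cont z K by (intro continuous_intros) auto
      then show "\<forall>\<^sub>F y in nhds z. - \<psi> y < c" using z(2) isCont_nhds[where g = "\<lambda>y. - \<psi> y" and z = z] by (intro order_tendstoD) auto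
    next
      fix z c assume z: "z \<in> K" "c < - \<psi> z + \<eta> / 2"
      have "isCont (\<lambda>y. - \<psi> y + \<eta> / 2) z" using cont z K by (intro continuous_intros) auto
      then have "\<forall>\<^sub>F y in nhds z. c < - \<psi> y + \<eta> / 2"
        using z(2) isCont_nhds[where g = "\<lambda>y. - \<psi> y + \<eta> / 2" and z = z] by (intro order_tendstoD(1)[of _ "- \<psi> z + \<eta> / 2"]) auto
      then show "\<forall>\<^sub>F y in nhds z. y \<in> K \<longrightarrow> c < - \<psi> y + \<eta> / 2" by eventually_elim simp
    qed (use \<eta> in simp)
    then show ?thesis using that by blast
  qed
  obtain d where d: "d > 0" "\<And>x. x \<in> K \<Longrightarrow> cball x (2 * d) \<subseteq> D"
  proof (cases "K = {}")
    case True
    then show ?thesis using that[of 1] by simp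
  next
    case False
    obtain d where d: "d > 0" "{x. infdist x K \<le> d} \<subseteq> D"
      using compact_in_open_separated[OF False K(1) D K(2)] by blast
    have "cball x (2 * (d / 2)) \<subseteq> D" if "x \<in> K" for x
    proof
      fix y assume "y \<in> cball x (2 * (d / 2))"
      then have "infdist y K \<le> d" using infdist_le[OF that, of y] by (simp add: dist_commute)
      then show "y \<in> D" using d(2) by blast
    qed
    then show ?thesis using that[of "d / 2"] d(1) by simp
  qed
  define r where "r = min d (min (r1 / 2) r0)"
  have r: "r > 0" "r \<le> d" "2 * r \<le> r1" "r \<le> r0" using d r1 r0 by (auto simp: r_def)
  have sub: "cball x (2 * r) \<subseteq> D" if "x \<in> K" for x
    using d(2)[OF that] r(2) subset_cball[of "2 * r" "2 * d" x] by auto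
  obtain w w' w'' where w: "C2_on UNIV w w' w''" "\<And>x. x \<in> K \<Longrightarrow> u x - e \<le> w x"
    "\<And>x m. x \<in> K \<Longrightarrow> (\<forall>y\<in>cball x r. u y \<le> m) \<Longrightarrow> w x \<le> m"
    "\<And>x c. x \<in> K \<Longrightarrow> superlevel c \<noteq> {} \<Longrightarrow> (\<forall>y\<in>cball x (2 * r). \<psi> y \<ge> c) \<Longrightarrow> opge c (w'' x)"
    using subsol_mollification[OF D u r(1) sub M e, of K] by blast
  define W where "W z = w z + (\<delta> * (norm (z - 0))\<^sup>2 + 0)" for z
  define W' where "W' z = w' z + (2 * \<delta>) *\<^sub>R blinfun_inner_right (z - 0)" for z
  define W'' where "W'' z = w'' z + (2 * \<delta>) *\<^sub>R inner2" for z
  have "C2_on UNIV W W' W''" using C2_on_add[OF w(1) C2_quadratic[of \<delta> 0 0]] by (simp add: W_def[abs_def] W'_def[abs_def] W''_def[abs_def])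
  moreover have "opge (\<psi> x + \<eta> / 2) (W'' x)" if x: "x \<in> K" for x
  proof -
    \<comment> \<open>Truncation at 0 keeps \<open>c\<close> in the range where the gain \<open>\<eta>\<close> is uniform.\<close>
    define c where "c = max 0 (\<psi> x - \<eta> / 2)"
    have xD: "x \<in> D" using x K by blast
    have c: "0 \<le> c" "c \<le> c1" using \<psi>(2,3)[OF xD] \<eta>(1) by (auto simp: c_def)
    have "\<psi> y \<ge> c" if y: "y \<in> cball x (2 * r)" for y
    proof -
      have "y \<in> cball x r1" using y r(3) by auto
      then have "- \<psi> y < - \<psi> x + \<eta> / 2" using r1(2)[OF x] by blast
      moreover have "\<psi> y \<ge> 0" using \<psi>(2) sub[OF x] y by blast
      ultimately show ?thesis by (simp add: c_def)
    qed
    moreover have "superlevel c \<noteq> {}" using R c by (intro superlevel_nonempty[of R]) auto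
    ultimately have "opge c (w'' x)" using w(4)[OF x] by blast
    then have "opge (c + \<eta>) (W'' x)" unfolding W''_def by (rule \<eta>(2)[OF c])
    then show ?thesis by (rule opge_mono) (simp add: c_def)
  qed
  moreover have "u x - e \<le> W x" if "x \<in> K" for x using w(2)[OF that] \<delta> by (simp add: W_def add_increasing2)
  moreover have "W x \<le> m + e" if x: "x \<in> K" and m: "\<forall>y\<in>cball x r0. u y \<le> m" for x m
  proof -
    have "w x \<le> m" using m r(4) by (intro w(3)[OF x]) auto
    then show ?thesis using \<delta>K[OF x] by (simp add: W_def)
  qed
  moreover have "\<eta> / 2 > 0" using \<eta>(1) by simp
  ultimately show ?thesis by blast
qed

text \<open>
  The boundary values are compared through a compact set off which the inequality holds up to \<open>e\<close>, so
  neither function needs to be defined on the boundary. The subsolution is approximated by strict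
  smooth subsolutions \<open>W\<close>; at an interior maximum of \<open>W - v\<close> a translate of \<open>W\<close> touches the
  supersolution from below, which contradicts strictness. On the boundary of the smaller set the
  approximation from above is controlled by the semicontinuity of both functions.
\<close>

theorem comparison:
  assumes D: "open D" and \<psi>: "continuous_on D \<psi>" "\<And>z. z \<in> D \<Longrightarrow> 0 \<le> \<psi> z" "\<And>z. z \<in> D \<Longrightarrow> \<exists>R>0. f (R *\<^sub>R ones) > \<psi> z"
    and u: "subsol \<psi> D u" and v: "supersol \<psi> D (\<lambda>z. ereal (v z))"
    and bd: "\<And>e. e > 0 \<Longrightarrow> \<exists>K. compact K \<and> K \<subseteq> D \<and> (\<forall>z\<in>D - K. u z \<le> ereal (v z + e))"
    and z1: "z1 \<in> D"
  shows "u z1 \<le> ereal (v z1)"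
proof (rule ccontr)
  assume "\<not> ?thesis"
  then have "ereal (v z1) < u z1" by simp
  then obtain s where s: "ereal (v z1) < ereal s" "ereal s < u z1" using ereal_dense2 by blast
  define e where "e = (s - v z1) / 4"
  have e: "e > 0" using s(1) by (simp add: e_def)
  have "v z1 + 4 * e = s" by (simp add: e_def field_simps)
  then have gap: "ereal (v z1 + 4 * e) < u z1" using s(2) by simp
  obtain K where K: "compact K" "K \<subseteq> D" "\<And>z. z \<in> D \<Longrightarrow> z \<notin> K \<Longrightarrow> u z \<le> ereal (v z + e)" using bd[OF e] by blast
  obtain D2 where D2: "open D2" "insert z1 K \<subseteq> D2" "compact (closure D2)" "closure D2 \<subseteq> D"
    using open_relatively_compact_neighbourhood[of "insert z1 K" D] K(1,2) z1 D by auto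
  obtain D3 where D3: "open D3" "closure D2 \<subseteq> D3" "compact (closure D3)" "closure D3 \<subseteq> D"
    using open_relatively_compact_neighbourhood[OF D2(3,4) D] by blast
  have D3D: "D3 \<subseteq> D" using D3(4) closure_subset by blast
  have z12: "z1 \<in> closure D2" "closure D2 \<noteq> {}" "closure D3 \<noteq> {}" using D2(2) D3(2) closure_subset by blast+
  have "continuous_on (closure D3) \<psi>" using continuous_on_subset[OF \<psi>(1) D3(4)] .
  then obtain zs where zs: "zs \<in> closure D3" "\<And>z. z \<in> closure D3 \<Longrightarrow> \<psi> z \<le> \<psi> zs"
    using continuous_attains_sup[OF D3(3) z12(3)] by blast
  obtain R where R: "R > 0" "f (R *\<^sub>R ones) > \<psi> zs" using \<psi>(3)[of zs] zs(1) D3(4) by blast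
  have lsc: "\<forall>\<^sub>F y in nhds z. c < v y" if "z \<in> D" "c < v z" for z c
    using supersol_lsc[OF D v that(1), of "ereal c"] that(2) by simp
  have "\<exists>x\<in>closure D2. \<forall>y\<in>closure D2. - v y \<le> - v x"
  proof (rule usc_attains_max[OF D2(3) z12(2)])
    fix x c assume x: "x \<in> closure D2" "- v x < c"
    then have "\<forall>\<^sub>F y in nhds x. - c < v y" using D2(4) by (intro lsc) auto
    then have "\<forall>\<^sub>F y in nhds x. - v y < c" by eventually_elim simp
    then show "\<exists>U. open U \<and> x \<in> U \<and> (\<forall>y\<in>U \<inter> closure D2. - v y < c)" unfolding eventually_nhds by blast
  qed
  then obtain xm where xm: "\<And>y. y \<in> closure D2 \<Longrightarrow> v xm \<le> v y" by auto
  obtain B where B: "\<And>z. z \<in> closure D3 \<Longrightarrow> norm z \<le> B" using compact_imp_bounded[OF D3(3)] by (auto simp: bounded_iff)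
  \<comment> \<open>\<open>Q\<close> is a smooth subsolution that does not exceed the minimum of \<open>v\<close> on the closure of \<open>D2\<close>; the maximum with it makes
      \<open>u\<close> bounded and does not change \<open>u\<close> at points of this set where \<open>u\<close> exceeds \<open>v\<close>.\<close>
  define L where "L = R * B\<^sup>2 - v xm"
  define Q where "Q z = R * (norm (z - 0))\<^sup>2 + (- L)" for z :: "complex ^ 'n"
  have Qle: "Q z \<le> v xm" if "z \<in> closure D3" for z
  proof -
    have "(norm z)\<^sup>2 \<le> B\<^sup>2" using B[OF that] by (intro power_mono) auto
    then show ?thesis using R(1) by (simp add: Q_def L_def)
  qed
  have Qge: "Q z \<ge> - L" for z using R(1) by (simp add: Q_def)
  have Qsub: "subsol \<psi> D3 (\<lambda>z. ereal (Q z))"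
    unfolding Q_def
  proof (rule smooth_subsol[OF D3(1) C2_quadratic subset_UNIV])
    fix z assume "z \<in> D3"
    then show "opge (\<psi> z) ((2 * R) *\<^sub>R inner2)"
    proof -
      have "z \<in> closure D3" using \<open>z \<in> D3\<close> closure_subset by blast
      then have "\<psi> z \<le> f (R *\<^sub>R ones)" using zs(2) R(2) by (meson less_imp_le order_trans)
      then show ?thesis by (rule opge_quadratic[OF R(1)])
    qed
  qed
  define u1 where "u1 z = real_of_ereal (max (u z) (ereal (Q z)))" for z
  have u_fin: "u z < \<infinity>" if "z \<in> D" for z using u that by (simp add: subsol_def)
  have u1: "ereal (u1 z) = max (u z) (ereal (Q z))" if "z \<in> D" for z
  proof -
    have "u z \<noteq> \<infinity>" using u_fin[OF that] by simp
    then show ?thesis unfolding u1_def max_def by (cases "u z") auto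
  qed
  have sub1: "subsol \<psi> D3 (\<lambda>z. ereal (u1 z))"
    by (rule subsol_cong[OF D3(1) _ subsol_max[OF D3(1) subsol_subset[OF D D3(1) D3D u] Qsub]]) (use u1 D3D in auto)
  have "\<exists>x\<in>closure D3. \<forall>y\<in>closure D3. u y \<le> u x"
  proof (rule usc_attains_max[OF D3(3) z12(3)])
    fix x c assume "x \<in> closure D3" "u x < c"
    then have "\<forall>\<^sub>F y in nhds x. u y < c" using D3(4) by (intro subsol_usc[OF D u]) auto
    then show "\<exists>U. open U \<and> x \<in> U \<and> (\<forall>y\<in>U \<inter> closure D3. u y < c)" unfolding eventually_nhds by blast
  qed
  then obtain xM where xM: "xM \<in> closure D3" "\<And>y. y \<in> closure D3 \<Longrightarrow> u y \<le> u xM" by blast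
  obtain m where m: "u xM \<le> ereal m"
  proof (cases "u xM")
    case (real t) then show ?thesis using that[of t] by simp
  next
    case PInf then show ?thesis using u_fin[of xM] xM(1) D3(4) by auto
  next
    case MInf then show ?thesis using that[of 0] by simp
  qed
  define M where "M = \<bar>m\<bar> + \<bar>v xm\<bar> + \<bar>L\<bar>"
  have u1b: "\<bar>u1 z\<bar> \<le> M" if z: "z \<in> D3" for z
  proof -
    have zc: "z \<in> closure D3" "z \<in> D" using z D3D closure_subset by blast+
    have "ereal (u1 z) \<le> ereal (max m (v xm))" unfolding u1[OF zc(2)]
      using order_trans[OF xM(2)[OF zc(1)] m] Qle[OF zc(1)] by (auto simp: max_def intro: order_trans)
    then have "u1 z \<le> max m (v xm)" by (simp only: ereal_less_eq)
    moreover have "ereal (Q z) \<le> ereal (u1 z)" unfolding u1[OF zc(2)] by simp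
    ultimately show ?thesis using Qge[of z] by (simp add: M_def)
  qed
  define S where "S = frontier D2"
  have "bounded D2" by (rule bounded_subset[OF compact_imp_bounded[OF D2(3)] closure_subset])
  then have S: "compact S" "S \<subseteq> closure D2" unfolding S_def by (rule compact_frontier_bounded, simp add: frontier_def)
  have SD: "S \<subseteq> D3" "S \<subseteq> D" using S(2) D3(2) D2(4) by auto
  have SK: "z \<notin> K" if "z \<in> S" for z using that D2(1,2) by (auto simp: S_def frontier_def interior_open)
  have uS: "u1 z < v z + 2 * e" if z: "z \<in> S" for z
  proof -
    have zD: "z \<in> D" "z \<in> closure D2" "z \<in> closure D3" using z S SD closure_subset by blast+
    have "ereal (u1 z) \<le> ereal (v z + e)" unfolding u1[OF zD(1)]
      using K(3)[OF zD(1) SK[OF z]] Qle[OF zD(3)] xm[OF zD(2)] e by simp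
    then show ?thesis using e by simp
  qed
  have "\<exists>r>0. \<forall>z\<in>S. \<forall>y\<in>cball z r. u1 y < v z + 2 * e"
  proof (rule usc_lsc_separation[OF S(1) _ _ uS])
    fix z c assume "z \<in> S" "u1 z < c"
    then show "\<forall>\<^sub>F y in nhds z. u1 y < c" using subsol_usc[OF D3(1) sub1, of z "ereal c"] SD by auto
  next
    fix z c assume "z \<in> S" "c < v z + 2 * e"
    then have "\<forall>\<^sub>F y in nhds z. c - 2 * e < v y" using SD by (intro lsc) auto
    then show "\<forall>\<^sub>F y in nhds z. y \<in> S \<longrightarrow> c < v y + 2 * e" by eventually_elim simp
  qed
  then obtain r where r: "r > 0" "\<And>z y. z \<in> S \<Longrightarrow> y \<in> cball z r \<Longrightarrow> u1 y < v z + 2 * e" by blast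
  have e2: "e / 2 > 0" using e by simp
  have \<psi>3: "continuous_on D3 \<psi>" using continuous_on_subset[OF \<psi>(1) D3D] .
  have p0: "0 \<le> \<psi> z" "\<psi> z \<le> \<psi> zs" if "z \<in> D3" for z
    using \<psi>(2) zs(2) D3D closure_subset that by blast+
  have "\<exists>W W' W'' \<eta>. \<eta> > 0 \<and> C2_on UNIV W W' W'' \<and>
     (\<forall>x\<in>closure D2. opge (\<psi> x + \<eta>) (W'' x) \<and> u1 x - e / 2 \<le> W x \<and> (\<forall>m. (\<forall>y\<in>cball x r. u1 y \<le> m) \<longrightarrow> W x \<le> m + e / 2))"
    by (rule strict_smooth_approximation[OF D3(1) sub1 u1b \<psi>3 p0 R D2(3) D3(2) e2 r(1)])
  then obtain W W' W'' \<eta> where A: "\<eta> > 0 \<and> C2_on UNIV W W' W'' \<and>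
     (\<forall>x\<in>closure D2. opge (\<psi> x + \<eta>) (W'' x) \<and> u1 x - e / 2 \<le> W x \<and> (\<forall>m. (\<forall>y\<in>cball x r. u1 y \<le> m) \<longrightarrow> W x \<le> m + e / 2))"
    by (elim exE)
  then have \<eta>: "\<eta> > 0" and C: "C2_on UNIV W W' W''" by blast+
  have W: "\<And>x. x \<in> closure D2 \<Longrightarrow> opge (\<psi> x + \<eta>) (W'' x)" "\<And>x. x \<in> closure D2 \<Longrightarrow> u1 x - e / 2 \<le> W x"
    "\<And>x m. x \<in> closure D2 \<Longrightarrow> (\<forall>y\<in>cball x r. u1 y \<le> m) \<Longrightarrow> W x \<le> m + e / 2"
    using A by blast+
  have contW: "isCont W z" for z using C2_on_isCont[OF C] by simp
  have "\<exists>x\<in>closure D2. \<forall>y\<in>closure D2. W y - v y \<le> W x - v x"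
  proof (rule usc_attains_max[OF D2(3) z12(2)])
    fix x c assume x: "x \<in> closure D2" "W x - v x < c"
    define t where "t = (c - (W x - v x)) / 2"
    have t: "t > 0" using x(2) by (simp add: t_def)
    have "\<forall>\<^sub>F y in nhds x. W y < W x + t" using contW[of x] t unfolding isCont_nhds by (intro order_tendstoD) auto
    moreover have "\<forall>\<^sub>F y in nhds x. v x - t < v y" using x D2(4) t by (intro lsc) auto
    ultimately have "\<forall>\<^sub>F y in nhds x. W y - v y < c" by eventually_elim (simp add: t_def field_simps)
    then show "\<exists>U. open U \<and> x \<in> U \<and> (\<forall>y\<in>U \<inter> closure D2. W y - v y < c)" unfolding eventually_nhds by blast
  qed
  then obtain z where z: "z \<in> closure D2" "\<And>y. y \<in> closure D2 \<Longrightarrow> W y - v y \<le> W z - v z" by blast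
  have "ereal (v z1 + 4 * e) < ereal (u1 z1)" unfolding u1[OF z1] using gap by (simp add: less_max_iff_disj)
  then have big: "W z1 - v z1 > 3 * e" using W(2)[OF z12(1)] e by simp
  show False
  proof (cases "z \<in> D2")
    case False
    then have zS: "z \<in> S" using z(1) D2(1) by (simp add: S_def frontier_def interior_open)
    have "W z \<le> (v z + 2 * e) + e / 2"
      by (rule W(3)[OF z(1)]) (use r(2)[OF zS] in \<open>auto intro: less_imp_le\<close>)
    then show False using z(2)[OF z12(1)] big e by linarith
  next
    case True
    have zD: "z \<in> D" using z(1) D2(4) by blast
    have "\<forall>\<^sub>F y in nhds z. y \<in> D2" using D2(1) True by (rule eventually_nhds_in_open)
    then have le: "\<forall>\<^sub>F y in nhds z. ereal (v y) \<ge> ereal (W y + (v z - W z))"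
    proof eventually_elim
      case (elim y)
      then have "W y - v y \<le> W z - v z" using z(2) closure_subset by blast
      then show ?case by simp
    qed
    have C': "C2_on UNIV (\<lambda>y. W y + (v z - W z)) W' W''" by (rule C2_on_add_const[OF C])
    have "\<not> opge (\<psi> z + \<eta>) (W'' z)"
      using v[unfolded supersol_def, THEN conjunct2, THEN conjunct2, rule_format, OF zD UNIV_I C' _ le, of "\<psi> z + \<eta>"] \<eta> by simp
    then show False using W(1)[OF z(1)] by simp
  qed
qed

text \<open>
  Stability of the viscosity inequality in the form that serves suprema and decreasing limits alike:
  it suffices that subsolutions lie below \<open>q + \<delta>\<close> on a fixed ball and come within \<open>\<delta>\<close> of \<open>q\<close>
  close to \<open>z0\<close>. A small paraboloid moves the contact to a nearby point.
\<close>

theorem subsol_stability: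
  assumes D: "open D" "z0 \<in> D" and \<psi>: "continuous_on D \<psi>" and C: "C2_on N q q' q''" "z0 \<in> N"
    and r0: "r0 > 0"
    and w: "\<And>\<delta>. \<delta> > 0 \<Longrightarrow> \<exists>w. subsol \<psi> D w \<and> (\<forall>y\<in>ball z0 r0. w y \<le> ereal (q y + \<delta>)) \<and> (\<exists>y\<in>ball z0 \<delta>. w y \<ge> ereal (q z0 - \<delta>))"
  shows "opge (\<psi> z0) (q'' z0)"
proof (rule opge_limit)
  fix \<epsilon> :: real assume \<epsilon>: "\<epsilon> > 0"
  let ?I = "inner2 :: (complex ^ 'n) \<Rightarrow>\<^sub>L (complex ^ 'n) \<Rightarrow>\<^sub>L real"
  define a where "a = \<epsilon> / (4 * (norm ?I + 1))"
  have nI: "norm ?I + 1 > 0" by (simp add: add_nonneg_pos)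
  have a: "a > 0" "2 * a * norm ?I < \<epsilon> / 2 + \<epsilon> / 4"
  proof -
    show "a > 0" using \<epsilon> nI by (simp add: a_def)
    then have "2 * a * norm ?I \<le> 2 * a * (norm ?I + 1)" by simp
    also have "\<dots> = \<epsilon> / 2" using nI by (simp add: a_def field_simps)
    finally show "2 * a * norm ?I < \<epsilon> / 2 + \<epsilon> / 4" using \<epsilon> by linarith
  qed
  have N: "open N" using C by (simp add: C2_on_def)
  have "isCont q'' z0" using C by (auto simp: C2_on_def continuous_on_eq_continuous_at)
  then have "\<forall>\<^sub>F y in nhds z0. dist (q'' y) (q'' z0) < \<epsilon> / 4" unfolding isCont_nhds by (rule tendstoD) (use \<epsilon> in simp)
  moreover have "isCont \<psi> z0" using \<psi> D by (simp add: continuous_on_eq_continuous_at)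
  then have "\<forall>\<^sub>F y in nhds z0. \<psi> y > \<psi> z0 - \<epsilon>" using \<epsilon> unfolding isCont_nhds by (intro order_tendstoD) auto
  moreover have "\<forall>\<^sub>F y in nhds z0. y \<in> N" "\<forall>\<^sub>F y in nhds z0. y \<in> D" using N C D by (auto intro: eventually_nhds_in_open)
  ultimately have "\<forall>\<^sub>F y in nhds z0. dist (q'' y) (q'' z0) < \<epsilon> / 4 \<and> \<psi> y > \<psi> z0 - \<epsilon> \<and> y \<in> N \<and> y \<in> D" by eventually_elim simp
  then obtain d where d: "d > 0" "\<And>y. dist y z0 < d \<Longrightarrow> dist (q'' y) (q'' z0) < \<epsilon> / 4 \<and> \<psi> y > \<psi> z0 - \<epsilon> \<and> y \<in> N \<and> y \<in> D"
    unfolding eventually_nhds_metric by blast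
  define \<rho> where "\<rho> = min d r0 / 2"
  have \<rho>: "\<rho> > 0" "\<rho> < d" "\<rho> < r0" using d r0 by (auto simp: \<rho>_def)
  \<comment> \<open>The paraboloid is \<open>8 t\<close> on the sphere of radius \<open>\<rho>\<close> and at most \<open>t\<close> where the approximants are close to \<open>q\<close>.\<close>
  define t where "t = a * \<rho>\<^sup>2 / 8"
  have t: "t > 0" using a \<rho> by (simp add: t_def)
  have "\<forall>\<^sub>F y in nhds z0. q y < q z0 + t" using C2_on_isCont[OF C] t unfolding isCont_nhds by (intro order_tendstoD) auto
  then obtain d2 where d2: "d2 > 0" "\<And>y. dist y z0 < d2 \<Longrightarrow> q y < q z0 + t" unfolding eventually_nhds_metric by blast
  define \<delta> where "\<delta> = min (min t d2) (\<rho> / 4)"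
  have \<delta>: "\<delta> > 0" "\<delta> \<le> t" "\<delta> \<le> d2" "\<delta> \<le> \<rho> / 4" using t d2 \<rho> by (auto simp: \<delta>_def)
  obtain w y' where w: "subsol \<psi> D w" "\<And>y. y \<in> ball z0 r0 \<Longrightarrow> w y \<le> ereal (q y + \<delta>)" and y': "y' \<in> ball z0 \<delta>" "w y' \<ge> ereal (q z0 - \<delta>)"
    using w[OF \<delta>(1)] by blast
  let ?P = "\<lambda>y. q y + (a * (norm (y - z0))\<^sup>2 + 0)"
  let ?g = "\<lambda>y. w y + ereal (- ?P y)"
  have y'c: "y' \<in> cball z0 \<rho>" using y' \<delta> \<rho> by auto
  have "\<exists>x\<in>cball z0 \<rho>. \<forall>y\<in>cball z0 \<rho>. ?g y \<le> ?g x"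
  proof (rule usc_attains_max)
    show "cball z0 \<rho> \<noteq> {}" using y'c by blast
    fix x c assume x: "x \<in> cball z0 \<rho>" "?g x < c"
    have xd: "dist x z0 < d" using x(1) \<rho> by (simp add: dist_commute)
    have "isCont q x" by (rule C2_on_isCont[OF C(1)]) (use d(2)[OF xd] in blast)
    then have "isCont (\<lambda>y. - ?P y) x" by (intro continuous_intros)
    moreover have "\<forall>\<^sub>F y in nhds x. w y < b" if "w x < b" for b
      by (rule subsol_usc[OF D(1) w(1) _ that]) (use d(2)[OF xd] in blast)
    ultimately have "\<forall>\<^sub>F y in nhds x. ?g y < c"
      using usc_add_real[of w x "\<lambda>y. - ?P y" c] x(2) by blast
    then show "\<exists>U. open U \<and> x \<in> U \<and> (\<forall>y\<in>U \<inter> cball z0 \<rho>. ?g y < c)" unfolding eventually_nhds by blast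
  qed simp
  then obtain x where x: "x \<in> cball z0 \<rho>" "\<And>y. y \<in> cball z0 \<rho> \<Longrightarrow> ?g y \<le> ?g x" by blast
  have xd: "dist x z0 < d" using x(1) \<rho> by (simp add: dist_commute)
  note X = d(2)[OF xd]
  have low: "ereal (- 3 * t) \<le> ?g x"
  proof -
    have "dist y' z0 < \<delta>" using y' by (simp add: dist_commute)
    then have "(norm (y' - z0))\<^sup>2 \<le> (\<rho> / 4)\<^sup>2" using \<delta> by (intro power_mono) (auto simp: dist_norm)
    then have "a * (norm (y' - z0))\<^sup>2 \<le> a * (\<rho> / 4)\<^sup>2" using a by (intro mult_left_mono) auto
    also have "\<dots> \<le> t" using a by (simp add: t_def power_divide)
    finally have 1: "a * (norm (y' - z0))\<^sup>2 \<le> t" .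
    have "q y' < q z0 + t" using d2(2)[of y'] \<open>dist y' z0 < \<delta>\<close> \<delta> by simp
    then have "- 3 * t \<le> (q z0 - \<delta>) + (- ?P y')" using 1 \<delta> by linarith
    then have "ereal (- 3 * t) \<le> ereal (q z0 - \<delta>) + ereal (- ?P y')" by simp
    also have "\<dots> \<le> ?g y'" using y'(2) by (intro add_mono) auto
    also have "\<dots> \<le> ?g x" by (rule x(2)[OF y'c])
    finally show ?thesis .
  qed
  have wfin: "w x < \<infinity>" using w(1) X by (simp add: subsol_def)
  obtain wx where wx: "w x = ereal wx" using low wfin by (cases "w x") auto
  have "dist x z0 < \<rho>"
  proof (rule ccontr)
    assume "\<not> dist x z0 < \<rho>"
    then have "norm (x - z0) = \<rho>" using x(1) by (simp add: dist_norm norm_minus_commute)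
    then have "a * (norm (x - z0))\<^sup>2 = 8 * t" by (simp add: t_def)
    moreover have "wx \<le> q x + \<delta>" using w(2)[of x] x(1) \<rho> wx by simp
    ultimately have "wx - ?P x \<le> - 7 * t" using \<delta> by simp
    moreover have "- 3 * t \<le> wx - ?P x" using low by (simp add: wx)
    ultimately show False using t by linarith
  qed
  then have "\<forall>\<^sub>F y in nhds x. y \<in> ball z0 \<rho>" by (intro eventually_nhds_in_open) (auto simp: dist_commute)
  then have le: "\<forall>\<^sub>F y in nhds x. w y \<le> ereal (?P y + (wx - ?P x))"
  proof eventually_elim
    case (elim y)
    then have "?g y \<le> ?g x" by (intro x(2)) auto
    then show ?case by (cases "w y") (auto simp: wx)
  qed
  have C': "C2_on (N \<inter> UNIV) (\<lambda>y. ?P y + (wx - ?P x)) (\<lambda>z. q' z + (2 * a) *\<^sub>R blinfun_inner_right (z - z0)) (\<lambda>z. q'' z + (2 * a) *\<^sub>R inner2)"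
    by (rule C2_on_add_const[OF C2_on_add[OF C(1) C2_quadratic]])
  have op: "opge (\<psi> x) (q'' x + (2 * a) *\<^sub>R ?I)"
    by (rule subsol_test[OF w(1) _ _ C' _ le]) (use X wx in auto)
  have "norm (q'' x + (2 * a) *\<^sub>R ?I - q'' z0) < \<epsilon>"
  proof -
    have "norm (q'' x + (2 * a) *\<^sub>R ?I - q'' z0) \<le> norm (q'' x - q'' z0) + norm ((2 * a) *\<^sub>R ?I)"
      using norm_triangle_ineq[of "q'' x - q'' z0" "(2 * a) *\<^sub>R ?I"] by (simp add: algebra_simps)
    also have "\<dots> < \<epsilon> / 4 + (\<epsilon> / 2 + \<epsilon> / 4)" using X a by (intro add_strict_mono) (auto simp: dist_norm)
    finally show ?thesis by simp
  qed
  then show "\<exists>c' A'. c' > \<psi> z0 - \<epsilon> \<and> norm (A' - q'' z0) < \<epsilon> \<and> opge c' A'" using X op by blast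
qed

end

section \<open>Suprema and decreasing limits of subsolutions\<close>

text \<open>
  Upper semicontinuous regularisation relative to \<open>D\<close>; with \<open>y = z\<close> included, it majorises \<open>S\<close> on \<open>D\<close>.
\<close>

definition usc_env :: "'a::metric_space set \<Rightarrow> ('a \<Rightarrow> ereal) \<Rightarrow> 'a \<Rightarrow> ereal" where
  "usc_env D S z = (INF r\<in>{0<..}. SUP y\<in>ball z r \<inter> D. S y)"

lemma usc_env_ge: "z \<in> D \<Longrightarrow> S z \<le> usc_env D S z"
  unfolding usc_env_def by (rule INF_greatest, rule SUP_upper) auto

lemma usc_env_upper: "r > 0 \<Longrightarrow> usc_env D S z \<le> (SUP y\<in>ball z r \<inter> D. S y)"
  unfolding usc_env_def by (rule INF_lower) simp

lemma usc_env_le: "r > 0 \<Longrightarrow> (\<And>y. y \<in> ball z r \<Longrightarrow> y \<in> D \<Longrightarrow> S y \<le> c) \<Longrightarrow> usc_env D S z \<le> c"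
  by (rule order_trans[OF usc_env_upper]) (auto intro!: SUP_least)

lemma usc_env_less:
  assumes "usc_env D S z < c"
  shows "\<exists>r>0. (SUP y\<in>ball z r \<inter> D. S y) < c"
  using assms unfolding usc_env_def INF_less_iff by auto

lemma usc_env_eventually:
  assumes "usc_env D S z < c"
  shows "\<forall>\<^sub>F y in nhds z. usc_env D S y < c"
proof -
  obtain r where r: "r > 0" "(SUP y\<in>ball z r \<inter> D. S y) < c" using usc_env_less[OF assms] by blast
  have "usc_env D S y < c" if y: "dist y z < r" for y
  proof -
    have "usc_env D S y \<le> (SUP x\<in>ball z r \<inter> D. S x)"
    proof (rule usc_env_le)
      show "r - dist y z > 0" using y by simp
      fix x assume x: "x \<in> ball y (r - dist y z)" "x \<in> D"
      have "dist z x \<le> dist y z + dist y x" using dist_triangle[of z x y] by (simp add: dist_commute)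
      then have "x \<in> ball z r \<inter> D" using x by simp
      then show "S x \<le> (SUP x\<in>ball z r \<inter> D. S x)" by (rule SUP_upper)
    qed
    then show ?thesis using r(2) by (rule le_less_trans)
  qed
  then show ?thesis using r(1) unfolding eventually_nhds_metric by blast
qed

lemma usc_env_approx:
  assumes "a < usc_env D S z" "r > 0"
  shows "\<exists>y\<in>ball z r \<inter> D. a < S y"
  using less_le_trans[OF assms(1) usc_env_upper[OF assms(2)]] unfolding less_SUP_iff .

lemma usc_env_le_continuous:
  fixes b :: "'a::metric_space \<Rightarrow> real"
  assumes b: "isCont b z" and le: "\<forall>\<^sub>F y in nhds z. y \<in> D \<longrightarrow> S y \<le> ereal (b y)"
  shows "usc_env D S z \<le> ereal (b z)"
proof (rule ereal_le_epsilon2)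
  fix e :: real assume e: "e > 0"
  have "\<forall>\<^sub>F y in nhds z. b y < b z + e" using b e unfolding isCont_nhds by (intro order_tendstoD) auto
  then have "\<forall>\<^sub>F y in nhds z. y \<in> D \<longrightarrow> S y \<le> ereal (b z + e)"
    using le
  proof eventually_elim
    case (elim y)
    then have "ereal (b y) \<le> ereal (b z + e)" by simp
    then show ?case using elim(2) order_trans by blast
  qed
  then obtain r where "r > 0" "\<And>y. dist y z < r \<Longrightarrow> y \<in> D \<longrightarrow> S y \<le> ereal (b z + e)"
    unfolding eventually_nhds_metric by blast
  then have "usc_env D S z \<le> ereal (b z + e)" by (intro usc_env_le[of r]) (auto simp: dist_commute)
  then show "usc_env D S z \<le> ereal (b z) + ereal e" by simp
qed

context hessian_operator
begin

theorem sup_subsol: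
  assumes D: "open D" and \<psi>: "continuous_on D \<psi>" and F: "\<And>w. w \<in> F \<Longrightarrow> subsol \<psi> D w"
    and fin: "\<And>z. z \<in> D \<Longrightarrow> usc_env D (\<lambda>z. SUP w\<in>F. w z) z < \<infinity>"
  shows "subsol \<psi> D (usc_env D (\<lambda>z. SUP w\<in>F. w z))"
  unfolding subsol_def
proof (intro conjI allI impI ballI)
  let ?S = "\<lambda>z. SUP w\<in>F. w z"
  show "usc_on D (usc_env D ?S)" unfolding usc_on_open[OF D] using usc_env_eventually by blast
  show "usc_env D ?S z < \<infinity>" if "z \<in> D" for z by (rule fin[OF that])
  fix z N q q' q''
  assume z: "z \<in> D" "z \<in> N" "C2_on N q q' q''" "usc_env D ?S z = ereal (q z)" "\<forall>\<^sub>F x in nhds z. usc_env D ?S x \<le> ereal (q x)"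
  have "\<forall>\<^sub>F x in nhds z. x \<in> D" using D z(1) by (rule eventually_nhds_in_open)
  then have "\<forall>\<^sub>F x in nhds z. x \<in> D \<and> usc_env D ?S x \<le> ereal (q x)" using z(5) by eventually_elim simp
  then obtain r0 where r0: "r0 > 0" "\<And>x. dist x z < r0 \<Longrightarrow> x \<in> D \<and> usc_env D ?S x \<le> ereal (q x)"
    unfolding eventually_nhds_metric by blast
  show "opge (\<psi> z) (q'' z)"
  proof (rule subsol_stability[OF D z(1) \<psi> z(3,2) r0(1)])
    fix \<delta> :: real assume \<delta>: "\<delta> > 0"
    have "ereal (q z - \<delta>) < usc_env D ?S z" using \<delta> z(4) by simp
    from usc_env_approx[OF this \<delta>] obtain y where y: "y \<in> ball z \<delta>" "ereal (q z - \<delta>) < ?S y" by blast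
    then obtain w where w: "w \<in> F" "ereal (q z - \<delta>) < w y" unfolding less_SUP_iff by blast
    have "w x \<le> ereal (q x + \<delta>)" if x: "x \<in> ball z r0" for x
    proof -
      have xx: "x \<in> D" "usc_env D ?S x \<le> ereal (q x)" using r0(2)[of x] x by (auto simp: dist_commute)
      have "w x \<le> ?S x" using w(1) by (rule SUP_upper)
      also have "\<dots> \<le> usc_env D ?S x" using xx(1) by (rule usc_env_ge)
      also have "\<dots> \<le> ereal (q x + \<delta>)" using xx(2) \<delta> by (auto intro: order_trans)
      finally show ?thesis .
    qed
    then show "\<exists>w. subsol \<psi> D w \<and> (\<forall>y\<in>ball z r0. w y \<le> ereal (q y + \<delta>)) \<and> (\<exists>y\<in>ball z \<delta>. w y \<ge> ereal (q z - \<delta>))"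
      using F[OF w(1)] w(2) y(1) by (intro exI[of _ w]) (auto intro: less_imp_le)
  qed
qed

text \<open>
  Dini's argument provides, for each \<open>\<delta>\<close>, one index at which \<open>w\<close> lies below \<open>q + \<delta>\<close> on a whole ball.
\<close>

theorem decreasing_limit_subsol:
  fixes w :: "nat \<Rightarrow> complex ^ 'n \<Rightarrow> ereal"
  assumes D: "open D" and \<psi>: "continuous_on D \<psi>" and w: "\<And>j. subsol \<psi> D (w j)"
    and dec: "\<And>j z. z \<in> D \<Longrightarrow> w (Suc j) z \<le> w j z"
  shows "subsol \<psi> D (\<lambda>z. INF j. w j z)"
  unfolding subsol_def
proof (intro conjI allI impI ballI)
  let ?W = "\<lambda>z. INF j. w j z"
  have mono: "w k z \<le> w j z" if "j \<le> k" "z \<in> D" for j k z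
    using that(1) by (induction k rule: dec_induct) (use dec[OF that(2)] order_trans in auto)
  show "usc_on D ?W" unfolding usc_on_open[OF D]
  proof (intro ballI allI impI)
    fix z c assume z: "z \<in> D" "?W z < c"
    then obtain j where "w j z < c" unfolding INF_less_iff by blast
    then have "\<forall>\<^sub>F y in nhds z. w j y < c" by (rule subsol_usc[OF D w z(1)])
    then show "\<forall>\<^sub>F y in nhds z. ?W y < c" by eventually_elim (auto intro: le_less_trans[OF INF_lower])
  qed
  show "?W z < \<infinity>" if "z \<in> D" for z
  proof -
    have "w 0 z < \<infinity>" using w[of 0] that by (simp add: subsol_def)
    then show ?thesis by (rule le_less_trans[OF INF_lower[OF UNIV_I]])
  qed
  fix z N q q' q''
  assume z: "z \<in> D" "z \<in> N" "C2_on N q q' q''" "?W z = ereal (q z)" "\<forall>\<^sub>F x in nhds z. ?W x \<le> ereal (q x)"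
  have N: "open N" using z(3) by (simp add: C2_on_def)
  have "\<forall>\<^sub>F x in nhds z. x \<in> D" "\<forall>\<^sub>F x in nhds z. x \<in> N" using D N z(1,2) by (auto intro: eventually_nhds_in_open)
  then have "\<forall>\<^sub>F x in nhds z. x \<in> D \<and> x \<in> N \<and> ?W x \<le> ereal (q x)" using z(5) by eventually_elim simp
  then obtain r1 where r1: "r1 > 0" "\<And>x. dist x z < r1 \<Longrightarrow> x \<in> D \<and> x \<in> N \<and> ?W x \<le> ereal (q x)"
    unfolding eventually_nhds_metric by blast
  define r0 where "r0 = r1 / 2"
  have r0: "r0 > 0" using r1 by (simp add: r0_def)
  have B: "x \<in> D \<and> x \<in> N \<and> ?W x \<le> ereal (q x)" if "x \<in> cball z r0" for x
    using that r1 by (intro r1(2)) (auto simp: r0_def dist_commute)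
  show "opge (\<psi> z) (q'' z)"
  proof (rule subsol_stability[OF D z(1) \<psi> z(3,2) r0])
    fix \<delta> :: real assume \<delta>: "\<delta> > 0"
    have "\<exists>j U. open U \<and> x \<in> U \<and> (\<forall>y\<in>U. w j y < ereal (q y + \<delta>))" if x: "x \<in> cball z r0" for x
    proof -
      have "?W x \<le> ereal (q x)" using B[OF x] by blast
      also have "\<dots> < ereal (q x + \<delta> / 2)" using \<delta> by simp
      finally obtain j where j: "w j x < ereal (q x + \<delta> / 2)" unfolding INF_less_iff by blast
      have "\<forall>\<^sub>F y in nhds x. w j y < ereal (q x + \<delta> / 2)" by (rule subsol_usc[OF D w _ j]) (use B[OF x] in blast)
      moreover have "isCont q x" by (rule C2_on_isCont[OF z(3)]) (use B[OF x] in blast)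
      then have "\<forall>\<^sub>F y in nhds x. q x - \<delta> / 2 < q y" using \<delta> unfolding isCont_nhds by (intro order_tendstoD) auto
      ultimately have "\<forall>\<^sub>F y in nhds x. w j y < ereal (q y + \<delta>)"
      proof eventually_elim
        case (elim y)
        have "ereal (q x + \<delta> / 2) \<le> ereal (q y + \<delta>)" using elim(2) by simp
        then show ?case using elim(1) by (rule less_le_trans[rotated])
      qed
      then show ?thesis unfolding eventually_nhds by blast
    qed
    then have "\<forall>x. \<exists>jU. x \<in> cball z r0 \<longrightarrow> open (snd jU) \<and> x \<in> snd jU \<and> (\<forall>y\<in>snd jU. w (fst jU) y < ereal (q y + \<delta>))"
      by (metis fst_conv snd_conv)
    then obtain jU where jU: "\<And>x. x \<in> cball z r0 \<Longrightarrow> open (snd (jU x)) \<and> x \<in> snd (jU x) \<and> (\<forall>y\<in>snd (jU x). w (fst (jU x)) y < ereal (q y + \<delta>))"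
      by metis
    have op: "\<And>x. x \<in> cball z r0 \<Longrightarrow> open (snd (jU x))" using jU by blast
    have cov: "cball z r0 \<subseteq> (\<Union>x\<in>cball z r0. snd (jU x))" using jU by blast
    obtain T where T: "T \<subseteq> cball z r0" "finite T" "cball z r0 \<subseteq> (\<Union>x\<in>T. snd (jU x))"
      by (rule compactE_image[OF compact_cball op cov]) (assumption, rule that)
    define J where "J = Max (insert 0 ((\<lambda>x. fst (jU x)) ` T))"
    have "w J y \<le> ereal (q y + \<delta>)" if y: "y \<in> ball z r0" for y
    proof -
      have yc: "y \<in> cball z r0" using y by auto
      then obtain x where x: "x \<in> T" "y \<in> snd (jU x)" using T(3) by blast
      have "fst (jU x) \<le> J" unfolding J_def using T(2) x(1) by (intro Max_ge) auto
      then have "w J y \<le> w (fst (jU x)) y" using B[OF yc] by (intro mono) auto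
      also have "\<dots> \<le> ereal (q y + \<delta>)" using jU x T(1) by (intro less_imp_le) blast
      finally show ?thesis .
    qed
    moreover have "w J z \<ge> ereal (q z - \<delta>)"
    proof -
      have "ereal (q z - \<delta>) \<le> ?W z" unfolding z(4) using \<delta> by simp
      also have "\<dots> \<le> w J z" by (rule INF_lower) simp
      finally show ?thesis .
    qed
    moreover have "z \<in> ball z \<delta>" using \<delta> by simp
    ultimately show "\<exists>w. subsol \<psi> D w \<and> (\<forall>y\<in>ball z r0. w y \<le> ereal (q y + \<delta>)) \<and> (\<exists>y\<in>ball z \<delta>. w y \<ge> ereal (q z - \<delta>))"
      using w by blast
  qed
qed

lemma subsol_local:
  assumes D: "open D1" "open D2" and w: "subsol \<psi> D1 w" "subsol \<psi> D2 w"
  shows "subsol \<psi> (D1 \<union> D2) w"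
proof -
  have "open (D1 \<union> D2)" using D by blast
  then show ?thesis
    using w unfolding subsol_def usc_on_open[OF D(1)] usc_on_open[OF D(2)] usc_on_open[OF \<open>open (D1 \<union> D2)\<close>] by blast
qed

end

section \<open>The Dirichlet problem\<close>

lemma C2_on_shift:
  assumes C: "C2_on UNIV q q' q''"
  shows "C2_on UNIV (\<lambda>z. q (z - c)) (\<lambda>z. q' (z - c)) (\<lambda>z. q'' (z - c))"
  unfolding C2_on_def
proof (intro conjI ballI)
  fix z
  have d: "((\<lambda>z. z - c) has_derivative (\<lambda>h. h)) (at z)" by (auto intro!: derivative_eq_intros)
  show "((\<lambda>z. q (z - c)) has_derivative blinfun_apply (q' (z - c))) (at z)"
    using has_derivative_compose[OF d, of q "blinfun_apply (q' (z - c))"] C by (simp add: C2_on_def)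
  show "((\<lambda>z. q' (z - c)) has_derivative blinfun_apply (q'' (z - c))) (at z)"
    using has_derivative_compose[OF d, of q' "blinfun_apply (q'' (z - c))"] C by (simp add: C2_on_def)
next
  have "continuous_on UNIV q''" using C by (simp add: C2_on_def)
  then show "continuous_on UNIV (\<lambda>z. q'' (z - c))"
    by (rule continuous_on_compose2) (auto intro!: continuous_intros)
qed simp

lemma C2_on_scale:
  assumes C: "C2_on N q q' q''"
  shows "C2_on N (\<lambda>z. s * q z) (\<lambda>z. s *\<^sub>R q' z) (\<lambda>z. s *\<^sub>R q'' z)"
  unfolding C2_on_def
proof (intro conjI ballI)
  fix z assume z: "z \<in> N"
  have "((\<lambda>z. s * q z) has_derivative (\<lambda>h. s * q' z h)) (at z)"
    using C z by (intro has_derivative_mult_right) (auto simp: C2_on_def)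
  then show "((\<lambda>z. s * q z) has_derivative blinfun_apply (s *\<^sub>R q' z)) (at z)"
    by (simp add: blinfun.scaleR_left[abs_def])
  have "((\<lambda>z. s *\<^sub>R q' z) has_derivative (\<lambda>h. s *\<^sub>R q'' z h)) (at z)"
    using C z by (intro has_derivative_scaleR_right) (auto simp: C2_on_def)
  then show "((\<lambda>z. s *\<^sub>R q' z) has_derivative blinfun_apply (s *\<^sub>R q'' z)) (at z)"
    by (simp add: blinfun.scaleR_left[abs_def])
qed (use C in \<open>auto simp: C2_on_def intro!: continuous_intros\<close>)

text \<open>
  The classical barrier \<open>exp(- \<alpha> r\<^sup>2) - exp(- \<alpha> |z - c|\<^sup>2)\<close>, multiplied by a constant that is large
  enough for it to dominate \<open>g\<close> away from \<open>\<zeta>\<close>. It is strictly superharmonic off the ball when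
  \<open>2 \<alpha> r\<^sup>2\<close> exceeds the dimension.
\<close>

lemma exterior_ball_barrier:
  fixes D :: "'a::euclidean_space set" and g :: "'a \<Rightarrow> real"
  assumes D: "bounded D" and \<zeta>: "\<zeta> \<in> closure D" and r: "r > 0" "norm (\<zeta> - c) = r"
    and out: "\<And>z. z \<in> closure D \<Longrightarrow> z \<noteq> \<zeta> \<Longrightarrow> r < norm (z - c)"
    and g: "continuous_on (closure D) g" and e: "e > 0"
  shows "\<exists>b b' b''. C2_on UNIV b b' b'' \<and> (\<forall>z\<in>closure D. trace_along uminus (b'' z) < 0) \<and> b \<zeta> = g \<zeta> + e \<and>
     (\<forall>\<xi>\<in>closure D. g \<xi> + e / 2 \<le> b \<xi>)"
proof -
  have clD: "compact (closure D)" using D by (simp add: compact_closure)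
  define \<alpha> where "\<alpha> = real DIM('a) / r\<^sup>2"
  have \<alpha>: "\<alpha> > 0" "\<alpha> * r\<^sup>2 = real DIM('a)" using r by (auto simp: \<alpha>_def)
  have out': "r \<le> norm (z - c)" if "z \<in> closure D" for z using out[OF that] r by (cases "z = \<zeta>") auto
  define k where "k z = exp (- \<alpha> * r\<^sup>2) - exp (- \<alpha> * ((z - c) \<bullet> (z - c)))" for z
  have k0: "k \<zeta> = 0" using r by (simp add: k_def dot_square_norm)
  have kpos: "k z \<ge> 0" if "z \<in> closure D" for z
    using mult_left_mono[OF power_mono[OF out'[OF that], of 2], of \<alpha>] \<alpha>(1) r by (simp add: k_def dot_square_norm)
  have kpos': "k z > 0" if "z \<in> closure D" "z \<noteq> \<zeta>" for z
    using mult_strict_left_mono[OF power_strict_mono[OF out[OF that], of 2], of \<alpha>] \<alpha>(1) r by (simp add: k_def dot_square_norm)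
  have kcont: "continuous_on UNIV k" unfolding k_def by (intro continuous_intros)
  obtain G where G: "\<And>\<xi>. \<xi> \<in> closure D \<Longrightarrow> \<bar>g \<xi>\<bar> \<le> G"
    using compact_imp_bounded[OF compact_continuous_image[OF g clD]] by (auto simp: bounded_iff)
  obtain d where d: "d > 0" "\<And>\<xi>. \<xi> \<in> closure D \<Longrightarrow> dist \<xi> \<zeta> < d \<Longrightarrow> dist (g \<xi>) (g \<zeta>) < e / 2"
    using g \<zeta> e unfolding continuous_on_iff by (meson half_gt_zero)
  have "\<exists>\<mu>>0. \<forall>\<xi>\<in>closure D - ball \<zeta> d. \<mu> \<le> k \<xi>"
  proof (cases "closure D - ball \<zeta> d = {}")
    case True
    then show ?thesis by (metis equals0D zero_less_one)
  next
    case False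
    have "compact (closure D - ball \<zeta> d)" using clD by (intro compact_diff) auto
    then obtain x where x: "x \<in> closure D - ball \<zeta> d" "\<And>y. y \<in> closure D - ball \<zeta> d \<Longrightarrow> k x \<le> k y"
      using continuous_attains_inf[OF _ False continuous_on_subset[OF kcont subset_UNIV]] by blast
    have "x \<noteq> \<zeta>" using x(1) d(1) by auto
    then have "k x > 0" using x(1) by (intro kpos') auto
    then show ?thesis using x(2) by blast
  qed
  then obtain \<mu> where \<mu>: "\<mu> > 0" "\<And>\<xi>. \<xi> \<in> closure D - ball \<zeta> d \<Longrightarrow> \<mu> \<le> k \<xi>" by blast
  have G0: "G \<ge> 0" using G[OF \<zeta>] by simp
  \<comment> \<open>\<open>C \<mu> = 2 (G + 1)\<close> exceeds the oscillation of \<open>g\<close>.\<close>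
  define C where "C = 2 * (G + 1) / \<mu>"
  have C: "C > 0" "C * \<mu> = 2 * (G + 1)" using \<mu> G0 by (auto simp: C_def)
  let ?f1 = "\<lambda>s. - \<alpha> * exp (- \<alpha> * s)" and ?f2 = "\<lambda>s. \<alpha>\<^sup>2 * exp (- \<alpha> * s)"
  have rad: "C2_on UNIV (\<lambda>z::'a. exp (- \<alpha> * (z \<bullet> z))) (\<lambda>z. (2 * ?f1 (z \<bullet> z)) *\<^sub>R blinfun_inner_right z)
     (\<lambda>z. (2 * ?f1 (z \<bullet> z)) *\<^sub>R inner2 + (4 * ?f2 (z \<bullet> z)) *\<^sub>R outer2 z z)"
    by (rule radial_C2[where f = "\<lambda>s. exp (- \<alpha> * s)"]) (auto intro!: derivative_eq_intros continuous_intros simp: power2_eq_square)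
  note rad' = C2_on_add_const[OF C2_on_scale[OF C2_on_shift[OF rad, of c], of "- C"], of "g \<zeta> + e + C * exp (- \<alpha> * r\<^sup>2)"]
  let ?b = "\<lambda>z. - C * exp (- \<alpha> * ((z - c) \<bullet> (z - c))) + (g \<zeta> + e + C * exp (- \<alpha> * r\<^sup>2))"
  let ?b'' = "\<lambda>z. - C *\<^sub>R ((2 * ?f1 ((z - c) \<bullet> (z - c))) *\<^sub>R inner2 + (4 * ?f2 ((z - c) \<bullet> (z - c))) *\<^sub>R outer2 (z - c) (z - c))"
  have bk: "?b z = g \<zeta> + e + C * k z" for z by (simp add: k_def algebra_simps)
  have "trace_along uminus (?b'' z) < 0" if z: "z \<in> closure D" for z
  proof -
    have 1: "trace_along uminus (inner2 :: 'a \<Rightarrow>\<^sub>L 'a \<Rightarrow>\<^sub>L real) = real DIM('a)" by (simp add: trace_along_def inner_Basis)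
    have 2: "trace_along uminus (outer2 y y) = y \<bullet> y" for y :: 'a
      unfolding trace_along_def by (simp add: euclidean_inner[of y y] inner_commute)
    let ?s = "(z - c) \<bullet> (z - c)"
    have "\<alpha> * r\<^sup>2 \<le> \<alpha> * ?s" using mult_left_mono[OF power_mono[OF out'[OF z], of 2], of \<alpha>] \<alpha>(1) r by (simp add: dot_square_norm)
    then have s: "real DIM('a) \<le> \<alpha> * ?s" using \<alpha> by simp
    have "real DIM('a) > 0" by simp
    then have p: "2 * (\<alpha> * ?s) - real DIM('a) > 0" using s by linarith
    have "trace_along uminus (?b'' z) = - (C * (2 * \<alpha> * exp (- \<alpha> * ?s)) * (2 * (\<alpha> * ?s) - real DIM('a)))"
      unfolding trace_along_scale trace_along_add 1 2 by (simp add: algebra_simps power2_eq_square)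
    also have "\<dots> < 0" using p C \<alpha> by simp
    finally show ?thesis .
  qed
  moreover have "g \<xi> + e / 2 \<le> ?b \<xi>" if \<xi>: "\<xi> \<in> closure D" for \<xi>
  proof (cases "\<xi> \<in> ball \<zeta> d")
    case True
    then have "dist (g \<xi>) (g \<zeta>) < e / 2" using d(2)[OF \<xi>] by (simp add: dist_commute)
    then have "g \<xi> < g \<zeta> + e / 2" unfolding dist_real_def abs_less_iff by linarith
    moreover have "C * k \<xi> \<ge> 0" using C kpos[OF \<xi>] by simp
    ultimately show ?thesis unfolding bk by linarith
  next
    case False
    then have "C * \<mu> \<le> C * k \<xi>" using \<mu>(2) \<xi> C by (intro mult_left_mono) auto
    then have "2 * G + 2 \<le> C * k \<xi>" using C(2) by simp
    moreover have "g \<xi> \<le> G" "- G \<le> g \<zeta>" using G[OF \<xi>] G[OF \<zeta>] by auto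
    ultimately show ?thesis using e G0 unfolding bk C(2) by linarith
  qed
  moreover have "?b \<zeta> = g \<zeta> + e" unfolding bk k0 by simp
  ultimately show ?thesis using rad' by blast
qed

lemma levi_perturb_nonneg:
  assumes "norm A \<le> \<eta>"
  shows "levi (A + \<eta> *\<^sub>R inner2) \<zeta> \<ge> 0"
proof -
  have "A h h \<ge> - \<eta> * (norm h)\<^sup>2" for h
  proof -
    have "\<bar>A h h\<bar> \<le> norm (A h) * norm h" using norm_blinfun[of "A h" h] by simp
    also have "\<dots> \<le> (\<eta> * norm h) * norm h"
      using order_trans[OF norm_blinfun[of A h] mult_right_mono[OF assms norm_ge_zero]] by (intro mult_right_mono) auto
    finally show ?thesis by (simp add: power2_eq_square)
  qed
  from this[of \<zeta>] this[of "\<i> *s \<zeta>"] show ?thesis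
    by (simp add: levi_def blinfun.add_left blinfun.scaleR_left power2_norm_eq_inner)
qed

context hessian_operator
begin

text \<open>
  Maximum principle: at a maximum of \<open>w - b\<close>, a translate of \<open>b\<close> is a test function whose Laplacian
  would have to be nonnegative.
\<close>

lemma subsol_le_superharmonic:
  assumes D: "open D" and w: "subsol \<psi> D w" and b: "C2_on UNIV b b' b''" "\<And>z. z \<in> D \<Longrightarrow> trace_along uminus (b'' z) < 0"
    and K: "compact K" "K \<subseteq> D" "\<And>z. z \<in> D - K \<Longrightarrow> w z \<le> ereal (b z)" and z: "z \<in> D"
  shows "w z \<le> ereal (b z)"
proof (rule ccontr)
  assume n: "\<not> ?thesis"
  then have zK: "z \<in> K" using K(3) z by blast
  let ?g = "\<lambda>y. w y + ereal (- b y)"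
  have "\<exists>x\<in>K. \<forall>y\<in>K. ?g y \<le> ?g x"
  proof (rule usc_attains_max[OF K(1)])
    show "K \<noteq> {}" using zK by blast
    fix x c assume x: "x \<in> K" "?g x < c"
    have "isCont (\<lambda>y. - b y) x" using C2_on_isCont[OF b(1) UNIV_I] by (intro continuous_intros)
    moreover have "\<forall>\<^sub>F y in nhds x. w y < a" if "w x < a" for a
      using subsol_usc[OF D w _ that] x(1) K(2) by blast
    ultimately have "\<forall>\<^sub>F y in nhds x. ?g y < c" using x(2) by (intro usc_add_real)
    then show "\<exists>U. open U \<and> x \<in> U \<and> (\<forall>y\<in>U \<inter> K. ?g y < c)" unfolding eventually_nhds by blast
  qed
  then obtain x where x: "x \<in> K" "\<And>y. y \<in> K \<Longrightarrow> ?g y \<le> ?g x" by blast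
  have xD: "x \<in> D" using x K(2) by blast
  have "0 < ?g z" using n by (cases "w z") auto
  then have gx: "0 < ?g x" using x(2)[OF zK] by (rule less_le_trans)
  have "w x < \<infinity>" using w xD by (simp add: subsol_def)
  then obtain m where m: "w x = ereal m" "m > b x" using gx by (cases "w x") auto
  let ?q = "\<lambda>y. b y + (m - b x)"
  have "\<forall>\<^sub>F y in nhds x. y \<in> D" using D xD by (rule eventually_nhds_in_open)
  then have ev: "\<forall>\<^sub>F y in nhds x. w y \<le> ereal (?q y)"
  proof eventually_elim
    case (elim y)
    show ?case
    proof (cases "y \<in> K")
      case True
      then show ?thesis using x(2)[OF True] m by (cases "w y") auto
    next
      case False
      then have "w y \<le> ereal (b y)" using K(3) elim by blast
      also have "\<dots> \<le> ereal (?q y)" using m by simp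
      finally show ?thesis .
    qed
  qed
  have "opge (\<psi> x) (b'' x)"
    by (rule subsol_test[OF w xD UNIV_I C2_on_add_const[OF b(1), of "m - b x"] _ ev]) (simp add: m)
  from opge_trace[OF this unitary_frame_mat_1] have "trace_along uminus (b'' x) \<ge> 0" unfolding trace_along_uminus by simp
  then show False using b(2)[OF xD] by simp
qed

text \<open>
  Perron's bump. If a test function from below has a strictly larger value of the operator at \<open>z0\<close>,
  then it remains a strict subsolution after a small paraboloid is subtracted and a constant \<open>2 m\<close>
  added. The maximum with \<open>U\<close> near \<open>z0\<close> is a subsolution that lies above \<open>q + m\<close> close to \<open>z0\<close> and
  agrees with \<open>U\<close> outside a compact ball.
\<close>

lemma subsol_bump:
  assumes D: "open D" and \<psi>: "continuous_on D \<psi>" and \<psi>0: "\<And>z. z \<in> D \<Longrightarrow> 0 \<le> \<psi> z" and U: "subsol \<psi> D U"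
    and z0: "z0 \<in> D" "z0 \<in> N" and C: "C2_on N q q' q''" and c: "opge c (q'' z0)" "c > \<psi> z0"
    and qU: "\<forall>\<^sub>F y in nhds z0. ereal (q y) \<le> U y"
  shows "\<exists>w r m. cball z0 r \<subseteq> D \<and> subsol \<psi> D w \<and> (\<forall>y. y \<notin> cball z0 r \<longrightarrow> w y = U y) \<and>
     m > 0 \<and> (\<forall>\<^sub>F y in nhds z0. ereal (q y + m) \<le> w y)"
proof -
  let ?I = "inner2 :: (complex ^ 'n) \<Rightarrow>\<^sub>L (complex ^ 'n) \<Rightarrow>\<^sub>L real"
  define c' where "c' = (c + \<psi> z0) / 2"
  have c': "0 \<le> c'" "c' < c" "\<psi> z0 < c'" using c(2) \<psi>0[OF z0(1)] by (auto simp: c'_def)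
  obtain \<eta> where \<eta>: "\<eta> > 0" "opge c' (q'' z0 - (2 * \<eta>) *\<^sub>R ?I)" using opge_open[OF c(1) c'(1,2)] by blast
  have N: "open N" using C by (simp add: C2_on_def)
  have "isCont q'' z0" using C z0 by (auto simp: C2_on_def continuous_on_eq_continuous_at)
  then have "\<forall>\<^sub>F y in nhds z0. dist (q'' y) (q'' z0) < \<eta>" unfolding isCont_nhds by (rule tendstoD) (use \<eta> in simp)
  moreover have "isCont \<psi> z0" using \<psi> D z0 by (simp add: continuous_on_eq_continuous_at)
  then have "\<forall>\<^sub>F y in nhds z0. \<psi> y < c'" using c' unfolding isCont_nhds by (intro order_tendstoD) auto
  moreover have "\<forall>\<^sub>F y in nhds z0. y \<in> N" "\<forall>\<^sub>F y in nhds z0. y \<in> D" using N D z0 by (auto intro: eventually_nhds_in_open)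
  ultimately have "\<forall>\<^sub>F y in nhds z0. dist (q'' y) (q'' z0) < \<eta> \<and> \<psi> y < c' \<and> y \<in> N \<and> y \<in> D \<and> ereal (q y) \<le> U y"
    using qU by eventually_elim simp
  then obtain d where d: "d > 0" "\<And>y. dist y z0 < d \<Longrightarrow> dist (q'' y) (q'' z0) < \<eta> \<and> \<psi> y < c' \<and> y \<in> N \<and> y \<in> D \<and> ereal (q y) \<le> U y"
    unfolding eventually_nhds_metric by blast
  \<comment> \<open>The paraboloid \<open>(\<eta>/2) |y - z0|\<^sup>2\<close> is at least \<open>\<eta> d\<^sup>2 / 8 = 4 m\<close> outside the ball of radius \<open>d / 2\<close>.\<close>
  define m where "m = \<eta> * d\<^sup>2 / 32"
  have m: "m > 0" using \<eta> d by (simp add: m_def)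
  let ?h = "\<lambda>y. q y + (- (\<eta> / 2) * (norm (y - z0))\<^sup>2 + 2 * m)"
  have B: "ball z0 d \<subseteq> N" "ball z0 d \<subseteq> D" using d(2) by (auto simp: dist_commute)
  have C': "C2_on (N \<inter> UNIV) ?h (\<lambda>z. q' z + (2 * (- (\<eta> / 2))) *\<^sub>R blinfun_inner_right (z - z0)) (\<lambda>z. q'' z + (2 * (- (\<eta> / 2))) *\<^sub>R inner2)"
    by (rule C2_on_add[OF C C2_quadratic])
  have h: "subsol \<psi> (ball z0 d) (\<lambda>y. ereal (?h y))"
  proof (rule smooth_subsol[OF open_ball C'])
    show "ball z0 d \<subseteq> N \<inter> UNIV" using B by simp
    fix y assume "y \<in> ball z0 d"
    then have y: "dist (q'' y) (q'' z0) < \<eta>" "\<psi> y < c'" using d(2)[of y] by (auto simp: dist_commute)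
    let ?P = "q'' y - q'' z0 + \<eta> *\<^sub>R ?I"
    have "levi ?P \<zeta> \<ge> 0" for \<zeta>
      using levi_perturb_nonneg[of "q'' y - q'' z0" \<eta> \<zeta>] y(1) by (simp add: dist_norm)
    from opge_add[OF \<eta>(2) this] have "opge c' (q'' z0 - (2 * \<eta>) *\<^sub>R ?I + ?P)" .
    moreover have "q'' z0 - (2 * \<eta>) *\<^sub>R ?I + ?P = q'' y + (2 * (- (\<eta> / 2))) *\<^sub>R ?I"
      by (simp add: algebra_simps scaleR_2 flip: scaleR_scaleR)
    ultimately show "opge (\<psi> y) (q'' y + (2 * (- (\<eta> / 2))) *\<^sub>R ?I)" using y(2) opge_mono by simp
  qed
  define w where "w y = (if y \<in> ball z0 d then max (U y) (ereal (?h y)) else U y)" for y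
  have far: "w y = U y" if "y \<notin> cball z0 (d / 2)" for y
  proof (cases "y \<in> ball z0 d")
    case True
    then have qU': "ereal (q y) \<le> U y" using d(2)[of y] by (simp add: dist_commute)
    have "d / 2 \<le> norm (y - z0)" using that by (simp add: dist_norm norm_minus_commute)
    from power_mono[OF this, of 2] have "\<eta> * (d\<^sup>2 / 4) \<le> \<eta> * (norm (y - z0))\<^sup>2"
      using \<eta> d by (intro mult_left_mono) (auto simp: power2_eq_square)
    moreover have "0 \<le> \<eta> * d\<^sup>2" using \<eta> by simp
    ultimately have "?h y \<le> q y" unfolding m_def by simp
    then have "ereal (?h y) \<le> U y" using qU' by (meson ereal_less_eq(3) order_trans)
    then show ?thesis by (simp add: w_def max_def)
  qed (simp add: w_def)
  have "subsol \<psi> (ball z0 d) (\<lambda>y. max (U y) (ereal (?h y)))"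
    by (rule subsol_max[OF open_ball subsol_subset[OF D open_ball B(2) U] h])
  then have w1: "subsol \<psi> (ball z0 d) w" by (rule subsol_cong[OF open_ball, rotated]) (simp add: w_def)
  have o2: "open (D - cball z0 (d / 2))" using D by (intro open_Diff) auto
  have "subsol \<psi> (D - cball z0 (d / 2)) U" by (rule subsol_subset[OF D o2 _ U]) auto
  then have w2: "subsol \<psi> (D - cball z0 (d / 2)) w" by (rule subsol_cong[OF o2, rotated]) (simp add: far)
  have "ball z0 d \<union> (D - cball z0 (d / 2)) = D" using B d(1) by auto
  then have wD: "subsol \<psi> D w" using subsol_local[OF open_ball o2 w1 w2] by simp
  have "isCont (\<lambda>y. - (\<eta> / 2) * (norm (y - z0))\<^sup>2 + 2 * m) z0" by (intro continuous_intros)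
  then have "\<forall>\<^sub>F y in nhds z0. m < - (\<eta> / 2) * (norm (y - z0))\<^sup>2 + 2 * m"
    using m unfolding isCont_nhds by (intro order_tendstoD) auto
  moreover have "\<forall>\<^sub>F y in nhds z0. y \<in> ball z0 d" using d(1) by (intro eventually_nhds_in_open) auto
  ultimately have "\<forall>\<^sub>F y in nhds z0. ereal (q y + m) \<le> w y"
  proof eventually_elim
    case (elim y)
    then have "ereal (q y + m) \<le> ereal (?h y)" by simp
    also have "\<dots> \<le> w y" using elim by (simp add: w_def)
    finally show ?case .
  qed
  moreover have "cball z0 (d / 2) \<subseteq> D" using B d(1) by auto
  ultimately show ?thesis using wD far m by (intro exI[of _ w] exI[of _ "d / 2"] exI[of _ m] conjI allI impI)
qed

text \<open>
  Perron's method. The family \<open>F\<close> consists of all subsolutions whose upper limits at the boundary are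
  at most \<open>g\<close>; barriers bound it from above and the continuous subsolution \<open>g\<close> from below. Its
  regularised supremum \<open>U\<close> is a member of the family, the lower regularisation \<open>V\<close> of \<open>U\<close> is a supersolution by
  the bump argument, and comparison gives \<open>U \<le> V\<close>, hence continuity. The last conjunct records the
  maximality of the solution, through which all later comparisons are made.
\<close>

theorem dirichlet_problem:
  fixes g :: "complex ^ 'n \<Rightarrow> real"
  assumes D: "open D" "bounded D" and \<psi>: "continuous_on D \<psi>" "\<And>z. z \<in> D \<Longrightarrow> 0 \<le> \<psi> z" "\<And>z. z \<in> D \<Longrightarrow> \<exists>R>0. f (R *\<^sub>R ones) > \<psi> z"
    and ext: "\<And>\<zeta>. \<zeta> \<in> frontier D \<Longrightarrow> \<exists>r>0. \<exists>c. norm (\<zeta> - c) = r \<and> (\<forall>z\<in>closure D. z \<noteq> \<zeta> \<longrightarrow> r < norm (z - c))"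
    and g: "continuous_on (closure D) g" "subsol \<psi> D (\<lambda>z. ereal (g z))"
  shows "\<exists>u. continuous_on D u \<and> subsol \<psi> D (\<lambda>z. ereal (u z)) \<and> supersol \<psi> D (\<lambda>z. ereal (u z)) \<and>
    (\<forall>\<zeta>\<in>frontier D. \<forall>e>0. \<forall>\<^sub>F z in at \<zeta> within D. u z \<le> g \<zeta> + e) \<and>
    (\<forall>w. subsol \<psi> D w \<longrightarrow> (\<forall>\<zeta>\<in>frontier D. \<forall>e>0. \<forall>\<^sub>F z in at \<zeta> within D. w z \<le> ereal (g \<zeta> + e)) \<longrightarrow>
       (\<forall>z\<in>D. w z \<le> ereal (u z)))"
proof -
  define F where "F = {w. subsol \<psi> D w \<and> (\<forall>\<zeta>\<in>frontier D. \<forall>e>0. \<forall>\<^sub>F z in at \<zeta> within D. w z \<le> ereal (g \<zeta> + e))}"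
  let ?S = "\<lambda>z. SUP w\<in>F. w z"
  define U where "U = usc_env D ?S"
  have gcont: "(g \<longlongrightarrow> g \<zeta>) (at \<zeta> within D)" if "\<zeta> \<in> closure D" for \<zeta>
    using g(1) that unfolding continuous_on by (blast intro: tendsto_within_subset[OF _ closure_subset])
  have gF: "(\<lambda>z. ereal (g z)) \<in> F" unfolding F_def
  proof (intro CollectI conjI ballI allI impI g(2))
    fix \<zeta> and e :: real assume "\<zeta> \<in> frontier D" "e > 0"
    then have "\<forall>\<^sub>F z in at \<zeta> within D. g z < g \<zeta> + e"
      by (intro order_tendstoD(2)[OF gcont]) (auto simp: frontier_def)
    then show "\<forall>\<^sub>F z in at \<zeta> within D. ereal (g z) \<le> ereal (g \<zeta> + e)" by eventually_elim simp
  qed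
  have bar: "\<exists>b. isCont b \<zeta> \<and> b \<zeta> = g \<zeta> + e \<and> (\<forall>z. U z \<le> ereal (b z))" if \<zeta>: "\<zeta> \<in> frontier D" and e: "e > 0" for \<zeta> e
  proof -
    obtain r c where r: "r > 0" "norm (\<zeta> - c) = r" "\<And>z. z \<in> closure D \<Longrightarrow> z \<noteq> \<zeta> \<Longrightarrow> r < norm (z - c)"
      using ext[OF \<zeta>] by blast
    have \<zeta>c: "\<zeta> \<in> closure D" using \<zeta> by (simp add: frontier_def)
    obtain b b' b'' where b: "C2_on UNIV b b' b''" "\<And>z. z \<in> closure D \<Longrightarrow> trace_along uminus (b'' z) < 0" "b \<zeta> = g \<zeta> + e"
      "\<And>\<xi>. \<xi> \<in> closure D \<Longrightarrow> g \<xi> + e / 2 \<le> b \<xi>"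
      using exterior_ball_barrier[OF D(2) \<zeta>c r g(1) e] by blast
    have bc: "isCont b z" for z by (rule C2_on_isCont[OF b(1) UNIV_I])
    have wb: "w z \<le> ereal (b z)" if w: "w \<in> F" and z: "z \<in> D" for w z
    proof -
      have "\<exists>K. compact K \<and> K \<subseteq> D \<and> (\<forall>z\<in>D - K. w z \<le> ereal (b z))"
      proof (rule compact_boundary_exhaustion[OF D])
        fix \<xi> assume \<xi>: "\<xi> \<in> frontier D"
        have "\<forall>e>0. \<forall>\<^sub>F z in at \<xi> within D. w z \<le> ereal (g \<xi> + e)" using w \<xi> unfolding F_def by blast
        from this[rule_format, of "e / 4"] have "\<forall>\<^sub>F z in at \<xi> within D. w z \<le> ereal (g \<xi> + e / 4)" using e by simp
        moreover have "(b \<longlongrightarrow> b \<xi>) (at \<xi> within D)" using bc[of \<xi>] unfolding isCont_def by (rule tendsto_within_subset) simp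
        then have "\<forall>\<^sub>F z in at \<xi> within D. b \<xi> - e / 4 < b z" using e by (intro order_tendstoD) auto
        ultimately show "\<forall>\<^sub>F z in at \<xi> within D. w z \<le> ereal (b z)"
        proof eventually_elim
          case (elim z)
          have "g \<xi> + e / 2 \<le> b \<xi>" using b(4) \<xi> by (simp add: frontier_def)
          then have "ereal (g \<xi> + e / 4) \<le> ereal (b z)" using elim(2) by simp
          then show ?case using elim(1) by (rule order_trans[rotated])
        qed
      qed
      then obtain K where K: "compact K" "K \<subseteq> D" "\<And>z. z \<in> D - K \<Longrightarrow> w z \<le> ereal (b z)" by blast
      have wS: "subsol \<psi> D w" using w by (simp add: F_def)
      show ?thesis
        by (rule subsol_le_superharmonic[OF D(1) wS b(1) _ K z]) (use b(2) closure_subset in blast)+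
    qed
    have "U z \<le> ereal (b z)" for z
      unfolding U_def by (rule usc_env_le_continuous[OF bc]) (use wb in \<open>auto intro!: always_eventually SUP_least\<close>)
    then show ?thesis using bc b(3) by blast
  qed
  have fin: "U z < \<infinity>" if "z \<in> D" for z
  proof -
    have "D \<noteq> UNIV" using D(2) not_bounded_UNIV by auto
    then obtain \<zeta> where "\<zeta> \<in> frontier D" using frontier_not_empty[of D] \<open>z \<in> D\<close> by blast
    from bar[OF this, of 1] obtain b where "U z \<le> ereal (b z)" by auto
    then show ?thesis by (rule le_less_trans) simp
  qed
  have Usub: "subsol \<psi> D U" unfolding U_def
  proof (rule sup_subsol[OF D(1) \<psi>(1)])
    show "subsol \<psi> D w" if "w \<in> F" for w using that by (simp add: F_def)
    show "usc_env D ?S z < \<infinity>" if "z \<in> D" for z using fin[OF that] by (simp add: U_def)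
  qed
  have Ubd: "\<forall>\<^sub>F z in at \<zeta> within D. U z \<le> ereal (g \<zeta> + e)" if \<zeta>: "\<zeta> \<in> frontier D" and e: "e > 0" for \<zeta> e
  proof -
    have e2: "e / 2 > 0" using e by simp
    obtain b where b: "isCont b \<zeta>" "b \<zeta> = g \<zeta> + e / 2" "\<And>z. U z \<le> ereal (b z)" using bar[OF \<zeta> e2] by blast
    have "(b \<longlongrightarrow> b \<zeta>) (at \<zeta> within D)" using b(1) unfolding isCont_def by (rule tendsto_within_subset) simp
    then have "\<forall>\<^sub>F z in at \<zeta> within D. b z < g \<zeta> + e" using e b(2) by (intro order_tendstoD) auto
    then show ?thesis
    proof eventually_elim
      case (elim z)
      then have "ereal (b z) \<le> ereal (g \<zeta> + e)" by simp
      then show ?case using b(3) order_trans by blast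
    qed
  qed
  have wU: "w z \<le> U z" if "w \<in> F" "z \<in> D" for w z
  proof -
    have "w z \<le> ?S z" using that(1) by (rule SUP_upper)
    also have "\<dots> \<le> U z" unfolding U_def using that(2) by (rule usc_env_ge)
    finally show ?thesis .
  qed
  define V where "V z = - usc_env D (\<lambda>z. - U z) z" for z
  have VU: "V z \<le> U z" if "z \<in> D" for z
    using usc_env_ge[OF that, of "\<lambda>z. - U z"] by (simp add: V_def ereal_uminus_le_reorder)
  have gV: "ereal (g z) \<le> V z" if z: "z \<in> D" for z
  proof -
    have "continuous_on D g" using g(1) closure_subset by (rule continuous_on_subset)
    then have "isCont g z" using D(1) z by (simp add: continuous_on_eq_continuous_at)
    then have "isCont (\<lambda>z. - g z) z" by (intro continuous_intros)
    then have "usc_env D (\<lambda>z. - U z) z \<le> ereal (- g z)"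
    proof (rule usc_env_le_continuous)
      show "\<forall>\<^sub>F y in nhds z. y \<in> D \<longrightarrow> - U y \<le> ereal (- g y)"
        using wU[OF gF] by (intro always_eventually) (simp add: ereal_minus_le_minus flip: uminus_ereal.simps(1))
    qed
    then show ?thesis by (cases "usc_env D (\<lambda>z. - U z) z") (auto simp: V_def)
  qed
  define v where "v z = real_of_ereal (V z)" for z
  have vV: "V z = ereal (v z)" if "z \<in> D" for z
    using gV[OF that] VU[OF that] fin[OF that] unfolding v_def by (cases "V z") auto
  have Vlsc: "\<forall>\<^sub>F y in nhds z. c < V y" if "c < V z" for z c
  proof -
    have "usc_env D (\<lambda>z. - U z) z < - c" using that by (simp add: V_def ereal_less_uminus_reorder)
    from usc_env_eventually[OF this] show ?thesis by eventually_elim (simp add: V_def ereal_less_uminus_reorder)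
  qed
  have inD: "\<forall>\<^sub>F y in nhds z. y \<in> D" if "z \<in> D" for z using D(1) that by (rule eventually_nhds_in_open)
  have vlsc: "\<forall>\<^sub>F y in nhds z. c < ereal (v y)" if z: "z \<in> D" "c < ereal (v z)" for z c
    using Vlsc[of c z] z inD[OF z(1)] vV[OF z(1)] by (auto elim: eventually_elim2 simp: vV)
  have vsup: "supersol \<psi> D (\<lambda>z. ereal (v z))"
    unfolding supersol_def lsc_on_open[OF D(1)]
  proof (intro conjI allI impI ballI notI)
    show "\<forall>\<^sub>F y in nhds z. c < ereal (v y)" if "z \<in> D" "c < ereal (v z)" for z c using that by (rule vlsc)
    show "- \<infinity> < ereal (v z)" for z by simp
    fix z N q q' q'' c
    assume z: "z \<in> D" "z \<in> N" "C2_on N q q' q''" "ereal (v z) = ereal (q z)" "\<forall>\<^sub>F x in nhds z. ereal (q x) \<le> ereal (v x)"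
      and c: "\<psi> z < c" "opge c (q'' z)"
    have "\<forall>\<^sub>F y in nhds z. ereal (q y) \<le> U y"
      using z(5) inD[OF z(1)]
    proof eventually_elim
      case (elim y)
      show ?case using elim(1) VU[OF elim(2)] unfolding vV[OF elim(2)] by (rule order_trans)
    qed
    then have "\<exists>w r m. cball z r \<subseteq> D \<and> subsol \<psi> D w \<and> (\<forall>y. y \<notin> cball z r \<longrightarrow> w y = U y) \<and>
        m > 0 \<and> (\<forall>\<^sub>F y in nhds z. ereal (q y + m) \<le> w y)"
      by (rule subsol_bump[OF D(1) \<psi>(1,2) Usub z(1,2,3) c(2,1), rotated])
    then obtain w r m where
      w: "cball z r \<subseteq> D" "subsol \<psi> D w" "\<And>y. y \<notin> cball z r \<Longrightarrow> w y = U y" "m > 0" "\<forall>\<^sub>F y in nhds z. ereal (q y + m) \<le> w y"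
      by blast
    have "w \<in> F" unfolding F_def
    proof (intro CollectI conjI ballI allI impI w(2))
      fix \<zeta> and e :: real assume a: "\<zeta> \<in> frontier D" "e > 0"
      have "\<zeta> \<notin> cball z r" using a(1) w(1) D(1) by (auto simp: frontier_def interior_open)
      then have "\<forall>\<^sub>F y in nhds \<zeta>. y \<in> - cball z r" by (intro eventually_nhds_in_open) auto
      then have "\<forall>\<^sub>F y in at \<zeta> within D. y \<in> - cball z r" by (rule filter_leD[OF at_within_le_nhds])
      then show "\<forall>\<^sub>F z in at \<zeta> within D. w z \<le> ereal (g \<zeta> + e)" using Ubd[OF a]
        by eventually_elim (simp add: w(3))
    qed
    then have wU': "w y \<le> U y" if "y \<in> D" for y using wU that by blast
    have "\<forall>\<^sub>F y in nhds z. y \<in> D \<and> ereal (q y + m) \<le> U y"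
      using w(5) inD[OF z(1)] by eventually_elim (blast intro: order_trans[OF _ wU'])
    then have ev: "\<forall>\<^sub>F y in nhds z. y \<in> D \<longrightarrow> - U y \<le> ereal (- (q y + m))"
    proof (rule eventually_mono, intro impI)
      fix y assume "y \<in> D \<and> ereal (q y + m) \<le> U y"
      then have "- U y \<le> - ereal (q y + m)" by (simp only: ereal_minus_le_minus)
      then show "- U y \<le> ereal (- (q y + m))" by simp
    qed
    have "isCont q z" using z by (intro C2_on_isCont)
    then have "isCont (\<lambda>y. - (q y + m)) z" by (intro continuous_intros)
    from usc_env_le_continuous[OF this ev] have "ereal (q z + m) \<le> V z"
      by (cases "usc_env D (\<lambda>z. - U z) z") (auto simp: V_def)
    then show False using vV[OF z(1)] z(4) w(4) by simp
  qed
  have Uv: "U z = ereal (v z)" if z: "z \<in> D" for z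
  proof (rule antisym)
    show "ereal (v z) \<le> U z" using VU[OF z] vV[OF z] by simp
    show "U z \<le> ereal (v z)"
    proof (rule comparison[OF D(1) \<psi> Usub vsup _ z])
      fix e :: real assume e: "e > 0"
      show "\<exists>K. compact K \<and> K \<subseteq> D \<and> (\<forall>z\<in>D - K. U z \<le> ereal (v z + e))"
      proof (rule compact_boundary_exhaustion[OF D])
        fix \<zeta> assume \<zeta>: "\<zeta> \<in> frontier D"
        have "\<forall>\<^sub>F z in at \<zeta> within D. U z \<le> ereal (g \<zeta> + e / 2)" using Ubd[OF \<zeta>, of "e / 2"] e by simp
        moreover have "\<forall>\<^sub>F z in at \<zeta> within D. g \<zeta> - e / 2 < g z"
          using \<zeta> e by (intro order_tendstoD(1)[OF gcont]) (auto simp: frontier_def)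
        moreover have "\<forall>\<^sub>F z in at \<zeta> within D. z \<in> D" by (simp add: eventually_at_filter)
        ultimately show "\<forall>\<^sub>F z in at \<zeta> within D. U z \<le> ereal (v z + e)"
        proof eventually_elim
          case (elim z)
          have "ereal (g z) \<le> ereal (v z)" using gV[OF elim(3)] vV[OF elim(3)] by simp
          then have "ereal (g \<zeta> + e / 2) \<le> ereal (v z + e)" using elim(2) by simp
          then show ?case using elim(1) by (rule order_trans[rotated])
        qed
      qed
    qed
  qed
  have vsub: "subsol \<psi> D (\<lambda>z. ereal (v z))" by (rule subsol_cong[OF D(1) Uv Usub])
  have vc: "continuous_on D v" unfolding continuous_on_eq_continuous_at[OF D(1)]
  proof
    fix z assume z: "z \<in> D"
    show "isCont v z" unfolding isCont_nhds
    proof (rule order_tendstoI)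
      fix a assume "a < v z"
      then show "\<forall>\<^sub>F y in nhds z. a < v y" using vlsc[OF z, of "ereal a"] by simp
    next
      fix a assume "v z < a"
      then show "\<forall>\<^sub>F y in nhds z. v y < a" using subsol_usc[OF D(1) vsub z, of "ereal a"] by simp
    qed
  qed
  have "\<forall>\<^sub>F z in at \<zeta> within D. v z \<le> g \<zeta> + e" if \<zeta>: "\<zeta> \<in> frontier D" "e > 0" for \<zeta> e
  proof -
    have "\<forall>\<^sub>F z in at \<zeta> within D. z \<in> D" by (simp add: eventually_at_filter)
    with Ubd[OF that] show ?thesis by eventually_elim (simp add: Uv)
  qed
  moreover have "w z \<le> ereal (v z)" if "subsol \<psi> D w" "\<forall>\<zeta>\<in>frontier D. \<forall>e>0. \<forall>\<^sub>F z in at \<zeta> within D. w z \<le> ereal (g \<zeta> + e)" "z \<in> D" for w z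
    using wU[of w z] that Uv[OF that(3)] by (simp add: F_def)
  ultimately show ?thesis using vsub vsup vc by (intro exI[of _ v] conjI ballI allI impI)
qed

end

section \<open>Approximation of the envelope\<close>

text \<open>
  Baire's theorem for upper semicontinuous functions with values in \<open>[-\<infinity>, M]\<close>: the exponential
  turns \<open>w\<close> into a bounded nonnegative function, to which the Lipschitz majorants apply.
\<close>

lemma usc_decreasing_continuous:
  fixes w :: "'a::metric_space \<Rightarrow> ereal"
  assumes K: "closed K" and usc: "\<And>z c. z \<in> K \<Longrightarrow> w z < c \<Longrightarrow> \<forall>\<^sub>F y in nhds z. w y < c"
    and M: "\<And>z. z \<in> K \<Longrightarrow> w z \<le> ereal M"
  shows "\<exists>h :: nat \<Rightarrow> 'a \<Rightarrow> real. (\<forall>n. continuous_on K (h n)) \<and> (\<forall>n. \<forall>z\<in>K. w z < ereal (h n z)) \<and>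
    (\<forall>z\<in>K. \<forall>c. w z < ereal c \<longrightarrow> (\<exists>n. h n z < c))"
proof -
  define p where "p z = (if z \<in> K \<and> w z \<noteq> - \<infinity> then exp (real_of_ereal (w z)) else 0)" for z
  have p0: "0 \<le> p z" for z by (simp add: p_def)
  have pM: "p z \<le> exp M" for z using M[of z] by (cases "w z") (auto simp: p_def)
  have pless: "p z < c \<longleftrightarrow> w z < ereal (ln c)" if "z \<in> K" "c > 0" for z c
  proof (cases "w z")
    case (real r)
    have "exp r < c \<longleftrightarrow> r < ln c" using that(2) by (metis exp_less_cancel_iff exp_ln)
    then show ?thesis using real that by (simp add: p_def)
  qed (use M[OF that(1)] that in \<open>auto simp: p_def\<close>)
  have usc_p: "usc_real p" unfolding usc_real_def
  proof (intro allI impI)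
    fix x c assume c: "p x < c"
    then have c0: "c > 0" using p0[of x] by linarith
    show "\<forall>\<^sub>F y in nhds x. p y < c"
    proof (cases "x \<in> K")
      case True
      have "\<forall>\<^sub>F y in nhds x. w y < ereal (ln c)" using c pless[OF True c0] by (intro usc[OF True]) simp
      then show ?thesis
      proof eventually_elim
        case (elim y)
        then show ?case using pless[of y c] c0 by (cases "y \<in> K") (auto simp: p_def)
      qed
    next
      case False
      then have "\<forall>\<^sub>F y in nhds x. y \<in> - K" using K by (intro eventually_nhds_in_open) auto
      then show ?thesis by eventually_elim (simp add: p_def c0)
    qed
  qed
  define h where "h n z = ln (lip_env (real n) p z + 1 / (real n + 1))" for n z
  have lip: "0 \<le> lip_env (real n) p z" "p z \<le> lip_env (real n) p z" for n z
    using lip_env_ge_self[of p "exp M" "real n" z, OF p0 pM] p0[of z] by auto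
  have pos: "0 < lip_env (real n) p z + 1 / (real n + 1)" for n z
    using lip(1)[of n z] by (intro add_nonneg_pos) auto
  have "continuous_on K (h n)" for n
  proof -
    have "continuous_on K (lip_env (real n) p)"
      unfolding continuous_on_iff
    proof (intro ballI allI impI)
      fix x and e :: real assume e: "e > 0"
      show "\<exists>d>0. \<forall>x'\<in>K. dist x' x < d \<longrightarrow> dist (lip_env (real n) p x') (lip_env (real n) p x) < e"
      proof (intro exI[of _ "e / (real n + 1)"] conjI ballI impI)
        show "0 < e / (real n + 1)" using e by simp
        fix x' assume d: "dist x' x < e / (real n + 1)"
        have "dist (lip_env (real n) p x') (lip_env (real n) p x) \<le> real n * dist x' x"
          using lip_env_lipschitz[of p "exp M" "real n" x' x, OF p0 pM] by (simp add: dist_real_def)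
        also have "\<dots> \<le> (real n + 1) * dist x' x" by (intro mult_right_mono) auto
        also have "\<dots> < e" using d by (simp add: field_simps)
        finally show "dist (lip_env (real n) p x') (lip_env (real n) p x) < e" .
      qed
    qed
    moreover have "lip_env (real n) p z + 1 / (real n + 1) \<noteq> 0" for z using pos[of n z] by linarith
    ultimately show ?thesis unfolding h_def by (intro continuous_intros) auto
  qed
  moreover have "w z < ereal (h n z)" if "z \<in> K" for n z
  proof -
    have "p z < lip_env (real n) p z + 1 / (real n + 1)" using add_le_less_mono[OF lip(2)[of z n], of 0 "1 / (real n + 1)"] by simp
    then show ?thesis using pless[OF that pos] by (simp add: h_def)
  qed
  moreover have "\<exists>n. h n z < c" if z: "z \<in> K" "w z < ereal c" for z c
  proof -
    have "(\<lambda>n. lip_env (real n) p z + 1 / (real n + 1)) \<longlonglongrightarrow> p z + 0"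
    proof (rule tendsto_add)
      show "(\<lambda>n. lip_env (real n) p z) \<longlonglongrightarrow> p z" by (rule lip_env_tendsto[OF p0 pM usc_p])
      show "(\<lambda>n. 1 / (real n + 1)) \<longlonglongrightarrow> 0"
        using LIMSEQ_inverse_real_of_nat by (simp add: inverse_eq_divide add.commute)
    qed
    moreover have "p z + 0 < exp c" using pless[OF z(1), of "exp c"] z(2) by simp
    ultimately have "\<forall>\<^sub>F n in sequentially. lip_env (real n) p z + 1 / (real n + 1) < exp c" by (rule order_tendstoD)
    then obtain n where "lip_env (real n) p z + 1 / (real n + 1) < exp c" by (auto simp: eventually_sequentially)
    then have "h n z < ln (exp c)" unfolding h_def using pos[of n z] by (simp only: ln_less_cancel_iff exp_gt_zero)
    then show ?thesis by auto
  qed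
  ultimately show ?thesis by (intro exI[of _ h] conjI allI ballI impI)
qed

text \<open>
  If \<open>p\<close> is a point of the complement nearest to \<open>\<zeta>\<close>, the ball of radius \<open>\<rho>\<close> about \<open>p\<close> misses \<open>D\<close>. The
  ball with diameter \<open>[\<zeta>, p]\<close> lies inside it and touches its sphere at \<open>\<zeta>\<close> only.
\<close>

lemma inner_parallel_exterior_ball:
  fixes \<Omega> :: "'a::euclidean_space set"
  assumes \<Omega>: "open \<Omega>" "\<Omega> \<noteq> UNIV" and \<rho>: "\<rho> > 0" and D: "D = {z. \<rho> < infdist z (- \<Omega>)}" and \<zeta>: "\<zeta> \<in> frontier D"
  shows "\<exists>r>0. \<exists>c. norm (\<zeta> - c) = r \<and> (\<forall>z\<in>closure D. z \<noteq> \<zeta> \<longrightarrow> r < norm (z - c))"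
proof -
  have cont: "continuous_on UNIV (\<lambda>z. infdist z (- \<Omega>))" by (intro continuous_intros)
  have oD: "open D" unfolding D by (intro open_Collect_less continuous_intros)
  have cD: "closure D \<subseteq> {z. \<rho> \<le> infdist z (- \<Omega>)}"
    unfolding D by (intro closure_minimal closed_Collect_le continuous_intros) auto
  have "\<zeta> \<in> closure D" "\<zeta> \<notin> D" using \<zeta> oD by (auto simp: frontier_def interior_open)
  then have i: "infdist \<zeta> (- \<Omega>) = \<rho>" using cD unfolding D by auto
  have "closed (- \<Omega>)" "- \<Omega> \<noteq> {}" using \<Omega> by auto
  from infdist_attains_inf[OF this, of \<zeta>] obtain p where p: "p \<in> - \<Omega>" "dist \<zeta> p = \<rho>" unfolding i by metis
  define c where "c = (1 / 2) *\<^sub>R (\<zeta> + p)"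
  have \<zeta>c: "\<zeta> - c = (1 / 2) *\<^sub>R (\<zeta> - p)" and pc: "c - p = (1 / 2) *\<^sub>R (\<zeta> - p)"
    by (simp_all add: c_def algebra_simps flip: scaleR_add_left)
  have n: "norm (\<zeta> - c) = \<rho> / 2" "norm (c - p) = \<rho> / 2" unfolding \<zeta>c pc using p(2) by (simp_all add: dist_norm)
  have "\<rho> / 2 < norm (z - c)" if z: "z \<in> closure D" "z \<noteq> \<zeta>" for z
  proof (rule ccontr)
    assume a: "\<not> ?thesis"
    have "\<rho> \<le> infdist z (- \<Omega>)" using z cD by blast
    also have "\<dots> \<le> dist z p" using p(1) by (rule infdist_le)
    finally have zp: "\<rho> \<le> norm (z - p)" by (simp add: dist_norm)
    let ?a = "z - c" and ?b = "c - p"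
    have s: "z - p = ?a + ?b" by simp
    have tri: "norm (?a + ?b) \<le> norm ?a + norm ?b" by (rule norm_triangle_ineq)
    have eq: "norm ?a = \<rho> / 2" "norm (?a + ?b) = norm ?a + norm ?b" using zp tri a n(2) unfolding s by linarith+
    have "norm ?a *\<^sub>R ?b = norm ?b *\<^sub>R ?a" by (rule iffD1[OF norm_triangle_eq eq(2)])
    then have "?b = ?a" using eq(1) n(2) \<rho> by simp
    then have "z = \<zeta>" using \<zeta>c pc by (metis diff_eq_eq)
    then show False using z(2) by simp
  qed
  then show ?thesis using n(1) \<rho> by (intro exI[of _ "\<rho> / 2"] exI[of _ c] conjI) auto
qed

context hessian_operator
begin

text \<open>
  The limit along the diagonal exists by monotonicity, so \<open>Lim\<close> is the supremum.
\<close>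

lemma ones_limit_exceeds:
  assumes "Lim at_top (\<lambda>R::real. ereal (f (\<chi> i. R))) > ereal c"
  shows "\<exists>R>0. f (R *\<^sub>R ones) > c"
proof -
  let ?g = "\<lambda>R. ereal (f (R *\<^sub>R ones))"
  have eq: "(\<chi> i. R) = R *\<^sub>R (ones :: real ^ 'n)" for R by (simp add: vec_eq_iff)
  have "(?g \<longlongrightarrow> (SUP R\<in>{0<..}. ?g R)) at_top"
  proof (rule order_tendstoI)
    fix a assume "a < (SUP R\<in>{0<..}. ?g R)"
    then obtain R where R: "R > 0" "a < ?g R" unfolding less_SUP_iff by auto
    show "\<forall>\<^sub>F x in at_top. a < ?g x" using eventually_ge_at_top[of R]
    proof eventually_elim
      case (elim x)
      then have "?g R \<le> ?g x" using f_ones_mono R(1) by simp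
      then show ?case by (rule less_le_trans[OF R(2)])
    qed
  next
    fix a assume a: "(SUP R\<in>{0<..}. ?g R) < a"
    show "\<forall>\<^sub>F x in at_top. ?g x < a" using eventually_gt_at_top[of 0]
    proof eventually_elim
      case (elim x)
      then have "?g x \<le> (SUP R\<in>{0<..}. ?g R)" by (intro SUP_upper) simp
      then show ?case using a by (rule le_less_trans)
    qed
  qed
  then have "Lim at_top ?g = (SUP R\<in>{0<..}. ?g R)" by (intro tendsto_Lim) simp
  then have "ereal c < (SUP R\<in>{0<..}. ?g R)" using assms unfolding eq by simp
  then show ?thesis unfolding less_SUP_iff by auto
qed

text \<open>
  Regularisation of the supremum preserves the subsolution property, and by comparison also the bound
  by \<open>v\<close>; the boundary values are controlled since \<open>v\<close> is continuous there. Thus the regularisation is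
  a competitor and coincides with the supremum on \<open>D\<close>.
\<close>

theorem envelope_subsol:
  fixes v :: "complex ^ 'n \<Rightarrow> real"
  assumes D: "open D" "bounded D" and \<psi>: "continuous_on D \<psi>" "\<And>z. z \<in> D \<Longrightarrow> 0 \<le> \<psi> z" "\<And>z. z \<in> D \<Longrightarrow> \<exists>R>0. f (R *\<^sub>R ones) > \<psi> z"
    and v: "supersol \<psi> D (\<lambda>z. ereal (v z))" and M: "\<And>z. z \<in> D \<Longrightarrow> v z \<le> M"
    and bd: "\<And>\<zeta>. \<zeta> \<in> frontier D \<Longrightarrow> (v \<longlongrightarrow> v \<zeta>) (at \<zeta> within D)"
    and F: "F = {w. subsol \<psi> D w \<and> (\<forall>y\<in>D. w y \<le> ereal (v y))}"
  shows "(\<lambda>z. SUP w\<in>F. w z) \<in> F"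
proof -
  let ?S = "\<lambda>z. SUP w\<in>F. w z"
  define U where "U = usc_env D ?S"
  have Sv: "?S z \<le> ereal (v z)" if "z \<in> D" for z using that by (intro SUP_least) (simp add: F)
  have UM: "U z \<le> ereal m" if "r > 0" "\<And>y. y \<in> ball z r \<Longrightarrow> y \<in> D \<Longrightarrow> v y \<le> m" for z r m
    unfolding U_def
  proof (rule usc_env_le[OF that(1)])
    fix y assume y: "y \<in> ball z r" "y \<in> D"
    have "ereal (v y) \<le> ereal m" using that(2)[OF y] by simp
    then show "?S y \<le> ereal m" using Sv[OF y(2)] order_trans by blast
  qed
  have Usub: "subsol \<psi> D U" unfolding U_def
  proof (rule sup_subsol[OF D(1) \<psi>(1)])
    show "subsol \<psi> D w" if "w \<in> F" for w using that by (simp add: F)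
    fix z
    have "U z \<le> ereal M" using M by (intro UM[of 1]) auto
    then show "usc_env D ?S z < \<infinity>" unfolding U_def by (rule le_less_trans) simp
  qed
  have Uv: "U z \<le> ereal (v z)" if z: "z \<in> D" for z
  proof (rule comparison[OF D(1) \<psi> Usub v _ z])
    fix e :: real assume e: "e > 0"
    show "\<exists>K. compact K \<and> K \<subseteq> D \<and> (\<forall>z\<in>D - K. U z \<le> ereal (v z + e))"
    proof (rule compact_boundary_exhaustion[OF D])
      fix \<zeta> assume \<zeta>: "\<zeta> \<in> frontier D"
      then have \<zeta>D: "\<zeta> \<notin> D" using D(1) by (simp add: frontier_def interior_open)
      have "\<forall>\<^sub>F z in at \<zeta> within D. dist (v z) (v \<zeta>) < e / 2" using e by (intro tendstoD[OF bd[OF \<zeta>]]) simp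
      then obtain d where d: "d > 0" "\<And>z. z \<in> D \<Longrightarrow> z \<noteq> \<zeta> \<Longrightarrow> dist z \<zeta> < d \<Longrightarrow> dist (v z) (v \<zeta>) < e / 2"
        unfolding eventually_at by blast
      have dv: "\<bar>v z - v \<zeta>\<bar> < e / 2" if "z \<in> D" "dist z \<zeta> < d" for z
        using d(2)[OF that(1) _ that(2)] \<zeta>D that(1) by (auto simp: dist_real_def)
      have "U z \<le> ereal (v z + e)" if z: "z \<in> D" "dist z \<zeta> < d" for z
      proof -
        have "U z \<le> ereal (v \<zeta> + e / 2)"
        proof (rule UM)
          show "d - dist z \<zeta> > 0" using z(2) by simp
          fix y assume y: "y \<in> ball z (d - dist z \<zeta>)" "y \<in> D"
          have "dist y \<zeta> \<le> dist z y + dist z \<zeta>" using dist_triangle[of y \<zeta> z] by (simp add: dist_commute)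
          then have "dist y \<zeta> < d" using y(1) by simp
          from dv[OF y(2) this] show "v y \<le> v \<zeta> + e / 2" unfolding abs_less_iff by linarith
        qed
        also have "\<dots> \<le> ereal (v z + e)" using dv[OF z] unfolding abs_less_iff ereal_less_eq by linarith
        finally show ?thesis .
      qed
      then show "\<forall>\<^sub>F z in at \<zeta> within D. U z \<le> ereal (v z + e)" unfolding eventually_at using d(1) by blast
    qed
  qed
  have "U \<in> F" using Usub Uv by (simp add: F)
  then have "U z \<le> ?S z" for z by (rule SUP_upper)
  moreover have "?S z \<le> U z" if "z \<in> D" for z unfolding U_def using that by (rule usc_env_ge)
  ultimately have eq: "U z = ?S z" if "z \<in> D" for z using that by (intro antisym) auto
  have "subsol \<psi> D ?S" by (rule subsol_cong[OF D(1) eq Usub])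
  then show ?thesis using Sv by (simp add: F)
qed

text \<open>
  The approximation from above of a bounded subsolution stays below \<open>h\<close>, because \<open>u < h\<close> holds with a
  uniform margin on the compact set, even after small displacements. A paraboloid far below
  \<open>h\<close> first makes \<open>u\<close> bounded below.
\<close>

lemma smooth_subsol_between:
  assumes D: "open D" "bounded D" and u: "subsol \<psi> D u" and M: "\<And>z. z \<in> D \<Longrightarrow> u z \<le> ereal M"
    and \<psi>: "continuous_on D \<psi>" "\<And>z. z \<in> D \<Longrightarrow> 0 \<le> \<psi> z" "\<And>z. z \<in> D \<Longrightarrow> \<psi> z \<le> c1"
    and R: "R > 0" "f (R *\<^sub>R ones) > c1" and K: "compact K" "K \<subseteq> D"
    and h: "continuous_on K h" "\<And>z. z \<in> K \<Longrightarrow> u z < ereal (h z)"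
  shows "\<exists>W W' W''. C2_on UNIV W W' W'' \<and> (\<forall>x\<in>K. opge (\<psi> x) (W'' x) \<and> u x < ereal (W x) \<and> W x < h x)"
proof (cases "K = {}")
  case True
  have "C2_on UNIV (\<lambda>z::complex^'n. 0 * (norm (z - 0))\<^sup>2 + 0) (\<lambda>z. (2 * 0) *\<^sub>R blinfun_inner_right (z - 0)) (\<lambda>z. (2 * 0) *\<^sub>R inner2)"
    by (rule C2_quadratic)
  then show ?thesis unfolding True by blast
next
  case False
  obtain xh where xh: "xh \<in> K" "\<And>y. y \<in> K \<Longrightarrow> h xh \<le> h y" using continuous_attains_inf[OF K(1) False h(1)] by blast
  obtain B where B: "B > 0" "\<And>z. z \<in> D \<Longrightarrow> norm z \<le> B" using D(2) by (auto simp: bounded_pos)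
  define L where "L = R * B\<^sup>2 + \<bar>h xh\<bar> + 1"
  let ?Q = "\<lambda>z::complex^'n. R * (norm (z - 0))\<^sup>2 + (- L)"
  have RB: "0 \<le> R * (norm z)\<^sup>2" "R * (norm z)\<^sup>2 \<le> R * B\<^sup>2" if "z \<in> D" for z
    using power_mono[OF B(2)[OF that] norm_ge_zero, of 2] R(1) by auto
  have Q: "subsol \<psi> D (\<lambda>z. ereal (?Q z))"
    by (rule smooth_subsol[OF D(1) C2_quadratic]) (use opge_mono[OF opge_quadratic[OF R(1) less_imp_le[OF R(2)]] \<psi>(3)] in auto)
  define u1 where "u1 z = real_of_ereal (max (u z) (ereal (?Q z)))" for z
  have u1: "ereal (u1 z) = max (u z) (ereal (?Q z))" if "z \<in> D" for z
    using M[OF that] unfolding u1_def by (cases "u z") (auto simp: max_def)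
  have u1sub: "subsol \<psi> D (\<lambda>z. ereal (u1 z))"
    by (rule subsol_cong[OF D(1) _ subsol_max[OF D(1) u Q]]) (simp add: u1)
  have u1M: "\<bar>u1 z\<bar> \<le> \<bar>M\<bar> + L + R * B\<^sup>2" if z: "z \<in> D" for z
  proof -
    have "ereal (?Q z) \<le> ereal (u1 z)" unfolding u1[OF z] by simp
    moreover have "ereal (u1 z) \<le> max (ereal M) (ereal (?Q z))" unfolding u1[OF z] using M[OF z] by (intro max.mono) auto
    ultimately show ?thesis using RB[OF z] L_def by (auto simp: max_def split: if_splits)
  qed
  have u1h: "u1 z < h z" if z: "z \<in> K" for z
  proof -
    have "?Q z < h z" using RB(2)[of z] z K(2) xh(2)[OF z] by (auto simp: L_def)
    then have "max (u z) (ereal (?Q z)) < ereal (h z)" using h(2)[OF z] by simp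
    then have "ereal (u1 z) < ereal (h z)" using u1[OF subsetD[OF K(2) z]] by (simp only:)
    then show ?thesis by simp
  qed
  have u1usc: "\<forall>\<^sub>F y in nhds z. u1 y < c" if "z \<in> D" "u1 z < c" for z c
    using subsol_usc[OF D(1) u1sub that(1), of "ereal c"] that(2) by simp
  have "\<exists>x\<in>K. \<forall>y\<in>K. u1 y - h y \<le> u1 x - h x"
  proof (rule usc_attains_max[OF K(1) False])
    fix x c assume x: "x \<in> K" "u1 x - h x < c"
    define t where "t = (c - (u1 x - h x)) / 2"
    have t: "t > 0" using x(2) by (simp add: t_def)
    have "\<forall>\<^sub>F y in nhds x. u1 y < u1 x + t" using x(1) K(2) t by (intro u1usc) auto
    moreover have "(h \<longlongrightarrow> h x) (at x within K)" using h(1) x(1) by (simp add: continuous_on)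
    then have "\<forall>\<^sub>F y in at x within K. h x - t < h y" using t by (intro order_tendstoD) auto
    then have "\<forall>\<^sub>F y in nhds x. y \<in> K \<longrightarrow> h x - t < h y"
      unfolding eventually_at_filter by eventually_elim (use t in auto)
    ultimately have "\<forall>\<^sub>F y in nhds x. y \<in> K \<longrightarrow> u1 y - h y < c"
    proof eventually_elim
      case (elim y)
      have "2 * t = c - (u1 x - h x)" by (simp add: t_def)
      then show ?case using elim by linarith
    qed
    then show "\<exists>U. open U \<and> x \<in> U \<and> (\<forall>y\<in>U \<inter> K. u1 y - h y < c)" unfolding eventually_nhds by blast
  qed
  then obtain xm where xm: "xm \<in> K" "\<And>y. y \<in> K \<Longrightarrow> u1 y - h y \<le> u1 xm - h xm" by blast
  define e where "e = (h xm - u1 xm) / 5"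
  have e: "e > 0" using u1h[OF xm(1)] by (simp add: e_def)
  have gap: "u1 y < h y - 4 * e" if "y \<in> K" for y
  proof -
    have "5 * e = h xm - u1 xm" by (simp add: e_def)
    then show ?thesis using xm(2)[OF that] e by linarith
  qed
  have "\<exists>r>0. \<forall>z\<in>K. \<forall>y\<in>cball z r. u1 y < h z - 4 * e"
  proof (rule usc_lsc_separation[OF K(1) _ _ gap])
    show "\<forall>\<^sub>F y in nhds z. u1 y < c" if "z \<in> K" "u1 z < c" for z c using that K(2) by (intro u1usc) auto
    fix z c assume z: "z \<in> K" "c < h z - 4 * e"
    have "(h \<longlongrightarrow> h z) (at z within K)" using h(1) z(1) by (simp add: continuous_on)
    then have "\<forall>\<^sub>F y in at z within K. c + 4 * e < h y" using z by (intro order_tendstoD) auto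
    then show "\<forall>\<^sub>F y in nhds z. y \<in> K \<longrightarrow> c < h y - 4 * e"
      unfolding eventually_at_filter by eventually_elim (use z in auto)
  qed
  then obtain r where r: "r > 0" "\<And>z y. z \<in> K \<Longrightarrow> y \<in> cball z r \<Longrightarrow> u1 y < h z - 4 * e" by blast
  obtain W W' W'' \<eta> where W: "\<eta> > 0" "C2_on UNIV W W' W''" "\<And>x. x \<in> K \<Longrightarrow> opge (\<psi> x + \<eta>) (W'' x)"
    "\<And>x. x \<in> K \<Longrightarrow> u1 x - e \<le> W x" "\<And>x m. x \<in> K \<Longrightarrow> (\<forall>y\<in>cball x r. u1 y \<le> m) \<Longrightarrow> W x \<le> m + e"
    using strict_smooth_approximation[OF D(1) u1sub u1M \<psi> R K e r(1)] by blast
  have "opge (\<psi> x) (W'' x) \<and> u x < ereal (W x + 2 * e) \<and> W x + 2 * e < h x" if x: "x \<in> K" for x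
  proof (intro conjI)
    show "opge (\<psi> x) (W'' x)" by (rule opge_mono[OF W(3)[OF x]]) (use W(1) in simp)
    have "u x \<le> ereal (u1 x)" using u1[of x] x K(2) by auto
    also have "\<dots> < ereal (W x + 2 * e)" using W(4)[OF x] e by simp
    finally show "u x < ereal (W x + 2 * e)" .
    have "W x \<le> h x - 4 * e + e" by (rule W(5)[OF x]) (use r(2)[OF x] in \<open>auto intro: less_imp_le\<close>)
    then show "W x + 2 * e < h x" using e by linarith
  qed
  then show ?thesis using C2_on_add_const[OF W(2), of "2 * e"] by blast
qed

text \<open>
  The functions \<open>W n\<close> are smooth, satisfy the inequality of a subsolution on \<open>K\<close>, which contains the
  closure of \<open>D\<close>, and decrease to \<open>\<Phi>\<close> there; \<open>u n\<close> solves the Dirichlet problem on \<open>D\<close> with data \<open>W n\<close>. Both \<open>\<Phi>\<close> and \<open>u (n + 1)\<close>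
  have boundary values at most \<open>W n\<close>, so they lie below \<open>u n\<close>.
\<close>

theorem envelope_decreasing_limit:
  fixes v :: "complex ^ 'n \<Rightarrow> real"
  assumes \<Omega>: "open \<Omega>" "bounded \<Omega>"
    and \<psi>: "continuous_on \<Omega> \<psi>" "\<And>z. z \<in> \<Omega> \<Longrightarrow> 0 \<le> \<psi> z" "\<And>z. z \<in> \<Omega> \<Longrightarrow> \<exists>R>0. f (R *\<^sub>R ones) > \<psi> z"
    and v: "supersol \<psi> \<Omega> (\<lambda>z. ereal (v z))" and M: "\<And>z. z \<in> \<Omega> \<Longrightarrow> v z \<le> M"
    and F: "F = {w. subsol \<psi> \<Omega> w \<and> (\<forall>y\<in>\<Omega>. w y \<le> ereal (v y))}"
    and env: "(\<lambda>z. SUP w\<in>F. w z) \<in> F"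
    and K0: "compact K0" "K0 \<subseteq> \<Omega>" "K0 \<noteq> {}"
  shows "\<exists>D u. open D \<and> K0 \<subseteq> D \<and>
    (\<forall>j. continuous_on D (u j) \<and> subsol \<psi> D (\<lambda>z. ereal (u j z)) \<and> supersol \<psi> D (\<lambda>z. ereal (u j z))) \<and>
    (\<forall>z\<in>D. decseq (\<lambda>j. u j z) \<and> (\<lambda>j. ereal (u j z)) \<longlonglongrightarrow> (SUP w\<in>F. w z))"
proof -
  define \<Phi> where "\<Phi> z = (SUP w\<in>F. w z)" for z
  have \<Phi>: "subsol \<psi> \<Omega> \<Phi>" "\<And>z. z \<in> \<Omega> \<Longrightarrow> \<Phi> z \<le> ereal (v z)" using env unfolding F \<Phi>_def by auto
  have \<Phi>max: "w z \<le> \<Phi> z" if "subsol \<psi> \<Omega> w" "\<And>y. y \<in> \<Omega> \<Longrightarrow> w y \<le> ereal (v y)" for w z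
    unfolding \<Phi>_def by (rule SUP_upper) (use that in \<open>simp add: F\<close>)
  have \<Phi>M: "\<Phi> z \<le> ereal M" if "z \<in> \<Omega>" for z
    using \<Phi>(2)[OF that] M[OF that] by (auto intro: order_trans)
  have "\<Omega> \<noteq> UNIV" using \<Omega>(2) not_bounded_UNIV by metis
  then have ne: "closed (- \<Omega>)" "- \<Omega> \<noteq> {}" "\<Omega> \<noteq> UNIV" using \<Omega>(1) by auto
  let ?d = "\<lambda>z. infdist z (- \<Omega>)"
  have dcont: "continuous_on S ?d" for S by (intro continuous_intros)
  obtain x0 where x0: "x0 \<in> K0" "\<And>y. y \<in> K0 \<Longrightarrow> ?d x0 \<le> ?d y" using continuous_attains_inf[OF K0(1,3) dcont] by blast
  have x0pos: "?d x0 > 0" using x0(1) K0(2) ne by (intro infdist_pos_not_in_closed) auto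
  define \<rho> where "\<rho> = ?d x0 / 2"
  have \<rho>: "\<rho> > 0" using x0pos by (simp add: \<rho>_def)
  define D where "D = {z. \<rho> < ?d z}"
  define D2 where "D2 = {z. \<rho> / 2 < ?d z}"
  define K where "K = {z. \<rho> \<le> ?d z}"
  define K2 where "K2 = {z. \<rho> / 2 \<le> ?d z}"
  have op: "open D" "open D2" unfolding D_def D2_def by (auto intro!: open_Collect_less continuous_intros)
  have cl: "closed K" "closed K2" unfolding K_def K2_def by (auto intro!: closed_Collect_le continuous_intros)
  have sub: "D \<subseteq> K" "K \<subseteq> D2" "D2 \<subseteq> K2" using \<rho> by (auto simp: D_def D2_def K_def K2_def)
  have K2\<Omega>: "K2 \<subseteq> \<Omega>"
  proof
    fix z assume "z \<in> K2"
    then have "?d z \<noteq> 0" using \<rho> by (simp add: K2_def)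
    then show "z \<in> \<Omega>" using infdist_zero[of z "- \<Omega>"] by blast
  qed
  have D\<Omega>: "D \<subseteq> \<Omega>" "D2 \<subseteq> \<Omega>" "K \<subseteq> \<Omega>" using sub K2\<Omega> by auto
  have bd: "bounded D" "bounded D2" "bounded K" "bounded K2" using \<Omega>(2) D\<Omega> K2\<Omega> bounded_subset by blast+
  have comp: "compact K" "compact K2" using cl bd by (auto simp: compact_eq_bounded_closed)
  have clD: "closure D \<subseteq> K" using sub(1) cl(1) by (rule closure_minimal)
  have K0D: "K0 \<subseteq> D" using x0(2) x0pos by (force simp: D_def \<rho>_def)
  have "K2 \<noteq> {}" using K0D sub K0(3) by blast
  then obtain zs where zs: "zs \<in> K2" "\<And>y. y \<in> K2 \<Longrightarrow> \<psi> y \<le> \<psi> zs"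
    using continuous_attains_sup[OF comp(2) _ continuous_on_subset[OF \<psi>(1) K2\<Omega>]] by blast
  obtain R where R: "R > 0" "f (R *\<^sub>R ones) > \<psi> zs" using \<psi>(3) zs(1) K2\<Omega> by blast
  have usc\<Phi>: "\<forall>\<^sub>F y in nhds z. \<Phi> y < c" if "z \<in> \<Omega>" "\<Phi> z < c" for z c using subsol_usc[OF \<Omega>(1) \<Phi>(1) that] .
  have "\<exists>h :: nat \<Rightarrow> complex ^ 'n \<Rightarrow> real. (\<forall>n. continuous_on K (h n)) \<and> (\<forall>n. \<forall>z\<in>K. \<Phi> z < ereal (h n z)) \<and>
    (\<forall>z\<in>K. \<forall>c. \<Phi> z < ereal c \<longrightarrow> (\<exists>n. h n z < c))"
    by (rule usc_decreasing_continuous[OF cl(1)]) (use usc\<Phi> D\<Omega>(3) \<Phi>M in \<open>blast+\<close>)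
  then obtain h :: "nat \<Rightarrow> complex ^ 'n \<Rightarrow> real" where h: "\<And>n. continuous_on K (h n)" "\<And>n z. z \<in> K \<Longrightarrow> \<Phi> z < ereal (h n z)"
    "\<And>z c. z \<in> K \<Longrightarrow> \<Phi> z < ereal c \<Longrightarrow> \<exists>n. h n z < c" by blast
  have smooth: "\<exists>W W' W''. C2_on UNIV W W' W'' \<and> (\<forall>x\<in>K. opge (\<psi> x) (W'' x) \<and> \<Phi> x < ereal (W x) \<and> W x < k x)"
    if k: "continuous_on K k" "\<And>z. z \<in> K \<Longrightarrow> \<Phi> z < ereal (k z)" for k
  proof (rule smooth_subsol_between[OF op(2) bd(2) _ _ _ _ _ R comp(1) sub(2) k])
    show "subsol \<psi> D2 \<Phi>" by (rule subsol_subset[OF \<Omega>(1) op(2) D\<Omega>(2) \<Phi>(1)])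
    show "continuous_on D2 \<psi>" by (rule continuous_on_subset[OF \<psi>(1) D\<Omega>(2)])
  qed (use \<Phi>M \<psi>(2) D\<Omega> zs(2) sub in auto)
  define P where "P n W \<longleftrightarrow> (\<exists>W' W''. C2_on UNIV W W' W'' \<and> (\<forall>x\<in>K. opge (\<psi> x) (W'' x) \<and> \<Phi> x < ereal (W x) \<and> W x < h n x))" for n W
  have "\<exists>W. \<forall>n. P n (W n) \<and> (\<forall>x\<in>K. W (Suc n) x < W n x)"
  proof (rule dependent_nat_choice)
    show "\<exists>W. P 0 W" unfolding P_def by (rule smooth[OF h(1,2)])
    fix W n assume "P n W"
    then obtain W' W'' where W: "C2_on UNIV W W' W''" "\<And>x. x \<in> K \<Longrightarrow> \<Phi> x < ereal (W x)" unfolding P_def by blast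
    have "continuous_on K W" using C2_on_isCont[OF W(1)] by (simp add: continuous_at_imp_continuous_on)
    then have "continuous_on K (\<lambda>x. min (W x) (h (Suc n) x))" using h(1) by (intro continuous_intros)
    moreover have "\<Phi> z < ereal (min (W z) (h (Suc n) z))" if "z \<in> K" for z
      using W(2)[OF that] h(2)[OF that, of "Suc n"] by (simp add: min_def)
    ultimately have "\<exists>Y Y' Y''. C2_on UNIV Y Y' Y'' \<and>
        (\<forall>x\<in>K. opge (\<psi> x) (Y'' x) \<and> \<Phi> x < ereal (Y x) \<and> Y x < min (W x) (h (Suc n) x))" by (rule smooth)
    then obtain Y Y' Y'' where Y: "C2_on UNIV Y Y' Y''"
      "\<And>x. x \<in> K \<Longrightarrow> opge (\<psi> x) (Y'' x) \<and> \<Phi> x < ereal (Y x) \<and> Y x < min (W x) (h (Suc n) x)" by blast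
    show "\<exists>Y. P (Suc n) Y \<and> (\<forall>x\<in>K. Y x < W x)" unfolding P_def using Y by (intro exI[of _ Y] conjI exI[of _ Y'] exI[of _ Y'']) auto
  qed
  then obtain W where PW: "\<And>n. P n (W n)" and Wdec: "\<And>n x. x \<in> K \<Longrightarrow> W (Suc n) x < W n x" by blast
  have W\<Phi>: "\<Phi> x < ereal (W n x)" and Wh: "W n x < h n x" if "x \<in> K" for n x using PW[of n] that unfolding P_def by blast+
  have Wsub: "subsol \<psi> D (\<lambda>z. ereal (W n z))" for n
  proof -
    obtain W' W'' where W: "C2_on UNIV (W n) W' W''" "\<And>x. x \<in> K \<Longrightarrow> opge (\<psi> x) (W'' x)" using PW[of n] unfolding P_def by blast
    show ?thesis by (rule smooth_subsol[OF op(1) W(1)]) (use W(2) sub(1) in auto)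
  qed
  have Wcont: "continuous_on (closure D) (W n)" for n
  proof -
    obtain W' W'' where "C2_on UNIV (W n) W' W''" using PW[of n] unfolding P_def by blast
    then show ?thesis using C2_on_isCont by (blast intro: continuous_at_imp_continuous_on)
  qed
  define sol where "sol n u \<longleftrightarrow> continuous_on D u \<and> subsol \<psi> D (\<lambda>z. ereal (u z)) \<and> supersol \<psi> D (\<lambda>z. ereal (u z)) \<and>
    (\<forall>\<zeta>\<in>frontier D. \<forall>e>0. \<forall>\<^sub>F z in at \<zeta> within D. u z \<le> W n \<zeta> + e) \<and>
    (\<forall>w. subsol \<psi> D w \<longrightarrow> (\<forall>\<zeta>\<in>frontier D. \<forall>e>0. \<forall>\<^sub>F z in at \<zeta> within D. w z \<le> ereal (W n \<zeta> + e)) \<longrightarrow>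
       (\<forall>z\<in>D. w z \<le> ereal (u z)))" for n u
  have "\<exists>u. sol n u" for n unfolding sol_def
  proof (rule dirichlet_problem[OF op(1) bd(1) _ _ _ _ Wcont Wsub])
    show "continuous_on D \<psi>" by (rule continuous_on_subset[OF \<psi>(1) D\<Omega>(1)])
    show "\<exists>r>0. \<exists>c. norm (\<zeta> - c) = r \<and> (\<forall>z\<in>closure D. z \<noteq> \<zeta> \<longrightarrow> r < norm (z - c))" if "\<zeta> \<in> frontier D" for \<zeta>
      by (rule inner_parallel_exterior_ball[OF \<Omega>(1) ne(3) \<rho> D_def that])
  qed (use \<psi>(2,3) D\<Omega>(1) in auto)
  then obtain u where u: "\<And>n. sol n (u n)" by metis
  have ucont: "continuous_on D (u n)" and usub: "subsol \<psi> D (\<lambda>z. ereal (u n z))" and usup: "supersol \<psi> D (\<lambda>z. ereal (u n z))"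
    and ubd: "\<And>\<zeta> e. \<zeta> \<in> frontier D \<Longrightarrow> e > 0 \<Longrightarrow> \<forall>\<^sub>F z in at \<zeta> within D. u n z \<le> W n \<zeta> + e" for n
    using u[of n] unfolding sol_def by blast+
  have umax: "w z \<le> ereal (u n z)"
    if "subsol \<psi> D w" "\<And>\<zeta> e. \<zeta> \<in> frontier D \<Longrightarrow> e > 0 \<Longrightarrow> \<forall>\<^sub>F z in at \<zeta> within D. w z \<le> ereal (W n \<zeta> + e)" "z \<in> D" for w n z
    using u[of n] that unfolding sol_def by blast
  have frK: "\<zeta> \<in> K" if "\<zeta> \<in> frontier D" for \<zeta> using that clD by (auto simp: frontier_def)
  have \<Phi>u: "\<Phi> z \<le> ereal (u n z)" if "z \<in> D" for n z
  proof (rule umax[OF subsol_subset[OF \<Omega>(1) op(1) D\<Omega>(1) \<Phi>(1)] _ that])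
    fix \<zeta> and e :: real assume \<zeta>: "\<zeta> \<in> frontier D" "e > 0"
    have "\<forall>\<^sub>F z in nhds \<zeta>. \<Phi> z < ereal (W n \<zeta>)" using frK[OF \<zeta>(1)] D\<Omega>(3) W\<Phi> by (intro usc\<Phi>) auto
    then have "\<forall>\<^sub>F z in at \<zeta> within D. \<Phi> z < ereal (W n \<zeta>)" by (rule filter_leD[OF at_within_le_nhds])
    then show "\<forall>\<^sub>F z in at \<zeta> within D. \<Phi> z \<le> ereal (W n \<zeta> + e)"
    proof eventually_elim
      case (elim z)
      have "ereal (W n \<zeta>) \<le> ereal (W n \<zeta> + e)" using \<zeta>(2) by simp
      then show ?case using elim by (meson less_imp_le order_trans)
    qed
  qed
  have udec: "u (Suc n) z \<le> u n z" if "z \<in> D" for n z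
  proof -
    have "ereal (u (Suc n) z) \<le> ereal (u n z)"
    proof (rule umax[OF usub _ that])
      fix \<zeta> and e :: real assume \<zeta>: "\<zeta> \<in> frontier D" "e > 0"
      show "\<forall>\<^sub>F z in at \<zeta> within D. ereal (u (Suc n) z) \<le> ereal (W n \<zeta> + e)"
        using ubd[OF \<zeta>, of "Suc n"]
      proof eventually_elim
        case (elim z)
        then show ?case using Wdec[OF frK[OF \<zeta>(1)], of n] by simp
      qed
    qed
    then show ?thesis by simp
  qed
  let ?I = "\<lambda>z. INF n. ereal (u n z)"
  \<comment> \<open>Gluing: \<open>w\<close> agrees with \<open>\<Phi>\<close> off \<open>D\<close> and majorises it on \<open>D\<close>, so at points off \<open>D\<close> every test function
      for \<open>w\<close> is one for \<open>\<Phi>\<close>; the upper limits of \<open>u n\<close> at the boundary are at most \<open>W n\<close>, which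
      decreases to \<open>\<Phi>\<close>, so \<open>w\<close> is upper semicontinuous.\<close>
  define w where "w z = (if z \<in> D then ?I z else \<Phi> z)" for z
  have Isub: "subsol \<psi> D ?I"
    by (rule decreasing_limit_subsol[OF op(1) continuous_on_subset[OF \<psi>(1) D\<Omega>(1)] usub]) (simp add: udec)
  have \<Phi>w: "\<Phi> z \<le> w z" for z using \<Phi>u by (auto simp: w_def intro!: INF_greatest)
  have wsubD: "subsol \<psi> D w" by (rule subsol_cong[OF op(1) _ Isub]) (simp add: w_def)
  have wusc: "\<forall>\<^sub>F y in nhds z. w y < c" if z: "z \<in> \<Omega>" "w z < c" for z c
  proof (cases "z \<in> D")
    case True
    show ?thesis by (rule subsol_usc[OF op(1) wsubD True z(2)])
  next
    case False
    then have \<Phi>c: "\<Phi> z < c" using z(2) by (simp add: w_def)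
    have "\<forall>\<^sub>F y in nhds z. y \<in> D \<longrightarrow> w y < c"
    proof (cases "z \<in> closure D")
      case True
      then have fr: "z \<in> frontier D" using False op(1) by (simp add: frontier_def interior_open)
      obtain t where t: "\<Phi> z < ereal t" "ereal t < c" using ereal_dense2[OF \<Phi>c] by blast
      obtain n where n: "h n z < t" using h(3)[OF frK[OF fr] t(1)] by blast
      then have "0 < t - W n z" using Wh[OF frK[OF fr], of n] by linarith
      from ubd[OF fr this, of n] have "\<forall>\<^sub>F y in nhds z. y \<noteq> z \<longrightarrow> y \<in> D \<longrightarrow> u n y \<le> t" by (simp add: eventually_at_filter)
      then show ?thesis
      proof (rule eventually_mono, intro impI)
        fix y assume y: "y \<noteq> z \<longrightarrow> y \<in> D \<longrightarrow> u n y \<le> t" "y \<in> D"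
        then have "ereal (u n y) \<le> ereal t" using False by auto
        then have "?I y \<le> ereal t" by (rule INF_lower2[OF UNIV_I])
        then show "w y < c" using y(2) t(2) by (simp add: w_def)
      qed
    next
      case False
      then have "\<forall>\<^sub>F y in nhds z. y \<in> - closure D" by (intro eventually_nhds_in_open) auto
      then show ?thesis by eventually_elim (use closure_subset in auto)
    qed
    then show ?thesis using usc\<Phi>[OF z(1) \<Phi>c] by eventually_elim (auto simp: w_def)
  qed
  have wsub: "subsol \<psi> \<Omega> w" unfolding subsol_def usc_on_open[OF \<Omega>(1)]
  proof (intro conjI ballI allI impI)
    show "\<forall>\<^sub>F y in nhds z. w y < c" if "z \<in> \<Omega>" "w z < c" for z c using that by (rule wusc)
    show "w z < \<infinity>" if "z \<in> \<Omega>" for z using wsubD \<Phi>(1) that by (cases "z \<in> D") (auto simp: subsol_def w_def)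
    fix z N q q' q''
    assume z: "z \<in> \<Omega>" "z \<in> N" "C2_on N q q' q''" "w z = ereal (q z)" "\<forall>\<^sub>F x in nhds z. w x \<le> ereal (q x)"
    show "opge (\<psi> z) (q'' z)"
    proof (cases "z \<in> D")
      case True
      show ?thesis by (rule subsol_test[OF wsubD True z(2-5)])
    next
      case False
      have "\<forall>\<^sub>F x in nhds z. \<Phi> x \<le> ereal (q x)" using z(5) by (rule eventually_mono) (rule order_trans[OF \<Phi>w])
      then show ?thesis by (rule subsol_test[OF \<Phi>(1) z(1-3), rotated]) (use z(4) False in \<open>simp add: w_def\<close>)
    qed
  qed
  have wv: "w z \<le> ereal (v z)" if "z \<in> \<Omega>" for z
  proof (rule comparison[OF \<Omega>(1) \<psi> wsub v _ that])
    fix e :: real assume e: "e > 0"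
    have "w y \<le> ereal (v y + e)" if "y \<in> \<Omega> - K" for y
    proof -
      have "w y \<le> ereal (v y)" using \<Phi>(2)[of y] that sub(1) by (auto simp: w_def)
      also have "\<dots> \<le> ereal (v y + e)" using e by simp
      finally show ?thesis .
    qed
    then show "\<exists>K. compact K \<and> K \<subseteq> \<Omega> \<and> (\<forall>y\<in>\<Omega> - K. w y \<le> ereal (v y + e))" using comp(1) D\<Omega>(3) by blast
  qed
  have I\<Phi>: "?I z = \<Phi> z" if "z \<in> D" for z
    using \<Phi>max[OF wsub wv, of z] \<Phi>w[of z] that by (simp add: w_def)
  have dec: "decseq (\<lambda>j. u j z)" if "z \<in> D" for z using udec[OF that] by (rule decseq_SucI)
  have "(\<lambda>j. ereal (u j z)) \<longlonglongrightarrow> \<Phi> z" if "z \<in> D" for z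
  proof -
    have "decseq (\<lambda>j. ereal (u j z))" using dec[OF that] by (simp add: decseq_def)
    then show ?thesis using LIMSEQ_INF I\<Phi>[OF that] by metis
  qed
  then show ?thesis using op(1) K0D ucont usub usup dec unfolding \<Phi>_def
    by (intro exI[of _ D] exI[of _ u] conjI allI ballI)
qed

end

theorem theorem1p4:
  fixes \<Omega> :: "(complex ^ 'n) set"
    and \<psi> :: "complex ^ 'n \<Rightarrow> real"
    and \<Gamma> :: "(real ^ 'n) set"
    and f :: "real ^ 'n \<Rightarrow> real"
    and v :: "complex ^ 'n \<Rightarrow> real"
  assumes "open \<Omega>" and "connected \<Omega>" and "\<Omega> \<noteq> {}" and "bounded \<Omega>"
    and "continuous_on (closure \<Omega>) \<psi>" and "\<forall>z\<in>closure \<Omega>. \<psi> z \<ge> 0"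
    and "admissible_cone \<Gamma>" and "admissible_fun \<Gamma> f"
    and "\<forall>z\<in>\<Omega>. Lim at_top (\<lambda>R::real. ereal (f (\<chi> i. R))) > ereal (\<psi> z)"
    and "bounded (v ` closure \<Omega>)"
    and "lsc_on (closure \<Omega>) (\<lambda>z. ereal (v z))"
    and "\<forall>z\<in>frontier \<Omega>. continuous (at z within closure \<Omega>) v"
    and "viscosity_supersol (matrix_op \<Gamma> f) \<psi> \<Omega> (\<lambda>z. ereal (v z))"
  shows "\<forall>U. open U \<and> U \<subseteq> \<Omega> \<and> compact (closure U) \<and> closure U \<subseteq> \<Omega> \<longrightarrow>
           (\<exists>u :: nat \<Rightarrow> complex ^ 'n \<Rightarrow> real.
              (\<forall>j. viscosity_sol (matrix_op \<Gamma> f) \<psi> U (u j)) \<and>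
              (\<forall>z\<in>U. decseq (\<lambda>j. u j z)) \<and>
              (\<forall>z\<in>U. (\<lambda>j. ereal (u j z)) \<longlonglongrightarrow> sub_envelope (matrix_op \<Gamma> f) \<psi> \<Omega> v z))"
proof (intro allI impI, elim conjE)
  fix U assume U: "open U" "U \<subseteq> \<Omega>" "compact (closure U)" "closure U \<subseteq> \<Omega>"
  interpret hessian_operator \<Gamma> f by unfold_locales fact+
  have \<psi>: "continuous_on \<Omega> \<psi>" "\<And>z. z \<in> \<Omega> \<Longrightarrow> 0 \<le> \<psi> z"
    using assms(5,6) closure_subset continuous_on_subset by blast+
  have \<psi>R: "\<exists>R>0. f (R *\<^sub>R ones) > \<psi> z" if "z \<in> \<Omega>" for z
    using assms(9) that by (intro ones_limit_exceeds) blast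
  have v: "supersol \<psi> \<Omega> (\<lambda>z. ereal (v z))" using assms(13) unfolding viscosity_supersol_iff .
  obtain M where "\<forall>x\<in>v ` closure \<Omega>. norm x \<le> M" using assms(10) unfolding bounded_iff by blast
  then have M: "v z \<le> M" if "z \<in> \<Omega>" for z using that closure_subset[of \<Omega>] by (force simp: abs_le_iff)
  have bd: "(v \<longlongrightarrow> v \<zeta>) (at \<zeta> within \<Omega>)" if "\<zeta> \<in> frontier \<Omega>" for \<zeta>
    using assms(12) that unfolding continuous_within by (blast intro: tendsto_within_subset[OF _ closure_subset])
  define F where "F = {w. subsol \<psi> \<Omega> w \<and> (\<forall>y\<in>\<Omega>. w y \<le> ereal (v y))}"
  have env: "(\<lambda>z. SUP w\<in>F. w z) \<in> F"
    by (rule envelope_subsol[OF assms(1,4) \<psi> \<psi>R v M bd F_def])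
  have sub: "sub_envelope (matrix_op \<Gamma> f) \<psi> \<Omega> v z = (SUP w\<in>F. w z)" for z
    by (simp add: sub_envelope_def viscosity_subsol_iff F_def)
  show "\<exists>u :: nat \<Rightarrow> complex ^ 'n \<Rightarrow> real.
              (\<forall>j. viscosity_sol (matrix_op \<Gamma> f) \<psi> U (u j)) \<and>
              (\<forall>z\<in>U. decseq (\<lambda>j. u j z)) \<and>
              (\<forall>z\<in>U. (\<lambda>j. ereal (u j z)) \<longlonglongrightarrow> sub_envelope (matrix_op \<Gamma> f) \<psi> \<Omega> v z)"
  proof (cases "U = {}")
    case True
    then show ?thesis by (simp add: viscosity_sol_def viscosity_subsol_def viscosity_supersol_def usc_on_def lsc_on_def)
  next
    case False
    then have "closure U \<noteq> {}" by simp
    from envelope_decreasing_limit[OF assms(1,4) \<psi> \<psi>R v M F_def env U(3,4) this]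
    obtain D u where D: "open D" "closure U \<subseteq> D"
      and u: "\<And>j. continuous_on D (u j)" "\<And>j. subsol \<psi> D (\<lambda>z. ereal (u j z))" "\<And>j. supersol \<psi> D (\<lambda>z. ereal (u j z))"
      and lim: "\<And>z. z \<in> D \<Longrightarrow> decseq (\<lambda>j. u j z)" "\<And>z. z \<in> D \<Longrightarrow> (\<lambda>j. ereal (u j z)) \<longlonglongrightarrow> (SUP w\<in>F. w z)"
      by blast
    have UD: "U \<subseteq> D" using D(2) closure_subset by blast
    have "viscosity_sol (matrix_op \<Gamma> f) \<psi> U (u j)" for j
      unfolding viscosity_sol_def viscosity_subsol_iff viscosity_supersol_iff
    proof (intro conjI)
      show "continuous_on U (u j)" using u(1) UD by (rule continuous_on_subset)
      show "subsol \<psi> U (\<lambda>z. ereal (u j z))" by (rule subsol_subset[OF D(1) U(1) UD u(2)])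
      show "supersol \<psi> U (\<lambda>z. ereal (u j z))"
        using u(3)[of j] UD unfolding supersol_def lsc_on_open[OF D(1)] lsc_on_open[OF U(1)] by blast
    qed
    then show ?thesis using lim UD unfolding sub by (intro exI[of _ u]) blast
  qed
qed

end
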